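(* Let $d\ge2$, let $\varepsilon>0$ be an arbitrarily small constant, and let $G\in\mathcal G(n,r,d)$ with $(1+\varepsilon)r_g\le r\le(1-\varepsilon)r_c$. Then a.a.s. $\tau_{cov}(L_1(G))\ge\delta\,n\log^2 n$, where $\delta>0$ is a constant depending only on $\varepsilon$ (and $d$).
   Context: Random geometric graph: $\mathcal G(n,r,d)$ has as vertex set a Poisson point process of intensity $1$ on $\Lambda_n=[-n^{1/d}/2,n^{1/d}/2]^d$, vertices adjacent iff at Euclidean distance $\le r$; $r_c=(\log n/V_d)^{1/d}$ with $V_d$ the unit-ball volume; $r_g\in(0,\infty)$ is the constant critical radius for the existence of a giant (linear-size) component; $L_1(G)$ is the largest connected component; a.a.s. means with probability tending to $1$ as $n\to\infty$. For a finite connected graph $H=(V,E)$, $\tau_{cov}(H)=\max_{v}\mathbb E_v[\min\{t\ge0:\{X_0,\dots,X_t\}=V\}]$ for simple random walk on $H$. *)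

theory Defs
  imports "HOL-Probability.Probability"
begin

text \<open>E is a symmetric irreflexive adjacency relation; the graph is (V, E restricted to V).
  Degree of u in the graph:\<close>
definition deg :: "('a \<Rightarrow> 'a \<Rightarrow> bool) \<Rightarrow> 'a set \<Rightarrow> 'a \<Rightarrow> nat" where
  "deg E V u = card {w \<in> V. E u w}"

definition walk_weight :: "('a \<Rightarrow> 'a \<Rightarrow> bool) \<Rightarrow> 'a set \<Rightarrow> 'a list \<Rightarrow> real" where
  "walk_weight E V xs =
     (\<Prod>i<length xs - 1. if E (xs ! i) (xs ! Suc i) \<and> xs ! Suc i \<in> V
                          then 1 / real (deg E V (xs ! i)) else 0)"

definition cover_tail :: "('a \<Rightarrow> 'a \<Rightarrow> bool) \<Rightarrow> 'a set \<Rightarrow> 'a \<Rightarrow> nat \<Rightarrow> real" where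
  "cover_tail E V v t =
     (\<Sum>xs\<in>{xs. length xs = Suc t \<and> set xs \<subseteq> V \<and> hd xs = v}.
        walk_weight E V xs * (if set xs = V then 0 else 1))"

definition expected_cover_time :: "('a \<Rightarrow> 'a \<Rightarrow> bool) \<Rightarrow> 'a set \<Rightarrow> 'a \<Rightarrow> ennreal" where
  "expected_cover_time E V v = (\<Sum>t. ennreal (cover_tail E V v t))"

definition tau_cov :: "('a \<Rightarrow> 'a \<Rightarrow> bool) \<Rightarrow> 'a set \<Rightarrow> ennreal" where
  "tau_cov E V = (SUP v\<in>V. expected_cover_time E V v)"

definition geo_adj :: "real \<Rightarrow> (nat \<Rightarrow> 'b::metric_space) \<Rightarrow> nat \<Rightarrow> nat \<Rightarrow> bool" where
  "geo_adj r x i j \<longleftrightarrow> i \<noteq> j \<and> dist (x i) (x j) \<le> r"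

definition geo_component :: "nat \<Rightarrow> real \<Rightarrow> (nat \<Rightarrow> 'b::metric_space) \<Rightarrow> nat \<Rightarrow> nat set" where
  "geo_component N r x i =
     {j. j < N \<and> (\<lambda>a b. a < N \<and> b < N \<and> geo_adj r x a b)\<^sup>*\<^sup>* i j}"

definition geo_components :: "nat \<Rightarrow> real \<Rightarrow> (nat \<Rightarrow> 'b::metric_space) \<Rightarrow> nat set set" where
  "geo_components N r x = geo_component N r x ` {..<N}"

definition is_largest_component :: "nat \<Rightarrow> real \<Rightarrow> (nat \<Rightarrow> 'b::metric_space) \<Rightarrow> nat set \<Rightarrow> bool" where
  "is_largest_component N r x C \<longleftrightarrow>
     C \<in> geo_components N r x \<and> (\<forall>C'\<in>geo_components N r x. card C' \<le> card C)"

definition Lambda :: "nat \<Rightarrow> (real^'d) set" where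
  "Lambda n = {y. \<forall>i. \<bar>y $ i\<bar> \<le> real n powr (1 / real CARD('d)) / 2}"

text \<open>Probability of the event P (a predicate on the number N of points and their positions)
  for the Poisson process of intensity 1 on Lambda_n: N ~ Poisson(vol Lambda_n = n),
  and given N, the points are i.i.d. uniform on Lambda_n.\<close>
definition ppp_prob :: "nat \<Rightarrow> (nat \<Rightarrow> (nat \<Rightarrow> real^'d) \<Rightarrow> bool) \<Rightarrow> real" where
  "ppp_prob n P =
     (\<Sum>N. exp (- real n) * real n ^ N / fact N *
        measure (PiM {..<N} (\<lambda>_. uniform_measure lborel (Lambda n :: (real^'d) set)))
                {x \<in> space (PiM {..<N} (\<lambda>_. uniform_measure lborel (Lambda n :: (real^'d) set))). P N x})"

definition aas :: "(nat \<Rightarrow> nat \<Rightarrow> (nat \<Rightarrow> real^'d) \<Rightarrow> bool) \<Rightarrow> bool" where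
  "aas P \<longleftrightarrow> (\<lambda>n. ppp_prob n (P n)) \<longlonglongrightarrow> 1"

definition unit_ball_volume :: "'d::finite itself \<Rightarrow> real" where
  "unit_ball_volume _ = measure lborel (ball (0 :: real^'d) 1)"

definition r_c :: "'d::finite itself \<Rightarrow> nat \<Rightarrow> real" where
  "r_c t n = (ln (real n) / unit_ball_volume t) powr (1 / real CARD('d))"

definition r_g :: "'d::finite itself \<Rightarrow> real" where
  "r_g t = Inf {r. r > 0 \<and> (\<exists>c>0. aas (\<lambda>n N (x :: nat \<Rightarrow> real^'d).
                 \<exists>C\<in>geo_components N r x. real (card C) \<ge> c * real n))}"

end

theory Submission
  imports Defs "HOL-Analysis.Harmonic_Numbers" "HOL-Real_Asymp.Real_Asymp"
begin

text \<open>The largest component has polynomially many pendant paths of length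
  \<open>l \<approx> \<delta>' ln n / r\<^sup>d\<close>. By reversibility the walk needs time at least \<open>l\<close> times the total degree, of order
  \<open>n ln n\<close>, to go from the tip of one of these paths to the tip of another, and Matthews' argument
  gains a further factor logarithmic in the number of paths.

  To find the paths, cut the box into tiles of diameter \<open>O(ln n)\<close>. A tile is planted if it contains
  an isolated chain of points that is attached, at one end only, to a frame of occupied cells which
  every crossing cluster must meet. Turning an arbitrary tile into a planted one costs a factor
  \<open>n\<^sup>\<theta>\<close> with \<open>\<theta> < 1\<close>, because \<open>r \<le> (1 - \<epsilon>) r_c\<close>. Tiles being planted and the shape of the component
  are not independent, so one switches instead: if a large component touched many tiles of which few
  are planted, planting one of them would give a configuration from which the tile can be recovered
  up to few choices, and the Mecke formula bounds the probability of this event by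
  \<open>n\<close> to a negative power.

  The component has linear size since \<open>r\<close> exceeds a radius at which a linear component exists; this
  uses that the infimum defining \<open>r_g\<close> is over a nonempty set, which is shown by renormalization,
  and positivity of \<open>r_g\<close>, shown by counting self-avoiding chains, disposes of \<open>\<epsilon> \<ge> 1\<close>.\<close>

section \<open>Cover times and pendant paths\<close>

text \<open>The bound is uniform in \<open>r\<close> because path length and degrees compensate: the
  degrees of the component sum to order \<open>n * r ^ d\<close>, so \<open>l\<close> of order
  \<open>ln n / r ^ d\<close> always gives hitting times of order \<open>n * ln n\<close>. Near
  \<open>r_c\<close> the path may have length 1, and emptying a single ball of radius
  \<open>(1 + \<eta>) * r\<close> costs \<open>n ^ \<alpha>\<close> with
  \<open>\<alpha> = ((1 + \<eta>) * (1 - \<epsilon>)) ^ d < 1\<close>; this is where the margin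
  below \<open>r_c\<close> is spent. The switching wins for the following reason. A cluster of
  linear size touches about \<open>n\<close> tiles up to logarithms. If fewer than \<open>K\<close>
  of them are planted, the switched clusters through a given point belong to at most
  \<open>2 * K + 1\<close> tiles; since each such cluster has order \<open>n\<close> points, a
  configuration can have arisen from order \<open>K\<close> tiles only. Hence the expected number of
  tiles that see a sparse cluster is at most of order \<open>n ^ \<theta> * K\<close>, far below the
  number of touched tiles. With \<open>K = n ^ q\<close> for a small constant \<open>q > 0\<close>,
  the logarithm of the number of pendant paths is still of order \<open>ln n\<close>.\<close>

definition step_prob :: "('a \<Rightarrow> 'a \<Rightarrow> bool) \<Rightarrow> 'a set \<Rightarrow> 'a \<Rightarrow> 'a \<Rightarrow> real" where
  "step_prob E V x y = (if E x y \<and> y \<in> V then 1 / real (deg E V x) else 0)"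

lemma step_prob_nonneg: "step_prob E V x y \<ge> 0"
  by (simp add: step_prob_def)

lemma walk_weight_Cons:
  assumes "xs \<noteq> []"
  shows "walk_weight E V (v # xs) = step_prob E V v (hd xs) * walk_weight E V xs"
proof -
  obtain y ys where xs: "xs = y # ys" using assms by (cases xs) auto
  show ?thesis unfolding walk_weight_def xs step_prob_def
    by (simp add: prod.lessThan_Suc_shift cong: if_cong del: prod.lessThan_Suc)
qed

text \<open>\<open>A\<close> collects the vertices visited before the walk reaches \<open>v\<close>,
  so this is the tail of a cover time with memory. With it the first-step recursion closes, which it
  does not for \<open>cover_tail\<close> alone.\<close>

definition avoid_tail :: "('a \<Rightarrow> 'a \<Rightarrow> bool) \<Rightarrow> 'a set \<Rightarrow> nat \<Rightarrow> 'a \<Rightarrow> 'a set \<Rightarrow> real" where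
  "avoid_tail E V t v A =
     (\<Sum>xs\<in>{xs. length xs = Suc t \<and> set xs \<subseteq> V \<and> hd xs = v}.
        walk_weight E V xs * (if A \<union> set xs = V then 0 else 1))"

lemma cover_tail_eq: "cover_tail E V v t = avoid_tail E V t v {}"
  by (simp add: cover_tail_def avoid_tail_def)

lemma finite_walks: "finite V \<Longrightarrow> finite {xs. length xs = n \<and> set xs \<subseteq> V \<and> hd xs = v}"
  by (rule finite_subset[OF _ finite_lists_length_eq[of V n]]) auto

lemma walk_weight_nonneg: "walk_weight E V xs \<ge> 0"
  unfolding walk_weight_def by (intro prod_nonneg) auto

lemma avoid_tail_nonneg: "avoid_tail E V t v A \<ge> 0"
  unfolding avoid_tail_def by (intro sum_nonneg) (auto simp: walk_weight_nonneg)

lemma avoid_tail_0: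
  assumes "v \<in> V"
  shows "avoid_tail E V 0 v A = (if insert v A = V then 0 else 1)"
proof -
  have "{xs. length xs = Suc 0 \<and> set xs \<subseteq> V \<and> hd xs = v} = {[v]}"
    using assms by (auto simp: length_Suc_conv)
  thus ?thesis by (simp add: avoid_tail_def walk_weight_def)
qed

lemma avoid_tail_Suc:
  assumes "finite V" "v \<in> V"
  shows "avoid_tail E V (Suc t) v A = (\<Sum>y\<in>V. step_prob E V v y * avoid_tail E V t y (insert v A))"
proof -
  let ?L = "\<lambda>y. {xs. length xs = Suc t \<and> set xs \<subseteq> V \<and> hd xs = y}"
  have eq: "{xs. length xs = Suc (Suc t) \<and> set xs \<subseteq> V \<and> hd xs = v}
      = (\<lambda>p. v # snd p) ` (SIGMA y:V. ?L y)"
  proof (intro equalityI subsetI)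
    fix xs assume "xs \<in> {xs. length xs = Suc (Suc t) \<and> set xs \<subseteq> V \<and> hd xs = v}"
    then obtain y ys where "xs = v # y # ys" "length ys = t" "y \<in> V" "set ys \<subseteq> V"
      by (auto simp: length_Suc_conv)
    thus "xs \<in> (\<lambda>p. v # snd p) ` (SIGMA y:V. ?L y)"
      by (intro image_eqI[of _ _ "(y, y # ys)"]) auto
  qed (use assms in auto)
  have inj: "inj_on (\<lambda>p. v # snd p) (SIGMA y:V. ?L y)" by (auto simp: inj_on_def)
  have "avoid_tail E V (Suc t) v A = (\<Sum>(y,xs)\<in>(SIGMA y:V. ?L y).
      walk_weight E V (v # xs) * (if A \<union> set (v # xs) = V then 0 else 1))"
    unfolding avoid_tail_def eq by (subst sum.reindex[OF inj]) (simp add: case_prod_beta)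
  also have "\<dots> = (\<Sum>y\<in>V. \<Sum>xs\<in>?L y. walk_weight E V (v # xs) * (if A \<union> set (v # xs) = V then 0 else 1))"
    using assms by (subst sum.Sigma) (auto intro: finite_walks)
  also have "\<dots> = (\<Sum>y\<in>V. step_prob E V v y * avoid_tail E V t y (insert v A))"
    unfolding avoid_tail_def sum_distrib_left
  proof (intro sum.cong refl)
    fix y xs assume "xs \<in> ?L y"
    hence "xs \<noteq> []" "hd xs = y" by auto
    thus "walk_weight E V (v # xs) * (if A \<union> set (v # xs) = V then 0 else 1) =
        step_prob E V v y * (walk_weight E V xs * (if insert v A \<union> set xs = V then 0 else 1))"
      by (simp add: walk_weight_Cons)
  qed
  finally show ?thesis .
qed

text \<open>Optional stopping for a potential of the position and the set of targets still to be
  hit. Along the walk \<open>g\<close> loses at most 1 per step on average and vanishes once all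
  targets are hit; truncation after \<open>T\<close> steps leaves a remainder of at most
  \<open>G\<close> on the event that the vertex set is not yet covered.\<close>

lemma potential_le_tail_sum:
  fixes g :: "'a \<Rightarrow> 'a set \<Rightarrow> real"
  assumes fin: "finite V" and UV: "U \<subseteq> V"
    and g0: "\<And>x. g x {} = 0"
    and gG: "\<And>x S. x \<in> V \<Longrightarrow> S \<subseteq> U \<Longrightarrow> g x S \<le> G"
    and gstep: "\<And>x S. x \<in> V \<Longrightarrow> S \<subseteq> U \<Longrightarrow> S \<noteq> {} \<Longrightarrow> x \<notin> S \<Longrightarrow>
       g x S \<le> 1 + (\<Sum>y\<in>V. step_prob E V x y * g y (S - {y}))"
    and v: "v \<in> V"
  shows "g v (U - insert v A) \<le> (\<Sum>t<T. avoid_tail E V t v A) + G * avoid_tail E V T v A"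
  using v
proof (induction T arbitrary: v A)
  case 0
  have "G \<ge> 0" using gG[OF 0, of "{}"] g0 by simp
  show ?case
  proof (cases "insert v A = V")
    case True
    hence e: "U - insert v A = {}" using UV by auto
    show ?thesis unfolding e g0 using \<open>G \<ge> 0\<close> by (simp add: avoid_tail_nonneg)
  next
    case False
    thus ?thesis using 0 gG[of v "U - insert v A"] by (simp add: avoid_tail_0 Diff_subset)
  qed
next
  case (Suc T)
  have "G \<ge> 0" using gG[OF Suc.prems, of "{}"] g0 by simp
  show ?case
  proof (cases "U - insert v A = {}")
    case True
    show ?thesis unfolding True g0 using \<open>G \<ge> 0\<close>
      by (simp add: sum_nonneg avoid_tail_nonneg del: sum.lessThan_Suc)
  next
    case False
    let ?S = "U - insert v A"
    have nV: "insert v A \<noteq> V" using False UV by auto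
    have "g v ?S \<le> 1 + (\<Sum>y\<in>V. step_prob E V v y * g y (?S - {y}))"
      using gstep[of v ?S] Suc.prems False by auto
    also have "\<dots> \<le> 1 + (\<Sum>y\<in>V. step_prob E V v y *
         ((\<Sum>t<T. avoid_tail E V t y (insert v A)) + G * avoid_tail E V T y (insert v A)))"
    proof (intro add_left_mono sum_mono mult_left_mono step_prob_nonneg)
      fix y assume "y \<in> V"
      have "?S - {y} = U - insert y (insert v A)" by auto
      thus "g y (?S - {y}) \<le> (\<Sum>t<T. avoid_tail E V t y (insert v A)) + G * avoid_tail E V T y (insert v A)"
        using Suc.IH[OF \<open>y \<in> V\<close>, of "insert v A"] by simp
    qed
    also have "\<dots> = avoid_tail E V 0 v A + (\<Sum>t<T. avoid_tail E V (Suc t) v A) + G * avoid_tail E V (Suc T) v A"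
    proof -
      have 1: "avoid_tail E V 0 v A = 1" using Suc.prems nV by (simp add: avoid_tail_0)
      have 2: "(\<Sum>t<T. avoid_tail E V (Suc t) v A) = (\<Sum>y\<in>V. step_prob E V v y * (\<Sum>t<T. avoid_tail E V t y (insert v A)))"
        unfolding avoid_tail_Suc[OF fin Suc.prems] sum_distrib_left by (rule sum.swap)
      have 3: "G * avoid_tail E V (Suc T) v A = (\<Sum>y\<in>V. step_prob E V v y * (G * avoid_tail E V T y (insert v A)))"
        unfolding avoid_tail_Suc[OF fin Suc.prems] sum_distrib_left by (simp add: mult.left_commute)
      show ?thesis unfolding 1 2 3 distrib_left sum.distrib by (simp only: add.assoc)
    qed
    also have "\<dots> = (\<Sum>t<Suc T. avoid_tail E V t v A) + G * avoid_tail E V (Suc T) v A"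
      by (simp add: sum.lessThan_Suc_shift del: sum.lessThan_Suc)
    finally show ?thesis .
  qed
qed

text \<open>If the expected cover time is infinite there is nothing to show. Otherwise the tails are
  summable, hence tend to 0, and the remainder term of the truncated bound disappears in the
  limit.\<close>

lemma potential_le_tau_cov:
  fixes g :: "'a \<Rightarrow> 'a set \<Rightarrow> real"
  assumes fin: "finite V" and UV: "U \<subseteq> V"
    and g0: "\<And>x. g x {} = 0"
    and gG: "\<And>x S. x \<in> V \<Longrightarrow> S \<subseteq> U \<Longrightarrow> g x S \<le> G"
    and gstep: "\<And>x S. x \<in> V \<Longrightarrow> S \<subseteq> U \<Longrightarrow> S \<noteq> {} \<Longrightarrow> x \<notin> S \<Longrightarrow>
       g x S \<le> 1 + (\<Sum>y\<in>V. step_prob E V x y * g y (S - {y}))"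
    and v: "v \<in> V"
  shows "ennreal (g v (U - {v})) \<le> tau_cov E V"
proof -
  have "ennreal (g v (U - {v})) \<le> expected_cover_time E V v"
  proof (cases "expected_cover_time E V v = \<top>")
    case False
    hence fin_sum: "(\<Sum>t. ennreal (cover_tail E V v t)) \<noteq> \<top>" by (simp add: expected_cover_time_def)
    have nn: "\<And>t. 0 \<le> cover_tail E V v t" by (simp add: cover_tail_eq avoid_tail_nonneg)
    have sm: "summable (cover_tail E V v)"
      using summable_suminf_not_top[OF nn fin_sum] .
    have eq: "expected_cover_time E V v = ennreal (\<Sum>t. cover_tail E V v t)"
      unfolding expected_cover_time_def by (rule suminf_ennreal2[OF nn sm])
    have "g v (U - {v}) \<le> (\<Sum>t<T. cover_tail E V v t) + G * cover_tail E V v T" for T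
      using potential_le_tail_sum[OF fin UV g0 gG gstep v, where A="{}" and T=T] by (simp add: cover_tail_eq)
    moreover have "(\<lambda>T. (\<Sum>t<T. cover_tail E V v t) + G * cover_tail E V v T) \<longlonglongrightarrow> (\<Sum>t. cover_tail E V v t) + G * 0"
      by (intro tendsto_intros summable_LIMSEQ summable_LIMSEQ_zero sm)
    ultimately have "g v (U - {v}) \<le> (\<Sum>t. cover_tail E V v t) + G * 0"
      by (intro LIMSEQ_le_const) auto
    thus ?thesis using eq by (simp add: ennreal_leI)
  qed auto
  also have "\<dots> \<le> tau_cov E V" unfolding tau_cov_def by (rule SUP_upper[OF v])
  finally show ?thesis .
qed

text \<open>Matthews' bound: the average hitting time of the unvisited targets, plus a harmonic correction,
  is a potential, because the average increases by at least \<open>h / k\<close> when one of \<open>k\<close> targets is hit.\<close>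

lemma matthews_lower_bound:
  fixes q :: "'a \<Rightarrow> 'a \<Rightarrow> real"
  assumes fin: "finite V" and UV: "U \<subseteq> V" and U: "U \<noteq> {}"
    and q0: "\<And>u. u \<in> U \<Longrightarrow> q u u = 0"
    and qnn: "\<And>u x. u \<in> U \<Longrightarrow> x \<in> V \<Longrightarrow> q u x \<ge> 0"
    and qstep: "\<And>u x. u \<in> U \<Longrightarrow> x \<in> V \<Longrightarrow> x \<noteq> u \<Longrightarrow> q u x \<le> 1 + (\<Sum>y\<in>V. step_prob E V x y * q u y)"
    and degpos: "\<And>x. x \<in> V \<Longrightarrow> (\<Sum>y\<in>V. step_prob E V x y) = 1"
    and h: "\<And>u w. u \<in> U \<Longrightarrow> w \<in> U \<Longrightarrow> u \<noteq> w \<Longrightarrow> h \<le> q w u" and h0: "h \<ge> 0"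
  shows "ennreal (h * (ln (real (card U)) - 1)) \<le> tau_cov E V"
proof -
  \<comment> \<open>The harmonic sum is lowered by 1 so that \<open>c 1 = 0\<close>: when a single
    target is left, hitting it must lead to the value 0 of \<open>g\<close> at the empty
    set.\<close>
  define c where "c k = h * ((\<Sum>i=1..k. 1 / real i) - 1)" for k
  define g where "g x S = (if S = {} then 0 else (\<Sum>u\<in>S. q u x) / real (card S) + c (card S))" for x S
  have finU: "finite U" using fin UV finite_subset by blast
  define G where "G = Max ((\<lambda>(x,S). g x S) ` (V \<times> Pow U))"
  have gG: "g x S \<le> G" if "x \<in> V" "S \<subseteq> U" for x S
    unfolding G_def using that fin finU by (intro Max_ge) auto
  have hit: "(\<Sum>u\<in>S. q u y) / real (card S) + c (card S) \<le> g y (S - {y})" if "S \<subseteq> U" "S \<noteq> {}" "y \<in> V" for S y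
  proof (cases "y \<in> S")
    case False
    thus ?thesis using that by (simp add: g_def)
  next
    case True
    have fS: "finite S" using that finU finite_subset by blast
    show ?thesis
    proof (cases "S = {y}")
      case True
      thus ?thesis using that q0 by (simp add: g_def c_def)
    next
      case False
      hence ne: "S - {y} \<noteq> {}" using True by auto
      define k where "k = card (S - {y})"
      have k: "k > 0" "card S = Suc k"
        using ne fS card_Suc_Diff1[OF fS True] unfolding k_def by (simp_all only: card_gt_0_iff finite_Diff simp_thms)
      have sm: "(\<Sum>u\<in>S. q u y) = (\<Sum>u\<in>S-{y}. q u y)"
        using True fS that q0 by (subst sum.remove[of S y]) auto
      have "real k * h = (\<Sum>u\<in>S-{y}. h)" by (simp add: k_def)
      also have "\<dots> \<le> (\<Sum>u\<in>S-{y}. q u y)" using that True by (intro sum_mono h) auto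
      finally have ge: "real k * h \<le> (\<Sum>u\<in>S-{y}. q u y)" .
      have cs: "c (Suc k) = c k + h / real (Suc k)" by (simp add: c_def algebra_simps)
      let ?s = "(\<Sum>u\<in>S-{y}. q u y)"
      have "?s / real k - ?s / real (Suc k) = ?s / (real k * real (Suc k))"
        using k by (simp add: field_simps)
      also have "\<dots> \<ge> (real k * h) / (real k * real (Suc k))"
        by (intro divide_right_mono ge) auto
      finally have "?s / real k - ?s / real (Suc k) \<ge> h / real (Suc k)" using k by simp
      thus ?thesis using ne cs sm k by (simp add: g_def flip: k_def)
    qed
  qed
  have gstep: "g x S \<le> 1 + (\<Sum>y\<in>V. step_prob E V x y * g y (S - {y}))"
    if "x \<in> V" "S \<subseteq> U" "S \<noteq> {}" "x \<notin> S" for x S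
  proof -
    have fS: "finite S" using that finU finite_subset by blast
    hence cS: "real (card S) > 0" using that by (simp add: card_gt_0_iff)
    have "(\<Sum>u\<in>S. q u x) \<le> (\<Sum>u\<in>S. 1 + (\<Sum>y\<in>V. step_prob E V x y * q u y))"
      using that by (intro sum_mono qstep) auto
    also have "\<dots> = card S + (\<Sum>y\<in>V. step_prob E V x y * (\<Sum>u\<in>S. q u y))"
      unfolding sum.distrib sum_distrib_left by (subst sum.swap) simp
    finally have "(\<Sum>u\<in>S. q u x) / card S \<le> (card S + (\<Sum>y\<in>V. step_prob E V x y * (\<Sum>u\<in>S. q u y))) / card S"
      using cS by (simp add: divide_right_mono)
    also have "\<dots> = 1 + (\<Sum>y\<in>V. step_prob E V x y * ((\<Sum>u\<in>S. q u y) / card S))"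
      using cS by (simp add: add_divide_distrib sum_divide_distrib[where A = V])
    finally have "g x S \<le> 1 + (\<Sum>y\<in>V. step_prob E V x y * ((\<Sum>u\<in>S. q u y) / card S)) + c (card S) * (\<Sum>y\<in>V. step_prob E V x y)"
      using that degpos by (simp add: g_def)
    also have "\<dots> = 1 + (\<Sum>y\<in>V. step_prob E V x y * ((\<Sum>u\<in>S. q u y) / card S + c (card S)))"
      by (simp only: distrib_left sum.distrib sum_distrib_left mult.commute[of "c (card S)"] add.assoc)
    also have "\<dots> \<le> 1 + (\<Sum>y\<in>V. step_prob E V x y * g y (S - {y}))"
      using that by (intro add_left_mono sum_mono mult_left_mono step_prob_nonneg hit) auto
    finally show ?thesis .
  qed
  obtain v where v: "v \<in> U" using U by auto
  define k where "k = card (U - {v})"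
  have ck: "card U = Suc k" using card_Suc_Diff1[OF finU v] by (simp add: k_def)
  have "h * (ln (real (card U)) - 1) \<le> g v (U - {v})"
  proof (cases "U - {v} = {}")
    case True
    hence "card U = 1" unfolding ck k_def True by simp
    thus ?thesis unfolding True using h0 by (simp add: g_def)
  next
    case False
    \<comment> \<open>The start \<open>v\<close> is itself a target, so only
      \<open>k = card U - 1\<close> targets remain; \<open>ln (k + 1) \<le> harm k\<close> makes up
      for the loss.\<close>
    have "ln (real (card U)) \<le> harm k" using ln_le_harm[of k] unfolding ck of_nat_Suc by (simp only: add.commute)
    also have "harm k = (\<Sum>i=1..k. 1 / real i)" unfolding harm_def by (intro sum.cong refl) (simp add: field_simps)
    finally have "h * (ln (real (card U)) - 1) \<le> c k" unfolding c_def using h0 by (intro mult_left_mono) auto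
    moreover have "(\<Sum>u\<in>U - {v}. q u v) / real (card (U - {v})) \<ge> 0"
      using v UV by (intro divide_nonneg_nonneg sum_nonneg qnn) auto
    ultimately show ?thesis using False unfolding g_def k_def by simp
  qed
  hence "ennreal (h * (ln (real (card U)) - 1)) \<le> ennreal (g v (U - {v}))" by (rule ennreal_leI)
  also have "\<dots> \<le> tau_cov E V"
    by (rule potential_le_tau_cov[OF fin UV _ gG gstep]) (use v UV in \<open>auto simp: g_def\<close>)
  finally show ?thesis .
qed

section \<open>Hitting times for the walk on a finite connected graph\<close>

locale walk_graph =
  fixes E :: "'a \<Rightarrow> 'a \<Rightarrow> bool" and V :: "'a set"
  assumes fin: "finite V"
    and E_sym: "E x y \<Longrightarrow> E y x"
    and E_V: "E x y \<Longrightarrow> y \<in> V"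
    and E_irrefl: "\<not> E x x"
    and conn: "x \<in> V \<Longrightarrow> y \<in> V \<Longrightarrow> E\<^sup>*\<^sup>* x y"
begin

abbreviation "dg x \<equiv> real (deg E V x)"

lemma dg_eq: "dg x = (\<Sum>y\<in>V. of_bool (E x y))"
proof -
  have "{w \<in> V. E x w} = V \<inter> {y. E x y}" by blast
  thus ?thesis using fin by (simp add: deg_def sum_of_bool_eq)
qed

lemma deg_pos:
  assumes "a \<in> V" "b \<in> V" "a \<noteq> b" "x \<in> V"
  shows "dg x > 0"
proof -
  obtain y where y: "y \<in> V" "x \<noteq> y" using assms by (cases "x = a") auto
  have "E\<^sup>*\<^sup>* x y" using conn assms y by auto
  then obtain z where "E x z" using y by (metis converse_rtranclpE)
  hence "z \<in> {w \<in> V. E x w}" using E_V by auto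
  thus ?thesis using fin by (auto simp: deg_def card_gt_0_iff)
qed

lemma deg_step_prob:
  assumes "dg x > 0"
  shows "dg x * (\<Sum>y\<in>V. step_prob E V x y * f y) = (\<Sum>y\<in>V. of_bool (E x y) * f y)"
  using assms unfolding sum_distrib_left by (intro sum.cong) (auto simp: step_prob_def)

lemma sum_step_prob: "dg x > 0 \<Longrightarrow> (\<Sum>y\<in>V. step_prob E V x y) = 1"
  using deg_step_prob[of x "\<lambda>_. 1"] by (simp add: dg_eq[of x])

text \<open>The expectation of the minimum of \<open>t\<close> and the hitting time of
  \<open>w\<close>; the expected hitting time is obtained as the limit from below.\<close>

fun hit_iter :: "'a \<Rightarrow> nat \<Rightarrow> 'a \<Rightarrow> real" where
  "hit_iter w 0 x = 0"
| "hit_iter w (Suc t) x = (if x = w then 0 else 1 + (\<Sum>y\<in>V. step_prob E V x y * hit_iter w t y))"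

lemma hit_iter_nonneg: "hit_iter w t x \<ge> 0"
  by (induction t arbitrary: x) (auto intro!: sum_nonneg add_nonneg_nonneg mult_nonneg_nonneg step_prob_nonneg)

lemma hit_iter_mono: "hit_iter w t x \<le> hit_iter w (Suc t) x"
proof (induction t arbitrary: x)
  case 0 thus ?case by simp
next
  case (Suc t)
  show ?case
  proof (cases "x = w")
    case False
    have "(\<Sum>y\<in>V. step_prob E V x y * hit_iter w t y) \<le> (\<Sum>y\<in>V. step_prob E V x y * hit_iter w (Suc t) y)"
      by (intro sum_mono mult_left_mono step_prob_nonneg Suc)
    thus ?thesis using False by (simp only: hit_iter.simps(2)[of w t x] hit_iter.simps(2)[of w "Suc t" x]) simp
  qed simp
qed

lemma hit_iter_self: "hit_iter w t w = 0"
  by (cases t) auto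

text \<open>Reversibility bounds the iterates at the neighbours of \<open>w\<close> by the total degree; the recursion
  then propagates boundedness along edges.\<close>

lemma hit_iter_bounded:
  assumes w: "w \<in> V" and x: "x \<in> V"
  shows "\<exists>B. \<forall>t. hit_iter w t x \<le> B"
proof (cases "V = {w}")
  case True
  thus ?thesis using x hit_iter_self by (intro exI[of _ 0]) auto
next
  case False
  then obtain w' where w': "w' \<in> V" "w' \<noteq> w" using w by blast
  have dpos: "dg z > 0" if "z \<in> V" for z
    by (rule deg_pos[OF w'(1) w w'(2) that])
  \<comment> \<open>Weight the recursion with the degrees, the reversible measure, and sum over all
    vertices other than \<open>w\<close>. By symmetry of \<open>E\<close> the transition sums
    reproduce the left side except for the terms at neighbours of \<open>w\<close>, and monotonicity
    in \<open>t\<close> cancels everything else.\<close>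
  have near: "(\<Sum>y\<in>V. of_bool (E w y) * hit_iter w t y) \<le> (\<Sum>z\<in>V. dg z)" for t
  proof -
    have "(\<Sum>z\<in>V. dg z * hit_iter w t z) \<le> (\<Sum>z\<in>V. dg z * hit_iter w (Suc t) z)"
      by (intro sum_mono mult_left_mono hit_iter_mono) auto
    also have "\<dots> = (\<Sum>z\<in>V-{w}. dg z * hit_iter w (Suc t) z)"
      using w fin by (subst sum.remove[of V w]) (auto simp: hit_iter_self)
    also have "\<dots> = (\<Sum>z\<in>V-{w}. dg z + (\<Sum>y\<in>V. of_bool (E z y) * hit_iter w t y))"
      by (intro sum.cong refl) (use dpos deg_step_prob in \<open>simp add: ring_distribs\<close>)
    also have "\<dots> = (\<Sum>z\<in>V-{w}. dg z) + ((\<Sum>z\<in>V. \<Sum>y\<in>V. of_bool (E z y) * hit_iter w t y) - (\<Sum>y\<in>V. of_bool (E w y) * hit_iter w t y))"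
      using w fin by (simp add: sum.distrib sum_diff1)
    also have "(\<Sum>z\<in>V. \<Sum>y\<in>V. of_bool (E z y) * hit_iter w t y) = (\<Sum>y\<in>V. dg y * hit_iter w t y)"
      using E_sym by (subst sum.swap) (auto simp: dg_eq sum_distrib_right intro!: sum.cong)
    finally have "(\<Sum>y\<in>V. of_bool (E w y) * hit_iter w t y) \<le> (\<Sum>z\<in>V-{w}. dg z)" by simp
    also have "\<dots> \<le> (\<Sum>z\<in>V. dg z)" using fin by (intro sum_mono2) auto
    finally show ?thesis .
  qed
  have "E\<^sup>*\<^sup>* w x" using conn w x by auto
  thus ?thesis
  proof (induction rule: rtranclp_induct)
    case base
    show ?case by (intro exI[of _ 0]) (simp add: hit_iter_self)
  next
    case (step z y)
    have yV: "y \<in> V" and zV: "z \<in> V" using E_V E_sym step by blast+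
    have single: "hit_iter w t y \<le> (\<Sum>y\<in>V. of_bool (E z y) * hit_iter w t y)" for t
    proof -
      have "of_bool (E z y) * hit_iter w t y \<le> (\<Sum>y\<in>V. of_bool (E z y) * hit_iter w t y)"
        using yV fin by (intro member_le_sum) (auto simp: hit_iter_nonneg)
      thus ?thesis using step by simp
    qed
    show ?case
    proof (cases "z = w")
      case True
      thus ?thesis using single near order_trans by (intro exI[of _ "\<Sum>z\<in>V. dg z"]) blast
    next
      case False
      obtain B where B: "\<And>t. hit_iter w t z \<le> B" using step by auto
      have "hit_iter w t y \<le> dg z * B" for t
      proof -
        have "hit_iter w t y \<le> dg z * (\<Sum>y\<in>V. step_prob E V z y * hit_iter w t y)"
          using single[of t] deg_step_prob[OF dpos[OF zV]] by simp
        also have "\<dots> \<le> dg z * hit_iter w (Suc t) z" using False by (intro mult_left_mono) auto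
        also have "\<dots> \<le> dg z * B" by (intro mult_left_mono B) auto
        finally show ?thesis .
      qed
      thus ?thesis by blast
    qed
  qed
qed

text \<open>The iterates increase and are bounded, so they converge. The limit satisfies an
  equation, not merely an inequality, and the flux computation on pendant paths needs this exact
  form.\<close>

lemma hitting_time_exists:
  assumes w: "w \<in> V"
  shows "\<exists>q. q w = 0 \<and> (\<forall>x\<in>V. q x \<ge> 0) \<and> (\<forall>x\<in>V-{w}. q x = 1 + (\<Sum>y\<in>V. step_prob E V x y * q y))"
proof -
  define q where "q x = lim (\<lambda>t. hit_iter w t x)" for x
  have lim: "(\<lambda>t. hit_iter w t x) \<longlonglongrightarrow> q x" if "x \<in> V" for x
  proof -
    obtain B where "\<And>t. hit_iter w t x \<le> B" using hit_iter_bounded[OF w \<open>x \<in> V\<close>] by auto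
    hence "convergent (\<lambda>t. hit_iter w t x)"
      using incseq_SucI[of "\<lambda>t. hit_iter w t x"] hit_iter_mono incseq_convergent[of "\<lambda>t. hit_iter w t x" B]
      by (metis convergent_def)
    thus ?thesis by (simp add: q_def convergent_LIMSEQ_iff)
  qed
  have "q w = 0" by (simp add: q_def hit_iter_self)
  moreover have "q x \<ge> 0" if "x \<in> V" for x
    using LIMSEQ_le_const[OF lim[OF that]] hit_iter_nonneg by blast
  moreover have "q x = 1 + (\<Sum>y\<in>V. step_prob E V x y * q y)" if "x \<in> V - {w}" for x
  proof -
    have "(\<lambda>t. hit_iter w (Suc t) x) \<longlonglongrightarrow> q x" using LIMSEQ_Suc[OF lim[of x]] that by simp
    moreover have "(\<lambda>t. hit_iter w (Suc t) x) \<longlonglongrightarrow> 1 + (\<Sum>y\<in>V. step_prob E V x y * q y)"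
      using that by (simp, intro tendsto_intros lim)
    ultimately show ?thesis using LIMSEQ_unique by blast
  qed
  ultimately show ?thesis by blast
qed

text \<open>A pendant path is recorded by its vertices \<open>u 0, \<dots>, u l\<close>, where \<open>u 0\<close> is the tip and only \<open>u l\<close>
  may have further neighbours.\<close>

definition pendant_path :: "nat \<Rightarrow> (nat \<Rightarrow> 'a) \<Rightarrow> bool" where
  "pendant_path l u \<longleftrightarrow> inj_on u {..l} \<and> u ` {..l} \<subseteq> V \<and>
     (\<forall>j<l. E (u j) (u (Suc j)) \<and> (\<forall>y. E (u j) y \<longrightarrow> y = u (Suc j) \<or> (j > 0 \<and> y = u (j - 1))))"

text \<open>A flux argument. Off the tip, \<open>dg x\<close> equals \<open>dg x\<close> times the
  excess of \<open>q x\<close> over its average; sum this over all vertices beyond the first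
  \<open>j + 1\<close> of the path. Edges inside that set cancel in pairs and the only edge leaving
  it joins \<open>u (Suc j)\<close> to \<open>u j\<close>, so each step away from the tip raises
  \<open>q\<close> by the total degree beyond it. Off the path \<open>q\<close> is at least its
  value at the root \<open>u l\<close>, by a minimum principle.\<close>

lemma pendant_path_hitting:
  assumes pp: "pendant_path l u" and l: "l > 0"
    and q0: "q (u 0) = 0" and qs: "\<And>x. x \<in> V - {u 0} \<Longrightarrow> q x = 1 + (\<Sum>y\<in>V. step_prob E V x y * q y)"
    and D: "D \<le> (\<Sum>x\<in>V - u ` {..<l}. dg x)"
    and x: "x \<in> V - u ` {..<l}"
  shows "real l * D \<le> q x"
proof -
  have inj: "u i = u j \<longleftrightarrow> i = j" if "i \<le> l" "j \<le> l" for i j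
    using pp that by (auto simp: pendant_path_def inj_on_def)
  have uV: "u j \<in> V" if "j \<le> l" for j using pp that by (auto simp: pendant_path_def)
  have E1: "E (u j) (u (Suc j))" if "j < l" for j using pp that by (auto simp: pendant_path_def)
  have E2: "E (u j) y \<Longrightarrow> y = u (Suc j) \<or> (j > 0 \<and> y = u (j - 1))" if "j < l" for j y
    using pp that by (auto simp: pendant_path_def)
  have dpos: "dg z > 0" if "z \<in> V" for z
    by (rule deg_pos[of "u 0" "u 1"]) (use that uV[of 0] uV[of 1] inj[of 0 1] l in auto)
  have diff: "(\<Sum>x\<in>V - u ` {..j}. dg x) = q (u (Suc j)) - q (u j)" if j: "j < l" for j
  proof -
    let ?B = "V - u ` {..j}"
    have "(\<Sum>x\<in>?B. dg x) = (\<Sum>x\<in>?B. dg x * (q x - (\<Sum>y\<in>V. step_prob E V x y * q y)))"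
    proof (intro sum.cong refl)
      fix x assume "x \<in> ?B"
      hence "x \<in> V - {u 0}" by auto
      thus "dg x = dg x * (q x - (\<Sum>y\<in>V. step_prob E V x y * q y))" using qs[of x] by simp
    qed
    also have "\<dots> = (\<Sum>x\<in>?B. \<Sum>y\<in>V. of_bool (E x y) * (q x - q y))"
    proof (intro sum.cong refl)
      fix x assume "x \<in> ?B"
      hence "dg x * (\<Sum>y\<in>V. step_prob E V x y * q y) = (\<Sum>y\<in>V. of_bool (E x y) * q y)"
        using deg_step_prob dpos by auto
      thus "dg x * (q x - (\<Sum>y\<in>V. step_prob E V x y * q y)) = (\<Sum>y\<in>V. of_bool (E x y) * (q x - q y))"
        by (simp add: right_diff_distrib sum_subtractf dg_eq sum_distrib_right)
    qed
    also have "\<dots> = (\<Sum>x\<in>?B. \<Sum>y\<in>?B. of_bool (E x y) * (q x - q y)) + (\<Sum>x\<in>?B. \<Sum>y\<in>u ` {..j}. of_bool (E x y) * (q x - q y))"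
    proof -
      have "u ` {..j} \<subseteq> V" using uV j by auto
      hence "(\<Sum>y\<in>V. f y) = (\<Sum>y\<in>?B. f y) + (\<Sum>y\<in>u ` {..j}. f y)" for f :: "'a \<Rightarrow> real"
        using fin by (rule sum.subset_diff)
      thus ?thesis by (simp add: sum.distrib)
    qed
    also have "(\<Sum>x\<in>?B. \<Sum>y\<in>?B. of_bool (E x y) * (q x - q y)) = 0"
    proof -
      have "(\<Sum>x\<in>?B. \<Sum>y\<in>?B. of_bool (E x y) * (q x - q y)) = (\<Sum>x\<in>?B. \<Sum>y\<in>?B. of_bool (E y x) * (q y - q x))"
        by (rule sum.swap)
      also have "\<dots> = - (\<Sum>x\<in>?B. \<Sum>y\<in>?B. of_bool (E x y) * (q x - q y))"
        unfolding sum_negf[symmetric] using E_sym by (intro sum.cong refl) (auto simp: of_bool_def)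
      finally show ?thesis by simp
    qed
    also have "(\<Sum>x\<in>?B. \<Sum>y\<in>u ` {..j}. of_bool (E x y) * (q x - q y))
        = (\<Sum>x\<in>?B. \<Sum>y\<in>u ` {..j}. if x = u (Suc j) \<and> y = u j then q x - q y else 0)"
    proof (intro sum.cong refl)
      fix x y assume x: "x \<in> ?B" and y: "y \<in> u ` {..j}"
      then obtain i where i: "y = u i" "i \<le> j" by auto
      have "E x y \<longleftrightarrow> x = u (Suc j) \<and> y = u j"
      proof
        assume "E x y"
        hence "E (u i) x" using E_sym i by blast
        hence "x = u (Suc i) \<or> (i > 0 \<and> x = u (i - 1))" using E2[of i x] i j by auto
        hence "x = u (Suc i)" using x i by auto
        moreover have "i = j" using x i \<open>x = u (Suc i)\<close> by (metis DiffD2 Suc_leI atMost_iff image_eqI le_neq_implies_less)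
        ultimately show "x = u (Suc j) \<and> y = u j" using i by simp
      qed (use E1[OF j] E_sym in auto)
      thus "of_bool (E x y) * (q x - q y) = (if x = u (Suc j) \<and> y = u j then q x - q y else 0)" by simp
    qed
    also have "\<dots> = (\<Sum>x\<in>?B. if x = u (Suc j) then (q x - q (u j)) else 0)"
      by (intro sum.cong refl) (auto simp: sum.delta)
    also have "\<dots> = q (u (Suc j)) - q (u j)"
    proof -
      have "u (Suc j) \<notin> u ` {..j}"
      proof
        assume "u (Suc j) \<in> u ` {..j}"
        then obtain i where "u (Suc j) = u i" "i \<le> j" by auto
        thus False using inj[of "Suc j" i] j by simp
      qed
      hence "u (Suc j) \<in> ?B" using uV[of "Suc j"] j by simp
      thus ?thesis using fin by (simp add: sum.delta)
    qed
    finally show ?thesis by simp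
  qed
  have "real j * D \<le> q (u j)" if "j \<le> l" for j
    using that
  proof (induction j)
    case 0 thus ?case using q0 by simp
  next
    case (Suc j)
    have "D \<le> (\<Sum>x\<in>V - u ` {..j}. dg x)"
      using Suc.prems fin by (intro order_trans[OF D] sum_mono2) auto
    thus ?case using Suc diff[of j] by (simp add: algebra_simps)
  qed
  hence ul: "real l * D \<le> q (u l)" by simp
  let ?B = "V - u ` {..<l}"
  have "u l \<notin> u ` {..<l}"
  proof
    assume "u l \<in> u ` {..<l}"
    then obtain i where "u l = u i" "i < l" by auto
    thus False using inj[of l i] by simp
  qed
  hence ulB: "u l \<in> ?B" using uV[of l] by simp
  define z where "z = arg_min_on q ?B"
  have zB: "z \<in> ?B" and zmin: "\<And>y. y \<in> ?B \<Longrightarrow> q z \<le> q y"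
    using arg_min_if_finite(1)[of ?B q] arg_min_least[of ?B _ q] fin ulB unfolding z_def by blast+
  have "z = u l"
  proof (rule ccontr)
    assume ne: "z \<noteq> u l"
    have "(\<Sum>y\<in>V. step_prob E V z y * q z) \<le> (\<Sum>y\<in>V. step_prob E V z y * q y)"
    proof (intro sum_mono)
      fix y assume "y \<in> V"
      show "step_prob E V z y * q z \<le> step_prob E V z y * q y"
      proof (cases "E z y")
        case False thus ?thesis by (simp add: step_prob_def)
      next
        case True
        have "y \<notin> u ` {..<l}"
        proof
          assume "y \<in> u ` {..<l}"
          then obtain i where i: "y = u i" "i < l" by auto
          hence "z = u (Suc i) \<or> (i > 0 \<and> z = u (i - 1))" using E2[of i z] E_sym True by blast
          thus False using zB ne i
            by (metis DiffD2 Suc_lessI image_eqI lessThan_iff less_imp_diff_less)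
        qed
        thus ?thesis using zmin[of y] \<open>y \<in> V\<close> by (intro mult_left_mono step_prob_nonneg) auto
      qed
    qed
    moreover have "(\<Sum>y\<in>V. step_prob E V z y * q z) = q z"
      using sum_step_prob[of z] dpos[of z] zB by (simp flip: sum_distrib_right)
    moreover have "z \<in> V - {u 0}" using zB l by auto
    ultimately show False using qs[of z] by simp
  qed
  thus ?thesis using zmin[OF x] ul by simp
qed

text \<open>Matthews' bound with the tips as targets. By \<open>disj\<close> each tip lies off the
  first \<open>l\<close> vertices of every other path, which is the region where
  \<open>pendant_path_hitting\<close> bounds the hitting time from below.\<close>

lemma tau_cov_ge_pendant_paths:
  assumes l: "l > 0" and U: "finite I" "I \<noteq> {}"
    and pp: "\<And>i. i \<in> I \<Longrightarrow> pendant_path l (u i)"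
    and disj: "\<And>i j. i \<in> I \<Longrightarrow> j \<in> I \<Longrightarrow> i \<noteq> j \<Longrightarrow> u i 0 \<notin> u j ` {..<l}"
    and D: "\<And>i. i \<in> I \<Longrightarrow> D \<le> (\<Sum>x\<in>V - u i ` {..<l}. dg x)" and D0: "D \<ge> 0"
  shows "ennreal (real l * D * (ln (real (card I)) - 1)) \<le> tau_cov E V"
proof -
  define t where "t i = u i 0" for i
  have tV: "t i \<in> V" if "i \<in> I" for i using pp[OF that] by (auto simp: t_def pendant_path_def)
  have "\<forall>i. \<exists>q. i \<in> I \<longrightarrow> (q (t i) = 0 \<and> (\<forall>x\<in>V. q x \<ge> 0) \<and> (\<forall>x\<in>V-{t i}. q x = 1 + (\<Sum>y\<in>V. step_prob E V x y * q y)))"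
    using hitting_time_exists[OF tV] by blast
  then obtain q where q: "\<And>i. i \<in> I \<Longrightarrow> q i (t i) = 0 \<and> (\<forall>x\<in>V. q i x \<ge> 0) \<and>
     (\<forall>x\<in>V-{t i}. q i x = 1 + (\<Sum>y\<in>V. step_prob E V x y * q i y))"
    by metis
  have inj: "inj_on t I"
  proof (rule inj_onI, rule ccontr)
    fix i j assume ij: "i \<in> I" "j \<in> I" "t i = t j" "i \<noteq> j"
    hence "t i \<in> u j ` {..<l}" using l by (auto simp: t_def)
    thus False using disj ij by (auto simp: t_def)
  qed
  have dpos: "dg z > 0" if "z \<in> V" for z
  proof -
    obtain i where i: "i \<in> I" using U by auto
    have "u i 0 \<noteq> u i 1" "u i 0 \<in> V" "u i 1 \<in> V" using pp[OF i] l unfolding pendant_path_def inj_on_def by force+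
    thus ?thesis using deg_pos[of "u i 0" "u i 1" z] that by blast
  qed
  have "ennreal (real l * D * (ln (real (card (t ` I))) - 1)) \<le> tau_cov E V"
  proof (rule matthews_lower_bound[where q = "\<lambda>w. q (inv_into I t w)"])
    fix a b assume "a \<in> t ` I" "b \<in> t ` I" "a \<noteq> b"
    then obtain i j where ij: "i \<in> I" "j \<in> I" "a = t i" "b = t j" "i \<noteq> j" by auto
    have "real l * D \<le> q j (t i)"
      by (rule pendant_path_hitting[of l "u j"])
         (use pp ij l q D disj tV in \<open>auto simp: t_def\<close>)
    thus "real l * D \<le> q (inv_into I t b) a" using inj ij by simp
  qed (use fin U tV q inj D0 l sum_step_prob dpos in \<open>auto simp: inv_into_f_f\<close>)
  thus ?thesis by (simp add: card_image inj)
qed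

end

section \<open>Poisson integrals of functionals of finite point sets\<close>

text \<open>Functionals see the set of the \<open>N\<close> points and not their labels, so deleting
  and inserting points become set operations.\<close>

definition iid_int :: "'a measure \<Rightarrow> nat \<Rightarrow> ('a set \<Rightarrow> ennreal) \<Rightarrow> ennreal" where
  "iid_int U N F = (\<integral>\<^sup>+x. F (x ` {..<N}) \<partial>PiM {..<N} (\<lambda>_. U))"

text \<open>Integration against a Poisson process with intensity measure \<open>t * U\<close>,
  written as a mixture over the number of points; the process itself is never constructed.\<close>

definition pois_int :: "'a measure \<Rightarrow> real \<Rightarrow> ('a set \<Rightarrow> ennreal) \<Rightarrow> ennreal" where
  "pois_int U t F = (\<Sum>N. ennreal (exp (- t) * t ^ N / fact N) * iid_int U N F)"

text \<open>Measurability is tested on labelled samples of every size, in place of a sigma-algebra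
  on the finite sets.\<close>

definition set_measurable :: "'a measure \<Rightarrow> ('a set \<Rightarrow> ennreal) \<Rightarrow> bool" where
  "set_measurable U F \<longleftrightarrow> (\<forall>N::nat. (\<lambda>x. F (x ` {..<N})) \<in> borel_measurable (PiM {..<N} (\<lambda>_. U)))"

definition set_measurable2 :: "'a measure \<Rightarrow> ('a \<Rightarrow> 'a set \<Rightarrow> ennreal) \<Rightarrow> bool" where
  "set_measurable2 U g \<longleftrightarrow> (\<forall>N::nat. (\<lambda>(y, x). g y (x ` {..<N})) \<in> borel_measurable (U \<Otimes>\<^sub>M PiM {..<N} (\<lambda>_. U)))"

text \<open>Expresses that \<open>Q\<close> is determined by the graph at radius \<open>r\<close>
  and by the position of the points relative to the regions in \<open>\<R>\<close>. For finitely
  many regions such a \<open>Q\<close> is a Boolean function of finitely many measurable tests on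
  the labelled points; this is the main source of measurability below.\<close>

definition local_prop :: "real \<Rightarrow> 'a::metric_space set set \<Rightarrow> ('a set \<Rightarrow> bool) \<Rightarrow> bool" where
  "local_prop r \<R> Q \<longleftrightarrow> (\<forall>\<omega> \<omega>' \<phi>. finite \<omega> \<and> bij_betw \<phi> \<omega> \<omega>' \<and>
      (\<forall>x\<in>\<omega>. \<forall>y\<in>\<omega>. dist (\<phi> x) (\<phi> y) \<le> r \<longleftrightarrow> dist x y \<le> r) \<and>
      (\<forall>x\<in>\<omega>. \<forall>R\<in>\<R>. \<phi> x \<in> R \<longleftrightarrow> x \<in> R) \<and> Q \<omega> \<longrightarrow> Q \<omega>')"

locale diffuse = prob_space U
  for U :: "'a::{metric_space, second_countable_topology} measure" +
  assumes sets_U [measurable_cong]: "sets U = sets borel"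
    and emeasure_singleton: "emeasure U {x} = 0"
begin

lemma space_U [simp]: "space U = UNIV"
  using sets_eq_imp_space_eq[OF sets_U] by simp

sublocale P: product_prob_space "\<lambda>_::nat. U" UNIV
  by unfold_locales

lemma prob_space_PiM': "prob_space (PiM (I::nat set) (\<lambda>_. U))"
  by (rule prob_space_PiM) (rule prob_space_axioms)

lemma sigma_finite_PiM: "finite I \<Longrightarrow> sigma_finite_measure (PiM (I::nat set) (\<lambda>_. U))"
  using prob_space_imp_sigma_finite[OF prob_space_PiM'] .

abbreviation prodU :: "nat \<Rightarrow> (nat \<Rightarrow> 'a) measure" where
  "prodU N \<equiv> PiM {..<N} (\<lambda>_. U)"

lemma set_measurable_section: "set_measurable2 U g \<Longrightarrow> set_measurable U (g y)"
  unfolding set_measurable_def set_measurable2_def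
  using measurable_Pair2[of _ U "prodU _" borel y] by fastforce

lemma image_upd: "(x(N := y)) ` {..<Suc N} = insert y (x ` {..<N})"
  by (auto simp: lessThan_Suc)

lemma set_measurable2_insert:
  assumes "set_measurable U F"
  shows "set_measurable2 U (\<lambda>y \<omega>. F (insert y \<omega>))"
  unfolding set_measurable2_def
proof
  fix N
  have m: "(\<lambda>(y, x). x(N := y)) \<in> measurable (U \<Otimes>\<^sub>M prodU N) (prodU (Suc N))"
    unfolding lessThan_Suc by measurable
  have "(\<lambda>x. F (x ` {..<Suc N})) \<in> borel_measurable (prodU (Suc N))"
    using assms by (auto simp: set_measurable_def)
  from measurable_compose[OF m this]
  show "(\<lambda>(y, x). F (insert y (x ` {..<N}))) \<in> borel_measurable (U \<Otimes>\<^sub>M prodU N)"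
    by (simp add: case_prod_beta image_upd del: fun_upd_apply)
qed

lemma iid_int_measurable:
  assumes "set_measurable2 U g"
  shows "(\<lambda>y. iid_int U N (g y)) \<in> borel_measurable U"
proof -
  interpret S: sigma_finite_measure "prodU N" by (rule sigma_finite_PiM) simp
  show ?thesis unfolding iid_int_def
    using assms by (intro S.borel_measurable_nn_integral) (auto simp: set_measurable2_def)
qed

lemma iid_int_0 [simp]: "iid_int U 0 F = F {}"
  using prob_space.emeasure_space_1[OF prob_space_PiM'[of "{}"]] by (simp add: iid_int_def)

lemma iid_int_Suc:
  assumes "set_measurable U F"
  shows "iid_int U (Suc N) F = (\<integral>\<^sup>+y. iid_int U N (\<lambda>\<omega>. F (insert y \<omega>)) \<partial>U)"
proof -
  have m: "(\<lambda>x. F (x ` insert N {..<N})) \<in> borel_measurable (PiM (insert N {..<N}) (\<lambda>_. U))"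
    using assms unfolding set_measurable_def lessThan_Suc[symmetric] by blast
  show ?thesis
    unfolding iid_int_def lessThan_Suc
    by (subst P.product_nn_integral_insert_rev[OF _ _ m]) (auto simp flip: lessThan_Suc simp: image_upd simp del: fun_upd_apply)
qed

text \<open>Absence of atoms makes the points distinct, so that sums over the point set agree with
  sums over the labels.\<close>

lemma AE_inj: "AE x in prodU N. inj_on x {..<N}"
proof -
  have "AE x in prodU N. \<forall>i\<in>{..<N}. \<forall>j\<in>{..<N}. i \<noteq> j \<longrightarrow> x i \<noteq> x j"
  proof (intro AE_finite_allI)
    fix i j assume ij: "i \<in> {..<N}" "j \<in> {..<N}"
    show "AE x in prodU N. i \<noteq> j \<longrightarrow> x i \<noteq> x j"
    proof (cases "i = j")
      case False
      define I where "I = {..<N} - {i}"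
      have I: "{..<N} = insert i I" "i \<notin> I" "finite I" "j \<in> I" using ij False by (auto simp: I_def)
      have meq: "{x \<in> space (prodU N). dist (x i) (x j) \<le> 0} \<in> sets (prodU N)"
        using ij by measurable
      have "emeasure (prodU N) {x \<in> space (prodU N). dist (x i) (x j) \<le> 0}
        = (\<integral>\<^sup>+x. indicator {x \<in> space (prodU N). dist (x i) (x j) \<le> 0} x \<partial>prodU N)"
        using meq by simp
      also have "\<dots> = (\<integral>\<^sup>+x. (\<integral>\<^sup>+y. indicator {x \<in> space (prodU N). dist (x i) (x j) \<le> 0} (x(i := y)) \<partial>U) \<partial>PiM I (\<lambda>_. U))"
        using meq unfolding I(1) by (intro P.product_nn_integral_insert I) auto
      also have "\<dots> \<le> (\<integral>\<^sup>+x. (\<integral>\<^sup>+y. indicator {x j} y \<partial>U) \<partial>PiM I (\<lambda>_. U))"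
        using I False by (intro nn_integral_mono) (auto simp: indicator_def)
      also have "\<dots> = 0" by (simp add: emeasure_singleton sets_U)
      finally have "AE x in prodU N. \<not> dist (x i) (x j) \<le> 0"
        using meq by (intro AE_I[OF _ _ meq]) auto
      thus ?thesis by eventually_elim auto
    qed simp
  qed simp_all
  thus ?thesis by eventually_elim (auto simp: inj_on_def)
qed

lemma iid_int_mono: "(\<And>\<omega>. finite \<omega> \<Longrightarrow> F \<omega> \<le> G \<omega>) \<Longrightarrow> iid_int U N F \<le> iid_int U N G"
  unfolding iid_int_def by (intro nn_integral_mono) auto

lemma pois_int_mono: "(\<And>\<omega>. finite \<omega> \<Longrightarrow> F \<omega> \<le> G \<omega>) \<Longrightarrow> pois_int U t F \<le> pois_int U t G"
  unfolding pois_int_def by (intro suminf_le mult_left_mono iid_int_mono) auto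

lemma iid_int_cmult: "set_measurable U F \<Longrightarrow> iid_int U N (\<lambda>\<omega>. c * F \<omega>) = c * iid_int U N F"
  unfolding iid_int_def set_measurable_def by (intro nn_integral_cmult) auto

lemma pois_int_cmult: "set_measurable U F \<Longrightarrow> pois_int U t (\<lambda>\<omega>. c * F \<omega>) = c * pois_int U t F"
  unfolding pois_int_def by (simp add: iid_int_cmult mult.left_commute)

lemma iid_int_add: "set_measurable U F \<Longrightarrow> set_measurable U G \<Longrightarrow>
    iid_int U N (\<lambda>\<omega>. F \<omega> + G \<omega>) = iid_int U N F + iid_int U N G"
  unfolding iid_int_def set_measurable_def by (intro nn_integral_add) auto

lemma pois_int_add: "set_measurable U F \<Longrightarrow> set_measurable U G \<Longrightarrow>
    pois_int U t (\<lambda>\<omega>. F \<omega> + G \<omega>) = pois_int U t F + pois_int U t G"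
  unfolding pois_int_def by (simp add: iid_int_add distrib_left suminf_add)

lemma set_measurable_sum:
  assumes "\<And>i. i \<in> I \<Longrightarrow> set_measurable U (F i)"
  shows "set_measurable U (\<lambda>\<omega>. \<Sum>i\<in>I. F i \<omega>)"
  using assms unfolding set_measurable_def by (auto intro!: borel_measurable_sum)

lemma pois_int_sum:
  assumes "finite I" "\<And>i. i \<in> I \<Longrightarrow> set_measurable U (F i)"
  shows "pois_int U t (\<lambda>\<omega>. \<Sum>i\<in>I. F i \<omega>) = (\<Sum>i\<in>I. pois_int U t (F i))"
  using assms
proof (induction I rule: finite_induct)
  case empty thus ?case by (simp add: pois_int_def iid_int_def)
next
  case (insert i I)
  thus ?case by (simp add: pois_int_add set_measurable_sum)
qed

lemma iid_int_const: "iid_int U N (\<lambda>_. c) = c"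
  unfolding iid_int_def using prob_space.emeasure_space_1[OF prob_space_PiM'] by simp

lemma poisson_sums:
  assumes "t \<ge> (0::real)"
  shows "(\<Sum>N. ennreal (exp (- t) * t ^ N / fact N)) = 1"
proof -
  have "(\<lambda>N. t ^ N / fact N) sums exp t" using exp_converges[of t] by (simp add: divide_inverse mult.commute)
  hence "(\<lambda>N. exp (- t) * (t ^ N / fact N)) sums (exp (- t) * exp t)" by (rule sums_mult)
  hence "(\<lambda>N. exp (- t) * t ^ N / fact N) sums 1" by (simp add: exp_minus)
  thus ?thesis using assms by (subst suminf_ennreal2) (auto simp: sums_iff)
qed

lemma pois_int_const: "t \<ge> 0 \<Longrightarrow> pois_int U t (\<lambda>_. c) = c"
  unfolding pois_int_def iid_int_const ennreal_suminf_multc by (simp only: poisson_sums mult_1_left)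

section \<open>Measurability\<close>

text \<open>The points with labels in \<open>S\<close> are renumbered as a sample of size
  \<open>card S\<close>, to which the definition of measurability applies.\<close>

lemma set_measurable2_subset:
  assumes g: "set_measurable2 U g" and S: "S \<subseteq> {..<N}" and i: "i < N"
  shows "(\<lambda>x. g (x i) (x ` S)) \<in> borel_measurable (prodU N)"
proof -
  have "finite S" using S finite_subset by blast
  then obtain h where h: "bij_betw h {..<card S} S"
    by (metis atLeast0LessThan ex_bij_betw_nat_finite)
  hence hS: "h k \<in> S" if "k < card S" for k using that by (auto simp: bij_betw_def)
  have m: "(\<lambda>x. (x i, \<lambda>k\<in>{..<card S}. x (h k))) \<in> measurable (prodU N) (U \<Otimes>\<^sub>M PiM {..<card S} (\<lambda>_. U))"
    using i hS S by (intro measurable_Pair measurable_restrict measurable_component_singleton) auto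
  have "(\<lambda>(y, x). g y (x ` {..<card S})) \<in> borel_measurable (U \<Otimes>\<^sub>M PiM {..<card S} (\<lambda>_. U))"
    using g by (auto simp: set_measurable2_def)
  from measurable_compose[OF m this]
  have "(\<lambda>x. g (x i) ((\<lambda>k\<in>{..<card S}. x (h k)) ` {..<card S})) \<in> borel_measurable (prodU N)"
    by simp
  moreover have "(\<lambda>k\<in>{..<card S}. x (h k)) ` {..<card S} = x ` S" for x :: "nat \<Rightarrow> 'a"
  proof -
    have "x ` S = x ` h ` {..<card S}" using h by (simp add: bij_betw_def)
    also have "\<dots> = (\<lambda>k\<in>{..<card S}. x (h k)) ` {..<card S}"
      unfolding image_image by (intro image_cong) auto
    finally show ?thesis by simp
  qed
  ultimately show ?thesis by simp
qed

lemma set_measurable2_const: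
  assumes "set_measurable U F"
  shows "set_measurable2 U (\<lambda>_. F)"
  unfolding set_measurable2_def
proof
  fix N
  have "(\<lambda>x. F (x ` {..<N})) \<in> borel_measurable (prodU N)" using assms by (simp add: set_measurable_def)
  from measurable_compose[OF measurable_snd this]
  show "(\<lambda>(y, x). F (x ` {..<N})) \<in> borel_measurable (U \<Otimes>\<^sub>M prodU N)"
    by (simp add: case_prod_unfold)
qed

lemma set_measurable_subset:
  assumes F: "set_measurable U F" and S: "S \<subseteq> {..<N}"
  shows "(\<lambda>x. F (x ` S)) \<in> borel_measurable (prodU N)"
proof (cases "N = 0")
  case True
  hence "S = {}" using S by auto
  thus ?thesis by simp
next
  case False
  from set_measurable2_subset[OF set_measurable2_const[OF F] S, of 0] show ?thesis using False by simp
qed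

text \<open>Split according to the finitely many possible sets \<open>S\<close> of labels whose
  points avoid \<open>E\<close>; on each part the functional depends on the points labelled by
  \<open>S\<close> only.\<close>

lemma set_measurable_del:
  assumes F: "set_measurable U F" and E: "E \<in> sets borel"
  shows "set_measurable U (\<lambda>\<omega>. F (\<omega> - E))"
  unfolding set_measurable_def
proof
  fix N
  let ?M = "prodU N"
  have eq: "F (x ` {..<N} - E) = (\<Sum>S\<in>Pow {..<N}. indicator {x \<in> space ?M. \<forall>i\<in>{..<N}. x i \<notin> E \<longleftrightarrow> i \<in> S} x * F (x ` S))"
    if "x \<in> space ?M" for x
  proof -
    have "(\<Sum>S\<in>Pow {..<N}. indicator {x \<in> space ?M. \<forall>i\<in>{..<N}. x i \<notin> E \<longleftrightarrow> i \<in> S} x * F (x ` S))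
      = (\<Sum>S\<in>Pow {..<N}. if S = {i\<in>{..<N}. x i \<notin> E} then F (x ` {i\<in>{..<N}. x i \<notin> E}) else 0)"
      using that by (intro sum.cong) (auto simp: indicator_def)
    also have "\<dots> = F (x ` {i\<in>{..<N}. x i \<notin> E})" by (subst sum.delta) auto
    also have "x ` {i\<in>{..<N}. x i \<notin> E} = x ` {..<N} - E" by auto
    finally show ?thesis by simp
  qed
  have "(\<lambda>x. \<Sum>S\<in>Pow {..<N}. indicator {x \<in> space ?M. \<forall>i\<in>{..<N}. x i \<notin> E \<longleftrightarrow> i \<in> S} x * F (x ` S)) \<in> borel_measurable ?M"
  proof (intro borel_measurable_sum borel_measurable_times_ennreal borel_measurable_indicator set_measurable_subset[OF F])
    fix S
    have "E \<in> sets U" using E sets_U by simp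
    thus "{x \<in> space ?M. \<forall>i\<in>{..<N}. x i \<notin> E \<longleftrightarrow> i \<in> S} \<in> sets ?M" by measurable
  qed auto
  thus "(\<lambda>x. F (x ` {..<N} - E)) \<in> borel_measurable ?M"
    by (subst measurable_cong[OF eq]) auto
qed

text \<open>\<Psi> is constant on the atoms of the finite algebra generated by the tests
  \<open>p k\<close>, so the event is a finite union of atoms.\<close>

lemma sets_bool_pattern:
  assumes K: "finite K" and p: "\<And>k. k \<in> K \<Longrightarrow> {x \<in> space M. p k x} \<in> sets M"
    and \<Psi>: "\<And>x x'. x \<in> space M \<Longrightarrow> x' \<in> space M \<Longrightarrow> (\<And>k. k \<in> K \<Longrightarrow> p k x \<longleftrightarrow> p k x') \<Longrightarrow> \<Psi> x \<Longrightarrow> \<Psi> x'"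
  shows "{x \<in> space M. \<Psi> x} \<in> sets M"
proof -
  define A where "A D = {x \<in> space M. \<forall>k\<in>K. p k x \<longleftrightarrow> k \<in> D}" for D
  have A: "A D \<in> sets M" for D
    unfolding A_def using K p
    by (intro sets.sets_Collect_finite_All' sets.sets_Collect_finite_All sets.sets_Collect) auto
  have "{x \<in> space M. \<Psi> x} = (\<Union>D\<in>{D\<in>Pow K. \<exists>x\<in>A D. \<Psi> x}. A D)"
  proof (intro equalityI subsetI)
    fix x assume x: "x \<in> {x \<in> space M. \<Psi> x}"
    hence "x \<in> A {k\<in>K. p k x}" by (auto simp: A_def)
    thus "x \<in> (\<Union>D\<in>{D\<in>Pow K. \<exists>x\<in>A D. \<Psi> x}. A D)" using x by (intro UN_I[of "{k\<in>K. p k x}"]) auto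
  next
    fix x assume "x \<in> (\<Union>D\<in>{D\<in>Pow K. \<exists>x\<in>A D. \<Psi> x}. A D)"
    then obtain D x' where "x \<in> A D" "x' \<in> A D" "\<Psi> x'" by auto
    thus "x \<in> {x \<in> space M. \<Psi> x}" using \<Psi>[of x' x] by (auto simp: A_def)
  qed
  thus ?thesis using K by (auto intro!: sets.finite_UN A)
qed

lemma sets_label_pattern:
  fixes \<R> :: "'a set set"
  assumes R: "finite \<R>" "\<R> \<subseteq> sets borel"
    and \<Psi>: "\<And>x x'. (\<And>i j. i < N \<Longrightarrow> j < N \<Longrightarrow> dist (x i) (x j) \<le> r \<longleftrightarrow> dist (x' i) (x' j) \<le> r) \<Longrightarrow>
       (\<And>i j. i < N \<Longrightarrow> j < N \<Longrightarrow> x i = x j \<longleftrightarrow> x' i = x' j) \<Longrightarrow>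
       (\<And>i R. i < N \<Longrightarrow> R \<in> \<R> \<Longrightarrow> x i \<in> R \<longleftrightarrow> x' i \<in> R) \<Longrightarrow> \<Psi> x \<Longrightarrow> \<Psi> x'"
  shows "{x \<in> space (prodU N). \<Psi> x} \<in> sets (prodU N)"
proof -
  let ?M = "prodU N"
  \<comment> \<open>Equality of two points is tested as distance at most 0, so that it has the same
    form as the adjacency test.\<close>
  define p where "p = (\<lambda>(k::nat, i, j, R) (x :: nat \<Rightarrow> 'a). if k = 0 then dist (x i) (x j) \<le> r else if k = 1 then dist (x i) (x j) \<le> 0 else x i \<in> R)"
  \<comment> \<open>The dummy region \<open>{}\<close> supplies an index for the first two kinds of
    test when \<open>\<R>\<close> is empty.\<close>
  let ?K = "{..<3::nat} \<times> {..<N} \<times> {..<N} \<times> insert {} \<R>"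
  show ?thesis
  proof (rule sets_bool_pattern[of ?K _ p])
    show "finite ?K" using R by auto
    fix k assume "k \<in> ?K"
    then obtain a i j R' where k: "k = (a, i, j, R')" "i < N" "j < N" "R' \<in> insert {} \<R>" by auto
    have "R' \<in> sets U" using k R sets_U by auto
    moreover have ij: "i \<in> {..<N}" "j \<in> {..<N}" using k by auto
    hence "{x \<in> space ?M. dist (x i) (x j) \<le> r} \<in> sets ?M" by measurable
    moreover have "{x \<in> space ?M. dist (x i) (x j) \<le> 0} \<in> sets ?M" using ij by measurable
    moreover have "{x \<in> space ?M. x i \<in> R'} \<in> sets ?M" using ij \<open>R' \<in> sets U\<close> by measurable
    ultimately show "{x \<in> space ?M. p k x} \<in> sets ?M" by (simp add: p_def k)
  next
    fix x x' assume k: "\<And>k. k \<in> ?K \<Longrightarrow> p k x \<longleftrightarrow> p k x'" and P: "\<Psi> x"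
    show "\<Psi> x'"
    proof (rule \<Psi>[OF _ _ _ P])
      fix i j assume "i < N" "j < N"
      thus "dist (x i) (x j) \<le> r \<longleftrightarrow> dist (x' i) (x' j) \<le> r" using k[of "(0,i,j,{})"] by (auto simp: p_def)
      show "x i = x j \<longleftrightarrow> x' i = x' j" using k[of "(1,i,j,{})"] \<open>i < N\<close> \<open>j < N\<close> by (auto simp: p_def)
    next
      fix i R assume "i < N" "R \<in> \<R>"
      thus "x i \<in> R \<longleftrightarrow> x' i \<in> R" using k[of "(2,i,i,R)"] by (auto simp: p_def)
    qed
  qed
qed

lemma local_prop_sets:
  assumes R: "finite \<R>" "\<R> \<subseteq> sets borel" and Q: "local_prop r \<R> Q"
  shows "{x \<in> space (prodU N). Q (x ` {..<N})} \<in> sets (prodU N)"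
proof (rule sets_label_pattern[OF R, of N r])
  fix x x' :: "nat \<Rightarrow> 'a"
  assume *: "\<And>i j. i < N \<Longrightarrow> j < N \<Longrightarrow> dist (x i) (x j) \<le> r \<longleftrightarrow> dist (x' i) (x' j) \<le> r"
    "\<And>i j. i < N \<Longrightarrow> j < N \<Longrightarrow> x i = x j \<longleftrightarrow> x' i = x' j"
    "\<And>i R. i < N \<Longrightarrow> R \<in> \<R> \<Longrightarrow> x i \<in> R \<longleftrightarrow> x' i \<in> R" "Q (x ` {..<N})"
  \<comment> \<open>Matches the two samples label by label. Which label is chosen for a point is
    immaterial, because the same labels coincide in both samples.\<close>
  define \<phi> where "\<phi> z = x' (SOME i. i < N \<and> x i = z)" for z
  have \<phi>: "\<phi> (x i) = x' i" if "i < N" for i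
  proof -
    have "(SOME j. j < N \<and> x j = x i) < N \<and> x (SOME j. j < N \<and> x j = x i) = x i"
      using that by (intro someI) auto
    thus ?thesis using *(2) that by (auto simp: \<phi>_def)
  qed
  have "bij_betw \<phi> (x ` {..<N}) (x' ` {..<N})"
    unfolding bij_betw_def inj_on_def using \<phi> *(2) by (auto simp: image_image)
  thus "Q (x' ` {..<N})"
    using Q[unfolded local_prop_def, rule_format, of "x ` {..<N}" \<phi> "x' ` {..<N}"] * \<phi> by auto
qed

lemma set_measurable_local_prop:
  assumes "finite \<R>" "\<R> \<subseteq> sets borel" "local_prop r \<R> Q"
  shows "set_measurable U (\<lambda>\<omega>. of_bool (Q \<omega>))"
  unfolding set_measurable_def
proof
  fix N
  let ?M = "prodU N"
  have "indicator {x \<in> space ?M. Q (x ` {..<N})} \<in> borel_measurable ?M"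
    by (intro borel_measurable_indicator local_prop_sets[OF assms])
  thus "(\<lambda>x. of_bool (Q (x ` {..<N})) :: ennreal) \<in> borel_measurable ?M"
    by (rule measurable_cong[THEN iffD1, rotated]) (auto simp: indicator_def)
qed

section \<open>The Mecke formula and deletion of points\<close>

text \<open>All \<open>N + 1\<close> labels contribute equally by exchangeability, made explicit by
  a transposition with the last label, whose term is a product integral.\<close>

lemma iid_int_mecke:
  assumes g: "set_measurable2 U g"
  shows "iid_int U (Suc N) (\<lambda>\<omega>. \<Sum>x\<in>\<omega>. g x (\<omega> - {x})) = of_nat (Suc N) * (\<integral>\<^sup>+y. iid_int U N (g y) \<partial>U)"
proof -
  let ?M = "prodU (Suc N)"
  have "iid_int U (Suc N) (\<lambda>\<omega>. \<Sum>x\<in>\<omega>. g x (\<omega> - {x})) = (\<integral>\<^sup>+x. (\<Sum>i<Suc N. g (x i) (x ` ({..<Suc N} - {i}))) \<partial>?M)"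
    unfolding iid_int_def
  proof (rule nn_integral_cong_AE, rule AE_mp[OF AE_inj[of "Suc N"]], rule AE_I2, rule impI)
    fix x :: "nat \<Rightarrow> 'a" assume inj: "inj_on x {..<Suc N}"
    show "(\<Sum>z\<in>x ` {..<Suc N}. g z (x ` {..<Suc N} - {z})) = (\<Sum>i<Suc N. g (x i) (x ` ({..<Suc N} - {i})))"
      unfolding sum.reindex[OF inj] o_def
    proof (intro sum.cong refl)
      fix i assume "i \<in> {..<Suc N}"
      hence "x ` ({..<Suc N} - {i}) = x ` {..<Suc N} - {x i}" using inj by (auto simp: inj_on_def)
      thus "g (x i) (x ` {..<Suc N} - {x i}) = g (x i) (x ` ({..<Suc N} - {i}))" by simp
    qed
  qed
  also have "\<dots> = (\<Sum>i<Suc N. \<integral>\<^sup>+x. g (x i) (x ` ({..<Suc N} - {i})) \<partial>?M)"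
    by (rule nn_integral_sum) (intro set_measurable2_subset[OF g], auto)
  also have "\<dots> = (\<Sum>i<Suc N. \<integral>\<^sup>+y. iid_int U N (g y) \<partial>U)"
  proof (intro sum.cong refl)
    fix i assume i: "i \<in> {..<Suc N}"
    define \<pi> where "\<pi> = Transposition.transpose i N"
    have \<pi>: "bij_betw \<pi> {..<Suc N} {..<Suc N}"
      using i unfolding \<pi>_def by (intro permutes_imp_bij permutes_swap_id) auto
    have inj: "inj_on \<pi> {..<Suc N}" and im: "\<pi> ` {..<Suc N} = {..<Suc N}" using \<pi> by (auto simp: bij_betw_def)
    have \<pi>i: "\<pi> i = N" by (simp add: \<pi>_def)
    have im2: "\<pi> ` ({..<Suc N} - {i}) = {..<N}"
    proof -
      have "\<pi> ` ({..<Suc N} - {i}) = \<pi> ` {..<Suc N} - \<pi> ` {i}"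
        using inj i by (intro inj_on_image_set_diff) auto
      thus ?thesis using im \<pi>i by auto
    qed
    have d: "distr ?M ?M (\<lambda>\<omega>. \<lambda>n\<in>{..<Suc N}. \<omega> (\<pi> n)) = ?M"
      using distr_PiM_reindex[of "{..<Suc N}" "\<lambda>_. U" \<pi> "{..<Suc N}"] inj im prob_space_axioms by (auto simp: Pi_iff)
    have mG: "(\<lambda>x. g (x i) (x ` ({..<Suc N} - {i}))) \<in> borel_measurable ?M"
      using i by (intro set_measurable2_subset[OF g]) auto
    have mt: "(\<lambda>\<omega>. \<lambda>n\<in>{..<Suc N}. \<omega> (\<pi> n)) \<in> measurable ?M ?M"
      using im by (intro measurable_restrict measurable_component_singleton) auto
    have "(\<integral>\<^sup>+x. g (x i) (x ` ({..<Suc N} - {i})) \<partial>?M) =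
        (\<integral>\<^sup>+x. g (x i) (x ` ({..<Suc N} - {i})) \<partial>distr ?M ?M (\<lambda>\<omega>. \<lambda>n\<in>{..<Suc N}. \<omega> (\<pi> n)))" by (simp add: d)
    also have "\<dots> = (\<integral>\<^sup>+x. g ((\<lambda>n\<in>{..<Suc N}. x (\<pi> n)) i) ((\<lambda>n\<in>{..<Suc N}. x (\<pi> n)) ` ({..<Suc N} - {i})) \<partial>?M)"
      by (rule nn_integral_distr[OF mt]) (use mG in simp)
    also have "\<dots> = (\<integral>\<^sup>+x. g (x N) (x ` {..<N}) \<partial>?M)"
    proof (intro nn_integral_cong)
      fix x :: "nat \<Rightarrow> 'a"
      have "(\<lambda>n\<in>{..<Suc N}. x (\<pi> n)) ` ({..<Suc N} - {i}) = x ` \<pi> ` ({..<Suc N} - {i})"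
        unfolding image_image by (intro image_cong) auto
      thus "g ((\<lambda>n\<in>{..<Suc N}. x (\<pi> n)) i) ((\<lambda>n\<in>{..<Suc N}. x (\<pi> n)) ` ({..<Suc N} - {i})) = g (x N) (x ` {..<N})"
        using i \<pi>i im2 by simp
    qed
    also have "\<dots> = (\<integral>\<^sup>+y. (\<integral>\<^sup>+x. g ((x(N := y)) N) ((x(N := y)) ` {..<N}) \<partial>prodU N) \<partial>U)"
    proof -
      have "(\<lambda>x. g (x N) (x ` {..<N})) \<in> borel_measurable ?M"
        by (intro set_measurable2_subset[OF g]) auto
      thus ?thesis unfolding lessThan_Suc by (intro P.product_nn_integral_insert_rev) auto
    qed
    also have "\<dots> = (\<integral>\<^sup>+y. iid_int U N (g y) \<partial>U)"
      unfolding iid_int_def by (intro nn_integral_cong) (auto cong: image_cong_simp)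
    finally show "(\<integral>\<^sup>+x. g (x i) (x ` ({..<Suc N} - {i})) \<partial>?M) = (\<integral>\<^sup>+y. iid_int U N (g y) \<partial>U)" .
  qed
  finally show ?thesis by simp
qed

text \<open>The factor \<open>N + 1\<close> of the version for samples of fixed size is turned into
  \<open>t\<close> by the Poisson weights, through the identity \<open>w\<close>.\<close>

lemma pois_int_mecke:
  assumes g: "set_measurable2 U g" and t: "t \<ge> 0"
  shows "pois_int U t (\<lambda>\<omega>. \<Sum>x\<in>\<omega>. g x (\<omega> - {x})) = ennreal t * (\<integral>\<^sup>+y. pois_int U t (g y) \<partial>U)"
proof -
  let ?w = "\<lambda>N. ennreal (exp (- t) * t ^ N / fact N)"
  let ?J = "\<lambda>N. \<integral>\<^sup>+y. iid_int U N (g y) \<partial>U"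
  let ?F = "\<lambda>\<omega>. \<Sum>x\<in>\<omega>. g x (\<omega> - {x})"
  have w: "?w (Suc N) * of_nat (Suc N) = ennreal t * ?w N" for N
  proof -
    have "?w (Suc N) * of_nat (Suc N) = ennreal (exp (- t) * t ^ Suc N / fact (Suc N) * real (Suc N))"
      using t by (subst ennreal_of_nat_eq_real_of_nat, subst ennreal_mult[symmetric]) auto
    also have "exp (- t) * t ^ Suc N / fact (Suc N) * real (Suc N) = t * (exp (- t) * t ^ N / fact N)"
      by (simp add: fact_Suc field_simps del: of_nat_Suc)
    also have "ennreal \<dots> = ennreal t * ?w N" using t by (subst ennreal_mult) auto
    finally show ?thesis .
  qed
  have "pois_int U t ?F = (\<Sum>N. ?w (N + 1) * iid_int U (N + 1) ?F) + (\<Sum>N<1. ?w N * iid_int U N ?F)"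
    unfolding pois_int_def by (rule suminf_offset) auto
  also have "\<dots> = (\<Sum>N. ennreal t * (?w N * ?J N))"
    using w by (simp add: iid_int_mecke[OF g] mult.assoc[symmetric] del: of_nat_Suc power_Suc fact_Suc)
  also have "\<dots> = ennreal t * (\<Sum>N. ?w N * ?J N)" by (rule ennreal_suminf_cmult)
  also have "(\<Sum>N. ?w N * ?J N) = (\<Sum>N. \<integral>\<^sup>+y. ?w N * iid_int U N (g y) \<partial>U)"
    using iid_int_measurable[OF g] by (simp add: nn_integral_cmult)
  also have "\<dots> = (\<integral>\<^sup>+y. (\<Sum>N. ?w N * iid_int U N (g y)) \<partial>U)"
    using iid_int_measurable[OF g] by (intro nn_integral_suminf[symmetric]) auto
  finally show ?thesis by (simp add: pois_int_def)
qed

section \<open>Erasing the points of a region and inserting single points\<close>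

lemma set_measurable_times:
  "set_measurable U F \<Longrightarrow> set_measurable U G \<Longrightarrow> set_measurable U (\<lambda>\<omega>. F \<omega> * G \<omega>)"
  unfolding set_measurable_def by (auto intro!: borel_measurable_times_ennreal)

lemma set_measurable_empty_on:
  "E \<in> sets borel \<Longrightarrow> set_measurable U (\<lambda>\<omega>. of_bool (\<omega> \<inter> E = {}))"
  by (rule set_measurable_local_prop[of "{E}" 0]) (auto simp: local_prop_def bij_betw_def)

text \<open>Group by the number \<open>a\<close> of sample points in \<open>E\<close>: these are
  erased, the others avoid \<open>E\<close>. The induction splits on whether the newest point lies
  in \<open>E\<close>, and Pascal's rule merges the two sums.\<close>

lemma iid_int_del:
  assumes E: "E \<in> sets borel" and F: "set_measurable U F"
  shows "iid_int U N (\<lambda>\<omega>. F (\<omega> - E)) =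
    (\<Sum>a\<le>N. of_nat (N choose a) * emeasure U E ^ a * iid_int U (N - a) (\<lambda>\<omega>. F \<omega> * of_bool (\<omega> \<inter> E = {})))"
  using F
proof (induction N arbitrary: F)
  case 0
  show ?case by simp
next
  case (Suc N)
  let ?q = "emeasure U E"
  let ?G = "\<lambda>F \<omega>. F \<omega> * of_bool (\<omega> \<inter> E = {}) :: ennreal"
  let ?S = "\<lambda>b. iid_int U b (?G F)"
  have EU: "E \<in> sets U" using E sets_U by simp
  have mG: "set_measurable U (?G F)" if "set_measurable U F" for F
    using that E by (intro set_measurable_times set_measurable_empty_on)
  have mFy: "set_measurable U (\<lambda>\<omega>. F (insert y \<omega>))" for y
    by (rule set_measurable_section[OF set_measurable2_insert[OF Suc.prems]])
  have m2: "set_measurable2 U (\<lambda>y \<omega>. ?G F (insert y \<omega>))"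
    by (rule set_measurable2_insert[OF mG[OF Suc.prems]])
  have S_Suc: "?S (Suc b) = (\<integral>\<^sup>+y. indicator (- E) y * iid_int U b (?G (\<lambda>\<omega>. F (insert y \<omega>))) \<partial>U)" for b
  proof -
    have "iid_int U b (\<lambda>\<omega>. ?G F (insert y \<omega>)) = indicator (- E) y * iid_int U b (?G (\<lambda>\<omega>. F (insert y \<omega>)))" for y
    proof (cases "y \<in> E")
      case True
      thus ?thesis by (simp add: iid_int_const)
    next
      case False
      hence "(\<lambda>\<omega>. ?G F (insert y \<omega>)) = ?G (\<lambda>\<omega>. F (insert y \<omega>))" by (auto simp: fun_eq_iff)
      thus ?thesis using False by simp
    qed
    thus ?thesis by (simp add: iid_int_Suc[OF mG[OF Suc.prems]])
  qed
  have m3: "(\<lambda>y. indicator (- E) y * iid_int U b (?G (\<lambda>\<omega>. F (insert y \<omega>)))) \<in> borel_measurable U" for b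
  proof -
    have "(\<lambda>y. iid_int U b (\<lambda>\<omega>. ?G F (insert y \<omega>))) = (\<lambda>y. indicator (- E) y * iid_int U b (?G (\<lambda>\<omega>. F (insert y \<omega>))))"
    proof
      fix y
      show "iid_int U b (\<lambda>\<omega>. ?G F (insert y \<omega>)) = indicator (- E) y * iid_int U b (?G (\<lambda>\<omega>. F (insert y \<omega>)))"
      proof (cases "y \<in> E")
        case True
        thus ?thesis by (simp add: iid_int_const)
      next
        case False
        hence "(\<lambda>\<omega>. ?G F (insert y \<omega>)) = ?G (\<lambda>\<omega>. F (insert y \<omega>))" by (auto simp: fun_eq_iff)
        thus ?thesis using False by simp
      qed
    qed
    thus ?thesis using iid_int_measurable[OF m2, of b] by simp
  qed
  let ?D = "iid_int U N (\<lambda>\<omega>. F (\<omega> - E))"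
  have split: "iid_int U N (\<lambda>\<omega>. F (insert y \<omega> - E)) = indicator E y * ?D +
     (\<Sum>a\<le>N. of_nat (N choose a) * ?q ^ a * (indicator (- E) y * iid_int U (N - a) (?G (\<lambda>\<omega>. F (insert y \<omega>)))))" for y
  proof (cases "y \<in> E")
    case True
    hence "insert y \<omega> - E = \<omega> - E" for \<omega> by auto
    thus ?thesis using True by simp
  next
    case False
    hence "insert y \<omega> - E = insert y (\<omega> - E)" for \<omega> by auto
    thus ?thesis using False Suc.IH[OF mFy[of y]] by simp
  qed
  have "iid_int U (Suc N) (\<lambda>\<omega>. F (\<omega> - E)) = (\<integral>\<^sup>+y. iid_int U N (\<lambda>\<omega>. F (insert y \<omega> - E)) \<partial>U)"
    by (rule iid_int_Suc[OF set_measurable_del[OF Suc.prems E]])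
  also have "\<dots> = ?q * ?D + (\<Sum>a\<le>N. of_nat (N choose a) * ?q ^ a * ?S (Suc (N - a)))"
    unfolding split S_Suc using m3 EU
    by (simp add: nn_integral_add nn_integral_sum nn_integral_cmult nn_integral_multc mult.commute)
  also have "?D = (\<Sum>a\<le>N. of_nat (N choose a) * ?q ^ a * ?S (N - a))"
    by (rule Suc.IH[OF Suc.prems])
  also have "?q * \<dots> + (\<Sum>a\<le>N. of_nat (N choose a) * ?q ^ a * ?S (Suc (N - a)))
      = (\<Sum>a\<le>N. of_nat (N choose a) * ?q ^ Suc a * ?S (N - a)) +
        (\<Sum>a\<le>Suc N. of_nat (N choose a) * ?q ^ a * ?S (Suc N - a))"
  proof -
    have "(\<Sum>a\<le>Suc N. of_nat (N choose a) * ?q ^ a * ?S (Suc N - a)) = (\<Sum>a\<le>N. of_nat (N choose a) * ?q ^ a * ?S (Suc N - a))"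
      by (simp add: binomial_eq_0)
    also have "\<dots> = (\<Sum>a\<le>N. of_nat (N choose a) * ?q ^ a * ?S (Suc (N - a)))"
      by (intro sum.cong refl) (simp add: Suc_diff_le)
    finally show ?thesis by (simp only: sum_distrib_left power_Suc mult_ac)
  qed
  also have "\<dots> = (\<Sum>a\<le>Suc N. of_nat (Suc N choose a) * ?q ^ a * ?S (Suc N - a))"
    by (simp add: sum.atMost_Suc_shift distrib_right sum.distrib add_ac del: power_Suc sum.atMost_Suc)
  finally show ?case .
qed

lemma ennreal_suminf_swap: "(\<Sum>N. \<Sum>a. f N a) = (\<Sum>a. \<Sum>N. (f N a :: ennreal))"
  using nn_integral_suminf[of "\<lambda>a N. f N a" "count_space UNIV"]
  by (simp add: nn_integral_count_space_nat)

lemma ennreal_Cauchy_product: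
  "(\<Sum>N. \<Sum>a\<le>N. u a * v (N - a)) = (\<Sum>a. u a) * (\<Sum>b. (v b :: ennreal))"
proof -
  have "(\<Sum>N. \<Sum>a\<le>N. u a * v (N - a)) = (\<Sum>N. \<Sum>a. if a \<le> N then u a * v (N - a) else 0)"
  proof (intro arg_cong[where f = suminf] ext)
    fix N
    have "(\<Sum>a. if a \<le> N then u a * v (N - a) else 0) = (\<Sum>a\<le>N. if a \<le> N then u a * v (N - a) else 0)"
      by (rule suminf_finite) auto
    thus "(\<Sum>a\<le>N. u a * v (N - a)) = (\<Sum>a. if a \<le> N then u a * v (N - a) else 0)" by simp
  qed
  also have "\<dots> = (\<Sum>a. \<Sum>N. if a \<le> N then u a * v (N - a) else 0)" by (rule ennreal_suminf_swap)
  also have "\<dots> = (\<Sum>a. \<Sum>b. u a * v b)"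
  proof (rule arg_cong[where f = suminf], rule ext)
    fix a
    have "(\<Sum>N. if a \<le> N then u a * v (N - a) else 0) =
      (\<Sum>b. if a \<le> b + a then u a * v (b + a - a) else 0) + (\<Sum>N<a. if a \<le> N then u a * v (N - a) else 0)"
      by (rule suminf_offset[where f = "\<lambda>N. if a \<le> N then u a * v (N - a) else 0" and i = a]) auto
    thus "(\<Sum>N. if a \<le> N then u a * v (N - a) else 0) = (\<Sum>b. u a * v b)" by simp
  qed
  finally show ?thesis by simp
qed

text \<open>The Poisson weights factor over the points inside and outside \<open>E\<close>, and
  summing out those inside gives the exponential. This factor is the price of emptying
  \<open>E\<close>: it compares a functional after erasing with the same functional on
  configurations that are void on \<open>E\<close>.\<close>

lemma pois_int_del:
  assumes E: "E \<in> sets borel" and F: "set_measurable U F" and t: "t \<ge> 0"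
  shows "pois_int U t (\<lambda>\<omega>. F (\<omega> - E)) =
    ennreal (exp (t * measure U E)) * pois_int U t (\<lambda>\<omega>. F \<omega> * of_bool (\<omega> \<inter> E = {}))"
proof -
  let ?S = "\<lambda>b. iid_int U b (\<lambda>\<omega>. F \<omega> * of_bool (\<omega> \<inter> E = {}))"
  let ?w = "\<lambda>N. ennreal (exp (- t) * t ^ N / fact N)"
  let ?u = "\<lambda>a. ennreal ((t * measure U E) ^ a / fact a)"
  have c: "?w N * (of_nat (N choose a) * emeasure U E ^ a) = ?u a * ?w (N - a)" if "a \<le> N" for N a
  proof -
    have "?w N * (of_nat (N choose a) * emeasure U E ^ a) = ennreal ((exp (- t) * t ^ N / fact N) * (real (N choose a) * measure U E ^ a))"
      using t by (simp add: emeasure_eq_measure ennreal_power ennreal_of_nat_eq_real_of_nat flip: ennreal_mult)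
    also have "(exp (- t) * t ^ N / fact N) * (real (N choose a) * measure U E ^ a)
       = ((t * measure U E) ^ a / fact a) * (exp (- t) * t ^ (N - a) / fact (N - a))"
    proof -
      have "t ^ N = t ^ a * t ^ (N - a)" using that by (simp flip: power_add)
      thus ?thesis using that by (simp add: binomial_fact power_mult_distrib)
    qed
    also have "ennreal \<dots> = ?u a * ?w (N - a)" using t by (intro ennreal_mult) auto
    finally show ?thesis .
  qed
  have "pois_int U t (\<lambda>\<omega>. F (\<omega> - E)) = (\<Sum>N. \<Sum>a\<le>N. ?u a * (?w (N - a) * ?S (N - a)))"
    unfolding pois_int_def iid_int_del[OF E F]
  proof (intro arg_cong[where f = suminf] ext)
    fix N
    have "?w N * (of_nat (N choose a) * emeasure U E ^ a * ?S (N - a)) = ?u a * (?w (N - a) * ?S (N - a))" if "a \<le> N" for a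
      using c[OF that] by (simp flip: mult.assoc)
    thus "?w N * (\<Sum>a\<le>N. of_nat (N choose a) * emeasure U E ^ a * ?S (N - a)) = (\<Sum>a\<le>N. ?u a * (?w (N - a) * ?S (N - a)))"
      unfolding sum_distrib_left by (intro sum.cong refl) auto
  qed
  also have "\<dots> = (\<Sum>a. ?u a) * (\<Sum>b. ?w b * ?S b)" by (rule ennreal_Cauchy_product)
  also have "(\<Sum>a. ?u a) = ennreal (exp (t * measure U E))"
  proof -
    have "(\<lambda>a. (t * measure U E) ^ a / fact a) sums exp (t * measure U E)"
      using exp_converges[of "t * measure U E"] by (simp add: divide_inverse mult.commute)
    thus ?thesis using t by (subst suminf_ennreal2) (auto simp: sums_iff)
  qed
  finally show ?thesis by (simp add: pois_int_def)
qed

text \<open>Follows from \<open>pois_int_del\<close> for the constant functional 1, whose integral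
  is 1.\<close>

lemma pois_int_void:
  assumes E: "E \<in> sets borel" and t: "t \<ge> 0"
  shows "pois_int U t (\<lambda>\<omega>. of_bool (\<omega> \<inter> E = {})) = ennreal (exp (- t * measure U E))"
proof -
  let ?P = "pois_int U t (\<lambda>\<omega>. of_bool (\<omega> \<inter> E = {}))"
  have 1: "1 = ennreal (exp (t * measure U E)) * ?P"
    using pois_int_del[OF E _ t, of "\<lambda>_. 1"] by (simp add: pois_int_const t set_measurable_def)
  have "ennreal (exp (- t * measure U E)) = ennreal (exp (- t * measure U E)) * (ennreal (exp (t * measure U E)) * ?P)"
    using 1 by simp
  also have "\<dots> = ?P" by (simp flip: mult.assoc ennreal_mult exp_add)
  finally show ?thesis by simp
qed

text \<open>Mecke's formula for inserting a point of \<open>Z\<close> into a configuration that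
  misses \<open>Z\<close>. The insertion can be undone in one way only: at most one point of
  \<open>Z\<close> has the property that its removal empties \<open>Z\<close>, so the resulting sum
  is at most one copy of \<open>F\<close>.\<close>

lemma pois_int_insert_if_empty:
  assumes Z: "Z \<in> sets borel" and F: "set_measurable U F" and t: "t \<ge> 0"
  shows "ennreal t * (\<integral>\<^sup>+y. indicator Z y * pois_int U t (\<lambda>\<omega>. of_bool (\<omega> \<inter> Z = {}) * F (insert y \<omega>)) \<partial>U) \<le> pois_int U t F"
proof -
  let ?g = "\<lambda>y \<omega>. indicator Z y * (of_bool (\<omega> \<inter> Z = {}) * F (insert y \<omega>)) :: ennreal"
  have ZU: "Z \<in> sets U" using Z sets_U by simp
  have mF: "set_measurable2 U (\<lambda>y \<omega>. F (insert y \<omega>))" by (rule set_measurable2_insert[OF F])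
  have me: "set_measurable2 U (\<lambda>y \<omega>. of_bool (\<omega> \<inter> Z = {}) :: ennreal)"
    by (rule set_measurable2_const[OF set_measurable_empty_on[OF Z]])
  have g: "set_measurable2 U ?g"
    unfolding set_measurable2_def
  proof
    fix N
    have "(\<lambda>(y, x). F (insert y (x ` {..<N}))) \<in> borel_measurable (U \<Otimes>\<^sub>M prodU N)"
      "(\<lambda>(y::'a, x). of_bool (x ` {..<N} \<inter> Z = {}) :: ennreal) \<in> borel_measurable (U \<Otimes>\<^sub>M prodU N)"
      using mF me by (auto simp: set_measurable2_def)
    hence "(\<lambda>p. indicator Z (fst p) * (of_bool (snd p ` {..<N} \<inter> Z = {}) * F (insert (fst p) (snd p ` {..<N})))) \<in> borel_measurable (U \<Otimes>\<^sub>M prodU N)"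
      using ZU unfolding case_prod_unfold
      by (intro borel_measurable_times_ennreal) auto
    thus "(\<lambda>(y, x). ?g y (x ` {..<N})) \<in> borel_measurable (U \<Otimes>\<^sub>M prodU N)"
      by (simp add: case_prod_unfold)
  qed
  have ms: "set_measurable U (\<lambda>\<omega>. of_bool (\<omega> \<inter> Z = {}) * F (insert y \<omega>))" for y
    by (intro set_measurable_times set_measurable_section[OF mF] set_measurable_section[OF me])
  have "ennreal t * (\<integral>\<^sup>+y. indicator Z y * pois_int U t (\<lambda>\<omega>. of_bool (\<omega> \<inter> Z = {}) * F (insert y \<omega>)) \<partial>U)
     = ennreal t * (\<integral>\<^sup>+y. pois_int U t (?g y) \<partial>U)"
    by (simp add: pois_int_cmult[OF ms])
  also have "\<dots> = pois_int U t (\<lambda>\<omega>. \<Sum>x\<in>\<omega>. ?g x (\<omega> - {x}))"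
    by (rule pois_int_mecke[OF g t, symmetric])
  also have "\<dots> \<le> pois_int U t F"
  proof (rule pois_int_mono)
    fix \<omega> :: "'a set" assume fin: "finite \<omega>"
    show "(\<Sum>x\<in>\<omega>. ?g x (\<omega> - {x})) \<le> F \<omega>"
    proof (cases "\<exists>x\<in>\<omega>. x \<in> Z \<and> (\<omega> - {x}) \<inter> Z = {}")
      case True
      then obtain x where x: "x \<in> \<omega>" "x \<in> Z" "(\<omega> - {x}) \<inter> Z = {}" by auto
      have "(\<Sum>x\<in>\<omega>. ?g x (\<omega> - {x})) = ?g x (\<omega> - {x}) + (\<Sum>y\<in>\<omega> - {x}. ?g y (\<omega> - {y}))"
        using fin x by (intro sum.remove)
      also have "(\<Sum>y\<in>\<omega> - {x}. ?g y (\<omega> - {y})) = 0" using x by (intro sum.neutral) (auto simp: indicator_def)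
      finally show ?thesis using x by (simp add: insert_absorb)
    next
      case False
      hence "(\<Sum>x\<in>\<omega>. ?g x (\<omega> - {x})) = 0" by (intro sum.neutral) (auto simp: indicator_def)
      thus ?thesis by simp
    qed
  qed
  finally show ?thesis .
qed

end

text \<open>A filling step in averaged form: a missing point of \<open>Z\<close> is placed at random
  with the law \<open>U\<close> conditioned on \<open>Z\<close>. Since it acts on functionals and
  not on configurations, several steps compose by \<open>foldr\<close>.\<close>

definition insert_if_empty :: "'a measure \<Rightarrow> 'a set \<Rightarrow> ('a set \<Rightarrow> ennreal) \<Rightarrow> 'a set \<Rightarrow> ennreal" where
  "insert_if_empty U Z F \<omega> = (if \<omega> \<inter> Z = {}
     then (\<integral>\<^sup>+y. indicator Z y * F (insert y \<omega>) \<partial>U) / emeasure U Z else F \<omega>)"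

text \<open>All possible outcomes of the filling steps for a list of cells taken in order; the
  pointwise counterpart of iterating \<open>insert_if_empty\<close>.\<close>

fun fillings :: "'a set list \<Rightarrow> 'a set \<Rightarrow> 'a set set" where
  "fillings [] \<omega> = {\<omega>}"
| "fillings (Z # Zs) \<omega> = (if \<omega> \<inter> Z = {} then (\<Union>y\<in>Z. fillings Zs (insert y \<omega>)) else fillings Zs \<omega>)"

lemma fillings_supset: "\<omega>' \<in> fillings Zs \<omega> \<Longrightarrow> \<omega> \<subseteq> \<omega>'"
proof (induction Zs arbitrary: \<omega>)
  case (Cons Z Zs)
  show ?case
  proof (cases "\<omega> \<inter> Z = {}")
    case True
    then obtain y where "\<omega>' \<in> fillings Zs (insert y \<omega>)" using Cons.prems by auto
    thus ?thesis using Cons.IH by blast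
  qed (use Cons in simp)
qed simp

lemma fillings_subset: "\<omega>' \<in> fillings Zs \<omega> \<Longrightarrow> \<omega>' \<subseteq> \<omega> \<union> \<Union>(set Zs)"
proof (induction Zs arbitrary: \<omega>)
  case (Cons Z Zs)
  show ?case
  proof (cases "\<omega> \<inter> Z = {}")
    case True
    then obtain y where "y \<in> Z" "\<omega>' \<in> fillings Zs (insert y \<omega>)" using Cons.prems by auto
    thus ?thesis using Cons.IH[of "insert y \<omega>"] by auto
  next
    case False
    hence "\<omega>' \<subseteq> \<omega> \<union> \<Union>(set Zs)" using Cons by simp
    thus ?thesis by auto
  qed
qed simp

lemma fillings_nonempty: "\<omega>' \<in> fillings Zs \<omega> \<Longrightarrow> Z \<in> set Zs \<Longrightarrow> \<omega>' \<inter> Z \<noteq> {}"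
proof (induction Zs arbitrary: \<omega>)
  case (Cons Y Zs)
  show ?case
  proof (cases "Z \<in> set Zs")
    case True
    thus ?thesis using Cons by (auto split: if_splits)
  next
    case False
    hence "Z = Y" using Cons by auto
    thus ?thesis using Cons.prems(1) fillings_supset[of \<omega>' Zs] by (auto split: if_splits; blast)
  qed
qed simp

lemma fillings_disjoint: "\<omega>' \<in> fillings Zs \<omega> \<Longrightarrow> \<forall>Z\<in>set Zs. D \<inter> Z = {} \<Longrightarrow> \<omega>' \<inter> D = \<omega> \<inter> D"
  using fillings_supset[of \<omega>' Zs \<omega>] fillings_subset[of \<omega>' Zs \<omega>] by blast

text \<open>Disjointness of the cells keeps the insertions made for other cells out of
  \<open>D\<close>.\<close>

lemma fillings_singleton:
  "\<omega>' \<in> fillings Zs \<omega> \<Longrightarrow> sorted_wrt (\<lambda>A B. A \<inter> B = {}) Zs \<Longrightarrow> D \<in> set Zs \<Longrightarrow> \<omega> \<inter> D = {} \<Longrightarrow> \<exists>u. \<omega>' \<inter> D = {u}"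
proof (induction Zs arbitrary: \<omega>)
  case (Cons Z Zs)
  show ?case
  proof (cases "D = Z")
    case True
    then obtain y where y: "y \<in> D" "\<omega>' \<in> fillings Zs (insert y \<omega>)" using Cons.prems by auto
    have "\<omega>' \<inter> D = insert y \<omega> \<inter> D"
      by (rule fillings_disjoint[OF y(2)]) (use Cons.prems True in auto)
    thus ?thesis using y Cons.prems by auto
  next
    case False
    hence D: "D \<in> set Zs" "Z \<inter> D = {}" "sorted_wrt (\<lambda>A B. A \<inter> B = {}) Zs" using Cons.prems by auto
    show ?thesis
    proof (cases "\<omega> \<inter> Z = {}")
      case True
      then obtain y where y: "y \<in> Z" "\<omega>' \<in> fillings Zs (insert y \<omega>)" using Cons.prems by auto
      have "insert y \<omega> \<inter> D = {}" using y D Cons.prems by auto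
      thus ?thesis using Cons.IH[OF y(2) D(3) D(1)] by simp
    next
      case False
      thus ?thesis using Cons D by auto
    qed
  qed
qed simp

section \<open>Averaging over inserted points\<close>

context diffuse
begin

lemma set_measurable_nn_integral:
  assumes "set_measurable2 U g"
  shows "set_measurable U (\<lambda>\<omega>. \<integral>\<^sup>+y. g y \<omega> \<partial>U)"
  unfolding set_measurable_def
proof
  fix N
  have "(\<lambda>(y, x). g y (x ` {..<N})) \<in> borel_measurable (U \<Otimes>\<^sub>M prodU N)" using assms by (simp add: set_measurable2_def)
  hence "(\<lambda>(x, y). g y (x ` {..<N})) \<in> borel_measurable (prodU N \<Otimes>\<^sub>M U)"
    by (subst measurable_pair_swap_iff) simp
  thus "(\<lambda>x. \<integral>\<^sup>+y. g y (x ` {..<N}) \<partial>U) \<in> borel_measurable (prodU N)"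
    by (rule borel_measurable_nn_integral)
qed

lemma pois_int_nn_integral:
  assumes g: "set_measurable2 U g"
  shows "pois_int U t (\<lambda>\<omega>. \<integral>\<^sup>+y. g y \<omega> \<partial>U) = (\<integral>\<^sup>+y. pois_int U t (g y) \<partial>U)"
proof -
  have i: "iid_int U N (\<lambda>\<omega>. \<integral>\<^sup>+y. g y \<omega> \<partial>U) = (\<integral>\<^sup>+y. iid_int U N (g y) \<partial>U)" for N
  proof -
    interpret S: sigma_finite_measure "prodU N" by (rule sigma_finite_PiM) simp
    interpret pair_sigma_finite U "prodU N" ..
    have "(\<lambda>(y, x). g y (x ` {..<N})) \<in> borel_measurable (U \<Otimes>\<^sub>M prodU N)" using g by (simp add: set_measurable2_def)
    from Fubini'[OF this] show ?thesis by (simp add: iid_int_def)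
  qed
  have "pois_int U t (\<lambda>\<omega>. \<integral>\<^sup>+y. g y \<omega> \<partial>U) = (\<Sum>N. \<integral>\<^sup>+y. ennreal (exp (- t) * t ^ N / fact N) * iid_int U N (g y) \<partial>U)"
    unfolding pois_int_def i using iid_int_measurable[OF g] by (simp add: nn_integral_cmult)
  also have "\<dots> = (\<integral>\<^sup>+y. pois_int U t (g y) \<partial>U)"
    unfolding pois_int_def using iid_int_measurable[OF g] by (intro nn_integral_suminf[symmetric]) auto
  finally show ?thesis .
qed

lemma set_measurable2_times_fun:
  assumes "h \<in> borel_measurable U" "set_measurable2 U g"
  shows "set_measurable2 U (\<lambda>y \<omega>. h y * g y \<omega>)"
  unfolding set_measurable2_def
proof
  fix N
  have "(\<lambda>(y, x). g y (x ` {..<N})) \<in> borel_measurable (U \<Otimes>\<^sub>M prodU N)" using assms by (simp add: set_measurable2_def)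
  hence "(\<lambda>p. h (fst p) * g (fst p) (snd p ` {..<N})) \<in> borel_measurable (U \<Otimes>\<^sub>M prodU N)"
    using assms(1) unfolding case_prod_unfold by (intro borel_measurable_times_ennreal) auto
  thus "(\<lambda>(y, x). h y * g y (x ` {..<N})) \<in> borel_measurable (U \<Otimes>\<^sub>M prodU N)"
    by (simp add: case_prod_unfold)
qed

lemma set_measurable_nonempty_on:
  "E \<in> sets borel \<Longrightarrow> set_measurable U (\<lambda>\<omega>. of_bool (\<omega> \<inter> E \<noteq> {}))"
  by (rule set_measurable_local_prop[of "{E}" 0]) (auto simp: local_prop_def bij_betw_def)

lemma insert_if_empty_eq:
  "insert_if_empty U Z F = (\<lambda>\<omega>. inverse (emeasure U Z) * (of_bool (\<omega> \<inter> Z = {}) * (\<integral>\<^sup>+y. indicator Z y * F (insert y \<omega>) \<partial>U))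
     + of_bool (\<omega> \<inter> Z \<noteq> {}) * F \<omega>)"
  by (auto simp: insert_if_empty_def fun_eq_iff divide_ennreal_def mult.commute)

lemma insert_if_empty_measurable:
  assumes Z: "Z \<in> sets borel" and F: "set_measurable U F"
  shows "set_measurable U (\<lambda>\<omega>. of_bool (\<omega> \<inter> Z = {}) * (\<integral>\<^sup>+y. indicator Z y * F (insert y \<omega>) \<partial>U))"
    and "set_measurable U (insert_if_empty U Z F)"
proof -
  have ind: "indicator Z \<in> borel_measurable U" using Z sets_U by auto
  have m2: "set_measurable2 U (\<lambda>y \<omega>. indicator Z y * F (insert y \<omega>))"
    by (intro set_measurable2_times_fun ind set_measurable2_insert F)
  show 1: "set_measurable U (\<lambda>\<omega>. of_bool (\<omega> \<inter> Z = {}) * (\<integral>\<^sup>+y. indicator Z y * F (insert y \<omega>) \<partial>U))"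
    by (intro set_measurable_times set_measurable_empty_on Z set_measurable_nn_integral m2)
  have c: "set_measurable U (\<lambda>_. inverse (emeasure U Z))" by (simp add: set_measurable_def)
  have 2: "set_measurable U (\<lambda>\<omega>. of_bool (\<omega> \<inter> Z \<noteq> {}) * F \<omega>)"
    by (intro set_measurable_times set_measurable_nonempty_on Z F)
  show "set_measurable U (insert_if_empty U Z F)"
    unfolding insert_if_empty_eq using set_measurable_times[OF c 1] 2
    by (auto simp: set_measurable_def intro!: borel_measurable_add)
qed

text \<open>A void cell contributes \<open>1 / (t * measure U Z)\<close>, at most
  \<open>1 / z\<close>, through \<open>pois_int_insert_if_empty\<close>; an occupied cell is left
  alone and contributes the 1.\<close>

lemma pois_int_insert_avg:
  assumes Z: "Z \<in> sets borel" and F: "set_measurable U F" and t: "t > 0" and z: "z > 0" "z \<le> t * measure U Z"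
  shows "pois_int U t (insert_if_empty U Z F) \<le> ennreal (1 + 1 / z) * pois_int U t F"
proof -
  let ?A = "\<lambda>\<omega>. of_bool (\<omega> \<inter> Z = {}) * (\<integral>\<^sup>+y. indicator Z y * F (insert y \<omega>) \<partial>U)"
  let ?B = "\<lambda>\<omega>. of_bool (\<omega> \<inter> Z \<noteq> {}) * F \<omega>"
  have ind: "indicator Z \<in> borel_measurable U" using Z sets_U by auto
  have mZ: "measure U Z > 0" using zero_less_mult_pos[OF less_le_trans[OF z] t] .
  have c: "set_measurable U (\<lambda>_. inverse (emeasure U Z))" by (simp add: set_measurable_def)
  have mA: "set_measurable U ?A" by (rule insert_if_empty_measurable[OF Z F])
  have mB: "set_measurable U ?B" by (intro set_measurable_times set_measurable_nonempty_on Z F)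
  have mi: "set_measurable2 U (\<lambda>y \<omega>. of_bool (\<omega> \<inter> Z = {}) * F (insert y \<omega>))"
    using set_measurable2_insert[OF F] set_measurable2_const[OF set_measurable_empty_on[OF Z]]
    unfolding set_measurable2_def case_prod_unfold by (auto intro!: borel_measurable_times_ennreal)
  have m2: "set_measurable2 U (\<lambda>y \<omega>. indicator Z y * (of_bool (\<omega> \<inter> Z = {}) * F (insert y \<omega>)))"
    by (intro set_measurable2_times_fun ind mi)
  have "?A = (\<lambda>\<omega>. \<integral>\<^sup>+y. indicator Z y * (of_bool (\<omega> \<inter> Z = {}) * F (insert y \<omega>)) \<partial>U)"
    by (auto simp: fun_eq_iff)
  hence "pois_int U t ?A = (\<integral>\<^sup>+y. pois_int U t (\<lambda>\<omega>. indicator Z y * (of_bool (\<omega> \<inter> Z = {}) * F (insert y \<omega>))) \<partial>U)"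
    by (simp only: pois_int_nn_integral[OF m2])
  also have "\<dots> = (\<integral>\<^sup>+y. indicator Z y * pois_int U t (\<lambda>\<omega>. of_bool (\<omega> \<inter> Z = {}) * F (insert y \<omega>)) \<partial>U)"
    by (simp only: pois_int_cmult[OF set_measurable_section[OF mi]])
  finally have "ennreal t * pois_int U t ?A \<le> pois_int U t F"
    using pois_int_insert_if_empty[OF Z F, of t] t by simp
  hence "ennreal (inverse t) * (ennreal t * pois_int U t ?A) \<le> ennreal (inverse t) * pois_int U t F"
    by (intro mult_left_mono) auto
  hence A: "pois_int U t ?A \<le> ennreal (inverse t) * pois_int U t F"
    using t by (simp flip: mult.assoc ennreal_mult)
  have B: "pois_int U t ?B \<le> pois_int U t F" by (intro pois_int_mono) auto
  have "pois_int U t (insert_if_empty U Z F) = inverse (emeasure U Z) * pois_int U t ?A + pois_int U t ?B"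
    unfolding insert_if_empty_eq
    by (subst pois_int_add[OF set_measurable_times[OF c mA] mB]) (simp only: pois_int_cmult[OF mA])
  also have "\<dots> \<le> inverse (emeasure U Z) * (ennreal (inverse t) * pois_int U t F) + pois_int U t F"
    by (intro add_mono mult_left_mono A B) auto
  also have "\<dots> = ennreal (1 + 1 / (t * measure U Z)) * pois_int U t F"
    using t mZ by (simp add: emeasure_eq_measure inverse_ennreal ennreal_plus distrib_right divide_inverse
        mult.commute add.commute flip: ennreal_mult mult.assoc del: ennreal_plus)
      (simp add: distrib_left)
  also have "\<dots> \<le> ennreal (1 + 1 / z) * pois_int U t F"
    using z by (intro mult_right_mono ennreal_leI add_left_mono divide_left_mono) auto
  finally show ?thesis .
qed

lemma foldr_insert_if_empty:
  assumes Z: "\<And>Z. Z \<in> set Zs \<Longrightarrow> Z \<in> sets borel \<and> z \<le> t * measure U Z"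
    and F: "set_measurable U F" and t: "t > 0" and z: "z > 0"
  shows "set_measurable U (foldr (insert_if_empty U) Zs F)"
    and "pois_int U t (foldr (insert_if_empty U) Zs F) \<le> ennreal ((1 + 1 / z) ^ length Zs) * pois_int U t F"
  using Z
proof (induction Zs)
  case Nil
  { case 1 show ?case using F by simp }
  { case 2 show ?case by simp }
next
  case (Cons Y Zs)
  have m: "set_measurable U (foldr (insert_if_empty U) Zs F)"
    if "\<And>Z. Z \<in> set (Y # Zs) \<Longrightarrow> Z \<in> sets borel \<and> z \<le> t * measure U Z"
    using Cons.IH(1) that by auto
  { case 1 show ?case using insert_if_empty_measurable(2)[OF _ m[OF 1], of Y] 1 by auto }
  { case 2
    have "pois_int U t (foldr (insert_if_empty U) (Y # Zs) F) \<le> ennreal (1 + 1 / z) * pois_int U t (foldr (insert_if_empty U) Zs F)"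
      using pois_int_insert_avg[OF _ m[OF 2] t z, of Y] 2 by auto
    also have "\<dots> \<le> ennreal (1 + 1 / z) * (ennreal ((1 + 1 / z) ^ length Zs) * pois_int U t F)"
      using Cons.IH(2) 2 by (intro mult_left_mono) auto
    also have "\<dots> = ennreal ((1 + 1 / z) ^ length (Y # Zs)) * pois_int U t F"
      using z by (simp add: ennreal_mult mult.assoc)
    finally show ?case . }
qed

text \<open>An average of values at least 1 is at least 1. This passes from a pointwise statement
  about all outcomes of the filling to the averaged functional.\<close>

lemma foldr_insert_if_empty_ge_1:
  assumes "\<And>Z. Z \<in> set Zs \<Longrightarrow> Z \<in> sets borel \<and> measure U Z > 0"
    and "\<And>\<omega>'. \<omega>' \<in> fillings Zs \<omega> \<Longrightarrow> F \<omega>' \<ge> 1"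
  shows "foldr (insert_if_empty U) Zs F \<omega> \<ge> 1"
  using assms
proof (induction Zs arbitrary: \<omega>)
  case (Cons Z Zs)
  let ?G = "foldr (insert_if_empty U) Zs F"
  show ?case
  proof (cases "\<omega> \<inter> Z = {}")
    case True
    have ZU: "Z \<in> sets U" using Cons.prems(1) sets_U by simp
    have "emeasure U Z = (\<integral>\<^sup>+y. indicator Z y \<partial>U)" using ZU by simp
    also have "\<dots> \<le> (\<integral>\<^sup>+y. indicator Z y * ?G (insert y \<omega>) \<partial>U)"
    proof (intro nn_integral_mono)
      fix y
      show "indicator Z y \<le> indicator Z y * ?G (insert y \<omega>)"
        using Cons.IH[of "insert y \<omega>"] Cons.prems True by (cases "y \<in> Z") (auto simp: indicator_def)
    qed
    finally have "emeasure U Z / emeasure U Z \<le> (\<integral>\<^sup>+y. indicator Z y * ?G (insert y \<omega>) \<partial>U) / emeasure U Z"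
      by (rule divide_right_mono_ennreal)
    moreover have "emeasure U Z / emeasure U Z = 1"
      using Cons.prems(1)[of Z] by (intro ennreal_divide_self) (auto simp: emeasure_eq_measure)
    ultimately show ?thesis using True
      unfolding foldr.simps o_def insert_if_empty_def[of U Z] by simp
  next
    case False
    thus ?thesis using Cons by (simp add: insert_if_empty_def)
  qed
qed simp

lemma set_measurable_card: "set_measurable U (\<lambda>\<omega>. of_nat (card \<omega>))"
  unfolding set_measurable_def
proof
  fix N
  have eq: "(of_nat (card (x ` {..<N})) :: ennreal) = (\<Sum>k\<le>N. of_nat k * of_bool (card (x ` {..<N}) = k))" for x :: "nat \<Rightarrow> 'a"
  proof -
    have "card (x ` {..<N}) \<le> N" using card_image_le[of "{..<N}" x] by simp
    thus ?thesis by (simp add: of_bool_def if_distrib[of "\<lambda>y. _ * y"] sum.delta' cong: if_cong)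
  qed
  have "set_measurable U (\<lambda>\<omega>. of_bool (card \<omega> = k))" for k
    by (rule set_measurable_local_prop[of "{}" 0]) (auto simp: local_prop_def bij_betw_same_card)
  thus "(\<lambda>x. of_nat (card (x ` {..<N})) :: ennreal) \<in> borel_measurable (prodU N)"
    unfolding eq set_measurable_def
    by (intro borel_measurable_sum borel_measurable_times_ennreal measurable_const) simp_all
qed

lemma pois_int_card: "t > 0 \<Longrightarrow> pois_int U t (\<lambda>\<omega>. of_nat (card \<omega>)) = ennreal t"
  using pois_int_mecke[of "\<lambda>_ _. 1" t] emeasure_space_1
  by (simp add: pois_int_const set_measurable2_def)

end

section \<open>Clusters and planted tiles\<close>

definition path_in :: "real \<Rightarrow> 'a::metric_space set \<Rightarrow> 'a \<Rightarrow> 'a \<Rightarrow> bool" where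
  "path_in r C = (\<lambda>a b. a \<in> C \<and> b \<in> C \<and> dist a b \<le> r)\<^sup>*\<^sup>*"

text \<open>A connected component, described by closure and path connectedness in place of a
  generating point, so that it is easily transported along bijections.\<close>

definition cluster :: "real \<Rightarrow> 'a::metric_space set \<Rightarrow> 'a set \<Rightarrow> bool" where
  "cluster r \<omega> C \<longleftrightarrow> C \<subseteq> \<omega> \<and> C \<noteq> {} \<and> (\<forall>x\<in>C. \<forall>y\<in>\<omega>. dist x y \<le> r \<longrightarrow> y \<in> C) \<and> (\<forall>x\<in>C. \<forall>y\<in>C. path_in r C x y)"

lemma path_in_map:
  assumes "path_in r C x y" "\<And>a b. a \<in> C \<Longrightarrow> b \<in> C \<Longrightarrow> dist (\<phi> a) (\<phi> b) \<le> r \<longleftrightarrow> dist a b \<le> r"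
  shows "path_in r (\<phi> ` C) (\<phi> x) (\<phi> y)"
  using assms(1) unfolding path_in_def
proof (induction rule: rtranclp_induct)
  case (step y z)
  hence "\<phi> y \<in> \<phi> ` C \<and> \<phi> z \<in> \<phi> ` C \<and> dist (\<phi> y) (\<phi> z) \<le> r" using assms(2) by auto
  thus ?case using step.IH by (rule rtranclp.rtrancl_into_rtrancl[rotated])
qed simp

lemma path_in_mono: "path_in r C x y \<Longrightarrow> C \<subseteq> D \<Longrightarrow> path_in r D x y"
  unfolding path_in_def by (erule rtranclp_mono[THEN predicate2D, rotated]) auto

text \<open>\<open>T i\<close> are the tiles, \<open>E i\<close> is the part of a tile to be emptied
  and \<open>Zs i\<close> are the cells to be filled afterwards. By \<open>E_deep\<close> no edge
  joins \<open>E i\<close> to the outside of the tile, so a path entering the tile arrives at a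
  point that survives the emptying; by \<open>Zs_E\<close> filling the cells off \<open>E i\<close>
  puts no point into \<open>E i\<close>.\<close>

locale tiling =
  fixes I :: "'i set" and T E :: "'i \<Rightarrow> 'a::{metric_space, second_countable_topology} set"
    and Zs :: "'i \<Rightarrow> 'a set list" and r :: real
  assumes finite_I: "finite I"
    and T_borel: "i \<in> I \<Longrightarrow> T i \<in> sets borel"
    and E_borel: "i \<in> I \<Longrightarrow> E i \<in> sets borel"
    and Zs_borel: "i \<in> I \<Longrightarrow> Z \<in> set (Zs i) \<Longrightarrow> Z \<in> sets borel"
    and T_disjoint: "i \<in> I \<Longrightarrow> j \<in> I \<Longrightarrow> i \<noteq> j \<Longrightarrow> T i \<inter> T j = {}"
    and E_T: "i \<in> I \<Longrightarrow> E i \<subseteq> T i"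
    and Zs_T: "i \<in> I \<Longrightarrow> Z \<in> set (Zs i) \<Longrightarrow> Z \<subseteq> T i"
    and Zs_disjoint: "i \<in> I \<Longrightarrow> sorted_wrt (\<lambda>A B. A \<inter> B = {}) (Zs i)"
    and Zs_E: "i \<in> I \<Longrightarrow> Z \<in> set (Zs i) \<Longrightarrow> Z \<subseteq> E i \<or> Z \<inter> E i = {}"
    and E_deep: "i \<in> I \<Longrightarrow> x \<notin> T i \<Longrightarrow> y \<in> E i \<Longrightarrow> dist x y > r"
begin

text \<open>The cells inside \<open>E i\<close> carry the chain and must account for all points of
  \<open>E i\<close>. The other cells form the frame; they are only required to be occupied, because
  their previous points are not erased.\<close>

definition planted :: "'i \<Rightarrow> 'a set \<Rightarrow> bool" where
  "planted i \<omega> \<longleftrightarrow> (\<forall>Z\<in>set (Zs i). \<omega> \<inter> Z \<noteq> {}) \<and> (\<forall>Z\<in>set (Zs i). Z \<subseteq> E i \<longrightarrow> (\<exists>u. \<omega> \<inter> Z = {u})) \<and>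
     \<omega> \<inter> E i \<subseteq> \<Union>{Z \<in> set (Zs i). Z \<subseteq> E i}"

text \<open>The \<open>s\<close> points are demanded outside the tile, because the switching keeps
  control of that part of the cluster only.\<close>

definition sparse_cluster :: "nat \<Rightarrow> nat \<Rightarrow> 'i \<Rightarrow> 'a set \<Rightarrow> bool" where
  "sparse_cluster K s i \<omega> \<longleftrightarrow> (\<exists>C. cluster r \<omega> C \<and> s \<le> card (C - T i) \<and> C \<inter> T i \<noteq> {} \<and>
      card {j\<in>I. planted j \<omega> \<and> C \<inter> T j \<noteq> {}} \<le> K)"

text \<open>What remains visible of a sparse cluster after tile \<open>i\<close> has been modified into a planted one.\<close>

definition switched :: "nat \<Rightarrow> nat \<Rightarrow> 'i \<Rightarrow> 'a set \<Rightarrow> 'a set \<Rightarrow> bool" where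
  "switched K s i \<omega> X \<longleftrightarrow> X \<subseteq> \<omega> - T i \<and> s \<le> card X \<and>
     (\<forall>x\<in>X. \<forall>y\<in>\<omega> - T i. dist x y \<le> r \<longrightarrow> y \<in> X) \<and>
     (\<forall>x\<in>X. \<exists>x'\<in>X. \<exists>u\<in>\<omega> \<inter> T i. dist x' u \<le> r \<and> path_in r X x x') \<and>
     card {j\<in>I - {i}. planted j \<omega> \<and> X \<inter> T j \<noteq> {}} \<le> K"

definition regions :: "'a set set" where
  "regions = (\<Union>i\<in>I. {T i, E i} \<union> set (Zs i))"

lemma regions: "finite regions" "regions \<subseteq> sets borel"
  using finite_I T_borel E_borel Zs_borel by (auto simp: regions_def)

lemma planted_map:
  assumes \<phi>: "bij_betw \<phi> \<omega> \<omega>'" and R: "\<forall>x\<in>\<omega>. \<forall>R\<in>regions. \<phi> x \<in> R \<longleftrightarrow> x \<in> R" and i: "i \<in> I"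
  shows "planted i \<omega>' \<longleftrightarrow> planted i \<omega>"
proof -
  have \<omega>': "\<omega>' = \<phi> ` \<omega>" and inj: "inj_on \<phi> \<omega>" using \<phi> by (auto simp: bij_betw_def)
  have EZ: "R \<in> regions" if "R = E i \<or> R \<in> set (Zs i)" for R using that i by (auto simp: regions_def)
  have int: "\<omega>' \<inter> R = \<phi> ` (\<omega> \<inter> R)" if "R \<in> regions" for R using that R \<omega>' by auto
  have 1: "(\<exists>u. \<omega>' \<inter> Z = {u}) \<longleftrightarrow> (\<exists>u. \<omega> \<inter> Z = {u})" if "Z \<in> set (Zs i)" for Z
  proof -
    have "card (\<omega>' \<inter> Z) = card (\<omega> \<inter> Z)"
      unfolding int[OF EZ[OF disjI2[OF that]]] by (rule card_image, rule inj_on_subset[OF inj]) auto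
    thus ?thesis by (simp add: card_1_singleton_iff[symmetric])
  qed
  have 2: "\<omega>' \<inter> Z \<noteq> {} \<longleftrightarrow> \<omega> \<inter> Z \<noteq> {}" if "Z \<in> set (Zs i)" for Z
    using int EZ that by simp
  have 3: "\<omega>' \<inter> E i \<subseteq> \<Union>{Z \<in> set (Zs i). Z \<subseteq> E i} \<longleftrightarrow> \<omega> \<inter> E i \<subseteq> \<Union>{Z \<in> set (Zs i). Z \<subseteq> E i}"
  proof -
    have RE: "\<phi> x \<in> Y \<longleftrightarrow> x \<in> Y" if "x \<in> \<omega>" "Y = E i \<or> Y \<in> set (Zs i)" for x Y
      using R EZ that by blast
    have "\<omega>' \<inter> E i \<subseteq> \<Union>{Z \<in> set (Zs i). Z \<subseteq> E i} \<longleftrightarrow> (\<forall>x\<in>\<omega>. \<phi> x \<in> E i \<longrightarrow> (\<exists>Z\<in>set (Zs i). Z \<subseteq> E i \<and> \<phi> x \<in> Z))"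
      unfolding \<omega>' by blast
    also have "\<dots> \<longleftrightarrow> (\<forall>x\<in>\<omega>. x \<in> E i \<longrightarrow> (\<exists>Z\<in>set (Zs i). Z \<subseteq> E i \<and> x \<in> Z))"
      using RE by (intro ball_cong refl) (simp cong: bex_cong conj_cong)
    also have "\<dots> \<longleftrightarrow> \<omega> \<inter> E i \<subseteq> \<Union>{Z \<in> set (Zs i). Z \<subseteq> E i}" by blast
    finally show ?thesis .
  qed
  show ?thesis unfolding planted_def using 1 2 3 by auto
qed

lemma card_touched_map:
  assumes \<phi>: "bij_betw \<phi> \<omega> \<omega>'" and R: "\<forall>x\<in>\<omega>. \<forall>R\<in>regions. \<phi> x \<in> R \<longleftrightarrow> x \<in> R" and X: "X \<subseteq> \<omega>" and J: "J \<subseteq> I"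
  shows "card {j\<in>J. planted j \<omega>' \<and> \<phi> ` X \<inter> T j \<noteq> {}} = card {j\<in>J. planted j \<omega> \<and> X \<inter> T j \<noteq> {}}"
proof -
  have "\<phi> ` X \<inter> T j \<noteq> {} \<longleftrightarrow> X \<inter> T j \<noteq> {}" if "j \<in> J" for j
  proof -
    have "T j \<in> regions" using that J by (auto simp: regions_def)
    thus ?thesis using R X by blast
  qed
  thus ?thesis using planted_map[OF \<phi> R] J by (intro arg_cong[where f = card]) auto
qed

lemma local_prop_sparse:
  assumes i: "i \<in> I"
  shows "local_prop r regions (sparse_cluster K s i)"
  unfolding local_prop_def
proof (intro allI impI, elim conjE)
  fix \<omega> \<omega>' :: "'a set" and \<phi>
  assume fin: "finite \<omega>" and \<phi>: "bij_betw \<phi> \<omega> \<omega>'"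
    and d: "\<forall>x\<in>\<omega>. \<forall>y\<in>\<omega>. dist (\<phi> x) (\<phi> y) \<le> r \<longleftrightarrow> dist x y \<le> r"
    and R: "\<forall>x\<in>\<omega>. \<forall>R\<in>regions. \<phi> x \<in> R \<longleftrightarrow> x \<in> R" and sp: "sparse_cluster K s i \<omega>"
  have \<omega>': "\<omega>' = \<phi> ` \<omega>" and inj: "inj_on \<phi> \<omega>" using \<phi> by (auto simp: bij_betw_def)
  obtain C where C: "cluster r \<omega> C" "s \<le> card (C - T i)" "C \<inter> T i \<noteq> {}"
    "card {j\<in>I. planted j \<omega> \<and> C \<inter> T j \<noteq> {}} \<le> K" using sp by (auto simp: sparse_cluster_def)
  have C\<omega>: "C \<subseteq> \<omega>" using C by (auto simp: cluster_def)
  have Ti: "T i \<in> regions" using i by (auto simp: regions_def)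
  have paths: "path_in r (\<phi> ` C) (\<phi> x) (\<phi> y)" if "x \<in> C" "y \<in> C" for x y
  proof (rule path_in_map)
    show "path_in r C x y" using C that by (auto simp: cluster_def)
  qed (use C\<omega> d in blast)
  have "cluster r \<omega>' (\<phi> ` C)"
    unfolding cluster_def
  proof (intro conjI ballI impI)
    show "\<phi> ` C \<subseteq> \<omega>'" "\<phi> ` C \<noteq> {}" using C(1) C\<omega> by (auto simp: \<omega>' cluster_def)
    fix x y assume "x \<in> \<phi> ` C" "y \<in> \<omega>'" "dist x y \<le> r"
    then obtain a b where ab: "a \<in> C" "x = \<phi> a" "b \<in> \<omega>" "y = \<phi> b" by (auto simp: \<omega>')
    have "dist a b \<le> r" using ab C\<omega> d \<open>dist x y \<le> r\<close> by blast
    hence "b \<in> C" using C(1) ab unfolding cluster_def by blast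
    thus "y \<in> \<phi> ` C" using ab by blast
  next
    fix x y assume "x \<in> \<phi> ` C" "y \<in> \<phi> ` C"
    thus "path_in r (\<phi> ` C) x y" using paths by blast
  qed
  moreover have "\<phi> ` C - T i = \<phi> ` (C - T i)" using R Ti C\<omega> by blast
  hence "card (\<phi> ` C - T i) = card (C - T i)"
    using inj_on_subset[OF inj, of "C - T i"] C\<omega> by (simp add: card_image Diff_subset subset_trans[OF Diff_subset])
  moreover have "\<phi> ` C \<inter> T i \<noteq> {}" using C(3) C\<omega> R Ti by blast
  moreover have "card {j\<in>I. planted j \<omega>' \<and> \<phi> ` C \<inter> T j \<noteq> {}} \<le> K"
    using card_touched_map[OF \<phi> R C\<omega>, of I] C by simp
  ultimately show "sparse_cluster K s i \<omega>'" unfolding sparse_cluster_def using C(2) by (intro exI[of _ "\<phi> ` C"]) simp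
qed

lemma local_prop_switched:
  assumes i: "i \<in> I"
  shows "local_prop r regions (\<lambda>\<omega>. planted i \<omega> \<and> (\<exists>X. switched K s i \<omega> X))"
  unfolding local_prop_def
proof (intro allI impI, elim conjE exE)
  fix \<omega> \<omega>' :: "'a set" and \<phi> X
  assume fin: "finite \<omega>" and \<phi>: "bij_betw \<phi> \<omega> \<omega>'"
    and d: "\<forall>x\<in>\<omega>. \<forall>y\<in>\<omega>. dist (\<phi> x) (\<phi> y) \<le> r \<longleftrightarrow> dist x y \<le> r"
    and R: "\<forall>x\<in>\<omega>. \<forall>R\<in>regions. \<phi> x \<in> R \<longleftrightarrow> x \<in> R" and pl: "planted i \<omega>" and sw: "switched K s i \<omega> X"
  have \<omega>': "\<omega>' = \<phi> ` \<omega>" and inj: "inj_on \<phi> \<omega>" using \<phi> by (auto simp: bij_betw_def)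
  have X\<omega>: "X \<subseteq> \<omega>" using sw by (auto simp: switched_def)
  have Ti: "T i \<in> regions" using i by (auto simp: regions_def)
  have RT: "\<phi> x \<in> T i \<longleftrightarrow> x \<in> T i" if "x \<in> \<omega>" for x using R Ti that by blast
  have dd: "dist (\<phi> x) (\<phi> y) \<le> r \<longleftrightarrow> dist x y \<le> r" if "x \<in> \<omega>" "y \<in> \<omega>" for x y using d that by blast
  have "card (\<phi> ` X) = card X" using inj X\<omega> by (auto intro!: card_image inj_on_subset[of \<phi> \<omega>])
  moreover have "\<phi> ` X \<subseteq> \<omega>' - T i" using sw X\<omega> RT by (auto simp: switched_def \<omega>')
  moreover have "\<forall>x\<in>\<phi> ` X. \<forall>y\<in>\<omega>' - T i. dist x y \<le> r \<longrightarrow> y \<in> \<phi> ` X"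
  proof (intro ballI impI)
    fix x y assume "x \<in> \<phi> ` X" "y \<in> \<omega>' - T i" "dist x y \<le> r"
    then obtain a b where ab: "a \<in> X" "x = \<phi> a" "b \<in> \<omega>" "y = \<phi> b" by (auto simp: \<omega>')
    have "dist a b \<le> r" "b \<notin> T i" using ab X\<omega> dd RT \<open>y \<in> \<omega>' - T i\<close> \<open>dist x y \<le> r\<close> by auto
    hence "b \<in> X" using sw ab by (auto simp: switched_def)
    thus "y \<in> \<phi> ` X" using ab by auto
  qed
  moreover have "\<forall>x\<in>\<phi> ` X. \<exists>x'\<in>\<phi> ` X. \<exists>u\<in>\<omega>' \<inter> T i. dist x' u \<le> r \<and> path_in r (\<phi> ` X) x x'"
  proof
    fix x assume "x \<in> \<phi> ` X"
    then obtain a where a: "a \<in> X" "x = \<phi> a" by auto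
    obtain a' u where a': "a' \<in> X" "u \<in> \<omega> \<inter> T i" "dist a' u \<le> r" "path_in r X a a'"
      using sw a unfolding switched_def by blast
    have "path_in r (\<phi> ` X) x (\<phi> a')" unfolding a(2)
      by (rule path_in_map[OF a'(4)]) (use dd X\<omega> in blast)
    moreover have "dist (\<phi> a') (\<phi> u) \<le> r" using dd a' X\<omega> by auto
    moreover have "\<phi> u \<in> \<omega>' \<inter> T i" using a' RT \<omega>' by auto
    ultimately show "\<exists>x'\<in>\<phi> ` X. \<exists>u\<in>\<omega>' \<inter> T i. dist x' u \<le> r \<and> path_in r (\<phi> ` X) x x'"
      using a'(1) by blast
  qed
  moreover have "card {j\<in>I - {i}. planted j \<omega>' \<and> \<phi> ` X \<inter> T j \<noteq> {}} \<le> K"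
    using card_touched_map[OF \<phi> R X\<omega>, of "I - {i}"] sw by (auto simp: switched_def)
  ultimately have "switched K s i \<omega>' (\<phi> ` X)" using sw by (auto simp: switched_def)
  thus "planted i \<omega>' \<and> (\<exists>X. switched K s i \<omega>' X)" using planted_map[OF \<phi> R i] pl by blast
qed

text \<open>Cut the path at its first point in \<open>A\<close>.\<close>

lemma path_enters:
  assumes "path_in r C x y" "x \<in> C - A" "y \<in> A"
  shows "\<exists>x'\<in>C - A. \<exists>u\<in>C \<inter> A. dist x' u \<le> r \<and> path_in r (C - A) x x'"
  using assms unfolding path_in_def
proof (induction rule: converse_rtranclp_induct)
  case base
  thus ?case by auto
next
  case (step x z)
  show ?case
  proof (cases "z \<in> A")
    case True
    thus ?thesis using step by (intro bexI[of _ x] bexI[of _ z]) auto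
  next
    case False
    then obtain x' u where *: "x' \<in> C - A" "u \<in> C \<inter> A" "dist x' u \<le> r"
       "(\<lambda>a b. a \<in> C - A \<and> b \<in> C - A \<and> dist a b \<le> r)\<^sup>*\<^sup>* z x'" using step by auto
    have "(\<lambda>a b. a \<in> C - A \<and> b \<in> C - A \<and> dist a b \<le> r)\<^sup>*\<^sup>* x x'"
      by (rule converse_rtranclp_into_rtranclp[OF _ *(4)]) (use step False in auto)
    thus ?thesis using * by blast
  qed
qed

text \<open>The witness is \<open>C - T i\<close>. Nothing changes outside the tile, so the same
  tiles other than \<open>i\<close> are planted before and after. The point at which a path in
  \<open>C\<close> first enters the tile lies off \<open>E i\<close> by \<open>E_deep\<close>, hence
  survives and attaches the path to the tile as \<open>switched\<close> demands.\<close>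

lemma sparse_cluster_switched:
  assumes i: "i \<in> I" and sp: "sparse_cluster K s i \<omega>" and fill: "\<omega>' \<in> fillings (Zs i) (\<omega> - E i)"
  shows "planted i \<omega>' \<and> (\<exists>X. switched K s i \<omega>' X)"
proof
  have sub: "\<omega>' \<subseteq> (\<omega> - E i) \<union> \<Union>(set (Zs i))" by (rule fillings_subset[OF fill])
  have sup: "\<omega> - E i \<subseteq> \<omega>'" by (rule fillings_supset[OF fill])
  show "planted i \<omega>'"
    unfolding planted_def
  proof (intro conjI ballI impI)
    fix Z assume "Z \<in> set (Zs i)"
    thus "\<omega>' \<inter> Z \<noteq> {}" by (rule fillings_nonempty[OF fill])
  next
    fix Z assume "Z \<in> set (Zs i)" "Z \<subseteq> E i"
    thus "\<exists>u. \<omega>' \<inter> Z = {u}" by (intro fillings_singleton[OF fill Zs_disjoint[OF i]]) auto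
  next
    show "\<omega>' \<inter> E i \<subseteq> \<Union>{Z \<in> set (Zs i). Z \<subseteq> E i}" using sub Zs_E[OF i] by blast
  qed
  obtain C where C: "cluster r \<omega> C" "s \<le> card (C - T i)" "C \<inter> T i \<noteq> {}"
    "card {j\<in>I. planted j \<omega> \<and> C \<inter> T j \<noteq> {}} \<le> K" using sp by (auto simp: sparse_cluster_def)
  have off: "\<omega>' - T i = \<omega> - T i" using sub sup Zs_T[OF i] E_T[OF i] by blast
  have offj: "\<omega>' \<inter> T j = \<omega> \<inter> T j" if "j \<in> I - {i}" for j
    using off T_disjoint[of i j] i that by blast
  have plj: "planted j \<omega>' \<longleftrightarrow> planted j \<omega>" if "j \<in> I - {i}" for j
  proof -
    have "\<omega>' \<inter> R = \<omega> \<inter> R" if "R \<subseteq> T j" for R using offj[OF \<open>j \<in> I - {i}\<close>] that by blast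
    thus ?thesis unfolding planted_def using that Zs_T[of j] E_T[of j] by auto
  qed
  define X where "X = C - T i"
  have "switched K s i \<omega>' X"
    unfolding switched_def off
  proof (intro conjI ballI impI)
    show "X \<subseteq> \<omega> - T i" "s \<le> card X" using C by (auto simp: X_def cluster_def)
    show "\<And>x y. x \<in> X \<Longrightarrow> y \<in> \<omega> - T i \<Longrightarrow> dist x y \<le> r \<Longrightarrow> y \<in> X"
      using C by (auto simp: X_def cluster_def)
    fix x assume x: "x \<in> X"
    obtain y where y: "y \<in> C \<inter> T i" using C by auto
    have "path_in r C x y" using C x y by (auto simp: cluster_def X_def)
    then obtain x' u where u: "x' \<in> C - T i" "u \<in> C \<inter> T i" "dist x' u \<le> r" "path_in r (C - T i) x x'"
      using path_enters[of C x y "T i"] x y by (auto simp: X_def)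
    have "u \<notin> E i" using E_deep[OF i, of x' u] u by auto
    hence "u \<in> \<omega>'" using u C sup by (auto simp: cluster_def)
    thus "\<exists>x'\<in>X. \<exists>u\<in>\<omega>' \<inter> T i. dist x' u \<le> r \<and> path_in r X x x'" using u unfolding X_def by blast
  next
    have "{j\<in>I - {i}. planted j \<omega>' \<and> X \<inter> T j \<noteq> {}} \<subseteq> {j\<in>I. planted j \<omega> \<and> C \<inter> T j \<noteq> {}}"
      using plj by (auto simp: X_def)
    hence "card {j\<in>I - {i}. planted j \<omega>' \<and> X \<inter> T j \<noteq> {}} \<le> card {j\<in>I. planted j \<omega> \<and> C \<inter> T j \<noteq> {}}"
      using finite_I by (intro card_mono) auto
    thus "card {j\<in>I - {i}. planted j \<omega>' \<and> X \<inter> T j \<noteq> {}} \<le> K" using C by simp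
  qed
  thus "\<exists>X. switched K s i \<omega>' X" by blast
qed

text \<open>A common point \<open>z\<close> is joined inside \<open>Xi\<close> to a point next to
  tile \<open>i\<close>. The joining path avoids tile \<open>j\<close>, so the closure property of
  \<open>Xj\<close> carries it into \<open>Xj\<close>, and one further step puts a point of tile
  \<open>i\<close> into \<open>Xj\<close>, contrary to \<open>no\<close>.\<close>

lemma switched_disjoint:
  assumes ij: "i \<in> I" "j \<in> I" "i \<noteq> j" and Xi: "switched K s i \<omega> Xi" and Xj: "switched K s j \<omega> Xj"
    and no: "Xi \<inter> T j = {}" "Xj \<inter> T i = {}"
  shows "Xi \<inter> Xj = {}"
proof (rule ccontr)
  assume "Xi \<inter> Xj \<noteq> {}"
  then obtain z where z: "z \<in> Xi" "z \<in> Xj" by auto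
  obtain x' u where u: "x' \<in> Xi" "u \<in> \<omega> \<inter> T i" "dist x' u \<le> r" "path_in r Xi z x'"
    using Xi z unfolding switched_def by blast
  have closed: "y \<in> Xj" if "x \<in> Xj" "y \<in> \<omega> - T j" "dist x y \<le> r" for x y
    using Xj that unfolding switched_def by blast
  have "x' \<in> Xj" using u(4) z(2) unfolding path_in_def
  proof (induction rule: rtranclp_induct)
    case (step y y')
    thus ?case using closed[of y y'] Xi no by (auto simp: switched_def)
  qed
  moreover have "u \<notin> T j" using T_disjoint[of i j] ij u by auto
  ultimately have "u \<in> Xj" using closed[of x' u] u by auto
  thus False using u no by auto
qed

text \<open>For each point \<open>z\<close>, the tiles whose switched cluster contains \<open>z\<close> form a semicomplete digraph
  with out-degrees at most \<open>K\<close>, so there are at most \<open>2 K + 1\<close> of them.\<close>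

lemma sum_switched_le:
  assumes fin: "finite \<omega>"
  shows "s * card {i\<in>I. planted i \<omega> \<and> (\<exists>X. switched K s i \<omega> X)} \<le> (2 * K + 1) * card \<omega>"
proof -
  define J where "J = {i\<in>I. planted i \<omega> \<and> (\<exists>X. switched K s i \<omega> X)}"
  have finJ: "finite J" using finite_I by (auto simp: J_def)
  define X where "X i = (SOME X. switched K s i \<omega> X)" for i
  have X: "switched K s i \<omega> (X i)" if "i \<in> J" for i
    using that unfolding X_def J_def by (auto intro: someI_ex)
  have X\<omega>: "X i \<subseteq> \<omega>" if "i \<in> J" for i using X[OF that] by (auto simp: switched_def)
  have le: "card {i\<in>J. z \<in> X i} \<le> 2 * K + 1" for z
  proof -
    define A where "A = {i\<in>J. z \<in> X i}"
    define R where "R i = {j\<in>A. j \<noteq> i \<and> X i \<inter> T j \<noteq> {}}" for i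
    have finA: "finite A" using finJ by (auto simp: A_def)
    have outdeg: "card (R i) \<le> K" if "i \<in> A" for i
    proof -
      have "R i \<subseteq> {j\<in>I - {i}. planted j \<omega> \<and> X i \<inter> T j \<noteq> {}}" by (auto simp: R_def A_def J_def)
      hence "card (R i) \<le> card {j\<in>I - {i}. planted j \<omega> \<and> X i \<inter> T j \<noteq> {}}" using finite_I by (intro card_mono) auto
      thus ?thesis using X[of i] that by (auto simp: switched_def A_def)
    qed
    have semi: "j \<in> R i \<or> i \<in> R j" if "i \<in> A" "j \<in> A" "i \<noteq> j" for i j
    proof (rule ccontr)
      assume "\<not> ?thesis"
      hence "X i \<inter> T j = {}" "X j \<inter> T i = {}" using that by (auto simp: R_def)
      moreover have "i \<in> J" "j \<in> J" using that by (auto simp: A_def)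
      ultimately have "X i \<inter> X j = {}"
        using switched_disjoint[OF _ _ that(3) X X] by (auto simp: J_def)
      thus False using that by (auto simp: A_def)
    qed
    have Id: "Id_on A = (\<lambda>x. (x, x)) ` A" by auto
    have "finite (Id_on A)" using finA by (simp add: Id)
    \<comment> \<open>Every ordered pair is diagonal, an arc or a reversed arc; with
      \<open>a = card A\<close> this amounts to \<open>a ^ 2 \<le> a + 2 * a * K\<close>.\<close>
    hence "card (A \<times> A) \<le> card (Id_on A \<union> (SIGMA i:A. R i) \<union> ((SIGMA i:A. R i)\<inverse>))"
      using semi finA by (intro card_mono) (auto simp: R_def)
    also have "\<dots> \<le> card (Id_on A) + card (SIGMA i:A. R i) + card ((SIGMA i:A. R i)\<inverse>)"
      by (rule order_trans[OF card_Un_le add_right_mono[OF card_Un_le]])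
    also have "card ((SIGMA i:A. R i)\<inverse>) = card (SIGMA i:A. R i)" by (rule card_inverse)
    also have "card (SIGMA i:A. R i) = (\<Sum>i\<in>A. card (R i))"
      using finA by (intro card_SigmaI) (auto simp: R_def)
    also have "card (Id_on A) = card A"
      unfolding Id by (intro card_image) (auto simp: inj_on_def)
    finally have "card A * card A \<le> card A + 2 * (\<Sum>i\<in>A. card (R i))" by (simp add: card_cartesian_product)
    also have "(\<Sum>i\<in>A. card (R i)) \<le> card A * K" using sum_bounded_above[of A "\<lambda>i. card (R i)" K] outdeg by simp
    finally have "card A * card A \<le> card A * (2 * K + 1)" by (simp add: algebra_simps)
    hence "card A \<le> 2 * K + 1" using mult_le_cancel1[of "card A" "card A" "2 * K + 1"] by (cases "card A = 0") auto
    thus ?thesis by (simp add: A_def)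
  qed
  have Xs: "s \<le> card (X i)" if "i \<in> J" for i using X[OF that] unfolding switched_def by blast
  have "s * card J \<le> (\<Sum>i\<in>J. card (X i))"
    using sum_bounded_below[of J s "\<lambda>i. card (X i)", OF Xs] by (simp only: mult.commute of_nat_id)
  also have "\<dots> = (\<Sum>i\<in>J. \<Sum>z\<in>\<omega>. of_bool (z \<in> X i))"
  proof (intro sum.cong refl)
    fix i assume "i \<in> J"
    hence "\<omega> \<inter> {z. z \<in> X i} = X i" using X\<omega> by auto
    thus "card (X i) = (\<Sum>z\<in>\<omega>. of_bool (z \<in> X i))" using fin by (simp add: sum_of_bool_eq)
  qed
  also have "\<dots> = (\<Sum>z\<in>\<omega>. card {i\<in>J. z \<in> X i})"
    using finJ by (subst sum.swap) (simp add: sum_of_bool_eq Collect_conj_eq)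
  also have "\<dots> \<le> (\<Sum>z\<in>\<omega>. 2 * K + 1)" by (intro sum_mono le)
  finally show ?thesis by (simp add: J_def mult.commute)
qed

end

locale diffuse_tiling = diffuse U + tiling I T E Zs r
  for U :: "'a::{metric_space, second_countable_topology} measure" and I :: "'i set" and T E :: "'i \<Rightarrow> 'a set" and Zs r
begin

text \<open>Emptying costs \<open>exp e\<close>, filling at most \<open>k\<close> cells costs
  \<open>(1 + 1 / z) ^ k\<close>, and the planted configurations that result are counted by
  \<open>sum_switched_le\<close>, the expected number of points being \<open>t\<close>. For
  \<open>s\<close> of order \<open>t\<close> the sum over all tiles is thus bounded without
  reference to the number of tiles.\<close>

theorem sparse_cluster_bound:
  assumes t: "t > 0" and z: "z > 0" "\<And>i Z. i \<in> I \<Longrightarrow> Z \<in> set (Zs i) \<Longrightarrow> z \<le> t * measure U Z"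
    and k: "\<And>i. i \<in> I \<Longrightarrow> length (Zs i) \<le> k" and e: "\<And>i. i \<in> I \<Longrightarrow> t * measure U (E i) \<le> e"
  shows "of_nat s * (\<Sum>i\<in>I. pois_int U t (\<lambda>\<omega>. of_bool (sparse_cluster K s i \<omega>))) \<le>
     ennreal (exp e * (1 + 1 / z) ^ k * real (2 * K + 1) * t)"
proof -
  define f where "f i \<omega> = (of_bool (planted i \<omega> \<and> (\<exists>X. switched K s i \<omega> X)) :: ennreal)" for i \<omega>
  have mf: "set_measurable U (f i)" if "i \<in> I" for i
    unfolding f_def by (rule set_measurable_local_prop[OF regions local_prop_switched[OF that]])
  define c where "c = ennreal (exp e * (1 + 1 / z) ^ k)"
  have one: "pois_int U t (\<lambda>\<omega>. of_bool (sparse_cluster K s i \<omega>)) \<le> c * pois_int U t (f i)" if i: "i \<in> I" for i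
  proof -
    let ?G = "foldr (insert_if_empty U) (Zs i) (f i)"
    have Z: "\<And>Z. Z \<in> set (Zs i) \<Longrightarrow> Z \<in> sets borel \<and> z \<le> t * measure U Z" using Zs_borel z i by auto
    have Zpos: "\<And>Z. Z \<in> set (Zs i) \<Longrightarrow> Z \<in> sets borel \<and> measure U Z > 0"
      using Z t z(1) by (metis less_le_trans zero_less_mult_pos)
    have mG: "set_measurable U ?G" by (rule foldr_insert_if_empty(1)[OF Z mf[OF i] t z(1)])
    have "pois_int U t (\<lambda>\<omega>. of_bool (sparse_cluster K s i \<omega>)) \<le> pois_int U t (\<lambda>\<omega>. ?G (\<omega> - E i))"
    proof (rule pois_int_mono)
      fix \<omega> :: "'a set"
      show "of_bool (sparse_cluster K s i \<omega>) \<le> ?G (\<omega> - E i)"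
      proof (cases "sparse_cluster K s i \<omega>")
        case True
        have "1 \<le> ?G (\<omega> - E i)"
          by (rule foldr_insert_if_empty_ge_1[OF Zpos]) (use sparse_cluster_switched[OF i True] in \<open>auto simp: f_def\<close>)
        thus ?thesis using True by simp
      qed simp
    qed
    also have "\<dots> = ennreal (exp (t * measure U (E i))) * pois_int U t (\<lambda>\<omega>. ?G \<omega> * of_bool (\<omega> \<inter> E i = {}))"
      by (rule pois_int_del[OF E_borel[OF i] mG]) (use t in simp)
    also have "\<dots> \<le> ennreal (exp e) * pois_int U t ?G"
      using e[OF i] by (intro mult_mono ennreal_leI pois_int_mono) auto
    also have "\<dots> \<le> ennreal (exp e) * (ennreal ((1 + 1 / z) ^ length (Zs i)) * pois_int U t (f i))"
      by (intro mult_left_mono foldr_insert_if_empty(2)[OF Z mf[OF i] t z(1)]) auto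
    also have "\<dots> \<le> ennreal (exp e) * (ennreal ((1 + 1 / z) ^ k) * pois_int U t (f i))"
      using z k[OF i] by (intro mult_left_mono mult_right_mono ennreal_leI power_increasing) auto
    also have "\<dots> = c * pois_int U t (f i)" using z by (simp add: c_def ennreal_mult mult.assoc)
    finally show ?thesis .
  qed
  have card: "pois_int U t (\<lambda>\<omega>. of_nat (card \<omega>)) = ennreal t"
    by (rule pois_int_card[OF t])
  have mcard: "set_measurable U (\<lambda>\<omega>. of_nat (card \<omega>))" by (rule set_measurable_card)
  have "of_nat s * (\<Sum>i\<in>I. pois_int U t (\<lambda>\<omega>. of_bool (sparse_cluster K s i \<omega>))) \<le> of_nat s * (\<Sum>i\<in>I. c * pois_int U t (f i))"
    by (intro mult_left_mono sum_mono one) auto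
  also have "\<dots> = c * pois_int U t (\<lambda>\<omega>. of_nat s * (\<Sum>i\<in>I. f i \<omega>))"
  proof -
    have "pois_int U t (\<lambda>\<omega>. of_nat s * (\<Sum>i\<in>I. f i \<omega>)) = of_nat s * (\<Sum>i\<in>I. pois_int U t (f i))"
      by (simp only: pois_int_cmult[OF set_measurable_sum[OF mf]] pois_int_sum[OF finite_I mf])
    thus ?thesis by (simp only: sum_distrib_left[symmetric] mult_ac)
  qed
  also have "\<dots> \<le> c * pois_int U t (\<lambda>\<omega>. of_nat (2 * K + 1) * of_nat (card \<omega>))"
  proof (intro mult_left_mono pois_int_mono)
    fix \<omega> :: "'a set" assume "finite \<omega>"
    have "(\<Sum>i\<in>I. f i \<omega>) = of_nat (card {i\<in>I. planted i \<omega> \<and> (\<exists>X. switched K s i \<omega> X)})"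
      unfolding f_def using finite_I by (simp add: sum_of_bool_eq Collect_conj_eq)
    hence "of_nat s * (\<Sum>i\<in>I. f i \<omega>) = of_nat (s * card {i\<in>I. planted i \<omega> \<and> (\<exists>X. switched K s i \<omega> X)})" by simp
    also have "\<dots> \<le> of_nat ((2 * K + 1) * card \<omega>)"
      using sum_switched_le[OF \<open>finite \<omega>\<close>, of s K] by (simp only: of_nat_le_iff)
    finally show "of_nat s * (\<Sum>i\<in>I. f i \<omega>) \<le> of_nat (2 * K + 1) * of_nat (card \<omega>)" by (simp only: of_nat_mult)
  qed simp
  also have "\<dots> = c * (of_nat (2 * K + 1) * ennreal t)"
    by (simp only: pois_int_cmult[OF mcard] card)
  also have "\<dots> = ennreal (exp e * (1 + 1 / z) ^ k * real (2 * K + 1) * t)"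
    using z t by (simp only: c_def ennreal_of_nat_eq_real_of_nat flip: ennreal_mult) (simp add: ennreal_mult mult.assoc)
  finally show ?thesis .
qed

end

section \<open>The Poisson process on the box\<close>

abbreviation unif :: "nat \<Rightarrow> (real^'d) measure" where
  "unif n \<equiv> uniform_measure lborel (Lambda n)"

abbreviation ball_vol :: "'d::finite itself \<Rightarrow> real" where
  "ball_vol \<equiv> unit_ball_volume"

lemma Lambda_cbox: "(Lambda n :: (real^'d) set) = cbox (\<chi> i. - (real n powr (1 / real CARD('d)) / 2)) (\<chi> i. real n powr (1 / real CARD('d)) / 2)"
proof -
  have "\<bar>a\<bar> \<le> b / 2 \<longleftrightarrow> - (b / 2) \<le> a \<and> a \<le> b / 2" for a b :: real by auto
  thus ?thesis unfolding Lambda_def by (auto simp: mem_box_cart simp del: divide_le_eq_numeral1 le_divide_eq_numeral1)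
qed

lemma side_power:
  assumes "n > 0" shows "(real n powr (1 / real CARD('d::finite))) ^ CARD('d) = real n"
  using assms by (simp add: powr_realpow[symmetric] powr_powr)

lemma emeasure_Lambda:
  assumes "n > 0" shows "emeasure lborel (Lambda n :: (real^'d::finite) set) = ennreal (real n)"
proof -
  have ne: "(Lambda n :: (real^'d) set) \<noteq> {}" by (auto simp: Lambda_def intro!: exI[of _ 0])
  have "measure lborel (Lambda n :: (real^'d) set) = real n"
    using ne side_power[OF assms, where 'd = 'd] unfolding Lambda_cbox
    by (subst content_cbox_cart) simp_all
  moreover have "emeasure lborel (Lambda n :: (real^'d) set) < \<infinity>" unfolding Lambda_cbox by (rule emeasure_lborel_cbox_finite)
  ultimately show ?thesis by (simp add: emeasure_eq_ennreal_measure)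
qed

lemma Lambda_borel [measurable]: "Lambda n \<in> sets borel"
  unfolding Lambda_cbox by simp

text \<open>With \<open>t = real n\<close>, the intensity measure \<open>t * U\<close> is Lebesgue
  measure on the box, that is, intensity 1.\<close>

lemma measure_unif:
  assumes n: "n > 0" and A: "A \<in> sets borel"
  shows "real n * measure (unif n) (A :: (real^'d::finite) set) = measure lborel (A \<inter> Lambda n)"
proof -
  have "emeasure (unif n) A = emeasure lborel (Lambda n \<inter> A) / ennreal (real n)"
    using A by (simp add: emeasure_uniform_measure emeasure_Lambda[OF n])
  moreover have "emeasure lborel (Lambda n \<inter> A) < \<infinity>"
    using emeasure_Lambda[OF n, where 'd = 'd] A
    by (metis Int_lower1 Lambda_borel emeasure_mono ennreal_less_top infinity_ennreal_def le_less_trans sets_lborel)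
  ultimately show ?thesis using n
    by (simp add: measure_def Int_commute divide_ennreal_def enn2real_mult inverse_ennreal)
qed

lemma diffuse_unif:
  assumes n: "n > 0" shows "diffuse (unif n :: (real^'d::finite) measure)"
proof -
  have "prob_space (unif n :: (real^'d) measure)"
    by (rule prob_space_uniform_measure) (use n in \<open>auto simp: emeasure_Lambda\<close>)
  moreover have "emeasure (unif n) {x :: real^'d} = 0" for x
  proof -
    have "emeasure lborel (Lambda n \<inter> {x}) \<le> emeasure lborel {x}" by (intro emeasure_mono) auto
    thus ?thesis by (simp add: emeasure_uniform_measure)
  qed
  ultimately show ?thesis unfolding diffuse_def diffuse_axioms_def by simp
qed

lemma measure_ball:
  assumes "\<rho> \<ge> 0" shows "measure lborel (ball (c :: real^'d::finite) \<rho>) = ball_vol TYPE('d) * \<rho> ^ CARD('d)"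
  using assms content_ball[of \<rho> c] content_ball[of 1 "0 :: real^'d"] by (simp add: unit_ball_volume_def)

lemma ball_vol_pos: "ball_vol TYPE('d::finite) > 0"
  unfolding unit_ball_volume_def using content_ball_pos[of 1 "0 :: real^'d"] by simp

lemma unif_ball_le:
  assumes n: "n > 0" and \<rho>: "\<rho> \<ge> 0"
  shows "real n * measure (unif n) (ball (c :: real^'d::finite) \<rho>) \<le> ball_vol TYPE('d) * \<rho> ^ CARD('d)"
  unfolding measure_unif[OF n borel_open[OF open_ball]] measure_ball[OF \<rho>, of c, symmetric]
  by (rule measure_mono_fmeasurable) (use Lambda_borel emeasure_bounded_finite[OF bounded_ball] in \<open>auto simp: sets.Int fmeasurable_def\<close>)

lemma unif_ge_ball:
  assumes n: "n > 0" and \<rho>: "\<rho> \<ge> 0" and A: "A \<in> sets borel" and b: "ball (c :: real^'d::finite) \<rho> \<subseteq> A \<inter> Lambda n"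
  shows "real n * measure (unif n) A \<ge> ball_vol TYPE('d) * \<rho> ^ CARD('d)"
proof -
  have "emeasure lborel (A \<inter> Lambda n) \<le> emeasure lborel (Lambda n :: (real^'d) set)" by (intro emeasure_mono) auto
  hence "A \<inter> Lambda n \<in> fmeasurable lborel" using A emeasure_Lambda[OF n, where 'd = 'd]
    by (auto simp: fmeasurable_def intro: le_less_trans)
  thus ?thesis unfolding measure_unif[OF n A] measure_ball[OF \<rho>, of c, symmetric]
    by (intro measure_mono_fmeasurable b) auto
qed

subsection \<open>From labelled configurations to point sets\<close>

lemma ppp_emeasure:
  assumes n: "n > 0"
    and m: "\<And>N. {x \<in> space (PiM {..<N} (\<lambda>_. unif n :: (real^'d::finite) measure)). P N x} \<in> sets (PiM {..<N} (\<lambda>_. unif n))"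
  shows "ennreal (ppp_prob n P) = (\<Sum>N. ennreal (exp (- real n) * real n ^ N / fact N) *
     emeasure (PiM {..<N} (\<lambda>_. unif n :: (real^'d::finite) measure)) {x \<in> space (PiM {..<N} (\<lambda>_. unif n)). P N x})"
    and "ppp_prob n P \<ge> 0"
proof -
  interpret diffuse "unif n :: (real^'d) measure" by (rule diffuse_unif[OF n])
  let ?w = "\<lambda>N. exp (- real n) * real n ^ N / fact N"
  let ?m = "\<lambda>N. measure (prodU N) {x \<in> space (prodU N). P N x}"
  have le1: "?m N \<le> 1" for N using prob_space.prob_le_1[OF prob_space_PiM'[of "{..<N}"]] .
  have "(\<lambda>N. real n ^ N / fact N) sums exp (real n)"
    using exp_converges[of "real n"] by (simp add: divide_inverse mult.commute)
  hence "(\<lambda>N. exp (- real n) * (real n ^ N / fact N)) sums (exp (- real n) * exp (real n))" by (rule sums_mult)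
  hence sw: "summable ?w" by (simp add: sums_iff)
  have sm: "summable (\<lambda>N. ?w N * ?m N)"
  proof (rule summable_comparison_test'[OF sw, of 0])
    fix N
    have "?w N * ?m N \<le> ?w N" using mult_left_le[OF le1[of N], of "?w N"] by simp
    thus "norm (?w N * ?m N) \<le> ?w N" by simp
  qed
  show "ppp_prob n P \<ge> 0" unfolding ppp_prob_def by (intro suminf_nonneg sm) simp
  have "ennreal (ppp_prob n P) = (\<Sum>N. ennreal (?w N * ?m N))"
    unfolding ppp_prob_def by (rule suminf_ennreal2[symmetric, OF _ sm]) simp
  also have "\<dots> = (\<Sum>N. ennreal (?w N) * emeasure (prodU N) {x \<in> space (prodU N). P N x})"
  proof -
    have "emeasure (prodU N) {x \<in> space (prodU N). P N x} = ennreal (?m N)" for N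
      using finite_measure.emeasure_eq_measure[OF prob_space.finite_measure[OF prob_space_PiM'[of "{..<N}"]]] by simp
    thus ?thesis by (simp only: ennreal_mult[symmetric] measure_nonneg) (simp add: ennreal_mult[symmetric])
  qed
  finally show "ennreal (ppp_prob n P) = (\<Sum>N. ennreal (?w N) * emeasure (prodU N) {x \<in> space (prodU N). P N x})" .
qed

text \<open>Almost surely the points are distinct and lie in the box, so the labelled event has to
  be compared with \<open>B\<close> on such configurations only.\<close>

lemma ppp_prob_le:
  assumes n: "n > 0"
    and m: "\<And>N. {x \<in> space (PiM {..<N} (\<lambda>_. unif n :: (real^'d::finite) measure)). P N x} \<in> sets (PiM {..<N} (\<lambda>_. unif n))"
    and B: "\<And>N x. inj_on x {..<N} \<Longrightarrow> x ` {..<N} \<subseteq> Lambda n \<Longrightarrow> P N x \<Longrightarrow> B (x ` {..<N})"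
    and b: "pois_int (unif n) (real n) (\<lambda>\<omega>. of_bool (B \<omega>)) \<le> ennreal b" and mB: "set_measurable (unif n) (\<lambda>\<omega>. of_bool (B \<omega>))" and "b \<ge> 0"
  shows "ppp_prob n P \<le> b"
proof -
  interpret diffuse "unif n :: (real^'d) measure" by (rule diffuse_unif[OF n])
  have AE_\<Lambda>: "AE x in prodU N. x ` {..<N} \<subseteq> Lambda n" for N
  proof -
    have "AE x in prodU N. \<forall>i\<in>{..<N}. x i \<in> Lambda n"
    proof (intro AE_finite_allI)
      fix i assume i: "i \<in> {..<N}"
      have "AE z in unif n :: (real^'d) measure. z \<in> Lambda n" by (rule AE_uniform_measureI) auto
      thus "AE x in prodU N. x i \<in> Lambda n"
        using i by (intro AE_PiM_component[where P = "\<lambda>z. z \<in> Lambda n"]) (auto intro: prob_space_axioms)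
    qed simp
    thus ?thesis by eventually_elim auto
  qed
  have "emeasure (prodU N) {x \<in> space (prodU N). P N x} \<le> iid_int (unif n) N (\<lambda>\<omega>. of_bool (B \<omega>))" for N
  proof -
    have "emeasure (prodU N) {x \<in> space (prodU N). P N x} = (\<integral>\<^sup>+x. indicator {x \<in> space (prodU N). P N x} x \<partial>prodU N)"
      using m by simp
    also have "\<dots> \<le> iid_int (unif n) N (\<lambda>\<omega>. of_bool (B \<omega>))"
      unfolding iid_int_def
    proof (rule nn_integral_mono_AE)
      show "AE x in prodU N. indicator {x \<in> space (prodU N). P N x} x \<le> (of_bool (B (x ` {..<N})) :: ennreal)"
        using AE_\<Lambda>[of N] AE_inj[of N] by eventually_elim (auto simp: indicator_def intro!: B)
    qed
    finally show ?thesis .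
  qed
  hence "ennreal (ppp_prob n P) \<le> pois_int (unif n) (real n) (\<lambda>\<omega>. of_bool (B \<omega>))"
    unfolding ppp_emeasure(1)[OF n m] pois_int_def by (intro suminf_le mult_left_mono) auto
  also have "\<dots> \<le> ennreal b" by (rule b)
  finally show ?thesis using \<open>b \<ge> 0\<close> by simp
qed

lemma ppp_prob_compl:
  assumes n: "n > 0"
    and m: "\<And>N. {x \<in> space (PiM {..<N} (\<lambda>_. unif n :: (real^'d::finite) measure)). P N x} \<in> sets (PiM {..<N} (\<lambda>_. unif n))"
  shows "ppp_prob n P + ppp_prob n (\<lambda>N (x :: nat \<Rightarrow> real^'d). \<not> P N x) = 1"
proof -
  interpret diffuse "unif n :: (real^'d) measure" by (rule diffuse_unif[OF n])
  let ?w = "\<lambda>N. ennreal (exp (- real n) * real n ^ N / fact N)"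
  have m': "{x \<in> space (prodU N). \<not> P N x} \<in> sets (prodU N)" for N using m[of N] by auto
  have "ennreal (ppp_prob n P + ppp_prob n (\<lambda>N (x :: nat \<Rightarrow> real^'d). \<not> P N x)) =
     ennreal (ppp_prob n P) + ennreal (ppp_prob n (\<lambda>N (x :: nat \<Rightarrow> real^'d). \<not> P N x))"
    by (intro ennreal_plus ppp_emeasure(2)[OF n m] ppp_emeasure(2)[OF n m'])
  also have "\<dots> = (\<Sum>N. ?w N * (emeasure (prodU N) {x \<in> space (prodU N). P N x} + emeasure (prodU N) {x \<in> space (prodU N). \<not> P N x}))"
    unfolding ppp_emeasure(1)[OF n m] ppp_emeasure(1)[OF n m'] distrib_left by (rule suminf_add[OF summableI summableI])
  also have "\<dots> = (\<Sum>N. ?w N)"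
  proof -
    have "emeasure (prodU N) {x \<in> space (prodU N). P N x} + emeasure (prodU N) {x \<in> space (prodU N). \<not> P N x} = 1" for N
    proof -
      have "emeasure (prodU N) {x \<in> space (prodU N). P N x} + emeasure (prodU N) {x \<in> space (prodU N). \<not> P N x}
        = emeasure (prodU N) ({x \<in> space (prodU N). P N x} \<union> {x \<in> space (prodU N). \<not> P N x})"
        by (intro plus_emeasure m m') auto
      also have "{x \<in> space (prodU N). P N x} \<union> {x \<in> space (prodU N). \<not> P N x} = space (prodU N)" by auto
      finally show ?thesis using prob_space.emeasure_space_1[OF prob_space_PiM'] by simp
    qed
    thus ?thesis by simp
  qed
  also have "\<dots> = ennreal 1" by (simp only: poisson_sums of_nat_0_le_iff ennreal_1)
  finally show ?thesis
    using ppp_emeasure(2)[OF n m] ppp_emeasure(2)[OF n m'] by (subst (asm) ennreal_inj) auto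
qed

text \<open>Failure is covered by events \<open>B n\<close> on unlabelled configurations, for which
  the Poisson integral calculus gives probability bounds.\<close>

lemma aasI:
  assumes m: "\<And>n N. n > 0 \<Longrightarrow> {x \<in> space (PiM {..<N} (\<lambda>_. unif n :: (real^'d::finite) measure)). P n N x} \<in> sets (PiM {..<N} (\<lambda>_. unif n))"
    and B: "\<forall>\<^sub>F n in sequentially. \<forall>N x. inj_on x {..<N} \<longrightarrow> x ` {..<N} \<subseteq> Lambda n \<longrightarrow> \<not> P n N x \<longrightarrow> B n (x ` {..<N})"
    and b: "\<forall>\<^sub>F n in sequentially. set_measurable (unif n) (\<lambda>\<omega>. of_bool (B n \<omega>)) \<and> pois_int (unif n) (real n) (\<lambda>\<omega>. of_bool (B n \<omega>)) \<le> ennreal (b n)"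
    and lim: "b \<longlonglongrightarrow> 0" and b0: "\<And>n. b n \<ge> 0"
  shows "aas (P :: nat \<Rightarrow> nat \<Rightarrow> (nat \<Rightarrow> real^'d) \<Rightarrow> bool)"
  unfolding aas_def
proof (rule tendsto_sandwich)
  show "(\<lambda>n. 1 - b n) \<longlonglongrightarrow> 1" using tendsto_diff[OF tendsto_const[of 1] lim] by simp
  show "\<forall>\<^sub>F n in sequentially. 1 - b n \<le> ppp_prob n (P n)"
    using B b eventually_gt_at_top[of 0]
  proof eventually_elim
    case (elim n)
    have m': "{x \<in> space (PiM {..<N} (\<lambda>_. unif n :: (real^'d) measure)). \<not> P n N x} \<in> sets (PiM {..<N} (\<lambda>_. unif n))" for N
      using m[of n N] elim by auto
    have "ppp_prob n (\<lambda>N x. \<not> P n N x) \<le> b n"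
      by (rule ppp_prob_le[OF _ m', of "B n"]) (use elim b0 in auto)
    thus ?case using ppp_prob_compl[of n "P n"] m elim by simp
  qed
  show "\<forall>\<^sub>F n in sequentially. ppp_prob n (P n) \<le> 1"
    using eventually_gt_at_top[of 0]
  proof eventually_elim
    case (elim n)
    have m': "{x \<in> space (PiM {..<N} (\<lambda>_. unif n :: (real^'d) measure)). \<not> P n N x} \<in> sets (PiM {..<N} (\<lambda>_. unif n))" for N
      using m[of n N] elim by auto
    show ?case using ppp_prob_compl[of n "P n"] ppp_emeasure(2)[of n "\<lambda>N x. \<not> P n N x", OF elim m'] m elim by simp
  qed
qed auto

lemma geo_component_cluster:
  assumes inj: "inj_on x {..<N}" and C: "C \<in> geo_components N r x"
  shows "cluster r (x ` {..<N}) (x ` C)" and "C \<subseteq> {..<N}"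
proof -
  obtain i where i: "i < N" "C = geo_component N r x i" using C by (auto simp: geo_components_def)
  let ?A = "\<lambda>a b. a < N \<and> b < N \<and> geo_adj r x a b"
  have Cd: "j \<in> C \<longleftrightarrow> j < N \<and> ?A\<^sup>*\<^sup>* i j" for j by (simp add: i geo_component_def)
  show sub: "C \<subseteq> {..<N}" using Cd by auto
  have sym: "symp ?A" by (auto simp: symp_def geo_adj_def dist_commute)
  have path: "path_in r (x ` C) (x j) (x k)" if "j \<in> C" "k \<in> C" for j k
  proof -
    have "?A\<^sup>*\<^sup>* j i" using Cd \<open>j \<in> C\<close> sympD[OF symp_rtranclp[OF sym]] by blast
    moreover have "?A\<^sup>*\<^sup>* i k" using Cd \<open>k \<in> C\<close> by blast
    ultimately have "?A\<^sup>*\<^sup>* j k" by (rule rtranclp_trans)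
    thus ?thesis using \<open>j \<in> C\<close>
    proof (induction rule: rtranclp_induct)
      case base thus ?case by (simp add: path_in_def)
    next
      case (step y z)
      have "?A\<^sup>*\<^sup>* i j" using Cd \<open>j \<in> C\<close> by blast
      hence iy: "?A\<^sup>*\<^sup>* i y" using step.hyps(1) by (rule rtranclp_trans)
      hence iz: "?A\<^sup>*\<^sup>* i z" using step.hyps(2) by (rule rtranclp.rtrancl_into_rtrancl)
      have "y \<in> C" "z \<in> C" using iy iz Cd step.hyps(2) by blast+
      moreover have "dist (x y) (x z) \<le> r" using step by (auto simp: geo_adj_def)
      ultimately have st: "x y \<in> x ` C \<and> x z \<in> x ` C \<and> dist (x y) (x z) \<le> r" by blast
      have "(\<lambda>a b. a \<in> x ` C \<and> b \<in> x ` C \<and> dist a b \<le> r)\<^sup>*\<^sup>* (x j) (x y)"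
        using step.IH[OF step.prems] by (simp add: path_in_def)
      thus ?case unfolding path_in_def by (rule rtranclp.rtrancl_into_rtrancl) (rule st)
    qed
  qed
  show "cluster r (x ` {..<N}) (x ` C)"
    unfolding cluster_def
  proof (intro conjI ballI impI)
    show "x ` C \<subseteq> x ` {..<N}" using sub by auto
    show "x ` C \<noteq> {}" using i Cd by auto
    fix a b assume "a \<in> x ` C" "b \<in> x ` {..<N}" "dist a b \<le> r"
    then obtain j k where jk: "j \<in> C" "a = x j" "k < N" "b = x k" by auto
    show "b \<in> x ` C"
    proof (cases "j = k")
      case False
      hence "?A j k" using jk \<open>dist a b \<le> r\<close> sub by (auto simp: geo_adj_def)
      moreover have "?A\<^sup>*\<^sup>* i j" using jk(1) Cd by blast
      ultimately have "?A\<^sup>*\<^sup>* i k" by (rule rtranclp.rtrancl_into_rtrancl[rotated])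
      thus ?thesis using jk Cd by auto
    qed (use jk in auto)
  next
    fix a b assume "a \<in> x ` C" "b \<in> x ` C"
    thus "path_in r (x ` C) a b" using path by auto
  qed
qed

lemma path_in_geo_component:
  assumes inj: "inj_on x {..<N}" and p: "path_in r (x ` {..<N}) (x i) b" and i: "i < N"
  shows "\<exists>j\<in>geo_component N r x i. b = x j"
  using p unfolding path_in_def
proof (induction rule: rtranclp_induct)
  case base
  show ?case using i by (auto simp: geo_component_def)
next
  case (step y z)
  then obtain j where j: "j \<in> geo_component N r x i" "y = x j" by auto
  obtain k where k: "k < N" "z = x k" using step by auto
  show ?case
  proof (cases "j = k")
    case False
    hence "k \<in> geo_component N r x i" using j k step
      by (auto simp: geo_component_def geo_adj_def intro: rtranclp.rtrancl_into_rtrancl)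
    thus ?thesis using k by auto
  qed (use j k in auto)
qed

text \<open>Paths at radius \<open>r'\<close> are paths at radius \<open>r\<close>, so the component
  at radius \<open>r\<close> of any index in \<open>D\<close> contains all of
  \<open>D\<close>.\<close>

lemma cluster_le_component:
  assumes inj: "inj_on x {..<N}" and C: "cluster r' (x ` {..<N}) D" and r: "r' \<le> r"
  shows "\<exists>C\<in>geo_components N r x. card D \<le> card C"
proof -
  have "D \<noteq> {}" "D \<subseteq> x ` {..<N}" using C unfolding cluster_def by blast+
  then obtain i where i: "i < N" "x i \<in> D" by blast
  let ?C = "geo_component N r x i"
  have "D \<subseteq> x ` ?C"
  proof
    fix b assume "b \<in> D"
    hence "path_in r' D (x i) b" using C i unfolding cluster_def by blast
    hence "path_in r' (x ` {..<N}) (x i) b" using \<open>D \<subseteq> x ` {..<N}\<close> by (rule path_in_mono)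
    hence "path_in r (x ` {..<N}) (x i) b"
      unfolding path_in_def by (rule rtranclp_mono[THEN predicate2D, rotated]) (use r in auto)
    thus "b \<in> x ` ?C" using path_in_geo_component[OF inj _ i(1)] by auto
  qed
  moreover have fin: "finite ?C" by (auto simp: geo_component_def)
  ultimately have "card D \<le> card (x ` ?C)" by (intro card_mono) auto
  also have "\<dots> \<le> card ?C" by (rule card_image_le[OF fin])
  finally show ?thesis using i by (auto simp: geo_components_def)
qed

section \<open>Connectivity in grids\<close>

type_synonym 'd cell = "'d \<Rightarrow> nat"

definition nbr :: "'d cell \<Rightarrow> 'd cell \<Rightarrow> bool" where
  "nbr a b \<longleftrightarrow> (\<exists>i. b = a(i := Suc (a i)) \<or> a = b(i := Suc (b i)))"

definition grid_conn :: "'d cell set \<Rightarrow> bool" where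
  "grid_conn X \<longleftrightarrow> (\<forall>x\<in>X. \<forall>y\<in>X. (\<lambda>a b. a \<in> X \<and> b \<in> X \<and> nbr a b)\<^sup>*\<^sup>* x y)"

abbreviation grid_path :: "'d cell set \<Rightarrow> 'd cell \<Rightarrow> 'd cell \<Rightarrow> bool" where
  "grid_path X \<equiv> (\<lambda>a b. a \<in> X \<and> b \<in> X \<and> nbr a b)\<^sup>*\<^sup>*"

lemma nbr_sym: "nbr a b \<Longrightarrow> nbr b a" by (auto simp: nbr_def)

lemma grid_path_sym: "grid_path X x y \<Longrightarrow> grid_path X y x"
  using symp_rtranclp[of "\<lambda>a b. a \<in> X \<and> b \<in> X \<and> nbr a b"] by (auto simp: symp_def nbr_sym)

lemma grid_path_mono: "grid_path X x y \<Longrightarrow> X \<subseteq> Y \<Longrightarrow> grid_path Y x y"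
  by (erule rtranclp_mono[THEN predicate2D, rotated]) auto

definition grid_box :: "'d cell \<Rightarrow> 'd cell \<Rightarrow> 'd cell set" where
  "grid_box lo hi = {t. \<forall>j. lo j \<le> t j \<and> t j \<le> hi j}"

lemma finite_grid_box: "finite (grid_box lo (hi :: 'd::finite cell))"
proof -
  have "grid_box lo hi \<subseteq> (\<Pi>\<^sub>E j\<in>UNIV. {lo j..hi j})" by (auto simp: grid_box_def)
  thus ?thesis by (rule finite_subset) (auto intro: finite_PiE)
qed

lemma grid_box_path:
  fixes x y :: "'d::finite cell"
  assumes "x \<in> grid_box lo hi" "y \<in> grid_box lo hi"
  shows "grid_path (grid_box lo hi) x y"
  using assms(1)
proof (induction "\<Sum>j\<in>UNIV. (x j - y j) + (y j - x j)" arbitrary: x rule: less_induct)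
  case less
  let ?S = "grid_box lo hi"
  show ?case
  proof (cases "x = y")
    case False
    then obtain j where j: "x j \<noteq> y j" by auto
    define x' where "x' = (if x j < y j then x(j := Suc (x j)) else x(j := x j - 1))"
    have x'S: "x' \<in> ?S"
    proof -
      have bnd: "lo k \<le> x k \<and> x k \<le> hi k \<and> lo k \<le> y k \<and> y k \<le> hi k" for k
        using less.prems assms(2) by (auto simp: grid_box_def)
      have "lo k \<le> x' k \<and> x' k \<le> hi k" for k
      proof (cases "k = j")
        case True
        thus ?thesis using bnd[of j] j by (simp add: x'_def) arith
      next
        case False
        thus ?thesis using bnd[of k] by (simp add: x'_def)
      qed
      thus ?thesis by (simp add: grid_box_def)
    qed
    have nb: "nbr x x'" unfolding nbr_def x'_def using j by (intro exI[of _ j]) (auto simp: fun_eq_iff)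
    have "(\<Sum>k\<in>UNIV. (x' k - y k) + (y k - x' k)) < (\<Sum>k\<in>UNIV. (x k - y k) + (y k - x k))"
    proof (rule sum_strict_mono_ex1)
      show "\<forall>k\<in>UNIV. (x' k - y k) + (y k - x' k) \<le> (x k - y k) + (y k - x k)"
        using j by (auto simp: x'_def)
      show "\<exists>k\<in>UNIV. (x' k - y k) + (y k - x' k) < (x k - y k) + (y k - x k)"
        using j by (intro bexI[of _ j]) (auto simp: x'_def)
    qed simp
    hence "grid_path ?S x' y" using x'S by (rule less.hyps)
    thus ?thesis using nb less.prems x'S by (intro converse_rtranclp_into_rtranclp[of _ x x']) auto
  qed simp
qed

lemma grid_conn_box: "grid_conn (grid_box lo (hi :: 'd::finite cell))"
  by (auto simp: grid_conn_def grid_box_path)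

lemma other_axis:
  assumes "CARD('d::finite) \<ge> 2"
  shows "\<exists>j::'d. j \<noteq> i"
proof (rule ccontr)
  assume "\<not> ?thesis"
  hence "(UNIV :: 'd set) = {i}" by auto
  hence "card (UNIV :: 'd set) = 1" by (metis card_1_singleton_iff One_nat_def)
  thus False using assms by simp
qed

text \<open>All points outside \<open>w\<close> can be joined, along a line in direction \<open>i\<close>, to a hyperplane \<open>t i = a\<close>
  that avoids \<open>w\<close>; points on the same line as \<open>w\<close> first take one step aside.\<close>

lemma grid_conn_box_minus_point:
  fixes lo hi w :: "'d::finite cell"
  assumes d: "CARD('d) \<ge> 2" and lh: "\<And>j. lo j < hi j"
  shows "grid_conn (grid_box lo hi - {w})"
proof -
  let ?S = "grid_box lo hi - {w}"
  obtain i :: 'd where True by auto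
  obtain j where ij: "j \<noteq> i" using other_axis[OF d] by auto
  \<comment> \<open>The face opposite to \<open>w\<close> is taken if \<open>w\<close> lies on the
    lower face; the two faces differ because \<open>lo i < hi i\<close>.\<close>
  define a where "a = (if w i = lo i then hi i else lo i)"
  have a: "a \<noteq> w i" "lo i \<le> a" "a \<le> hi i" using lh[of i] by (auto simp: a_def)
  let ?H = "grid_box (lo(i := a)) (hi(i := a))"
  have H: "?H \<subseteq> ?S"
  proof
    fix t assume t: "t \<in> ?H"
    have ti: "t i = a" using t by (auto simp: grid_box_def dest: spec[of _ i])
    have "lo k \<le> t k \<and> t k \<le> hi k" for k
      using t a ti by (cases "k = i") (auto simp: grid_box_def dest: spec[of _ k])
    thus "t \<in> ?S" using ti a by (auto simp: grid_box_def)
  qed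
  have line: "\<exists>h\<in>?H. grid_path ?S t h" if t: "t \<in> ?S" and k: "k \<noteq> i" "t k \<noteq> w k" for t k
  proof
    let ?L = "grid_box (t(i := lo i)) (t(i := hi i))"
    have tb: "lo l \<le> t l \<and> t l \<le> hi l" for l using t by (auto simp: grid_box_def)
    have "?L \<subseteq> ?S"
    proof
      fix s assume s: "s \<in> ?L"
      have sl: "s l = t l" if "l \<noteq> i" for l
        using s that by (auto simp: grid_box_def dest!: spec[of _ l])
      have "lo l \<le> s l \<and> s l \<le> hi l" for l
        using s tb[of l] sl[of l] by (cases "l = i") (auto simp: grid_box_def dest: spec[of _ i])
      moreover have "s \<noteq> w" using sl[OF k(1)] k(2) by auto
      ultimately show "s \<in> ?S" by (auto simp: grid_box_def)
    qed
    moreover have "t \<in> ?L" "t(i := a) \<in> ?L" using tb[of i] a by (auto simp: grid_box_def)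
    ultimately show "grid_path ?S t (t(i := a))" using grid_path_mono[OF grid_box_path] by blast
    show "t(i := a) \<in> ?H" using tb a by (auto simp: grid_box_def)
  qed
  have toH: "\<exists>h\<in>?H. grid_path ?S t h" if t: "t \<in> ?S" for t
  proof (cases "\<exists>k. k \<noteq> i \<and> t k \<noteq> w k")
    case True
    thus ?thesis using line[OF t] by blast
  next
    case False
    define t' where "t' = (if t j = lo j then t(j := Suc (t j)) else t(j := t j - 1))"
    have tj: "lo j \<le> t j" "t j \<le> hi j" using t by (auto simp: grid_box_def)
    have t'j: "t' j \<noteq> w j" using False ij tj by (auto simp: t'_def)
    have "lo k \<le> t' k \<and> t' k \<le> hi k" for k
    proof (cases "k = j")
      case True
      thus ?thesis using lh[of j] tj by (simp add: t'_def) arith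
    next
      case False
      thus ?thesis using t by (simp add: t'_def grid_box_def)
    qed
    hence t'S: "t' \<in> ?S" using t'j by (auto simp: grid_box_def)
    have nb: "nbr t t'" unfolding nbr_def t'_def using tj by (intro exI[of _ j]) (auto simp: fun_eq_iff)
    obtain h where "h \<in> ?H" "grid_path ?S t' h" using line[OF t'S ij t'j] by blast
    thus ?thesis using nb t t'S by (intro bexI[of _ h] converse_rtranclp_into_rtranclp[of _ t t']) auto
  qed
  show ?thesis
    unfolding grid_conn_def
  proof (intro ballI)
    fix x y assume "x \<in> ?S" "y \<in> ?S"
    then obtain h h' where h: "h \<in> ?H" "grid_path ?S x h" "h' \<in> ?H" "grid_path ?S y h'" using toH by blast
    have "grid_path ?S h h'" using grid_path_mono[OF grid_box_path[OF h(1,3)] H] .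
    thus "grid_path ?S x y" using h(2) grid_path_sym[OF h(4)] by (meson rtranclp_trans)
  qed
qed

text \<open>Paths in the index grid are lifted: move inside one set to a crossing pair, cross to the
  next set, and continue.\<close>

lemma grid_conn_UN:
  assumes J: "grid_conn J" and X: "\<And>c. c \<in> J \<Longrightarrow> grid_conn (X c)" and ne: "\<And>c. c \<in> J \<Longrightarrow> X c \<noteq> {}"
    and nb: "\<And>c c'. c \<in> J \<Longrightarrow> c' \<in> J \<Longrightarrow> nbr c c' \<Longrightarrow> \<exists>z\<in>X c. \<exists>z'\<in>X c'. nbr z z'"
  shows "grid_conn (\<Union>c\<in>J. X c)"
  unfolding grid_conn_def
proof (intro ballI)
  let ?U = "\<Union>c\<in>J. X c"
  fix x y assume "x \<in> ?U" "y \<in> ?U"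
  then obtain c e where c: "c \<in> J" "x \<in> X c" and e: "e \<in> J" "y \<in> X e" by auto
  have in_c: "grid_path ?U p q" if "b \<in> J" "p \<in> X b" "q \<in> X b" for b p q
  proof -
    have "grid_path (X b) p q" using X[OF that(1)] that by (auto simp: grid_conn_def)
    thus ?thesis by (rule grid_path_mono) (use that in auto)
  qed
  have "grid_path J c e" using J c e by (auto simp: grid_conn_def)
  hence "\<forall>y\<in>X e. grid_path ?U x y"
  proof (induction rule: rtranclp_induct)
    case base thus ?case using in_c c by blast
  next
    case (step b b')
    obtain z z' where z: "z \<in> X b" "z' \<in> X b'" "nbr z z'" using nb step by blast
    have "grid_path ?U x z" using step z by blast
    moreover have "grid_path ?U z z'" using z step by (intro r_into_rtranclp) auto
    moreover have "grid_path ?U z' y'" if "y' \<in> X b'" for y' using in_c step z that by blast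
    ultimately show ?case by (meson rtranclp_trans)
  qed
  thus "grid_path ?U x y" using e by auto
qed

section \<open>Hierarchical renormalization\<close>

text \<open>The side, in cells, of a box of level \<open>k\<close>. The ratios \<open>k + 3\<close>
  grow, so that the loss of one child out of \<open>(k + 3) ^ d\<close> at each level has a positive
  product over all levels.\<close>

definition scale :: "nat \<Rightarrow> nat" where "scale k = (\<Prod>j<k. j + 3)"

definition subboxes :: "nat \<Rightarrow> 'd cell \<Rightarrow> 'd cell set" where
  "subboxes L b = grid_box (\<lambda>i. L * b i) (\<lambda>i. L * b i + (L - 1))"

text \<open>A box of level \<open>k + 1\<close> may have one bad child: a grid box without one point is still connected,
  so the good children have connected cores, while badness needs \<open>2\<^sup>k\<close> empty cells.\<close>

fun good :: "('d::finite cell \<Rightarrow> bool) \<Rightarrow> nat \<Rightarrow> 'd cell \<Rightarrow> bool" where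
  "good occ 0 b = occ b"
| "good occ (Suc k) b = (\<exists>w. \<forall>c\<in>subboxes (k + 3) b. c \<noteq> w \<longrightarrow> good occ k c)"

fun core :: "('d::finite cell \<Rightarrow> bool) \<Rightarrow> nat \<Rightarrow> 'd cell \<Rightarrow> 'd cell set" where
  "core occ 0 b = {b}"
| "core occ (Suc k) b = (\<Union>c\<in>{c \<in> subboxes (k + 3) b. good occ k c}. core occ k c)"

lemma subboxes_div: "c \<in> subboxes L b \<Longrightarrow> L > 0 \<Longrightarrow> c i div L = b i"
proof -
  assume c: "c \<in> subboxes L b" "L > 0"
  hence "L * b i \<le> c i" "c i < L * b i + L" by (auto simp: subboxes_def grid_box_def dest!: spec[of _ i])
  thus ?thesis by (metis add.commute div_nat_eqI mult.commute mult_Suc)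
qed

lemma subboxes_step:
  assumes i: "b' = b(i := Suc (b i))" and j: "j \<noteq> i" and v: "v < L"
  defines "c \<equiv> (\<lambda>l. L * b l)(i := L * b i + (L - 1), j := L * b j + v)"
  shows "c \<in> subboxes L b" "c(i := Suc (c i)) \<in> subboxes L b'"
  using v j unfolding c_def subboxes_def grid_box_def i by auto

text \<open>Both claims need one induction: a core is connected because the cores of neighbouring
  good children touch. Two neighbouring good boxes touch because their common face has at least
  three pairs of facing children in a row, and the two exceptional children spoil at most two of
  these pairs.\<close>

lemma good_core:
  fixes b :: "'d::finite cell"
  assumes d: "CARD('d) \<ge> 2"
  shows "good occ k b \<Longrightarrow> grid_conn (core occ k b) \<and> core occ k b \<noteq> {} \<and> (\<forall>z\<in>core occ k b. occ z)"
    and "good occ k b \<Longrightarrow> good occ k b' \<Longrightarrow> nbr b b' \<Longrightarrow> \<exists>z\<in>core occ k b. \<exists>z'\<in>core occ k b'. nbr z z'"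
proof (induction k arbitrary: b b')
  case 0
  { case 1 thus ?case by (auto simp: grid_conn_def) }
  { case 2 thus ?case by auto }
next
  case (Suc k)
  let ?L = "k + 3"
  let ?J = "\<lambda>b. {c \<in> subboxes ?L b. good occ k c}"
  { case 1
    then obtain w where w: "\<And>c. c \<in> subboxes ?L b \<Longrightarrow> c \<noteq> w \<Longrightarrow> good occ k c" by auto
    have "grid_conn (?J b)"
    proof (cases "w \<in> ?J b")
      case True
      hence "?J b = subboxes ?L b" using w by auto
      thus ?thesis by (simp add: subboxes_def grid_conn_box)
    next
      case False
      hence "?J b = subboxes ?L b - {w}" using w by auto
      thus ?thesis unfolding subboxes_def by (simp add: grid_conn_box_minus_point[OF d])
    qed
    moreover have "?J b \<noteq> {}"
    proof -
      obtain i j :: 'd where "j \<noteq> i" using other_axis[OF d] by blast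
      define b1 where "b1 = (\<lambda>l. ?L * b l)"
      have "b1 \<in> subboxes ?L b" "b1(i := Suc (b1 i)) \<in> subboxes ?L b" by (auto simp: b1_def subboxes_def grid_box_def)
      moreover have "b1 \<noteq> b1(i := Suc (b1 i))" by (auto simp: fun_eq_iff)
      ultimately show ?thesis using w by blast
    qed
    moreover have "grid_conn (core occ (Suc k) b)" if "grid_conn (?J b)"
      unfolding core.simps by (rule grid_conn_UN[OF that]) (use Suc in blast)+
    ultimately show ?case using Suc(1) by fastforce }
  { case 2
    have main: "\<exists>z\<in>core occ (Suc k) b. \<exists>z'\<in>core occ (Suc k) b'. nbr z z'"
      if g: "good occ (Suc k) b" "good occ (Suc k) b'" and i: "b' = b(i := Suc (b i))" for b b' i
    proof -
      obtain j where j: "j \<noteq> i" using other_axis[OF d] by blast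
      obtain w where w: "\<And>c. c \<in> subboxes ?L b \<Longrightarrow> c \<noteq> w \<Longrightarrow> good occ k c" using g by auto
      obtain w' where w': "\<And>c. c \<in> subboxes ?L b' \<Longrightarrow> c \<noteq> w' \<Longrightarrow> good occ k c" using g by auto
      define c where "c v = (\<lambda>l. ?L * b l)(i := ?L * b i + (?L - 1), j := ?L * b j + v)" for v
      have cj: "c v j = ?L * b j + v" for v by (simp add: c_def)
      \<comment> \<open>\<open>?L \<ge> 3\<close> offers the offsets 0, 1, 2 along axis
        \<open>j\<close>, and each of \<open>w\<close>, \<open>w'\<close> excludes at most one of
        them.\<close>
      define v :: nat where "v = (if ?L * b j + 0 \<noteq> w j \<and> ?L * b j + 0 \<noteq> w' j then 0 else
         if ?L * b j + 1 \<noteq> w j \<and> ?L * b j + 1 \<noteq> w' j then 1 else 2)"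
      have v: "v < ?L" "?L * b j + v \<noteq> w j" "?L * b j + v \<noteq> w' j" by (auto simp: v_def)
      let ?c = "c v" and ?c' = "(c v)(i := Suc (c v i))"
      have cc: "?c \<in> subboxes ?L b" "?c' \<in> subboxes ?L b'" unfolding c_def using subboxes_step[OF i j v(1)] by auto
      have "?c j \<noteq> w j" "?c' j \<noteq> w' j" using v j cj by auto
      hence gg: "good occ k ?c" "good occ k ?c'" using w w' cc by metis+
      have "nbr ?c ?c'" by (auto simp: nbr_def)
      then obtain z z' where "z \<in> core occ k ?c" "z' \<in> core occ k ?c'" "nbr z z'" using Suc(2) gg by blast
      thus ?thesis using cc gg by auto
    qed
    from 2(3) obtain i where "b' = b(i := Suc (b i)) \<or> b = b'(i := Suc (b' i))" by (auto simp: nbr_def)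
    thus ?case
    proof
      assume "b' = b(i := Suc (b i))" thus ?thesis using main 2 by blast
    next
      assume "b = b'(i := Suc (b' i))"
      then obtain z z' where "z \<in> core occ (Suc k) b'" "z' \<in> core occ (Suc k) b" "nbr z z'" using main 2 by blast
      thus ?thesis using nbr_sym by blast
    qed }
qed

lemma core_div: "z \<in> core occ k b \<Longrightarrow> z i div scale k = b i"
proof (induction k arbitrary: b)
  case 0 thus ?case by (simp add: scale_def)
next
  case (Suc k)
  then obtain c where c: "c \<in> subboxes (k + 3) b" "z \<in> core occ k c" by auto
  have "z i div scale (Suc k) = z i div scale k div (k + 3)" by (simp add: scale_def div_mult2_eq)
  thus ?case using Suc.IH[OF c(2)] subboxes_div[OF c(1), of i] by simp
qed

lemma finite_core: "finite (core occ k b)"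
  by (induction k arbitrary: b) (auto simp: subboxes_def finite_grid_box)

lemma card_grid_box:
  assumes "\<And>j. lo j \<le> hi j"
  shows "card (grid_box lo (hi :: 'd::finite cell)) = (\<Prod>j\<in>UNIV. hi j - lo j + 1)"
proof -
  have "grid_box lo hi = (\<Pi>\<^sub>E j\<in>UNIV. {lo j..hi j})" by (auto simp: grid_box_def)
  thus ?thesis using assms by (simp add: card_PiE Suc_diff_le)
qed

lemma card_subboxes: "L > 0 \<Longrightarrow> card (subboxes L (b :: 'd::finite cell)) = L ^ CARD('d)"
  unfolding subboxes_def by (subst card_grid_box) auto

text \<open>The factor is the telescoping product of \<open>1 - 1 / L ^ 2\<close> over
  \<open>3 \<le> L \<le> k + 2\<close>, which stays above 2 / 3. In dimension at least 2, losing one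
  of \<open>L ^ d\<close> children costs no more than \<open>1 - 1 / L ^ 2\<close>.\<close>

lemma card_core:
  fixes b :: "'d::finite cell"
  assumes d: "CARD('d) \<ge> 2"
  shows "good occ k b \<Longrightarrow> real (card (core occ k b)) \<ge> 2 / 3 * ((real k + 3) / (real k + 2)) * real (scale k) ^ CARD('d)"
proof (induction k arbitrary: b)
  case 0 thus ?case by (simp add: scale_def)
next
  case (Suc k)
  let ?L = "k + 3"
  let ?J = "{c \<in> subboxes ?L b. good occ k c}"
  let ?a = "2 / 3 * ((real k + 3) / (real k + 2)) * real (scale k) ^ CARD('d)"
  obtain w where w: "\<And>c. c \<in> subboxes ?L b \<Longrightarrow> c \<noteq> w \<Longrightarrow> good occ k c" using Suc.prems by auto
  have finS: "finite (subboxes ?L b)" by (simp add: subboxes_def finite_grid_box)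
  have "subboxes ?L b - {w} \<subseteq> ?J" using w by auto
  hence "card (subboxes ?L b - {w}) \<le> card ?J" using finS by (intro card_mono) auto
  have "card (subboxes ?L b) - 1 \<le> card (subboxes ?L b - {w})" by (simp add: card_Diff_singleton_if)
  have cJ: "real ?L ^ CARD('d) - 1 \<le> real (card ?J)"
  proof -
    have "(k + 3) ^ CARD('d) \<le> card ?J + 1"
      using \<open>card (subboxes ?L b - {w}) \<le> card ?J\<close> \<open>card (subboxes ?L b) - 1 \<le> card (subboxes ?L b - {w})\<close>
      by (simp add: card_subboxes)
    hence "real ((k + 3) ^ CARD('d)) \<le> real (card ?J + 1)" by (simp only: of_nat_le_iff)
    thus ?thesis by simp
  qed
  have "card (core occ (Suc k) b) = (\<Sum>c\<in>?J. card (core occ k c))"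
    unfolding core.simps
  proof (rule card_UN_disjoint)
    show "\<forall>i\<in>?J. \<forall>j\<in>?J. i \<noteq> j \<longrightarrow> core occ k i \<inter> core occ k j = {}"
    proof (intro ballI impI, rule ccontr)
      fix i j assume "i \<noteq> j" "core occ k i \<inter> core occ k j \<noteq> {}"
      then obtain z where "z \<in> core occ k i" "z \<in> core occ k j" by auto
      hence "i l = j l" for l using core_div by metis
      thus False using \<open>i \<noteq> j\<close> by auto
    qed
  qed (use finS finite_core in auto)
  hence "real (card (core occ (Suc k) b)) = (\<Sum>c\<in>?J. real (card (core occ k c)))" by simp
  also have "\<dots> \<ge> (\<Sum>c\<in>?J. ?a)" using Suc.IH by (intro sum_mono) auto
  also have "(\<Sum>c\<in>?J. ?a) = real (card ?J) * ?a" by simp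
  finally have 1: "real (card ?J) * ?a \<le> real (card (core occ (Suc k) b))" .
  have "real ?L ^ CARD('d) * (1 - 1 / (real ?L)\<^sup>2) \<le> real ?L ^ CARD('d) - 1"
  proof -
    have "(real ?L)\<^sup>2 \<le> real ?L ^ CARD('d)" using d by (intro power_increasing) auto
    thus ?thesis by (simp add: field_simps)
  qed
  hence e1: "real ?L ^ CARD('d) * (1 - 1 / (real ?L)\<^sup>2) * ?a \<le> real (card ?J) * ?a"
    using cJ by (intro mult_right_mono) auto
  have e2: "real ?L ^ CARD('d) * (1 - 1 / (real ?L)\<^sup>2) * ?a
      = 2 / 3 * ((1 - 1 / (real ?L)\<^sup>2) * ((real k + 3) / (real k + 2))) * real (scale (Suc k)) ^ CARD('d)"
    by (simp add: scale_def power_mult_distrib)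
  have e3: "(1 - 1 / (real ?L)\<^sup>2) * ((real k + 3) / (real k + 2)) = (real (Suc k) + 3) / (real (Suc k) + 2)"
  proof -
    have "(1 - 1 / x\<^sup>2) * (x / (x - 1)) = (x + 1) / x" if "x > 1" for x :: real
    proof -
      have "x - 1 \<noteq> 0" "x \<noteq> 0" using that by auto
      thus ?thesis by (simp add: divide_simps) (simp add: algebra_simps power2_eq_square)
    qed
    from this[of "real k + 3"]
    have "(1 - 1 / (real k + 3)\<^sup>2) * ((real k + 3) / (real k + 3 - 1)) = (real k + 3 + 1) / (real k + 3)" by simp
    moreover have "real k + 3 - 1 = real k + 2" "real ?L = real k + 3" "real (Suc k) + 3 = real k + 3 + 1" "real (Suc k) + 2 = real k + 3"
      by simp_all
    ultimately show ?thesis by (simp only:)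
  qed
  from order_trans[OF e1 1] show ?case unfolding e2 e3 .
qed

text \<open>Candidates for a set of empty cells that witnesses badness, obtained by picking two
  distinct bad children at every level: an explicit finite family for a union bound.\<close>

fun bad_sets :: "nat \<Rightarrow> 'd::finite cell \<Rightarrow> 'd cell set set" where
  "bad_sets 0 b = {{b}}"
| "bad_sets (Suc k) b = (\<Union>c\<in>subboxes (k + 3) b. \<Union>c'\<in>subboxes (k + 3) b - {c}. (\<lambda>(A, B). A \<union> B) ` (bad_sets k c \<times> bad_sets k c'))"

lemma not_good_bad_sets: "\<not> good occ k b \<Longrightarrow> \<exists>A\<in>bad_sets k b. \<forall>z\<in>A. \<not> occ z"
proof (induction k arbitrary: b)
  case (Suc k)
  let ?S = "subboxes (k + 3) b"
  have n: "\<And>w. \<exists>c\<in>?S. c \<noteq> w \<and> \<not> good occ k c" using Suc.prems by auto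
  obtain c where c: "c \<in> ?S" "\<not> good occ k c" using n by blast
  obtain c' where c': "c' \<in> ?S" "c' \<noteq> c" "\<not> good occ k c'" using n[of c] by blast
  obtain A B where "A \<in> bad_sets k c" "\<forall>z\<in>A. \<not> occ z" "B \<in> bad_sets k c'" "\<forall>z\<in>B. \<not> occ z"
    using Suc.IH c c' by meson
  note AB = this
  have "A \<union> B \<in> bad_sets (Suc k) b"
    unfolding bad_sets.simps
    by (rule UN_I[OF c(1)], rule UN_I[of c'], use c' in simp, rule image_eqI[of _ _ "(A, B)"]) (use AB in auto)
  thus ?case using AB by (intro bexI[of _ "A \<union> B"]) auto
qed simp

lemma bad_sets_props:
  "A \<in> bad_sets k b \<Longrightarrow> finite A \<and> card A = 2 ^ k \<and> (\<forall>z\<in>A. \<forall>i. z i div scale k = b i)"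
proof (induction k arbitrary: b A)
  case 0 thus ?case by (simp add: scale_def)
next
  case (Suc k)
  then obtain c c' A1 A2 where c: "c \<in> subboxes (k + 3) b" "c' \<in> subboxes (k + 3) b" "c \<noteq> c'"
    "A1 \<in> bad_sets k c" "A2 \<in> bad_sets k c'" "A = A1 \<union> A2" by auto
  have "A1 \<inter> A2 = {}"
  proof (rule ccontr)
    assume "A1 \<inter> A2 \<noteq> {}"
    then obtain z where "z \<in> A1" "z \<in> A2" by auto
    hence "c i = c' i" for i using Suc.IH[OF c(4)] Suc.IH[OF c(5)] by metis
    thus False using c by auto
  qed
  moreover have "z i div scale (Suc k) = b i" if "z \<in> A" for z i
  proof -
    have "z i div scale (Suc k) = z i div scale k div (k + 3)" by (simp add: scale_def div_mult2_eq)
    thus ?thesis using Suc.IH[OF c(4)] Suc.IH[OF c(5)] subboxes_div[OF c(1), of i] subboxes_div[OF c(2), of i] that c(6) by auto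
  qed
  ultimately show ?case using Suc.IH[OF c(4)] Suc.IH[OF c(5)] c(6) by (auto simp: card_Un_disjoint)
qed

lemma finite_bad_sets: "finite (bad_sets k b)"
  by (induction k arbitrary: b) (auto simp: subboxes_def finite_grid_box)

text \<open>With \<open>L = k + 3\<close>, a bad set of level \<open>k + 1\<close> is a union of bad
  sets of two of the \<open>L ^ d\<close> children, so the weighted count is squared and multiplied
  by at most \<open>L ^ (2 * d)\<close>. The exponent \<open>4 * d\<close> is large enough for the
  squared bound to absorb this factor and the shift from \<open>k + 4\<close> to
  \<open>k + 5\<close>.\<close>

lemma card_bad_sets_weighted:
  fixes b :: "'d::finite cell"
  assumes v: "exp (- v) \<le> 1 / 4 ^ (4 * CARD('d))"
  shows "real (card (bad_sets k b)) * exp (- v * 2 ^ k) \<le> 1 / (real k + 4) ^ (4 * CARD('d))"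
proof (induction k arbitrary: b)
  case 0 thus ?case using v by simp
next
  case (Suc k)
  let ?S = "subboxes (k + 3) b"
  let ?q = "1 / (real k + 4) ^ (4 * CARD('d))" and ?e = "exp (- v * 2 ^ k)"
  have finS: "finite ?S" by (simp add: subboxes_def finite_grid_box)
  have "card (bad_sets (Suc k) b) \<le> (\<Sum>c\<in>?S. \<Sum>c'\<in>?S - {c}. card (bad_sets k c \<times> bad_sets k c'))"
    unfolding bad_sets.simps using finS
    by (intro order_trans[OF card_UN_le] sum_mono card_image_le finite_cartesian_product finite_bad_sets) auto
  also have "\<dots> \<le> (\<Sum>c\<in>?S. \<Sum>c'\<in>?S. card (bad_sets k c) * card (bad_sets k c'))"
    using finS by (intro sum_mono) (auto simp: card_cartesian_product intro!: sum_mono2)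
  finally have "real (card (bad_sets (Suc k) b)) \<le> (\<Sum>c\<in>?S. \<Sum>c'\<in>?S. real (card (bad_sets k c)) * real (card (bad_sets k c')))"
    by (simp flip: of_nat_mult of_nat_sum)
  hence "real (card (bad_sets (Suc k) b)) * (?e * ?e) \<le> (\<Sum>c\<in>?S. \<Sum>c'\<in>?S. real (card (bad_sets k c)) * real (card (bad_sets k c'))) * (?e * ?e)"
    by (intro mult_right_mono) auto
  also have "\<dots> = (\<Sum>c\<in>?S. \<Sum>c'\<in>?S. (real (card (bad_sets k c)) * ?e) * (real (card (bad_sets k c')) * ?e))"
    unfolding sum_distrib_right by (intro sum.cong refl) (simp add: mult_ac)
  also have "\<dots> \<le> (\<Sum>c\<in>?S. \<Sum>c'\<in>?S. ?q * ?q)"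
    by (intro sum_mono mult_mono Suc.IH) auto
  also have "\<dots> = (real k + 3) ^ (2 * CARD('d)) * (?q * ?q)"
    by (simp add: card_subboxes power_mult power2_eq_square power_mult_distrib add.commute)
  also have "\<dots> \<le> 1 / (real (Suc k) + 4) ^ (4 * CARD('d))"
  proof -
    have "(real k + 3) ^ (2 * CARD('d)) * (real k + 5) ^ (4 * CARD('d)) \<le> (real k + 4) ^ (8 * CARD('d))"
    proof -
      have "(real k + 3) * (real k + 5) \<le> (real k + 4)\<^sup>2" by (simp add: power2_eq_square algebra_simps)
      hence "((real k + 3) * (real k + 5)) ^ (2 * CARD('d)) \<le> ((real k + 4)\<^sup>2) ^ (2 * CARD('d))" by (intro power_mono) auto
      hence 1: "(real k + 3) ^ (2 * CARD('d)) * (real k + 5) ^ (2 * CARD('d)) \<le> (real k + 4) ^ (4 * CARD('d))"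
        by (simp add: power_mult_distrib flip: power_mult)
      have "real k + 5 \<le> (real k + 4)\<^sup>2" by (simp add: power2_eq_square algebra_simps)
      hence "(real k + 5) ^ (2 * CARD('d)) \<le> ((real k + 4)\<^sup>2) ^ (2 * CARD('d))" by (intro power_mono) auto
      hence 2: "(real k + 5) ^ (2 * CARD('d)) \<le> (real k + 4) ^ (4 * CARD('d))" by (simp flip: power_mult)
      have "(real k + 3) ^ (2 * CARD('d)) * (real k + 5) ^ (2 * CARD('d)) * (real k + 5) ^ (2 * CARD('d)) \<le> (real k + 4) ^ (4 * CARD('d)) * (real k + 4) ^ (4 * CARD('d))"
        by (intro mult_mono 1 2) auto
      thus ?thesis by (simp add: mult.assoc flip: power_add)
    qed
    thus ?thesis by (simp add: field_simps flip: power_add)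
  qed
  also have "?e * ?e = exp (- v * 2 ^ Suc k)" by (simp flip: exp_add)
  finally show ?case .
qed

section \<open>The cluster generated by a point\<close>

definition cluster_of :: "real \<Rightarrow> 'a::metric_space set \<Rightarrow> 'a \<Rightarrow> 'a set" where
  "cluster_of r \<omega> x = {y. path_in r \<omega> x y}"

lemma path_in_sym: "path_in r C x y \<Longrightarrow> path_in r C y x"
  unfolding path_in_def
  using sympD[OF symp_rtranclp[of "\<lambda>a b. a \<in> C \<and> b \<in> C \<and> dist a b \<le> r"]] by (auto simp: symp_def dist_commute)

lemma path_in_trans: "path_in r C x y \<Longrightarrow> path_in r C y z \<Longrightarrow> path_in r C x z"
  unfolding path_in_def by (rule rtranclp_trans)

lemma path_in_step: "a \<in> C \<Longrightarrow> b \<in> C \<Longrightarrow> dist a b \<le> r \<Longrightarrow> path_in r C a b"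
  unfolding path_in_def by (rule r_into_rtranclp) auto

lemma path_in_refl: "path_in r C a a"
  unfolding path_in_def by simp

lemma cluster_cluster_of:
  assumes x: "x \<in> \<omega>" shows "cluster r \<omega> (cluster_of r \<omega> x)"
proof -
  have sub: "y \<in> \<omega>" if "path_in r \<omega> x y" for y
    using that x unfolding path_in_def by (induction rule: rtranclp_induct) auto
  have pth: "path_in r (cluster_of r \<omega> x) x y" if "path_in r \<omega> x y" for y
    using that unfolding path_in_def
  proof (induction rule: rtranclp_induct)
    case (step y z)
    have xy: "path_in r \<omega> x y" using step.hyps(1) by (simp add: path_in_def)
    moreover have "path_in r \<omega> y z" using step.hyps(2) by (intro path_in_step) auto
    hence "path_in r \<omega> x z" by (rule path_in_trans[OF xy])
    ultimately have "y \<in> cluster_of r \<omega> x \<and> z \<in> cluster_of r \<omega> x \<and> dist y z \<le> r" using step by (simp add: cluster_of_def)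
    with step.IH show ?case by (rule rtranclp.rtrancl_into_rtrancl)
  qed simp
  show ?thesis
    unfolding cluster_def
  proof (intro conjI ballI impI)
    show "cluster_of r \<omega> x \<subseteq> \<omega>" using sub by (auto simp: cluster_of_def)
    have "x \<in> cluster_of r \<omega> x" by (simp add: cluster_of_def path_in_refl)
    thus "cluster_of r \<omega> x \<noteq> {}" by blast
    fix a b assume ab: "a \<in> cluster_of r \<omega> x" "b \<in> \<omega>" "dist a b \<le> r"
    hence xa: "path_in r \<omega> x a" by (simp add: cluster_of_def)
    have "path_in r \<omega> a b" using ab sub[OF xa] by (intro path_in_step)
    thus "b \<in> cluster_of r \<omega> x" using path_in_trans[OF xa] by (simp add: cluster_of_def)
  next
    fix a b assume "a \<in> cluster_of r \<omega> x" "b \<in> cluster_of r \<omega> x"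
    hence "path_in r (cluster_of r \<omega> x) x a" "path_in r (cluster_of r \<omega> x) x b"
      using pth unfolding cluster_of_def[of r \<omega> x] by blast+
    thus "path_in r (cluster_of r \<omega> x) a b" by (rule path_in_trans[OF path_in_sym])
  qed
qed

section \<open>Rectangular cells\<close>

text \<open>The sides may differ between the axes, as needed for the elongated tiles below; the
  cells are half-open to make them disjoint.\<close>

definition rcell :: "real^'d \<Rightarrow> ('d \<Rightarrow> real) \<Rightarrow> 'd cell \<Rightarrow> (real^'d) set" where
  "rcell p h z = {x. \<forall>i. p $ i + h i * real (z i) \<le> x $ i \<and> x $ i < p $ i + h i * (real (z i) + 1)}"

lemma rcell_borel [measurable]: "rcell p h z \<in> sets borel"
proof -
  have "rcell p h z = (\<Inter>i. {x. p $ i + h i * real (z i) \<le> x $ i} \<inter> {x. x $ i < p $ i + h i * (real (z i) + 1)})"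
    by (auto simp: rcell_def)
  also have "\<dots> \<in> sets borel" by measurable
  finally show ?thesis .
qed

lemma rcell_disjoint:
  assumes "\<And>i. h i > 0" "z \<noteq> z'" shows "rcell p h z \<inter> rcell p h z' = {}"
proof (rule ccontr)
  assume "\<not> ?thesis"
  then obtain x where x: "x \<in> rcell p h z" "x \<in> rcell p h z'" by auto
  obtain i where i: "z i \<noteq> z' i" using assms(2) by auto
  have "h i * real (z i) < h i * (real (z' i) + 1)" "h i * real (z' i) < h i * (real (z i) + 1)"
    using x by (auto simp: rcell_def dest!: spec[of _ i])
  hence "real (z i) < real (z' i) + 1" "real (z' i) < real (z i) + 1" using assms(1)[of i] by simp_all
  thus False using i by linarith
qed

text \<open>Lower bounds for the measure of a cell are taken from this inscribed ball, through
  \<open>unif_ge_ball\<close>.\<close>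

lemma rcell_ball:
  assumes h: "\<And>i. \<rho> \<le> h i / 2"
  shows "ball (\<chi> i. p $ i + h i * (real (z i) + 1 / 2)) \<rho> \<subseteq> rcell p h z"
proof
  fix x assume x: "x \<in> ball (\<chi> i. p $ i + h i * (real (z i) + 1 / 2)) \<rho>"
  have "\<bar>x $ i - (p $ i + h i * (real (z i) + 1 / 2))\<bar> < h i / 2" for i
  proof -
    have "\<bar>((\<chi> i. p $ i + h i * (real (z i) + 1 / 2)) - x) $ i\<bar> \<le> norm ((\<chi> i. p $ i + h i * (real (z i) + 1 / 2)) - x)"
      by (rule component_le_norm_cart)
    also have "\<dots> < h i / 2" using x h[of i] by (simp add: dist_norm)
    finally show ?thesis by (simp add: abs_minus_commute)
  qed
  hence *: "\<bar>x $ i - (p $ i + (h i * real (z i) + h i * (1 / 2)))\<bar> < h i / 2" for i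
    by (simp only: distrib_left)
  have "p $ i + h i * real (z i) \<le> x $ i \<and> x $ i < p $ i + h i * (real (z i) + 1)" for i
    using *[of i] unfolding distrib_left abs_less_iff by linarith
  thus "x \<in> rcell p h z" unfolding rcell_def by blast
qed

lemma dist_le_sum_coords:
  fixes x y :: "real^'d::finite"
  assumes "\<And>i. \<bar>x $ i - y $ i\<bar> \<le> b i" shows "dist x y \<le> (\<Sum>i\<in>UNIV. b i)"
proof -
  have "dist x y \<le> (\<Sum>i\<in>UNIV. \<bar>(x - y) $ i\<bar>)" unfolding dist_norm by (rule norm_le_l1_cart)
  also have "\<dots> \<le> (\<Sum>i\<in>UNIV. b i)" using assms by (intro sum_mono) auto
  finally show ?thesis .
qed

lemma rcell_nbr_dist:
  fixes x y :: "real^'d::finite"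
  assumes "x \<in> rcell p h z" "y \<in> rcell p h z'" "nbr z z' \<or> z = z'" and h: "\<And>i. 0 \<le> h i \<and> h i \<le> H"
  shows "dist x y \<le> 2 * real CARD('d) * H"
proof -
  have "\<bar>x $ i - y $ i\<bar> \<le> 2 * H" for i
  proof -
    have zz: "real (z' i) \<le> real (z i) + 1" "real (z i) \<le> real (z' i) + 1"
      using assms(3) by (auto simp: nbr_def)
    have "h i * real (z' i) \<le> h i * (real (z i) + 1)" "h i * real (z i) \<le> h i * (real (z' i) + 1)"
      using zz h[of i] by (auto intro: mult_left_mono)
    moreover have "p $ i + h i * real (z i) \<le> x $ i" "x $ i < p $ i + h i * (real (z i) + 1)"
      "p $ i + h i * real (z' i) \<le> y $ i" "y $ i < p $ i + h i * (real (z' i) + 1)"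
      using assms(1,2) by (auto simp: rcell_def)
    ultimately show ?thesis using h[of i] unfolding distrib_left by (simp add: abs_le_iff)
  qed
  from dist_le_sum_coords[OF this] show ?thesis by (simp add: mult_ac)
qed

lemma grid_path_points:
  fixes p :: "'d::finite cell \<Rightarrow> 'a::metric_space"
  assumes "grid_path X x y" and "\<And>z. z \<in> X \<Longrightarrow> p z \<in> \<omega>"
    and "\<And>z z'. z \<in> X \<Longrightarrow> z' \<in> X \<Longrightarrow> nbr z z' \<Longrightarrow> dist (p z) (p z') \<le> r"
  shows "path_in r \<omega> (p x) (p y)"
  using assms(1)
proof (induction rule: rtranclp_induct)
  case (step y z)
  thus ?case using assms(2,3) by (intro path_in_trans[OF step.IH path_in_step]) auto
qed (rule path_in_refl)

section \<open>A giant component for large radii\<close>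

lemma scale_pos: "scale k > 0" by (simp add: scale_def)

lemma scale_Suc: "scale (Suc k) = scale k * (k + 3)" by (simp add: scale_def)

lemma scale_mono: "j \<le> k \<Longrightarrow> scale j \<le> scale k"
  by (rule lift_Suc_mono_le[of scale]) (auto simp: scale_Suc)

lemma scale_ge: "k < scale k"
proof (induction k)
  case (Suc k)
  have "Suc k < scale k * 3" using Suc scale_pos[of k] by linarith
  also have "\<dots> \<le> scale (Suc k)" by (simp add: scale_Suc)
  finally show ?case .
qed (simp add: scale_def)

text \<open>For \<open>m \<ge> 1\<close> this is the largest level whose boxes fit into
  \<open>m\<close> cells per axis.\<close>

definition level :: "nat \<Rightarrow> nat" where "level m = (LEAST k. m < scale (Suc k))"

lemma level_ub: "m < scale (Suc (level m))"
  unfolding level_def by (rule LeastI[of _ m]) (use scale_ge[of "Suc m"] in simp)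

lemma level_lb: "m \<ge> 1 \<Longrightarrow> scale (level m) \<le> m"
proof (cases "level m")
  case (Suc k)
  have "\<not> m < scale (Suc k)" using not_less_Least[of k "\<lambda>k. m < scale (Suc k)"] Suc by (simp add: level_def)
  thus ?thesis using Suc by simp
qed (simp add: scale_def)

lemma level_at_top: "filterlim level at_top sequentially"
  unfolding filterlim_at_top
proof
  fix K
  show "\<forall>\<^sub>F m in sequentially. K \<le> level m"
    using eventually_ge_at_top[of "scale K"]
  proof eventually_elim
    case (elim m)
    have "scale K < scale (Suc (level m))" using elim level_ub[of m] by simp
    thus ?case using scale_mono[of "Suc (level m)" K] by (metis not_less not_less_eq_eq)
  qed
qed

text \<open>Union bound over the top boxes and their bad sets. With \<open>k = level m\<close> there
  are between 1 and \<open>k + 3\<close> top boxes per axis, so their number is polynomial in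
  \<open>k\<close> and beaten by \<open>card_bad_sets_weighted\<close>.\<close>

lemma not_all_good_prob:
  fixes p :: "real^'d::finite"
  assumes d: "CARD('d) \<ge> 2" and n: "n > 0" and h: "h > 0"
    and v: "exp (- (ball_vol TYPE('d) * (h / 2) ^ CARD('d))) \<le> 1 / 4 ^ (4 * CARD('d))"
    and m: "m \<ge> 1" and \<Lambda>: "\<And>z. (\<And>i. z i < m) \<Longrightarrow> rcell p (\<lambda>_. h) z \<subseteq> Lambda n"
  defines "k \<equiv> level m"
  defines "BX \<equiv> grid_box (\<lambda>_. 0) (\<lambda>_. m div scale k - 1) :: 'd cell set"
  defines "B \<equiv> (\<lambda>\<omega>. \<exists>b\<in>BX. \<not> good (\<lambda>z. \<omega> \<inter> rcell p (\<lambda>_. h) z \<noteq> {}) k b)"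
  shows "set_measurable (unif n) (\<lambda>\<omega>. of_bool (B \<omega>))"
    and "pois_int (unif n) (real n) (\<lambda>\<omega>. of_bool (B \<omega>)) \<le> ennreal (1 / (real (level m) + 4))"
proof -
  interpret diffuse "unif n :: (real^'d) measure" by (rule diffuse_unif[OF n])
  let ?h = "\<lambda>_::'d. h"
  let ?M = "m div scale k"
  let ?v = "ball_vol TYPE('d) * (h / 2) ^ CARD('d)"
  have M1: "?M \<ge> 1" using level_lb[OF m] scale_pos[of k] by (simp add: k_def Suc_le_eq div_greater_zero_iff)
  have M2: "?M \<le> k + 3"
  proof -
    have "m < scale k * (k + 3)" using level_ub[of m] by (simp add: k_def scale_Suc)
    thus ?thesis using less_mult_imp_div_less[of m "k + 3" "scale k"] by (simp add: mult.commute)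
  qed
  have finBX: "finite BX" by (simp add: BX_def finite_grid_box)
  have cardBX: "card BX = ?M ^ CARD('d)" unfolding BX_def using M1 by (subst card_grid_box) auto
  define PR where "PR = (SIGMA b:BX. bad_sets k b)"
  have finPR: "finite PR" unfolding PR_def using finBX finite_bad_sets by auto
  define W where "W A = (\<Union>z\<in>A. rcell p ?h z)" for A
  have Wb: "W A \<in> sets borel" if "finite A" for A unfolding W_def using that by (intro sets.finite_UN rcell_borel)
  have finA: "finite A" if "(b, A) \<in> PR" for b A using that bad_sets_props by (auto simp: PR_def)
  have BW: "of_bool (B \<omega>) \<le> (\<Sum>q\<in>PR. of_bool (\<omega> \<inter> W (snd q) = {}) :: ennreal)" for \<omega>
  proof (cases "B \<omega>")
    case True
    then obtain b where b: "b \<in> BX" "\<not> good (\<lambda>z. \<omega> \<inter> rcell p ?h z \<noteq> {}) k b" by (auto simp: B_def)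
    from not_good_bad_sets[OF b(2)] obtain A where A: "A \<in> bad_sets k b" "\<forall>z\<in>A. \<omega> \<inter> rcell p ?h z = {}" by auto
    have q: "(b, A) \<in> PR" using A b by (auto simp: PR_def)
    have "\<omega> \<inter> W A = {}" using A by (auto simp: W_def)
    hence "of_bool (B \<omega>) \<le> (of_bool (\<omega> \<inter> W (snd (b, A)) = {}) :: ennreal)" by simp
    also have "\<dots> \<le> (\<Sum>q\<in>PR. of_bool (\<omega> \<inter> W (snd q) = {}))"
      by (rule member_le_sum[OF q]) (use finPR in auto)
    finally show ?thesis .
  qed simp
  define \<R> where "\<R> = (\<lambda>z. rcell p ?h z) ` (grid_box (\<lambda>_. 0) (\<lambda>_. m))"
  have lowb: "z \<in> grid_box (\<lambda>_. 0) (\<lambda>_. m)" if "A \<in> bad_sets k b" "b \<in> BX" "z \<in> A" for A b z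
  proof -
    have "z i < m" for i
    proof -
      have "z i div scale k \<le> ?M - 1" using bad_sets_props[OF that(1)] that by (auto simp: BX_def grid_box_def)
      hence "z i div scale k < m div scale k" using M1 by linarith
      thus ?thesis using div_le_mono[of m "z i" "scale k"] by linarith
    qed
    thus ?thesis by (auto simp: grid_box_def less_imp_le)
  qed
  show "set_measurable (unif n) (\<lambda>\<omega>. of_bool (B \<omega>))"
  proof (rule set_measurable_local_prop[of "\<R>" 0])
    show "finite \<R>" unfolding \<R>_def by (intro finite_imageI finite_grid_box)
    show "\<R> \<subseteq> sets borel" unfolding \<R>_def by (intro image_subsetI rcell_borel)
    \<comment> \<open>Goodness of \<open>b\<close> looks only at the cells inside \<open>b\<close>;
      for top boxes in \<open>BX\<close> their coordinates are less than \<open>m\<close>, which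
      leaves finitely many regions.\<close>
    have good_eq: "good o1 k b = good o2 k b" if "\<And>z. (\<And>i. z i div scale k = b i) \<Longrightarrow> o1 z = o2 z" for o1 o2 :: "'d cell \<Rightarrow> bool" and k b
      using that
    proof (induction k arbitrary: b)
      case 0 thus ?case by (auto simp: scale_def)
    next
      case (Suc k)
      have "good o1 k c = good o2 k c" if c: "c \<in> subboxes (k + 3) b" for c
      proof (rule Suc.IH)
        fix z assume z: "\<And>i. z i div scale k = c i"
        show "o1 z = o2 z"
        proof (rule Suc.prems)
          fix i
          have "z i div scale (Suc k) = z i div scale k div (k + 3)" by (simp add: scale_def div_mult2_eq)
          thus "z i div scale (Suc k) = b i" using z subboxes_div[OF c, of i] by simp
        qed
      qed
      thus ?case by auto
    qed
    show "local_prop 0 \<R> B"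
      unfolding local_prop_def
    proof (intro allI impI, elim conjE)
      fix \<omega> \<omega>' :: "(real^'d) set" and \<phi>
      assume \<phi>: "bij_betw \<phi> \<omega> \<omega>'" and R: "\<forall>x\<in>\<omega>. \<forall>R\<in>\<R>. \<phi> x \<in> R \<longleftrightarrow> x \<in> R" and B: "B \<omega>"
      have \<omega>': "\<omega>' = \<phi> ` \<omega>" using \<phi> by (auto simp: bij_betw_def)
      have "good (\<lambda>z. \<omega> \<inter> rcell p ?h z \<noteq> {}) k b = good (\<lambda>z. \<omega>' \<inter> rcell p ?h z \<noteq> {}) k b" if b: "b \<in> BX" for b
      proof (rule good_eq)
        fix z assume z: "\<And>i. z i div scale k = b i"
        have "z i < m" for i
        proof -
          have "z i div scale k \<le> ?M - 1" using z[of i] b by (auto simp: BX_def grid_box_def)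
          hence "z i div scale k < m div scale k" using M1 by linarith
          thus ?thesis using div_le_mono[of m "z i" "scale k"] by linarith
        qed
        hence "rcell p ?h z \<in> \<R>" unfolding \<R>_def by (intro imageI) (auto simp: grid_box_def less_imp_le)
        thus "(\<omega> \<inter> rcell p ?h z \<noteq> {}) = (\<omega>' \<inter> rcell p ?h z \<noteq> {})" using R \<omega>' by blast
      qed
      thus "B \<omega>'" using B by (auto simp: B_def)
    qed
  qed
  have void: "pois_int (unif n) (real n) (\<lambda>\<omega>. of_bool (\<omega> \<inter> W A = {})) \<le> ennreal (exp (- ?v * 2 ^ k))"
    if q: "(b, A) \<in> PR" for b A
  proof -
    have A: "A \<in> bad_sets k b" "b \<in> BX" using q by (auto simp: PR_def)
    have fA: "finite A" "card A = 2 ^ k" using bad_sets_props[OF A(1)] by auto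
    have "real n * measure (unif n) (W A) = real n * (\<Sum>z\<in>A. measure (unif n) (rcell p ?h z))"
      unfolding W_def using fA rcell_disjoint[of ?h] h
      by (subst finite_measure_finite_Union) (auto simp: disjoint_family_on_def)
    also have "\<dots> = (\<Sum>z\<in>A. real n * measure (unif n) (rcell p ?h z))" by (rule sum_distrib_left)
    also have "\<dots> \<ge> (\<Sum>z\<in>A. ?v)"
    proof (intro sum_mono unif_ge_ball[OF n])
      fix z assume "z \<in> A"
      have "z i < m" for i
      proof -
        have "z i div scale k \<le> ?M - 1" using bad_sets_props[OF A(1)] A(2) \<open>z \<in> A\<close> by (auto simp: BX_def grid_box_def)
        hence "z i div scale k < m div scale k" using M1 by linarith
        thus ?thesis using div_le_mono[of m "z i" "scale k"] by linarith
      qed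
      thus "ball (\<chi> i. p $ i + ?h i * (real (z i) + 1 / 2)) (h / 2) \<subseteq> rcell p ?h z \<inter> Lambda n"
        using rcell_ball[of "h / 2" ?h p z] \<Lambda> by auto
    qed (use h rcell_borel in auto)
    finally have "?v * 2 ^ k \<le> real n * measure (unif n) (W A)" using fA by (simp add: mult.commute)
    thus ?thesis using pois_int_void[OF Wb[OF fA(1)], of "real n"] by (simp add: ennreal_leI)
  qed
  have "pois_int (unif n) (real n) (\<lambda>\<omega>. of_bool (B \<omega>)) \<le> pois_int (unif n) (real n) (\<lambda>\<omega>. \<Sum>q\<in>PR. of_bool (\<omega> \<inter> W (snd q) = {}))"
    by (intro pois_int_mono BW)
  also have "\<dots> = (\<Sum>q\<in>PR. pois_int (unif n) (real n) (\<lambda>\<omega>. of_bool (\<omega> \<inter> W (snd q) = {})))"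
    using finA by (intro pois_int_sum finPR set_measurable_empty_on Wb) auto
  also have "\<dots> \<le> (\<Sum>q\<in>PR. ennreal (exp (- ?v * 2 ^ k)))" using void by (intro sum_mono) auto
  also have "\<dots> = ennreal (\<Sum>b\<in>BX. real (card (bad_sets k b)) * exp (- ?v * 2 ^ k))"
  proof -
    have "card PR = (\<Sum>b\<in>BX. card (bad_sets k b))"
      unfolding PR_def using finBX finite_bad_sets by (intro card_SigmaI) auto
    hence "real (card PR) * exp (- ?v * 2 ^ k) = (\<Sum>b\<in>BX. real (card (bad_sets k b)) * exp (- ?v * 2 ^ k))"
      by (simp add: sum_distrib_right)
    moreover have "(\<Sum>q\<in>PR. ennreal (exp (- ?v * 2 ^ k))) = ennreal (real (card PR) * exp (- ?v * 2 ^ k))"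
      by (simp add: ennreal_of_nat_eq_real_of_nat ennreal_mult)
    ultimately show ?thesis by simp
  qed
  also have "\<dots> \<le> ennreal (1 / (real (level m) + 4))"
  proof (rule ennreal_leI)
    have "(\<Sum>b\<in>BX. real (card (bad_sets k b)) * exp (- ?v * 2 ^ k)) \<le> (\<Sum>b\<in>BX. 1 / (real k + 4) ^ (4 * CARD('d)))"
      by (intro sum_mono card_bad_sets_weighted v)
    also have "\<dots> = real ?M ^ CARD('d) / (real k + 4) ^ (4 * CARD('d))" by (simp add: cardBX)
    also have "\<dots> \<le> (real k + 4) ^ CARD('d) / (real k + 4) ^ (4 * CARD('d))"
      using M2 by (intro divide_right_mono power_mono) auto
    also have "\<dots> = 1 / (real k + 4) ^ (3 * CARD('d))"
      by (simp add: field_simps flip: power_add)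
    also have "\<dots> \<le> 1 / (real k + 4) ^ 1"
      using d by (intro divide_left_mono power_increasing) auto
    finally show "(\<Sum>b\<in>BX. real (card (bad_sets k b)) * exp (- ?v * 2 ^ k)) \<le> 1 / (real (level m) + 4)"
      by (simp add: k_def)
  qed
  finally show "pois_int (unif n) (real n) (\<lambda>\<omega>. of_bool (B \<omega>)) \<le> ennreal (1 / (real (level m) + 4))" .
qed

text \<open>One point is chosen in each cell of the union of the top cores. The choices are
  distinct, and neighbouring cells give points within \<open>2 * d * h\<close>. Rounding
  \<open>m\<close> down to a multiple of \<open>scale k\<close> at most halves it, whence
  \<open>m / 2\<close>.\<close>

lemma all_good_giant:
  fixes p :: "real^'d::finite" and \<omega> :: "(real^'d) set"
  assumes d: "CARD('d) \<ge> 2" and h: "h > 0" and fin: "finite \<omega>" and m: "m \<ge> 1"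
  defines "k \<equiv> level m"
  defines "BX \<equiv> grid_box (\<lambda>_. 0) (\<lambda>_. m div scale k - 1) :: 'd cell set"
  assumes g: "\<And>b. b \<in> BX \<Longrightarrow> good (\<lambda>z. \<omega> \<inter> rcell p (\<lambda>_. h) z \<noteq> {}) k b"
  shows "\<exists>C. cluster (2 * real CARD('d) * h) \<omega> C \<and> real (card C) \<ge> 2 / 3 * (real m / 2) ^ CARD('d)"
proof -
  let ?occ = "\<lambda>z. \<omega> \<inter> rcell p (\<lambda>_. h) z \<noteq> {}" and ?r = "2 * real CARD('d) * h"
  let ?M = "m div scale k"
  have M1: "?M \<ge> 1" using level_lb[OF m] scale_pos[of k] by (simp add: k_def Suc_le_eq div_greater_zero_iff)
  have finBX: "finite BX" by (simp add: BX_def finite_grid_box)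
  have cardBX: "card BX = ?M ^ CARD('d)" unfolding BX_def using M1 by (subst card_grid_box) auto
  define X where "X = (\<Union>b\<in>BX. core ?occ k b)"
  have conn: "grid_conn X"
    unfolding X_def
  proof (rule grid_conn_UN)
    show "grid_conn BX" unfolding BX_def by (rule grid_conn_box)
  qed (use good_core[OF d] g in blast)+
  have occ: "?occ z" if z: "z \<in> X" for z
  proof -
    obtain b where b: "b \<in> BX" "z \<in> core ?occ k b" using z unfolding X_def by blast
    show ?thesis using good_core(1)[OF d g[OF b(1)]] b(2) by blast
  qed
  define q where "q z = (SOME x. x \<in> \<omega> \<inter> rcell p (\<lambda>_. h) z)" for z
  have q: "q z \<in> \<omega> \<inter> rcell p (\<lambda>_. h) z" if "z \<in> X" for z
  proof -
    have "\<exists>x. x \<in> \<omega> \<inter> rcell p (\<lambda>_. h) z" using occ[OF that] by blast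
    thus ?thesis unfolding q_def by (rule someI_ex)
  qed
  have inj: "inj_on q X"
  proof (rule inj_onI, rule ccontr)
    fix z z' assume "z \<in> X" "z' \<in> X" "q z = q z'" "z \<noteq> z'"
    thus False using q[of z] q[of z'] rcell_disjoint[of "\<lambda>_. h" z z' p] h by auto
  qed
  have "card X = (\<Sum>b\<in>BX. card (core ?occ k b))"
    unfolding X_def
  proof (rule card_UN_disjoint)
    show "\<forall>i\<in>BX. \<forall>j\<in>BX. i \<noteq> j \<longrightarrow> core ?occ k i \<inter> core ?occ k j = {}"
    proof (intro ballI impI, rule ccontr)
      fix i j assume "i \<noteq> j" "core ?occ k i \<inter> core ?occ k j \<noteq> {}"
      then obtain z where "z \<in> core ?occ k i" "z \<in> core ?occ k j" by auto
      hence "i l = j l" for l using core_div by metis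
      thus False using \<open>i \<noteq> j\<close> by auto
    qed
  qed (use finBX finite_core in auto)
  hence "real (card X) = (\<Sum>b\<in>BX. real (card (core ?occ k b)))" by simp
  also have "\<dots> \<ge> (\<Sum>b\<in>BX. 2 / 3 * real (scale k) ^ CARD('d))"
  proof (intro sum_mono)
    fix b assume "b \<in> BX"
    have "2 / 3 * real (scale k) ^ CARD('d) \<le> 2 / 3 * ((real k + 3) / (real k + 2)) * real (scale k) ^ CARD('d)"
    proof (rule mult_right_mono)
      have "1 \<le> (real k + 3) / (real k + 2)" by (simp add: le_divide_eq)
      thus "2 / 3 \<le> 2 / 3 * ((real k + 3) / (real k + 2))" by linarith
    qed simp
    also have "\<dots> \<le> real (card (core ?occ k b))" by (rule card_core[OF d g[OF \<open>b \<in> BX\<close>]])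
    finally show "2 / 3 * real (scale k) ^ CARD('d) \<le> real (card (core ?occ k b))" .
  qed
  also have "(\<Sum>b\<in>BX. 2 / 3 * real (scale k) ^ CARD('d)) = 2 / 3 * real (?M * scale k) ^ CARD('d)"
    by (simp add: cardBX power_mult_distrib)
  also have "\<dots> \<ge> 2 / 3 * (real m / 2) ^ CARD('d)"
  proof -
    have "m < ?M * scale k + scale k" using scale_pos[of k] by (metis add.commute dividend_less_div_times mult.commute)
    moreover have "scale k \<le> ?M * scale k" using M1 by simp
    ultimately have "m \<le> 2 * (?M * scale k)" by linarith
    hence "real m / 2 \<le> real (?M * scale k)" by linarith
    thus ?thesis by (intro mult_left_mono power_mono) auto
  qed
  finally have card: "real (card X) \<ge> 2 / 3 * (real m / 2) ^ CARD('d)" by linarith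
  have "(2 / 3 * (real m / 2) ^ CARD('d) :: real) > 0" using m by simp
  hence "card X > 0" using card by linarith
  then obtain z0 where z0: "z0 \<in> X" by (metis card_gt_0_iff ex_in_conv)
  let ?C = "cluster_of ?r \<omega> (q z0)"
  have cl: "cluster ?r \<omega> ?C" using q[OF z0] by (intro cluster_cluster_of) auto
  have "q ` X \<subseteq> ?C"
  proof
    fix y assume "y \<in> q ` X"
    then obtain z where z: "z \<in> X" "y = q z" by auto
    have "grid_path X z0 z" using conn z0 z by (auto simp: grid_conn_def)
    hence "path_in ?r \<omega> (q z0) (q z)"
    proof (rule grid_path_points)
      fix a b assume "a \<in> X" "b \<in> X" "nbr a b"
      thus "dist (q a) (q b) \<le> ?r" using rcell_nbr_dist[of "q a" p "\<lambda>_. h" a "q b" b h] q h by auto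
    qed (use q in auto)
    thus "y \<in> ?C" using z by (simp add: cluster_of_def)
  qed
  moreover have "?C \<subseteq> \<omega>" using cl unfolding cluster_def by blast
  hence "finite ?C" using fin by (rule finite_subset)
  ultimately have "card (q ` X) \<le> card ?C" by (intro card_mono)
  hence "card X \<le> card ?C" by (simp add: card_image inj)
  thus ?thesis using cl card by (intro exI[of _ ?C]) simp
qed

lemma side_at_top:
  "\<forall>\<^sub>F n in sequentially. K \<le> real n powr (1 / real CARD('d::finite))"
proof -
  let ?d = "real CARD('d)"
  have d: "?d > 0" by simp
  show ?thesis
    using eventually_ge_at_top[of "nat \<lceil>\<bar>K\<bar> powr ?d\<rceil>"]
  proof eventually_elim
    case (elim n)
    hence "\<bar>K\<bar> powr ?d \<le> real n" by linarith
    hence "(\<bar>K\<bar> powr ?d) powr (1 / ?d) \<le> real n powr (1 / ?d)" using d by (intro powr_mono2) auto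
    thus ?case using d by (simp add: powr_powr)
  qed
qed

lemma geo_components_cong:
  assumes "\<And>i j. i < N \<Longrightarrow> j < N \<Longrightarrow> dist (x i) (x j) \<le> r \<longleftrightarrow> dist (x' i) (x' j) \<le> r"
  shows "geo_components N r x = geo_components N r x'"
proof -
  have "(\<lambda>a b. a < N \<and> b < N \<and> geo_adj r x a b) = (\<lambda>a b. a < N \<and> b < N \<and> geo_adj r x' a b)"
    using assms by (auto simp: fun_eq_iff geo_adj_def)
  hence "geo_component N r x = geo_component N r x'" by (simp add: geo_component_def fun_eq_iff)
  thus ?thesis by (simp add: geo_components_def)
qed

lemma giant_event_sets:
  assumes n: "n > 0"
  shows "{x \<in> space (PiM {..<N} (\<lambda>_. unif n :: (real^'d::finite) measure)). \<exists>C\<in>geo_components N r x. c \<le> real (card C)}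
     \<in> sets (PiM {..<N} (\<lambda>_. unif n))"
proof -
  interpret diffuse "unif n :: (real^'d) measure" by (rule diffuse_unif[OF n])
  show ?thesis
  proof (rule sets_label_pattern[of "{}" N r])
    fix x x' :: "nat \<Rightarrow> real^'d"
    assume "\<And>i j. i < N \<Longrightarrow> j < N \<Longrightarrow> dist (x i) (x j) \<le> r \<longleftrightarrow> dist (x' i) (x' j) \<le> r"
      and g: "\<exists>C\<in>geo_components N r x. c \<le> real (card C)"
    hence "geo_components N r x = geo_components N r x'" by (intro geo_components_cong)
    thus "\<exists>C\<in>geo_components N r x'. c \<le> real (card C)" using g by simp
  qed auto
qed

theorem giant_exists:
  assumes d: "CARD('d::finite) \<ge> 2"
  shows "\<exists>r>0. \<exists>c>0. aas (\<lambda>n N (x :: nat \<Rightarrow> real^'d). \<exists>C\<in>geo_components N r x. real (card C) \<ge> c * real n)"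
proof -
  let ?V = "ball_vol TYPE('d)" and ?d = "CARD('d)"
  \<comment> \<open>The side at which a cell is empty with probability at most
    \<open>1 / 4 ^ (4 * d)\<close>, as \<open>card_bad_sets_weighted\<close> asks; the maximum with
    1 permits \<open>h / 2 \<le> (h / 2) ^ d\<close>.\<close>
  define s0 where "s0 = 2 * max 1 (real (4 * ?d) * ln 4 / ?V)"
  have s0: "s0 \<ge> 2" by (simp add: s0_def)
  have V: "?V > 0" by (rule ball_vol_pos)
  have v0: "exp (- (?V * (h / 2) ^ ?d)) \<le> 1 / 4 ^ (4 * ?d)" if "h \<ge> s0" for h
  proof -
    have h2: "h / 2 \<ge> 1" "h / 2 \<ge> real (4 * ?d) * ln 4 / ?V" using that by (auto simp: s0_def)
    have "real (4 * ?d) * ln 4 \<le> ?V * (h / 2)" using h2(2) V by (simp add: field_simps)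
    also have "\<dots> \<le> ?V * (h / 2) ^ ?d" using V self_le_power[OF h2(1), of ?d] by (intro mult_left_mono) auto
    finally have "exp (- (?V * (h / 2) ^ ?d)) \<le> exp (- (real (4 * ?d) * ln 4))" by simp
    also have "\<dots> = 1 / 4 ^ (4 * ?d)"
      using exp_of_nat_mult[of "4 * ?d" "ln 4 :: real"] by (simp add: exp_minus divide_inverse del: of_nat_mult)
    finally show ?thesis .
  qed
  define L where "L n = real n powr (1 / real ?d)" for n
  define m where "m n = nat \<lfloor>L n / s0\<rfloor>" for n
  define h where "h n = L n / real (m n)" for n
  define p :: "nat \<Rightarrow> real^'d" where "p n = (\<chi> i. - L n / 2)" for n
  define B where "B n \<omega> = (\<exists>b\<in>(grid_box (\<lambda>_. 0) (\<lambda>_. m n div scale (level (m n)) - 1) :: 'd cell set).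
     \<not> good (\<lambda>z. \<omega> \<inter> rcell (p n) (\<lambda>_. h n) z \<noteq> {}) (level (m n)) b)" for n \<omega>
  \<comment> \<open>The cell side lies between \<open>s0\<close> and \<open>2 * s0\<close>; this
    gives the radius and, from \<open>m \<ge> L / (2 * s0)\<close>, the constant
    \<open>c\<close>.\<close>
  define r where "r = 4 * real ?d * s0"
  define c where "c = 2 / 3 / (4 * s0) ^ ?d"
  have big: "\<forall>\<^sub>F n in sequentially. n > 0 \<and> L n \<ge> K * s0" for K
    unfolding L_def using side_at_top[where 'd = 'd, of "K * s0"] eventually_gt_at_top[of 0] by eventually_elim auto
  have mprops: "m n \<ge> 1" "s0 \<le> h n" "h n \<le> 2 * s0" "L n \<le> 2 * s0 * real (m n)" if "n > 0 \<and> L n \<ge> 1 * s0" for n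
  proof -
    have q: "L n / s0 \<ge> 1" using that s0 by (simp add: field_simps)
    hence fl: "real (m n) \<le> L n / s0" "L n / s0 < real (m n) + 1" "m n \<ge> 1"
      unfolding m_def by linarith+
    show m1: "m n \<ge> 1" by (rule fl)
    show "s0 \<le> h n" using fl s0 m1 by (simp add: h_def field_simps)
    have "L n / s0 \<le> 2 * real (m n)" using fl by linarith
    thus L2: "L n \<le> 2 * s0 * real (m n)" using s0 by (simp add: field_simps)
    thus "h n \<le> 2 * s0" using m1 by (simp add: h_def field_simps)
  qed
  have m_inf: "filterlim m at_top sequentially"
    unfolding filterlim_at_top
  proof
    fix K :: nat
    show "\<forall>\<^sub>F n in sequentially. K \<le> m n"
      using big[of "real K"]
    proof eventually_elim
      case (elim n)
      hence "real K \<le> L n / s0" using s0 by (simp add: field_simps)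
      thus ?case unfolding m_def by linarith
    qed
  qed
  have "aas (\<lambda>n N (x :: nat \<Rightarrow> real^'d). \<exists>C\<in>geo_components N r x. c * real n \<le> real (card C))"
  proof (rule aasI[of _ B "\<lambda>n. 1 / (real (level (m n)) + 4)"])
    fix n N :: nat assume "n > 0"
    thus "{x \<in> space (PiM {..<N} (\<lambda>_. unif n :: (real^'d) measure)). \<exists>C\<in>geo_components N r x. c * real n \<le> real (card C)}
     \<in> sets (PiM {..<N} (\<lambda>_. unif n))" by (rule giant_event_sets)
  next
    show "\<forall>\<^sub>F n in sequentially. \<forall>N (x :: nat \<Rightarrow> real^'d). inj_on x {..<N} \<longrightarrow> x ` {..<N} \<subseteq> Lambda n \<longrightarrow>
        \<not> (\<exists>C\<in>geo_components N r x. c * real n \<le> real (card C)) \<longrightarrow> B n (x ` {..<N})"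
      using big[of 1]
    proof eventually_elim
      case (elim n)
      note mp = mprops[OF elim]
      show ?case
      proof (intro allI impI, rule ccontr)
        fix N and x :: "nat \<Rightarrow> real^'d"
        assume inj: "inj_on x {..<N}" and no: "\<not> (\<exists>C\<in>geo_components N r x. c * real n \<le> real (card C))"
          and "\<not> B n (x ` {..<N})"
        hence "good (\<lambda>z. x ` {..<N} \<inter> rcell (p n) (\<lambda>_. h n) z \<noteq> {}) (level (m n)) b"
          if "b \<in> grid_box (\<lambda>_. 0) (\<lambda>_. m n div scale (level (m n)) - 1)" for b
          using that by (auto simp: B_def)
        then obtain C where C: "cluster (2 * real ?d * h n) (x ` {..<N}) C" "2 / 3 * (real (m n) / 2) ^ ?d \<le> real (card C)"
          using all_good_giant[OF d, of "h n" "x ` {..<N}" "m n" "p n"] mp s0 by fastforce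
        have "2 * real ?d * h n \<le> r" using mp by (simp add: r_def)
        from cluster_le_component[OF inj C(1) this] obtain C' where C': "C' \<in> geo_components N r x" "card C \<le> card C'" by auto
        have "c * real n = 2 / 3 * (L n / (4 * s0)) ^ ?d"
          using side_power[of n, where 'd = 'd] elim by (simp add: c_def L_def power_divide)
        also have "\<dots> \<le> 2 / 3 * (real (m n) / 2) ^ ?d"
          using mp(4) s0 by (intro mult_left_mono power_mono) (auto simp: field_simps L_def)
        finally show False using C C' no by fastforce
      qed
    qed
  next
    show "\<forall>\<^sub>F n in sequentially. set_measurable (unif n) (\<lambda>\<omega>. of_bool (B n \<omega>)) \<and>
       pois_int (unif n) (real n) (\<lambda>\<omega>. of_bool (B n \<omega>)) \<le> ennreal (1 / (real (level (m n)) + 4))"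
      using big[of 1]
    proof eventually_elim
      case (elim n)
      note mp = mprops[OF elim]
      have cells: "rcell (p n) (\<lambda>_. h n) z \<subseteq> Lambda n" if z: "\<And>i. z i < m n" for z
      proof
        fix x assume x: "x \<in> rcell (p n) (\<lambda>_. h n) z"
        have hm: "h n * real (m n) = L n" using mp by (simp add: h_def)
        have "\<bar>x $ i\<bar> \<le> L n / 2" for i
        proof -
          have "h n * (real (z i) + 1) \<le> h n * real (m n)" using z[of i] mp s0 by (intro mult_left_mono) auto
          moreover have "0 \<le> h n * real (z i)" using mp s0 by (intro mult_nonneg_nonneg) auto
          moreover have "- L n / 2 + h n * real (z i) \<le> x $ i" "x $ i < - L n / 2 + h n * (real (z i) + 1)"
            using x by (auto simp: rcell_def p_def)
          ultimately show ?thesis using hm by linarith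
        qed
        thus "x \<in> Lambda n" by (simp add: Lambda_def L_def)
      qed
      show ?case
        unfolding B_def using not_all_good_prob[OF d _ _ v0[OF mp(2)] mp(1) cells] elim mp s0 by auto
    qed
  next
    have "filterlim (\<lambda>n. level (m n)) at_top sequentially" by (rule filterlim_compose[OF level_at_top m_inf])
    hence "filterlim (\<lambda>n. real (level (m n)) + 4) at_top sequentially"
      by (rule filterlim_at_top_mono[OF filterlim_compose[OF filterlim_real_sequentially]]) simp
    thus "(\<lambda>n. 1 / (real (level (m n)) + 4)) \<longlonglongrightarrow> 0"
      using tendsto_inverse_0_at_top by (simp add: divide_inverse)
  qed simp
  moreover have "r > 0" "c > 0" using s0 by (auto simp: r_def c_def)
  ultimately show ?thesis by blast
qed

section \<open>The critical radius\<close>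

text \<open>Counts self-avoiding sequences of \<open>k\<close> further points from \<open>x\<close>
  with steps at most \<open>r\<close>. Removing each visited point brings the sum into the form of
  Mecke's formula.\<close>

fun chains :: "real \<Rightarrow> nat \<Rightarrow> 'a::metric_space \<Rightarrow> 'a set \<Rightarrow> ennreal" where
  "chains r 0 x \<omega> = 1"
| "chains r (Suc k) x \<omega> = (\<Sum>y\<in>\<omega>. of_bool (dist x y \<le> r) * chains r k y (\<omega> - {y}))"

lemma chains_map:
  assumes "inj_on \<phi> (insert x \<omega>)"
    and "\<And>a b. a \<in> insert x \<omega> \<Longrightarrow> b \<in> insert x \<omega> \<Longrightarrow> dist (\<phi> a) (\<phi> b) \<le> r \<longleftrightarrow> dist a b \<le> r"
  shows "chains r k (\<phi> x) (\<phi> ` \<omega>) = chains r k x \<omega>"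
  using assms
proof (induction k arbitrary: x \<omega>)
  case (Suc k)
  have inj: "inj_on \<phi> \<omega>" using Suc.prems(1) by (rule inj_on_subset) auto
  have "chains r (Suc k) (\<phi> x) (\<phi> ` \<omega>) = (\<Sum>y\<in>\<omega>. of_bool (dist (\<phi> x) (\<phi> y) \<le> r) * chains r k (\<phi> y) (\<phi> ` \<omega> - {\<phi> y}))"
    by (simp add: sum.reindex[OF inj])
  also have "\<dots> = (\<Sum>y\<in>\<omega>. of_bool (dist x y \<le> r) * chains r k y (\<omega> - {y}))"
  proof (intro sum.cong refl)
    fix y assume y: "y \<in> \<omega>"
    have "\<phi> ` \<omega> - {\<phi> y} = \<phi> ` (\<omega> - {y})" using inj y by (auto simp: inj_on_def)
    moreover have "chains r k (\<phi> y) (\<phi> ` (\<omega> - {y})) = chains r k y (\<omega> - {y})"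
    proof (rule Suc.IH)
      show "inj_on \<phi> (insert y (\<omega> - {y}))" using inj y by (simp add: insert_absorb)
    qed (use Suc.prems y in auto)
    moreover have "dist (\<phi> x) (\<phi> y) \<le> r \<longleftrightarrow> dist x y \<le> r" using Suc.prems(2) y by auto
    ultimately show "of_bool (dist (\<phi> x) (\<phi> y) \<le> r) * chains r k (\<phi> y) (\<phi> ` \<omega> - {\<phi> y}) =
        of_bool (dist x y \<le> r) * chains r k y (\<omega> - {y})" by simp
  qed
  finally show ?case by simp
qed simp

lemma path_avoiding_start:
  assumes "path_in r (insert x \<omega>) x z" "z \<noteq> x"
  shows "\<exists>y\<in>\<omega>. dist x y \<le> r \<and> path_in r \<omega> y z"
proof -
  have "z = x \<or> (\<exists>y\<in>\<omega>. dist x y \<le> r \<and> path_in r \<omega> y z)"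
    using assms(1) unfolding path_in_def[of r "insert x \<omega>"]
  proof (induction rule: rtranclp_induct)
    case (step z z')
    show ?case
    proof (cases "z' = x")
      case False
      hence z': "z' \<in> \<omega>" using step by auto
      show ?thesis
      proof (cases "z = x")
        case True
        thus ?thesis using step z' path_in_refl[of r \<omega> z'] by auto
      next
        case False
        then obtain y where y: "y \<in> \<omega>" "dist x y \<le> r" "path_in r \<omega> y z" using step.IH by auto
        have "path_in r \<omega> z z'" using step z' False by (intro path_in_step) auto
        thus ?thesis using y path_in_trans[OF y(3)] by auto
      qed
    qed simp
  qed simp
  thus ?thesis using assms(2) by simp
qed

text \<open>Removing \<open>x\<close> breaks its cluster into the clusters of its neighbours in the
  remaining set. By recursion every point of the cluster is the end of at least one self-avoiding
  chain.\<close>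

lemma card_cluster_le_chains:
  assumes "finite \<omega>" "x \<notin> \<omega>"
  shows "of_nat (card (cluster_of r (insert x \<omega>) x)) \<le> (\<Sum>k\<le>card \<omega>. chains r k x \<omega>)"
  using assms
proof (induction "card \<omega>" arbitrary: \<omega> x)
  case 0
  hence "\<omega> = {}" by simp
  have "cluster_of r {x} x \<subseteq> {x}"
    using path_avoiding_start[of r x "{}"] by (auto simp: cluster_of_def)
  hence "card (cluster_of r {x} x) \<le> 1" using card_mono[of "{x}"] by fastforce
  hence "(of_nat (card (cluster_of r {x} x)) :: ennreal) \<le> of_nat 1" by (simp only: of_nat_le_iff)
  thus ?case using \<open>\<omega> = {}\<close> by simp
next
  case (Suc m)
  let ?A = "{y\<in>\<omega>. dist x y \<le> r}"
  have finA: "finite ?A" using Suc by auto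
  have cfin: "finite (cluster_of r \<omega> y)" if "y \<in> \<omega>" for y
    using cluster_cluster_of[OF that, of r] Suc.prems(1) unfolding cluster_def by (blast intro: finite_subset)
  have "cluster_of r (insert x \<omega>) x \<subseteq> {x} \<union> (\<Union>y\<in>?A. cluster_of r \<omega> y)"
    using path_avoiding_start[of r x \<omega>] by (auto simp: cluster_of_def)
  hence "card (cluster_of r (insert x \<omega>) x) \<le> card ({x} \<union> (\<Union>y\<in>?A. cluster_of r \<omega> y))"
    using finA cfin by (intro card_mono) auto
  also have "\<dots> \<le> 1 + (\<Sum>y\<in>?A. card (cluster_of r \<omega> y))"
    using card_UN_le[OF finA, of "cluster_of r \<omega>"] card_Un_le[of "{x}" "\<Union>y\<in>?A. cluster_of r \<omega> y"] by simp
  finally have "(of_nat (card (cluster_of r (insert x \<omega>) x)) :: ennreal) \<le> of_nat (1 + (\<Sum>y\<in>?A. card (cluster_of r \<omega> y)))"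
    by (simp only: of_nat_le_iff)
  also have "\<dots> = 1 + (\<Sum>y\<in>?A. of_nat (card (cluster_of r \<omega> y)))" by simp
  also have "\<dots> \<le> 1 + (\<Sum>y\<in>?A. \<Sum>k\<le>m. chains r k y (\<omega> - {y}))"
  proof (intro add_left_mono sum_mono)
    fix y assume y: "y \<in> ?A"
    have c: "card (\<omega> - {y}) = m" using y Suc by simp
    have "of_nat (card (cluster_of r (insert y (\<omega> - {y})) y)) \<le> (\<Sum>k\<le>card (\<omega> - {y}). chains r k y (\<omega> - {y}))"
      by (rule Suc.hyps(1)) (use c Suc.prems in auto)
    thus "of_nat (card (cluster_of r \<omega> y)) \<le> (\<Sum>k\<le>m. chains r k y (\<omega> - {y}))"
      using c y by (simp add: insert_absorb)
  qed
  also have "\<dots> = 1 + (\<Sum>k\<le>m. \<Sum>y\<in>?A. chains r k y (\<omega> - {y}))" by (subst sum.swap) simp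
  also have "\<dots> = 1 + (\<Sum>k\<le>m. chains r (Suc k) x \<omega>)"
  proof -
    have "(\<Sum>y\<in>?A. chains r k y (\<omega> - {y})) = chains r (Suc k) x \<omega>" for k
      using Suc.prems(1) by (simp add: sum.inter_filter of_bool_def if_distrib[of "\<lambda>c. c * _"] cong: if_cong)
    thus ?thesis by simp
  qed
  also have "\<dots> = (\<Sum>k\<le>card \<omega>. chains r k x \<omega>)"
    unfolding Suc.hyps(2)[symmetric] by (simp add: sum.atMost_Suc_shift del: sum.atMost_Suc)
  finally show ?case .
qed

lemma local_prop_big_cluster:
  "local_prop r {} (\<lambda>\<omega>. \<exists>C. cluster r \<omega> C \<and> s \<le> real (card C))"
  unfolding local_prop_def
proof (intro allI impI, elim conjE exE)
  fix \<omega> \<omega>' :: "'a::metric_space set" and \<phi> C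
  assume \<phi>: "bij_betw \<phi> \<omega> \<omega>'" and d: "\<forall>x\<in>\<omega>. \<forall>y\<in>\<omega>. dist (\<phi> x) (\<phi> y) \<le> r \<longleftrightarrow> dist x y \<le> r"
    and C: "cluster r \<omega> C" and s: "s \<le> real (card C)"
  have \<omega>': "\<omega>' = \<phi> ` \<omega>" and inj: "inj_on \<phi> \<omega>" using \<phi> by (auto simp: bij_betw_def)
  have C\<omega>: "C \<subseteq> \<omega>" using C unfolding cluster_def by blast
  have "cluster r \<omega>' (\<phi> ` C)"
    unfolding cluster_def
  proof (intro conjI ballI impI)
    show "\<phi> ` C \<subseteq> \<omega>'" "\<phi> ` C \<noteq> {}" using C C\<omega> by (auto simp: \<omega>' cluster_def)
    fix x y assume "x \<in> \<phi> ` C" "y \<in> \<omega>'" "dist x y \<le> r"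
    then obtain a b where ab: "a \<in> C" "x = \<phi> a" "b \<in> \<omega>" "y = \<phi> b" by (auto simp: \<omega>')
    have "dist a b \<le> r" using ab C\<omega> d \<open>dist x y \<le> r\<close> by blast
    hence "b \<in> C" using C ab unfolding cluster_def by blast
    thus "y \<in> \<phi> ` C" using ab by blast
  next
    fix x y assume "x \<in> \<phi> ` C" "y \<in> \<phi> ` C"
    then obtain a b where ab: "a \<in> C" "x = \<phi> a" "b \<in> C" "y = \<phi> b" by auto
    have "path_in r C a b" using C ab unfolding cluster_def by blast
    thus "path_in r (\<phi> ` C) x y" unfolding ab by (rule path_in_map) (use C\<omega> d in blast)
  qed
  moreover have "card (\<phi> ` C) = card C" using inj_on_subset[OF inj C\<omega>] by (rule card_image)
  ultimately show "\<exists>C. cluster r \<omega>' C \<and> s \<le> real (card C)" using s by (intro exI[of _ "\<phi> ` C"]) simp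
qed

section \<open>Self-avoiding chains under the Poisson process\<close>

context diffuse
begin

text \<open>The value depends only on the pattern of distances and coincidences, so
  \<open>sets_label_pattern\<close> applies, with the start of the chain as the last label.\<close>

lemma set_measurable2_chains: "set_measurable2 U (chains r k)"
  unfolding set_measurable2_def
proof
  fix N
  let ?M = "prodU (Suc N)"
  let ?G = "\<lambda>p :: nat \<Rightarrow> 'a. chains r k (p N) (p ` {..<N})"
  have m: "(\<lambda>(y, x). x(N := y)) \<in> measurable (U \<Otimes>\<^sub>M prodU N) ?M"
    unfolding lessThan_Suc by measurable
  have G: "?G \<in> borel_measurable ?M"
  proof (rule measurableI)
    fix A :: "ennreal set" assume "A \<in> sets borel"
    have "{p \<in> space ?M. ?G p \<in> A} \<in> sets ?M"
    proof (rule sets_label_pattern[of "{}" "Suc N" r])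
      fix x x' :: "nat \<Rightarrow> 'a"
      assume d: "\<And>i j. i < Suc N \<Longrightarrow> j < Suc N \<Longrightarrow> dist (x i) (x j) \<le> r \<longleftrightarrow> dist (x' i) (x' j) \<le> r"
        and e: "\<And>i j. i < Suc N \<Longrightarrow> j < Suc N \<Longrightarrow> x i = x j \<longleftrightarrow> x' i = x' j" and A: "?G x \<in> A"
      define \<phi> where "\<phi> z = x' (SOME i. i < Suc N \<and> x i = z)" for z
      have \<phi>: "\<phi> (x i) = x' i" if "i < Suc N" for i
      proof -
        have "(SOME j. j < Suc N \<and> x j = x i) < Suc N \<and> x (SOME j. j < Suc N \<and> x j = x i) = x i"
          using that by (intro someI) auto
        thus ?thesis using e that by (auto simp: \<phi>_def)
      qed
      have ins: "insert (x N) (x ` {..<N}) = x ` {..<Suc N}" by (auto simp: lessThan_Suc)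
      have "chains r k (\<phi> (x N)) (\<phi> ` (x ` {..<N})) = chains r k (x N) (x ` {..<N})"
      proof (rule chains_map)
        show "inj_on \<phi> (insert (x N) (x ` {..<N}))"
          unfolding ins inj_on_def using \<phi> e by auto
        fix a b assume "a \<in> insert (x N) (x ` {..<N})" "b \<in> insert (x N) (x ` {..<N})"
        thus "dist (\<phi> a) (\<phi> b) \<le> r \<longleftrightarrow> dist a b \<le> r" unfolding ins using \<phi> d by auto
      qed
      moreover have "\<phi> ` (x ` {..<N}) = x' ` {..<N}" unfolding image_image using \<phi> by (intro image_cong) auto
      ultimately show "?G x' \<in> A" using \<phi>[of N] A by simp
    qed auto
    thus "?G -` A \<inter> space ?M \<in> sets ?M" by (simp add: vimage_def Int_def conj_commute)
  qed simp
  have im: "(x(N := y)) ` {..<N} = x ` {..<N}" for x :: "nat \<Rightarrow> 'a" and y by (intro image_cong) auto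
  from measurable_compose[OF m G]
  show "(\<lambda>(y, x). chains r k y (x ` {..<N})) \<in> borel_measurable (U \<Otimes>\<^sub>M prodU N)"
    by (simp add: case_prod_unfold im)
qed

text \<open>Mecke's formula peels off one point of the chain at a time, each contributing the mean
  number of points in a ball of radius \<open>r\<close>.\<close>

lemma pois_int_chains:
  assumes t: "t \<ge> 0" and q: "\<And>x. t * measure U (cball x r) \<le> q"
  shows "pois_int U t (chains r k x) \<le> ennreal (q ^ k)"
proof (induction k arbitrary: x)
  case 0
  have "chains r 0 x = (\<lambda>_. 1)" by (simp add: fun_eq_iff)
  thus ?case using t by (simp add: pois_int_const)
next
  case (Suc k)
  have q0: "q \<ge> 0" using q[of x] t by (meson measure_nonneg mult_nonneg_nonneg order_trans)
  let ?g = "\<lambda>y \<omega>. of_bool (dist x y \<le> r) * chains r k y \<omega>"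
  have ind: "(\<lambda>y. of_bool (dist x y \<le> r) :: ennreal) \<in> borel_measurable U" by measurable
  have g: "set_measurable2 U ?g" by (rule set_measurable2_times_fun[OF ind set_measurable2_chains])
  have "chains r (Suc k) x = (\<lambda>\<omega>. \<Sum>y\<in>\<omega>. ?g y (\<omega> - {y}))" by (rule ext) simp
  hence "pois_int U t (chains r (Suc k) x) = pois_int U t (\<lambda>\<omega>. \<Sum>y\<in>\<omega>. ?g y (\<omega> - {y}))" by (simp only:)
  also have "\<dots> = ennreal t * (\<integral>\<^sup>+y. pois_int U t (?g y) \<partial>U)" by (rule pois_int_mecke[OF g t])
  also have "\<dots> \<le> ennreal t * (\<integral>\<^sup>+y. indicator (cball x r) y * ennreal (q ^ k) \<partial>U)"
  proof (intro mult_left_mono nn_integral_mono)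
    fix y
    have "pois_int U t (?g y) = of_bool (dist x y \<le> r) * pois_int U t (chains r k y)"
      by (rule pois_int_cmult[OF set_measurable_section[OF set_measurable2_chains]])
    also have "\<dots> \<le> indicator (cball x r) y * ennreal (q ^ k)"
      using Suc.IH[of y] by (auto simp: indicator_def)
    finally show "pois_int U t (?g y) \<le> indicator (cball x r) y * ennreal (q ^ k)" .
  qed simp
  also have "\<dots> = ennreal t * (ennreal (measure U (cball x r)) * ennreal (q ^ k))"
    by (subst nn_integral_multc) (auto simp: sets_U emeasure_eq_measure intro!: borel_measurable_indicator)
  also have "\<dots> = ennreal (t * measure U (cball x r) * q ^ k)"
    using t q0 by (simp add: ennreal_mult mult.assoc)
  also have "\<dots> \<le> ennreal (q ^ Suc k)"
    using q[of x] q0 by (intro ennreal_leI) (simp add: mult_right_mono)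
  finally show ?case .
qed

text \<open>In a cluster of at least \<open>s\<close> points every point reaches at least
  \<open>s\<close> points by chains, so the total number of chains is at least \<open>s ^ 2\<close>.
  Its mean is at most \<open>2 * t\<close>, by the geometric series with ratio 1 / 2. For
  \<open>s\<close> proportional to \<open>t\<close> the bound tends to 0 as \<open>t\<close>
  grows.\<close>

lemma pois_int_big_cluster:
  assumes t: "t > 0" and q: "\<And>x. t * measure U (cball x r) \<le> 1 / 2" and s: "s > 0"
  shows "pois_int U t (\<lambda>\<omega>. of_bool (\<exists>C. cluster r \<omega> C \<and> s \<le> real (card C))) \<le> ennreal (2 * t / s\<^sup>2)"
proof -
  let ?B = "\<lambda>\<omega>. \<exists>C. cluster r \<omega> C \<and> s \<le> real (card C)"
  let ?g = "\<lambda>x \<omega>. \<Sum>k. chains r k x \<omega>"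
  have g: "set_measurable2 U ?g"
    unfolding set_measurable2_def
  proof
    fix N
    have "(\<lambda>(y, x). chains r k y (x ` {..<N})) \<in> borel_measurable (U \<Otimes>\<^sub>M prodU N)" for k
      using set_measurable2_chains by (simp add: set_measurable2_def)
    hence "(\<lambda>p. \<Sum>k. chains r k (fst p) (snd p ` {..<N})) \<in> borel_measurable (U \<Otimes>\<^sub>M prodU N)"
      unfolding case_prod_unfold by measurable
    thus "(\<lambda>(y, x). \<Sum>k. chains r k y (x ` {..<N})) \<in> borel_measurable (U \<Otimes>\<^sub>M prodU N)"
      by (simp add: case_prod_unfold)
  qed
  have mch: "(\<lambda>z. chains r k x (z ` {..<N})) \<in> borel_measurable (prodU N)" for k x N
    using set_measurable_section[OF set_measurable2_chains[of r k], of x] by (simp add: set_measurable_def)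
  have sum: "pois_int U t (?g x) \<le> 2" for x
  proof -
    have "iid_int U N (?g x) = (\<Sum>k. iid_int U N (chains r k x))" for N
      unfolding iid_int_def by (rule nn_integral_suminf) (rule mch)
    hence "pois_int U t (?g x) = (\<Sum>N. \<Sum>k. ennreal (exp (- t) * t ^ N / fact N) * iid_int U N (chains r k x))"
      unfolding pois_int_def by simp
    also have "\<dots> = (\<Sum>k. pois_int U t (chains r k x))"
      unfolding pois_int_def by (rule ennreal_suminf_swap)
    also have "\<dots> \<le> (\<Sum>k. ennreal ((1 / 2) ^ k))"
      using t q by (intro suminf_le pois_int_chains) auto
    also have "\<dots> = ennreal (\<Sum>k. (1 / 2) ^ k)" by (rule suminf_ennreal2) (auto intro: summable_geometric)
    also have "(\<Sum>k. (1 / 2 :: real) ^ k) = 2" using suminf_geometric[of "1/2 :: real"] by simp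
    finally show ?thesis by simp
  qed
  have point: "ennreal (s\<^sup>2) * of_bool (?B \<omega>) \<le> (\<Sum>x\<in>\<omega>. ?g x (\<omega> - {x}))" if fin: "finite \<omega>" for \<omega>
  proof (cases "?B \<omega>")
    case True
    then obtain C where C: "cluster r \<omega> C" "s \<le> real (card C)" by auto
    have C\<omega>: "C \<subseteq> \<omega>" using C(1) unfolding cluster_def by blast
    have each: "of_nat (card C) \<le> ?g x (\<omega> - {x})" if x: "x \<in> C" for x
    proof -
      have "C \<subseteq> cluster_of r \<omega> x"
      proof
        fix y assume "y \<in> C"
        hence "path_in r C x y" using C(1) x unfolding cluster_def by blast
        thus "y \<in> cluster_of r \<omega> x" unfolding cluster_of_def using path_in_mono[OF _ C\<omega>] by blast
      qed
      moreover have "finite (cluster_of r \<omega> x)"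
        using cluster_cluster_of[of x \<omega> r] x C\<omega> fin unfolding cluster_def by (blast intro: finite_subset)
      ultimately have "(of_nat (card C) :: ennreal) \<le> of_nat (card (cluster_of r \<omega> x))"
        by (simp only: of_nat_le_iff card_mono)
      also have "\<dots> = of_nat (card (cluster_of r (insert x (\<omega> - {x})) x))" using x C\<omega> by (simp add: insert_absorb subsetD)
      also have "\<dots> \<le> (\<Sum>k\<le>card (\<omega> - {x}). chains r k x (\<omega> - {x}))"
        using fin by (intro card_cluster_le_chains) auto
      also have "\<dots> \<le> ?g x (\<omega> - {x})" by (rule sum_le_suminf) auto
      finally show ?thesis .
    qed
    have "s\<^sup>2 \<le> real (card C) * real (card C)" unfolding power2_eq_square using C(2) s by (intro mult_mono) auto
    hence "ennreal (s\<^sup>2) \<le> ennreal (real (card C) * real (card C))" by (rule ennreal_leI)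
    also have "\<dots> = (\<Sum>x\<in>C. of_nat (card C))" by (simp add: ennreal_mult ennreal_of_nat_eq_real_of_nat)
    also have "\<dots> \<le> (\<Sum>x\<in>C. ?g x (\<omega> - {x}))" by (intro sum_mono each)
    also have "\<dots> \<le> (\<Sum>x\<in>\<omega>. ?g x (\<omega> - {x}))" using C\<omega> fin by (intro sum_mono2) auto
    finally show ?thesis using True by simp
  next
    case False
    hence "of_bool (?B \<omega>) = (0 :: ennreal)" by (simp only: of_bool_eq simp_thms)
    thus ?thesis by (simp only: mult_zero_right zero_le)
  qed
  have mB: "set_measurable U (\<lambda>\<omega>. of_bool (?B \<omega>))"
    by (rule set_measurable_local_prop[OF _ _ local_prop_big_cluster]) auto
  have "ennreal (s\<^sup>2) * pois_int U t (\<lambda>\<omega>. of_bool (?B \<omega>)) = pois_int U t (\<lambda>\<omega>. ennreal (s\<^sup>2) * of_bool (?B \<omega>))"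
    by (rule pois_int_cmult[OF mB, symmetric])
  also have "\<dots> \<le> pois_int U t (\<lambda>\<omega>. \<Sum>x\<in>\<omega>. ?g x (\<omega> - {x}))" by (intro pois_int_mono point)
  also have "\<dots> = ennreal t * (\<integral>\<^sup>+x. pois_int U t (?g x) \<partial>U)" using t by (intro pois_int_mecke[OF g]) simp
  also have "\<dots> \<le> ennreal t * (\<integral>\<^sup>+x. 2 \<partial>U)" by (intro mult_left_mono nn_integral_mono sum) auto
  also have "\<dots> = ennreal (2 * t)" using t emeasure_space_1 by (simp add: ennreal_mult mult.commute)
  finally have *: "ennreal (s\<^sup>2) * pois_int U t (\<lambda>\<omega>. of_bool (?B \<omega>)) \<le> ennreal (2 * t)" .
  have "pois_int U t (\<lambda>\<omega>. of_bool (?B \<omega>)) = ennreal (1 / s\<^sup>2) * (ennreal (s\<^sup>2) * pois_int U t (\<lambda>\<omega>. of_bool (?B \<omega>)))"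
    using s by (simp flip: mult.assoc ennreal_mult)
  also have "\<dots> \<le> ennreal (1 / s\<^sup>2) * ennreal (2 * t)" by (intro mult_left_mono *) auto
  also have "\<dots> = ennreal (2 * t / s\<^sup>2)" using t by (simp flip: ennreal_mult)
  finally show ?thesis .
qed

end

theorem r_g_pos:
  assumes d: "CARD('d::finite) \<ge> 2"
  shows "r_g TYPE('d) > 0"
proof -
  let ?V = "ball_vol TYPE('d)" and ?d = "CARD('d)"
  let ?S = "{r. r > 0 \<and> (\<exists>c>0. aas (\<lambda>n N (x :: nat \<Rightarrow> real^'d). \<exists>C\<in>geo_components N r x. real (card C) \<ge> c * real n))}"
  have V: "?V > 0" by (rule ball_vol_pos)
  \<comment> \<open>A ball of this radius contains at most 1 / 2 of a point on average;
    \<open>\<rho> \<le> 1\<close> allows \<open>\<rho> ^ d\<close> to be replaced by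
    \<open>\<rho>\<close>.\<close>
  define \<rho> where "\<rho> = min 1 (1 / (2 * ?V))"
  have \<rho>: "\<rho> > 0" "\<rho> \<le> 1" "?V * \<rho> \<le> 1 / 2" using V by (auto simp: \<rho>_def min_def field_simps)
  have no: "r \<ge> \<rho> / 2" if r: "r \<in> ?S" for r
  proof (rule ccontr)
    assume "\<not> r \<ge> \<rho> / 2"
    hence rr: "r < \<rho> / 2" by simp
    from r obtain c where c: "r > 0" "c > 0" and a: "aas (\<lambda>n N (x :: nat \<Rightarrow> real^'d). \<exists>C\<in>geo_components N r x. real (card C) \<ge> c * real n)"
      by auto
    let ?P = "\<lambda>n N (x :: nat \<Rightarrow> real^'d). \<exists>C\<in>geo_components N r x. c * real n \<le> real (card C)"
    have le: "ppp_prob n (?P n) \<le> 2 / (c\<^sup>2 * real n)" if n: "n > 0" for n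
    proof -
      interpret diffuse "unif n :: (real^'d) measure" by (rule diffuse_unif[OF n])
      let ?B = "\<lambda>\<omega> :: (real^'d) set. \<exists>C. cluster r \<omega> C \<and> c * real n \<le> real (card C)"
      have q: "real n * measure (unif n) (cball x r) \<le> 1 / 2" for x :: "real^'d"
      proof -
        have "measure (unif n) (cball x r) \<le> measure (unif n) (ball x \<rho>)"
          using rr \<rho> c by (intro finite_measure_mono) auto
        hence "real n * measure (unif n) (cball x r) \<le> real n * measure (unif n) (ball x \<rho>)" by (intro mult_left_mono) auto
        also have "\<dots> \<le> ?V * \<rho> ^ ?d" using n \<rho> by (intro unif_ball_le) auto
        also have "\<dots> \<le> ?V * \<rho>" using V \<rho> power_decreasing[of 1 ?d \<rho>] by (intro mult_left_mono) auto
        finally show ?thesis using \<rho> by simp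
      qed
      have "ppp_prob n (?P n) \<le> 2 * real n / (c * real n)\<^sup>2"
      proof (rule ppp_prob_le[OF n, where B = ?B])
        fix N and x :: "nat \<Rightarrow> real^'d"
        assume inj: "inj_on x {..<N}" and "\<exists>C\<in>geo_components N r x. c * real n \<le> real (card C)"
        then obtain C where C: "C \<in> geo_components N r x" "c * real n \<le> real (card C)" by auto
        have "card (x ` C) = card C"
          by (rule card_image, rule inj_on_subset[OF inj geo_component_cluster(2)[OF inj C(1)]])
        thus "?B (x ` {..<N})" using geo_component_cluster(1)[OF inj C(1)] C(2) by (intro exI[of _ "x ` C"]) simp
      next
        show "set_measurable (unif n) (\<lambda>\<omega>. of_bool (?B \<omega>))"
          by (rule set_measurable_local_prop[OF _ _ local_prop_big_cluster]) auto
        show "pois_int (unif n) (real n) (\<lambda>\<omega>. of_bool (?B \<omega>)) \<le> ennreal (2 * real n / (c * real n)\<^sup>2)"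
          using n c q by (intro pois_int_big_cluster) auto
      qed (use giant_event_sets[OF n] in auto)
      also have "\<dots> = 2 / (c\<^sup>2 * real n)" using n by (simp add: power2_eq_square)
      finally show ?thesis .
    qed
    have "(\<lambda>n. 2 / c\<^sup>2 * (1 / real n)) \<longlonglongrightarrow> 2 / c\<^sup>2 * 0" by (intro tendsto_mult tendsto_const lim_1_over_n)
    hence lim0: "(\<lambda>n. 2 / (c\<^sup>2 * real n)) \<longlonglongrightarrow> 0" by simp
    have "(\<lambda>n. ppp_prob n (?P n)) \<longlonglongrightarrow> 1" using a by (simp add: aas_def)
    moreover have "\<forall>\<^sub>F n in sequentially. ppp_prob n (?P n) \<le> 2 / (c\<^sup>2 * real n)"
      using eventually_gt_at_top[of 0] by eventually_elim (rule le)
    ultimately have "(1::real) \<le> 0" using lim0 by (intro tendsto_le[OF _ lim0]) auto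
    thus False by simp
  qed
  have "?S \<noteq> {}" using giant_exists[OF d] by blast
  hence "\<rho> / 2 \<le> Inf ?S" using no by (intro cInf_greatest)
  thus ?thesis using \<rho> by (simp add: r_g_def)
qed

lemma giant_below:
  assumes d: "CARD('d::finite) \<ge> 2" and R: "R > r_g TYPE('d)"
  shows "\<exists>r. 0 < r \<and> r < R \<and> (\<exists>c>0. aas (\<lambda>n N (x :: nat \<Rightarrow> real^'d). \<exists>C\<in>geo_components N r x. real (card C) \<ge> c * real n))"
proof -
  let ?S = "{r. r > 0 \<and> (\<exists>c>0. aas (\<lambda>n N (x :: nat \<Rightarrow> real^'d). \<exists>C\<in>geo_components N r x. real (card C) \<ge> c * real n))}"
  have "?S \<noteq> {}" using giant_exists[OF d] by blast
  moreover have "Inf ?S < R" using R by (simp add: r_g_def)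
  ultimately have "\<exists>r\<in>?S. r < R" by (rule cInf_lessD)
  then obtain r where r: "r \<in> ?S" "r < R" by (rule bexE)
  from r(1) have "r > 0 \<and> (\<exists>c>0. aas (\<lambda>n N (x :: nat \<Rightarrow> real^'d). \<exists>C\<in>geo_components N r x. real (card C) \<ge> c * real n))"
    by (rule CollectD)
  thus ?thesis using r(2) by (intro exI[of _ r]) simp
qed

section \<open>The tiling of the box\<close>

text \<open>A frame cell violates the inner bounds on some axis \<open>j\<close>. The slab through
  it orthogonal to \<open>j\<close> stays in the frame and contains the point that has the same
  \<open>j\<close>-coordinate and zeros elsewhere. That point lies in the hyperplane
  \<open>z j' = 0\<close>, which contains the origin and belongs to the frame because
  \<open>lo j' \<ge> 1\<close>.\<close>

lemma grid_conn_frame: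
  fixes N lo up :: "'d::finite cell"
  assumes d: "CARD('d) \<ge> 2" and lo: "\<And>j. 1 \<le> lo j" and N: "\<And>j. 1 \<le> N j"
  shows "grid_conn {z. (\<forall>j. z j < N j) \<and> \<not> (\<forall>j. lo j \<le> z j \<and> z j < up j)}"
proof -
  let ?A = "{z. (\<forall>j. z j < N j) \<and> \<not> (\<forall>j. lo j \<le> z j \<and> z j < up j)}"
  have to0: "grid_path ?A z (\<lambda>_. 0)" if z: "z \<in> ?A" for z
  proof -
    obtain j where j: "\<not> (lo j \<le> z j \<and> z j < up j)" using z by auto
    obtain j' where j': "j' \<noteq> j" using other_axis[OF d] by blast
    have zN: "z k < N k" for k using z by auto
    let ?z1 = "(\<lambda>_. 0)(j := z j)"
    let ?B1 = "grid_box ((\<lambda>_. 0)(j := z j)) ((\<lambda>k. N k - 1)(j := z j))"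
    have "?B1 \<subseteq> ?A"
    proof
      fix y assume y: "y \<in> ?B1"
      have yj: "y j = z j" using y by (auto simp: grid_box_def dest: spec[of _ j])
      have "y k < N k" for k
      proof (cases "k = j")
        case False
        hence "y k \<le> N k - 1" using y by (auto simp: grid_box_def dest: spec[of _ k])
        thus ?thesis using N[of k] by linarith
      qed (use yj zN in simp)
      moreover have "\<not> (lo j \<le> y j \<and> y j < up j)" using yj j by simp
      ultimately show "y \<in> ?A" by blast
    qed
    moreover have "z k \<le> N k - 1" for k using zN[of k] by simp
    hence "z \<in> ?B1" by (simp add: grid_box_def)
    moreover have "?z1 \<in> ?B1" by (auto simp: grid_box_def)
    ultimately have 1: "grid_path ?A z ?z1" using grid_path_mono[OF grid_box_path] by blast
    let ?B2 = "grid_box (\<lambda>_. 0) ((\<lambda>k. N k - 1)(j' := 0))"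
    have "?B2 \<subseteq> ?A"
    proof
      fix y assume y: "y \<in> ?B2"
      have yj: "y j' = 0" using y by (auto simp: grid_box_def dest: spec[of _ j'])
      have "y k < N k" for k
      proof (cases "k = j'")
        case False
        hence "y k \<le> N k - 1" using y by (auto simp: grid_box_def dest: spec[of _ k])
        thus ?thesis using N[of k] by linarith
      qed (use yj N[of j'] in simp)
      moreover have "\<not> lo j' \<le> y j'" using yj lo[of j'] by simp
      ultimately show "y \<in> ?A" by blast
    qed
    moreover have "?z1 \<in> ?B2" using zN[of j] j' by (auto simp: grid_box_def)
    moreover have "(\<lambda>_. 0) \<in> ?B2" by (auto simp: grid_box_def)
    ultimately have 2: "grid_path ?A ?z1 (\<lambda>_. 0)" using grid_path_mono[OF grid_box_path] by blast
    show ?thesis by (rule rtranclp_trans[OF 1 2])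
  qed
  show ?thesis
    unfolding grid_conn_def
  proof (intro ballI)
    fix x y assume "x \<in> ?A" "y \<in> ?A"
    thus "grid_path ?A x y" using to0[of x] grid_path_sym[OF to0[of y]] by (meson rtranclp_trans)
  qed
qed

lemma dist_triangle_via2: "dist w z \<le> dist w x + dist x y + dist y (z :: 'a::metric_space)"
  using dist_triangle[of w z x] dist_triangle[of x z y] by linarith

lemma norm_axis_real: "norm (axis a (c::real)) = \<bar>c\<bar>"
proof -
  have "axis a c = c *\<^sub>R axis a (1::real)" by (simp add: axis_def vec_eq_iff)
  thus ?thesis by simp
qed

text \<open>Tiles consist of \<open>W j * S\<close> cells of side \<open>h j\<close> along axis \<open>j\<close> and are longer along axis \<open>a\<close>. The
  frame is a shell of thickness between \<open>2 r\<close> and \<open>4 r\<close>. The balls \<open>D i k\<close>, with centres on a line along \<open>a\<close> and spacing slightly less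
  than \<open>r\<close>, carry the pendant path; \<open>E i\<close> is the neighbourhood of its first \<open>l\<close> points that has to be
  empty otherwise, and \<open>D i l\<close> is within reach of the frame.\<close>

locale tile_geom =
  fixes n :: nat and r \<eta> :: real and l :: nat and a :: "'d::finite"
  assumes d2: "CARD('d) \<ge> 2" and n_pos: "n > 0" and r_pos: "r > 0" and eta: "0 < \<eta>" "\<eta> \<le> 1 / 10" and l_pos: "l \<ge> 1"
    and big: "real n powr (1 / real CARD('d)) \<ge> (real l + 8) * r"
begin

definition L :: real where "L = real n powr (1 / real CARD('d))"
text \<open>Cells per unit of tile width. Since \<open>h j \<le> 2 * r / S\<close>, points in
  neighbouring cells are at distance at most \<open>2 * d * (2 * r / S) = r / 2\<close>.\<close>

definition S :: nat where "S = 8 * CARD('d)"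
text \<open>Tile widths in units whose length lies between \<open>r\<close> and
  \<open>2 * r\<close>: two units of frame on either side and an inner part with room for balls of
  radius \<open>(1 + \<eta>) * r\<close>, longer by \<open>l\<close> units along the chain.\<close>

definition W :: "'d \<Rightarrow> nat" where "W j = (if j = a then l + 8 else 8)"
definition Mt :: "'d \<Rightarrow> nat" where "Mt j = nat \<lfloor>L / (real (W j) * r)\<rfloor>"
definition side :: "'d \<Rightarrow> real" where "side j = L / real (Mt j)"
definition h :: "'d \<Rightarrow> real" where "h j = side j / real (W j * S)"
definition tiles :: "'d cell set" where "tiles = {i. \<forall>j. i j < Mt j}"
definition corner :: "'d cell \<Rightarrow> real^'d" where "corner i = (\<chi> j. - L / 2 + side j * real (i j))"
text \<open>The outermost tiles are unbounded outwards, so that the tiles cover the closed box and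
  remain disjoint.\<close>

definition T :: "'d cell \<Rightarrow> (real^'d) set" where
  "T i = {x. \<forall>j. (i j = 0 \<or> corner i $ j \<le> x $ j) \<and> (Suc (i j) = Mt j \<or> x $ j < corner i $ j + side j)}"
definition up :: "'d \<Rightarrow> nat" where "up j = W j * S - 2 * S"
text \<open>Laid out backwards from the inner face of the frame: \<open>ctr i l\<close> is
  \<open>3 * \<eta> * r\<close> short of it and \<open>ctr i (l - 1)\<close> exactly
  \<open>(1 + \<eta>) * r\<close>, so that \<open>E i\<close> just stops at the frame. The spacing
  \<open>(1 - 2 * \<eta>) * r\<close> keeps points of consecutive balls within \<open>r\<close>, as
  the two radii add up to \<open>\<eta> * r\<close>, and points of other pairs of balls farther
  apart than \<open>r\<close>.\<close>

definition ctr :: "'d cell \<Rightarrow> nat \<Rightarrow> real^'d" where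
  "ctr i k = (\<chi> j. if j = a then corner i $ a + h a * real (up a) - (1 + \<eta>) * r + (real k + 1 - real l) * ((1 - 2 * \<eta>) * r)
     else corner i $ j + h j * real (4 * S))"
text \<open>The radius \<open>(1 + \<eta>) * r\<close> covers the \<open>r\<close>-neighbourhood of
  every possible point of \<open>D i k\<close> for \<open>k < l\<close>.\<close>

definition E :: "'d cell \<Rightarrow> (real^'d) set" where "E i = (\<Union>k<l. ball (ctr i k) ((1 + \<eta>) * r))"
definition D :: "'d cell \<Rightarrow> nat \<Rightarrow> (real^'d) set" where "D i k = ball (ctr i k) (\<eta> * r / 2)"
definition frame :: "'d cell set" where
  "frame = {z. (\<forall>j. z j < W j * S) \<and> \<not> (\<forall>j. 2 * S \<le> z j \<and> z j < up j)}"
definition frame_list :: "'d cell list" where "frame_list = (SOME xs. set xs = frame \<and> distinct xs)"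
definition Zs :: "'d cell \<Rightarrow> (real^'d) set list" where
  "Zs i = map (D i) [0..<Suc l] @ map (rcell (corner i) h) frame_list"

lemma S_pos: "S \<ge> 16" "real S = 8 * real CARD('d)" using d2 by (auto simp: S_def)

lemma W_ge: "8 \<le> W j" "W j \<le> l + 8" by (auto simp: W_def)

text \<open>Rounding the number of tiles down stretches them by a factor of at most 2;
  \<open>big\<close> ensures at least one tile per axis.\<close>

lemma Mt_props: "1 \<le> Mt j" "real (W j) * r \<le> side j" "side j \<le> 2 * real (W j) * r" "side j * real (Mt j) = L"
proof -
  have wr: "real (W j) * r > 0" using W_ge[of j] r_pos by simp
  have "real (W j) * r \<le> (real l + 8) * r" using W_ge(2)[of j] r_pos by (intro mult_right_mono) auto
  hence q: "L / (real (W j) * r) \<ge> 1" using big wr by (simp add: L_def)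
  hence fl: "real (Mt j) \<le> L / (real (W j) * r)" "L / (real (W j) * r) < real (Mt j) + 1" "1 \<le> Mt j"
    unfolding Mt_def by linarith+
  show "1 \<le> Mt j" by (rule fl)
  show "side j * real (Mt j) = L" using fl by (simp add: side_def)
  show "real (W j) * r \<le> side j" using fl wr by (simp add: side_def field_simps)
  have "L / (real (W j) * r) \<le> 2 * real (Mt j)" using fl by linarith
  thus "side j \<le> 2 * real (W j) * r" using wr fl by (simp add: side_def field_simps)
qed

lemma side_pos: "side j > 0"
proof -
  have "0 < real (W j) * r" using W_ge[of j] r_pos by simp
  thus ?thesis using Mt_props(2)[of j] by linarith
qed

lemma h_props: "r \<le> h j * real S" "h j * real S \<le> 2 * r" "h j > 0" "h j * real (W j * S) = side j"
proof -
  have W0: "real (W j) > 0" using W_ge[of j] by simp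
  have S0: "real S > 0" using S_pos by simp
  have hs: "h j * real S = side j / real (W j)" using S0 W0 by (simp add: h_def)
  show "r \<le> h j * real S" "h j * real S \<le> 2 * r" unfolding hs using Mt_props[of j] W0 by (auto simp: field_simps)
  show "h j > 0" unfolding h_def using side_pos[of j] W0 S0 by (intro divide_pos_pos) auto
  show "h j * real (W j * S) = side j" using W0 S0 by (simp add: h_def)
qed

lemma up_W: "real (up j) = real (W j * S) - 2 * real S" "up a = (l + 6) * S" "j \<noteq> a \<Longrightarrow> up j = 6 * S"
proof -
  have "2 * S \<le> W j * S" using W_ge[of j] by (intro mult_right_mono) auto
  thus "real (up j) = real (W j * S) - 2 * real S" by (simp add: up_def of_nat_diff)
  show "up a = (l + 6) * S" by (simp add: up_def W_def algebra_simps)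
  show "j \<noteq> a \<Longrightarrow> up j = 6 * S" by (simp add: up_def W_def)
qed

lemma corner_Lambda:
  assumes "i \<in> tiles" shows "- L / 2 \<le> corner i $ j" "corner i $ j + side j \<le> L / 2"
proof -
  have s0: "side j \<ge> 0" using side_pos[of j] by simp
  show "- L / 2 \<le> corner i $ j" using s0 by (simp add: corner_def)
  have "real (i j) + 1 \<le> real (Mt j)" using assms by (auto simp: tiles_def dest!: spec[of _ j])
  hence "side j * (real (i j) + 1) \<le> side j * real (Mt j)" using s0 by (intro mult_left_mono)
  thus "corner i $ j + side j \<le> L / 2" using Mt_props(4)[of j] by (simp add: corner_def algebra_simps)
qed

lemma box_Lambda:
  assumes "i \<in> tiles" "\<And>j. corner i $ j \<le> x $ j \<and> x $ j \<le> corner i $ j + side j"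
  shows "x \<in> Lambda n"
proof -
  have "\<bar>x $ j\<bar> \<le> L / 2" for j using corner_Lambda[OF assms(1), of j] assms(2)[of j] by linarith
  thus ?thesis by (simp add: Lambda_def L_def)
qed

lemma T_disj:
  assumes "i \<in> tiles" "i' \<in> tiles" "i \<noteq> i'" shows "T i \<inter> T i' = {}"
proof -
  have *: False if "i \<in> tiles" "i' \<in> tiles" "i j < i' j" "x \<in> T i" "x \<in> T i'" for i i' j x
  proof -
    have "Suc (i j) \<noteq> Mt j" "i' j \<noteq> 0" using that by (auto simp: tiles_def dest!: spec[of _ j])
    hence "x $ j < corner i $ j + side j" "corner i' $ j \<le> x $ j" using that by (auto simp: T_def dest!: spec[of _ j])
    moreover have "side j * (real (i j) + 1) \<le> side j * real (i' j)"
      using that(3) side_pos[of j] by (intro mult_left_mono) auto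
    ultimately show False by (simp add: corner_def algebra_simps)
  qed
  obtain j where j: "i j \<noteq> i' j" using assms(3) by auto
  show ?thesis
  proof (rule ccontr)
    assume "T i \<inter> T i' \<noteq> {}"
    then obtain x where "x \<in> T i" "x \<in> T i'" by auto
    thus False using *[of i i' j x] *[of i' i j x] assms j by linarith
  qed
qed

lemma T_cover: "x \<in> Lambda n \<Longrightarrow> \<exists>i\<in>tiles. x \<in> T i"
proof -
  assume x: "x \<in> Lambda n"
  define i where "i j = min (Mt j - 1) (nat \<lfloor>(x $ j + L / 2) / side j\<rfloor>)" for j
  have "(i j = 0 \<or> corner i $ j \<le> x $ j) \<and> (Suc (i j) = Mt j \<or> x $ j < corner i $ j + side j)" for j
  proof -
    have s0: "side j > 0" by (rule side_pos)
    have q: "(x $ j + L / 2) / side j \<ge> 0" using x s0 by (auto simp: Lambda_def L_def abs_le_iff intro!: divide_nonneg_pos dest!: spec[of _ j])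
    let ?f = "nat \<lfloor>(x $ j + L / 2) / side j\<rfloor>"
    have f: "real ?f \<le> (x $ j + L / 2) / side j" "(x $ j + L / 2) / side j < real ?f + 1" using q by linarith+
    have f': "side j * real ?f \<le> x $ j + L / 2" "x $ j + L / 2 < side j * (real ?f + 1)" using f s0 by (simp_all add: field_simps)
    have "side j * real (i j) \<le> side j * real ?f" using s0 by (intro mult_left_mono) (auto simp: i_def)
    hence "corner i $ j \<le> x $ j" using f' by (simp add: corner_def)
    moreover have "Suc (i j) = Mt j \<or> i j = ?f" using Mt_props(1)[of j] by (auto simp: i_def min_def)
    ultimately show ?thesis using f' by (auto simp: corner_def algebra_simps)
  qed
  moreover have "i j < Mt j" for j using Mt_props(1)[of j] by (simp add: i_def min_less_iff_disj)
  hence "i \<in> tiles" by (simp add: tiles_def)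
  ultimately show ?thesis unfolding T_def by blast
qed

text \<open>Orthogonally to the chain the centres sit in the middle of an inner part of half-width
  at least \<open>2 * r\<close>, and \<open>(1 + \<eta>) * r < 2 * r\<close>. Along the chain the
  extra \<open>l\<close> units make room for its length of at most \<open>l * r\<close>.\<close>

lemma inner_E:
  assumes x: "x \<in> E i"
  shows "corner i $ j + h j * real (2 * S) \<le> x $ j" "x $ j < corner i $ j + h j * real (up j)"
proof -
  obtain k where k: "k < l" "dist (ctr i k) x < (1 + \<eta>) * r" using x by (auto simp: E_def)
  have "\<bar>(ctr i k - x) $ j\<bar> \<le> norm (ctr i k - x)" by (rule component_le_norm_cart)
  hence c: "\<bar>ctr i k $ j - x $ j\<bar> < (1 + \<eta>) * r" using k by (simp add: dist_norm)
  have er: "(1 + \<eta>) * r \<le> 2 * r" using eta r_pos by (intro mult_right_mono) auto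
  have hS: "h j * real (2 * S) = 2 * (h j * real S)" by simp
  have "corner i $ j + h j * real (2 * S) \<le> x $ j \<and> x $ j < corner i $ j + h j * real (up j)"
  proof (cases "j = a")
    case False
    have "ctr i k $ j = corner i $ j + 4 * (h j * real S)" using False by (simp add: ctr_def)
    moreover have "h j * real (up j) = 6 * (h j * real S)" using up_W(3)[OF False] by simp
    ultimately show ?thesis using c er h_props(1)[of j] hS by linarith
  next
    case True
    let ?g = "(1 - 2 * \<eta>) * r"
    have g: "0 \<le> ?g" "?g \<le> r" using eta r_pos by (auto simp: mult_left_le_one_le)
    have ck: "ctr i k $ a = corner i $ a + h a * real (up a) - (1 + \<eta>) * r + (real k + 1 - real l) * ?g" by (simp add: ctr_def)
    have "(real k + 1 - real l) * ?g \<le> 0" using k g by (intro mult_nonpos_nonneg) auto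
    moreover have c: "\<bar>ctr i k $ a - x $ a\<bar> < (1 + \<eta>) * r" using c True by simp
    ultimately have u: "x $ a < corner i $ a + h a * real (up a)" using ck by linarith
    have "(real l - 1 - real k) * ?g \<le> real l * r" using g k by (intro mult_mono) auto
    moreover have "(real k + 1 - real l) * ?g = - ((real l - 1 - real k) * ?g)" by (simp add: algebra_simps)
    moreover have "h a * real (up a) = (real l + 6) * (h a * real S)" by (simp add: up_W(2))
    moreover have "(real l + 4) * r \<le> (real l + 4) * (h a * real S)" using h_props(1)[of a] by (intro mult_left_mono) auto
    moreover have "(real l + 4) * r = real l * r + 4 * r" "(real l + 6) * (h a * real S) = (real l + 4) * (h a * real S) + 2 * (h a * real S)"
      by (simp_all add: algebra_simps)
    ultimately have "corner i $ a + h a * real (2 * S) \<le> x $ a" using c ck er hS True by simp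
    thus ?thesis using u True by simp
  qed
  thus "corner i $ j + h j * real (2 * S) \<le> x $ j" "x $ j < corner i $ j + h j * real (up j)" by auto
qed

lemma inner_E_deep:
  assumes "x \<in> E i"
  shows "corner i $ j + 2 * r \<le> x $ j" "x $ j < corner i $ j + side j - 2 * r"
proof -
  have "h j * real (2 * S) \<ge> 2 * r" using h_props(1)[of j] by simp
  moreover have "h j * real (up j) = side j - 2 * (h j * real S)" using h_props(4)[of j] up_W(1)[of j] by (simp add: right_diff_distrib)
  ultimately show "corner i $ j + 2 * r \<le> x $ j" "x $ j < corner i $ j + side j - 2 * r"
    using inner_E[OF assms, of j] h_props(1)[of j] by linarith+
qed

lemma box_T:
  assumes "\<And>j. corner i $ j \<le> x $ j \<and> x $ j < corner i $ j + side j" shows "x \<in> T i"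
  using assms by (auto simp: T_def)

lemma E_sub_T: "E i \<subseteq> T i"
proof
  fix x assume "x \<in> E i"
  thus "x \<in> T i" using inner_E_deep[of x i] r_pos by (intro box_T) (smt (verit, best))
qed

lemma E_deep': "x \<notin> T i \<Longrightarrow> y \<in> E i \<Longrightarrow> dist x y > r"
proof (rule ccontr)
  assume x: "x \<notin> T i" and y: "y \<in> E i" and "\<not> dist x y > r"
  hence "\<bar>x $ j - y $ j\<bar> \<le> r" for j
    using component_le_norm_cart[of "x - y" j] by (simp add: dist_norm)
  hence "corner i $ j \<le> x $ j \<and> x $ j < corner i $ j + side j" for j
    using inner_E_deep[OF y, of j] r_pos by (smt (verit, best))
  thus False using box_T x by blast
qed

lemma rcell_sub:
  assumes z: "\<And>j. z j < W j * S" and x: "x \<in> rcell (corner i) h z"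
  shows "corner i $ j \<le> x $ j \<and> x $ j < corner i $ j + side j"
proof -
  have "h j * (real (z j) + 1) \<le> h j * real (W j * S)"
    using z[of j] h_props(3)[of j] by (intro mult_left_mono) linarith+
  moreover have "0 \<le> h j * real (z j)" using h_props(3)[of j] by simp
  moreover have "corner i $ j + h j * real (z j) \<le> x $ j" "x $ j < corner i $ j + h j * (real (z j) + 1)"
    using x by (auto simp: rcell_def)
  ultimately show ?thesis using h_props(4)[of j] by linarith
qed

lemma frame_E_disjoint:
  assumes "z \<in> frame" shows "rcell (corner i) h z \<inter> E i = {}"
proof (rule ccontr)
  assume "\<not> ?thesis"
  then obtain x where x: "x \<in> rcell (corner i) h z" "x \<in> E i" by auto
  have b: "corner i $ j + h j * real (z j) \<le> x $ j" "x $ j < corner i $ j + h j * (real (z j) + 1)" for j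
    using x by (auto simp: rcell_def)
  have "2 * S \<le> z j \<and> z j < up j" for j
  proof -
    have "h j * real (2 * S) < h j * (real (z j) + 1)" "h j * real (z j) < h j * real (up j)"
      using b[of j] inner_E[OF x(2), of j] by linarith+
    hence "real (2 * S) < real (z j) + 1" "real (z j) < real (up j)"
      using h_props(3)[of j] by (simp_all only: mult_less_cancel_left_pos)
    thus ?thesis by linarith
  qed
  thus False using assms by (auto simp: frame_def)
qed

lemma ctr_dist: "dist (ctr i k) (ctr i k') = \<bar>real k - real k'\<bar> * ((1 - 2 * \<eta>) * r)"
proof -
  have "(1 - 2 * \<eta>) * r \<ge> 0" using eta r_pos by simp
  have "ctr i k - ctr i k' = axis a ((real k - real k') * ((1 - 2 * \<eta>) * r))"
    by (simp add: vec_eq_iff ctr_def axis_def algebra_simps)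
  thus ?thesis using \<open>(1 - 2 * \<eta>) * r \<ge> 0\<close>
    by (simp only: dist_norm norm_axis_real abs_mult[of "real k - real k'"] abs_of_nonneg)
qed

text \<open>For \<open>k = l\<close> there is no ball of \<open>E i\<close> with the same centre;
  \<open>D i l\<close> lies in the ball around \<open>ctr i (l - 1)\<close> instead.\<close>

lemma D_sub_E: "k \<le> l \<Longrightarrow> D i k \<subseteq> E i"
proof
  fix x assume k: "k \<le> l" and x: "x \<in> D i k"
  show "x \<in> E i"
  proof (cases "k < l")
    case True
    have "\<eta> * r / 2 \<le> (1 + \<eta>) * r" using eta r_pos by (simp add: field_simps)
    thus ?thesis using x True by (auto simp: D_def E_def intro!: bexI[of _ k])
  next
    case False
    hence kl: "k = l" using k by simp
    have "real l - real (l - 1) = 1" using l_pos by (simp add: of_nat_diff)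
    hence "dist (ctr i (l - 1)) (ctr i k) = (1 - 2 * \<eta>) * r" unfolding ctr_dist kl by (simp add: abs_minus_commute)
    hence "dist (ctr i (l - 1)) x < (1 - 2 * \<eta>) * r + \<eta> * r / 2"
      using x dist_triangle[of "ctr i (l - 1)" x "ctr i k"] by (simp add: D_def)
    also have "\<dots> \<le> (1 + \<eta>) * r" using eta r_pos by (simp add: field_simps)
    finally show ?thesis using l_pos unfolding E_def by (intro UN_I[of "l - 1"]) auto
  qed
qed

lemma D_disj: "k \<noteq> k' \<Longrightarrow> D i k \<inter> D i k' = {}"
proof (rule ccontr)
  assume kk: "k \<noteq> k'" and "D i k \<inter> D i k' \<noteq> {}"
  then obtain x where "dist (ctr i k) x < \<eta> * r / 2" "dist (ctr i k') x < \<eta> * r / 2" by (auto simp: D_def)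
  hence "dist (ctr i k) (ctr i k') < \<eta> * r" using dist_triangle2[of "ctr i k" "ctr i k'" x] by linarith
  moreover have "1 \<le> \<bar>real k - real k'\<bar>" using kk by linarith
  hence "1 * ((1 - 2 * \<eta>) * r) \<le> \<bar>real k - real k'\<bar> * ((1 - 2 * \<eta>) * r)" using eta r_pos by (intro mult_right_mono) auto
  moreover have "\<eta> * r \<le> (1 - 2 * \<eta>) * r" using eta r_pos by (intro mult_right_mono) auto
  ultimately show False unfolding ctr_dist by linarith
qed

lemma finite_frame: "finite frame"
proof -
  have "frame \<subseteq> grid_box (\<lambda>_. 0) (\<lambda>j. W j * S)" by (auto simp: frame_def grid_box_def less_imp_le)
  thus ?thesis by (rule finite_subset) (rule finite_grid_box)
qed

lemma frame_list: "set frame_list = frame" "distinct frame_list"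
proof -
  have "set frame_list = frame \<and> distinct frame_list"
    unfolding frame_list_def using finite_distinct_list[OF finite_frame] by (rule someI_ex)
  thus "set frame_list = frame" "distinct frame_list" by auto
qed

lemma set_Zs: "set (Zs i) = D i ` {..l} \<union> rcell (corner i) h ` frame"
  unfolding Zs_def by (simp only: set_append set_map set_upt frame_list(1) atLeast0LessThan lessThan_Suc_atMost)

text \<open>The bound is linear in \<open>l\<close> because the tile is long along one axis only.
  The number of cells becomes an exponent in \<open>sparse_cluster_bound\<close>, so a higher power
  of \<open>l\<close> would be too expensive.\<close>

lemma length_Zs: "length (Zs i) \<le> (2 + 9 * 8 ^ CARD('d) * S ^ CARD('d)) * l"
proof -
  have "card frame \<le> card (grid_box (\<lambda>_. 0) (\<lambda>j. W j * S - 1))"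
  proof (intro card_mono finite_grid_box subsetI)
    fix z assume "z \<in> frame"
    hence zW: "z j < W j * S" for j by (simp add: frame_def)
    have "z j \<le> W j * S - 1" for j using zW[of j] by linarith
    thus "z \<in> grid_box (\<lambda>_. 0) (\<lambda>j. W j * S - 1)" by (simp add: grid_box_def)
  qed
  also have "\<dots> = (\<Prod>j\<in>UNIV. W j * S)"
  proof -
    have "W j * S \<ge> 1" for j using W_ge[of j] S_pos by (simp add: Suc_le_eq)
    hence e: "W j * S - 1 - 0 + 1 = W j * S" for j by (metis Suc_diff_1 Suc_eq_plus1 Suc_le_eq One_nat_def minus_nat.diff_0)
    show ?thesis by (subst card_grid_box, simp) (simp only: e)
  qed
  also have "\<dots> = (\<Prod>j\<in>UNIV. W j) * S ^ CARD('d)" by (simp add: prod.distrib)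
  also have "(\<Prod>j\<in>UNIV. W j) = W a * (\<Prod>j\<in>UNIV - {a}. W j)" by (rule prod.remove) auto
  also have "(\<Prod>j\<in>UNIV - {a}. W j) = (\<Prod>j\<in>UNIV - {a}. 8)" by (intro prod.cong) (auto simp: W_def)
  also have "(\<Prod>j\<in>UNIV - {a}. 8 :: nat) = 8 ^ (CARD('d) - 1)" by (simp add: card_Diff_singleton)
  also have "W a * 8 ^ (CARD('d) - 1) \<le> (9 * l) * 8 ^ CARD('d)"
    using l_pos by (intro mult_mono power_increasing) (auto simp: W_def)
  finally have "card frame \<le> 9 * l * 8 ^ CARD('d) * S ^ CARD('d)" by (simp add: mult_right_mono)
  moreover have "length frame_list = card frame" using frame_list distinct_card by metis
  ultimately have "length (Zs i) \<le> Suc l + 9 * l * 8 ^ CARD('d) * S ^ CARD('d)" by (simp add: Zs_def)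
  also have "\<dots> \<le> 2 * l + 9 * l * 8 ^ CARD('d) * S ^ CARD('d)" using l_pos by simp
  also have "\<dots> = (2 + 9 * 8 ^ CARD('d) * S ^ CARD('d)) * l" by (simp add: algebra_simps)
  finally show ?thesis .
qed

lemma Zs_disj: "sorted_wrt (\<lambda>A B. A \<inter> B = {}) (Zs i)"
proof -
  have "sorted_wrt (\<lambda>A B. A \<inter> B = {}) (map (D i) [0..<Suc l])"
    unfolding sorted_wrt_map by (rule sorted_wrt_mono_rel[OF _ sorted_wrt_upt]) (rule D_disj, auto)
  moreover have "sorted_wrt (\<lambda>A B. A \<inter> B = {}) (map (rcell (corner i) h) frame_list)"
    unfolding sorted_wrt_iff_nth_less
  proof (intro allI impI)
    fix k k' assume k: "k < k'" "k' < length (map (rcell (corner i) h) frame_list)"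
    hence "frame_list ! k \<noteq> frame_list ! k'" using frame_list(2) by (auto simp: distinct_conv_nth)
    thus "map (rcell (corner i) h) frame_list ! k \<inter> map (rcell (corner i) h) frame_list ! k' = {}"
      using k rcell_disjoint[OF h_props(3)] by simp
  qed
  moreover have "A \<inter> B = {}" if AB: "A \<in> set (map (D i) [0..<Suc l])" "B \<in> set (map (rcell (corner i) h) frame_list)" for A B
  proof -
    have "A \<in> D i ` {..l}" using AB(1) by (simp only: set_map set_upt atLeast0LessThan lessThan_Suc_atMost)
    then obtain k where "k \<le> l" "A = D i k" by blast
    moreover obtain z where "z \<in> frame" "B = rcell (corner i) h z" using AB(2) by (auto simp: frame_list(1))
    ultimately show ?thesis using D_sub_E[of k i] frame_E_disjoint[of z i] by blast
  qed
  ultimately show ?thesis unfolding Zs_def sorted_wrt_append by blast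
qed

lemma T_borel': "T i \<in> sets borel"
proof -
  have "T i = (\<Inter>j. {x. (i j = 0 \<or> corner i $ j \<le> x $ j) \<and> (Suc (i j) = Mt j \<or> x $ j < corner i $ j + side j)})"
    by (auto simp: T_def)
  also have "\<dots> \<in> sets borel" by measurable
  finally show ?thesis .
qed

lemma finite_tiles: "finite tiles"
proof -
  have "tiles \<subseteq> grid_box (\<lambda>_. 0) Mt" by (auto simp: tiles_def grid_box_def less_imp_le)
  thus ?thesis by (rule finite_subset) (rule finite_grid_box)
qed

lemma tiling: "tiling tiles T E Zs r"
proof
  show "finite tiles" by (rule finite_tiles)
  show "T i \<in> sets borel" for i by (rule T_borel')
  show "E i \<in> sets borel" for i unfolding E_def by auto
  show "Z \<in> sets borel" if "Z \<in> set (Zs i)" for i Z using that unfolding set_Zs by (auto simp: D_def)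
  show "T i \<inter> T j = {}" if "i \<in> tiles" "j \<in> tiles" "i \<noteq> j" for i j by (rule T_disj[OF that])
  show "E i \<subseteq> T i" for i by (rule E_sub_T)
  show "Z \<subseteq> T i" if Z: "Z \<in> set (Zs i)" for i Z
  proof -
    have "rcell (corner i) h z \<subseteq> T i" if "z \<in> frame" for z
    proof
      fix x assume "x \<in> rcell (corner i) h z"
      thus "x \<in> T i" using rcell_sub[of z x i] that by (intro box_T) (auto simp: frame_def)
    qed
    thus ?thesis using Z D_sub_E[of _ i] E_sub_T[of i] unfolding set_Zs by blast
  qed
  show "sorted_wrt (\<lambda>A B. A \<inter> B = {}) (Zs i)" for i by (rule Zs_disj)
  show "Z \<subseteq> E i \<or> Z \<inter> E i = {}" if "Z \<in> set (Zs i)" for i Z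
    using that D_sub_E[of _ i] frame_E_disjoint[of _ i] unfolding set_Zs by blast
  show "dist x y > r" if "x \<notin> T i" "y \<in> E i" for i x y by (rule E_deep'[OF that])
qed

sublocale tiling tiles T E Zs r by (rule tiling)

lemma unif_E: "real n * measure (unif n) (E i) \<le> real l * (ball_vol TYPE('d) * ((1 + \<eta>) * r) ^ CARD('d))"
proof -
  interpret diffuse "unif n :: (real^'d) measure" by (rule diffuse_unif[OF n_pos])
  have "measure (unif n) (E i) \<le> (\<Sum>k<l. measure (unif n) (ball (ctr i k) ((1 + \<eta>) * r)))"
    unfolding E_def by (rule finite_measure_subadditive_finite) (auto simp: sets_U)
  hence "real n * measure (unif n) (E i) \<le> (\<Sum>k<l. real n * measure (unif n) (ball (ctr i k) ((1 + \<eta>) * r)))"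
    by (simp add: mult_left_mono flip: sum_distrib_left)
  also have "\<dots> \<le> (\<Sum>k<l. ball_vol TYPE('d) * ((1 + \<eta>) * r) ^ CARD('d))"
    using eta r_pos by (intro sum_mono unif_ball_le n_pos) auto
  finally show ?thesis by simp
qed

text \<open>Both kinds of cells, the balls \<open>D i k\<close> and the frame cells, contain a ball
  whose radius is the stated multiple of \<open>r\<close>.\<close>

lemma unif_Zs:
  assumes i: "i \<in> tiles" and Z: "Z \<in> set (Zs i)"
  shows "ball_vol TYPE('d) * (min (\<eta> / 2) (1 / (2 * real S)) * r) ^ CARD('d) \<le> real n * measure (unif n) Z"
proof -
  let ?m = "min (\<eta> / 2) (1 / (2 * real S)) * r"
  have m: "0 \<le> ?m" "?m \<le> \<eta> * r / 2" "?m \<le> r / (2 * real S)"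
  proof -
    show "0 \<le> ?m" using eta r_pos by auto
    have "?m \<le> (\<eta> / 2) * r" using r_pos by (intro mult_right_mono) auto
    thus "?m \<le> \<eta> * r / 2" by simp
    have "?m \<le> (1 / (2 * real S)) * r" using r_pos by (intro mult_right_mono) auto
    thus "?m \<le> r / (2 * real S)" by simp
  qed
  consider k where "k \<le> l" "Z = D i k" | z where "z \<in> frame" "Z = rcell (corner i) h z"
    using Z unfolding set_Zs by auto
  thus ?thesis
  proof cases
    case 1
    have "x \<in> Lambda n" if "x \<in> D i k" for x
    proof (rule box_Lambda[OF i])
      fix j
      have "x \<in> E i" using that D_sub_E 1 by blast
      thus "corner i $ j \<le> x $ j \<and> x $ j \<le> corner i $ j + side j" using inner_E_deep[of x i j] r_pos by linarith
    qed
    hence "ball (ctr i k) ?m \<subseteq> D i k \<inter> Lambda n" using m by (auto simp: D_def)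
    thus ?thesis unfolding 1 using m by (intro unif_ge_ball[OF n_pos]) (auto simp: D_def)
  next
    case 2
    have h2: "?m \<le> h j / 2" for j
    proof -
      have "r / real S \<le> h j" using h_props(1)[of j] S_pos by (simp add: field_simps)
      thus ?thesis using m(3) by (simp add: field_simps)
    qed
    have "rcell (corner i) h z \<subseteq> Lambda n"
    proof
      fix x assume x: "x \<in> rcell (corner i) h z"
      show "x \<in> Lambda n"
      proof (rule box_Lambda[OF i])
        fix j
        show "corner i $ j \<le> x $ j \<and> x $ j \<le> corner i $ j + side j"
          using rcell_sub[OF _ x, of j] 2 by (auto simp: frame_def less_imp_le)
      qed
    qed
    thus ?thesis unfolding 2 using m rcell_ball[where \<rho> = ?m and h = h and p = "corner i" and z = z, OF h2]
      by (intro unif_ge_ball[OF n_pos]) auto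
  qed
qed

text \<open>An enclosing ball is precise enough, since the number of points in a tile matters only
  up to powers of \<open>ln n\<close>.\<close>

lemma unif_T:
  assumes i: "i \<in> tiles"
  shows "real n * measure (unif n) (T i) \<le> ball_vol TYPE('d) * (2 * r * (8 * real CARD('d) + real l + 9)) ^ CARD('d)"
proof -
  let ?\<rho> = "2 * r * (8 * real CARD('d) + real l + 9)"
  have sub: "T i \<inter> Lambda n \<subseteq> ball (corner i) ?\<rho>"
  proof
    fix x assume x: "x \<in> T i \<inter> Lambda n"
    have "\<bar>corner i $ j - x $ j\<bar> \<le> 2 * r * real (W j)" for j
    proof -
      have xl: "- L / 2 \<le> x $ j" "x $ j \<le> L / 2" using x by (auto simp: Lambda_def L_def abs_le_iff dest!: spec[of _ j])
      have "corner i $ j \<le> x $ j" using x xl by (auto simp: T_def corner_def dest!: spec[of _ j])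
      moreover have "x $ j \<le> corner i $ j + side j"
      proof (cases "Suc (i j) = Mt j")
        case True
        have "corner i $ j + side j = - L / 2 + side j * real (Suc (i j))" by (simp add: corner_def algebra_simps)
        also have "\<dots> = L / 2" unfolding True using Mt_props(4)[of j] by simp
        finally show ?thesis using xl by simp
      next
        case False
        thus ?thesis using x by (auto simp: T_def less_imp_le dest!: spec[of _ j])
      qed
      ultimately show ?thesis using Mt_props(3)[of j] by (simp add: mult_ac)
    qed
    from dist_le_sum_coords[OF this] have "dist (corner i) x \<le> 2 * r * (\<Sum>j\<in>UNIV. real (W j))" by (simp add: sum_distrib_left)
    also have "(\<Sum>j\<in>UNIV. real (W j)) = real (W a) + (\<Sum>j\<in>UNIV - {a}. real (W j))" by (rule sum.remove) auto
    also have "(\<Sum>j\<in>UNIV - {a}. real (W j)) = (\<Sum>j\<in>UNIV - {a}. 8)" by (intro sum.cong) (auto simp: W_def)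
    also have "(\<Sum>j\<in>UNIV - {a}. 8 :: real) = 8 * (real CARD('d) - 1)" by (simp add: card_Diff_singleton of_nat_diff)
    also have "real (W a) + 8 * (real CARD('d) - 1) = 8 * real CARD('d) + real l" by (simp add: W_def)
    also have "2 * r * (8 * real CARD('d) + real l) < ?\<rho>" using r_pos by (intro mult_strict_left_mono) auto
    finally show "x \<in> ball (corner i) ?\<rho>" by simp
  qed
  have "real n * measure (unif n) (T i) = measure lborel (T i \<inter> Lambda n)" by (rule measure_unif[OF n_pos T_borel'])
  also have "\<dots> \<le> measure lborel (ball (corner i) ?\<rho>)"
    using sub T_borel' emeasure_bounded_finite[OF bounded_ball]
    by (intro measure_mono_fmeasurable) (auto simp: fmeasurable_def)
  also have "\<dots> = ball_vol TYPE('d) * ?\<rho> ^ CARD('d)" using r_pos by (intro measure_ball) auto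
  finally show ?thesis .
qed

text \<open>A planted tile touched by a cluster that is not confined to it carries a pendant path of that
  cluster: the cluster passes through the frame of the tile, whose occupied cells are joined to the
  root \<open>u l\<close>.\<close>

lemma planted_pendant:
  assumes i: "i \<in> tiles" and pl: "planted i \<omega>" and C: "cluster r \<omega> C" and \<Lambda>: "\<omega> \<subseteq> Lambda n"
    and t: "C \<inter> T i \<noteq> {}" "\<not> C \<subseteq> T i"
  shows "\<exists>u. (\<forall>k\<le>l. u k \<in> C \<inter> D i k) \<and> inj_on u {..l} \<and> (\<forall>k<l. dist (u k) (u (Suc k)) \<le> r) \<and>
     (\<forall>k<l. \<forall>y\<in>\<omega>. dist (u k) y \<le> r \<longrightarrow> y = u k \<or> y = u (Suc k) \<or> (k > 0 \<and> y = u (k - 1)))"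
proof -
  have DZ: "D i k \<in> set (Zs i)" "D i k \<subseteq> E i" if "k \<le> l" for k using that D_sub_E by (auto simp: set_Zs)
  have "\<forall>k. \<exists>u. k \<le> l \<longrightarrow> \<omega> \<inter> D i k = {u}"
  proof
    fix k
    have "\<exists>u. \<omega> \<inter> D i k = {u}" if "k \<le> l" using pl DZ[OF that] unfolding planted_def by blast
    thus "\<exists>u. k \<le> l \<longrightarrow> \<omega> \<inter> D i k = {u}" by blast
  qed
  then obtain u where u: "\<And>k. k \<le> l \<Longrightarrow> \<omega> \<inter> D i k = {u k}" by metis
  have uD: "u k \<in> D i k" "u k \<in> \<omega>" if "k \<le> l" for k using u[OF that] by auto
  have ud: "dist (ctr i k) (u k) < \<eta> * r / 2" if "k \<le> l" for k using uD[OF that] by (simp add: D_def)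
  have inj: "inj_on u {..l}"
  proof (rule inj_onI, rule ccontr)
    fix k k' assume "k \<in> {..l}" "k' \<in> {..l}" "u k = u k'" "k \<noteq> k'"
    thus False using uD[of k] uD[of k'] D_disj[of k k' i] by auto
  qed
  have step: "dist (u k) (u (Suc k)) \<le> r" if "k < l" for k
  proof -
    have "dist (ctr i k) (ctr i (Suc k)) = (1 - 2 * \<eta>) * r" unfolding ctr_dist by simp
    moreover have "dist (u k) (u (Suc k)) \<le> dist (u k) (ctr i k) + dist (ctr i k) (ctr i (Suc k)) + dist (ctr i (Suc k)) (u (Suc k))"
      by (rule dist_triangle_via2)
    ultimately have "dist (u k) (u (Suc k)) \<le> (1 - 2 * \<eta>) * r + \<eta> * r"
      using ud[of k] ud[of "Suc k"] that by (simp add: dist_commute)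
    also have "\<dots> \<le> r" using eta r_pos by (simp add: algebra_simps)
    finally show ?thesis .
  qed
  have nbrs: "y = u k \<or> y = u (Suc k) \<or> (k > 0 \<and> y = u (k - 1))" if k: "k < l" and y: "y \<in> \<omega>" "dist (u k) y \<le> r" for k y
  proof -
    have "dist (ctr i k) y < \<eta> * r / 2 + r" using ud[of k] k y dist_triangle[of "ctr i k" y "u k"] by simp
    also have "\<dots> \<le> (1 + \<eta>) * r" using eta r_pos by (simp add: algebra_simps)
    finally have "y \<in> E i" using k by (auto simp: E_def)
    then obtain Z where Z: "Z \<in> set (Zs i)" "Z \<subseteq> E i" "y \<in> Z" using pl y unfolding planted_def by blast
    have "\<exists>k'\<le>l. Z = D i k'"
    proof (rule ccontr)
      assume "\<not> ?thesis"
      then obtain z where "z \<in> frame" "Z = rcell (corner i) h z" using Z(1) unfolding set_Zs by auto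
      thus False using frame_E_disjoint[of z i] Z by blast
    qed
    then obtain k' where k': "k' \<le> l" "Z = D i k'" by auto
    have yu: "y = u k'" using u[OF k'(1)] Z k' y by blast
    \<comment> \<open>Centres at least two places apart are at distance at least
      \<open>2 * (1 - 2 * \<eta>) * r\<close>, which exceeds \<open>r + \<eta> * r\<close> because
      \<open>\<eta> \<le> 1 / 10\<close>.\<close>
    have "\<bar>real k - real k'\<bar> < 2"
    proof (rule ccontr)
      assume "\<not> ?thesis"
      hence "2 * ((1 - 2 * \<eta>) * r) \<le> dist (ctr i k) (ctr i k')"
        unfolding ctr_dist using eta r_pos by (intro mult_right_mono) auto
      also have "\<dots> \<le> dist (ctr i k) (u k) + dist (u k) (u k') + dist (u k') (ctr i k')"
        by (rule dist_triangle_via2)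
      also have "\<dots> < \<eta> * r / 2 + r + \<eta> * r / 2"
        using ud[of k] ud[of k'] k k' y yu by (simp add: dist_commute)
      finally have "(2 - 5 * \<eta>) * r < 1 * r" by (simp add: algebra_simps)
      hence "2 - 5 * \<eta> < 1" using r_pos by (simp only: mult_less_cancel_right_pos)
      thus False using eta by simp
    qed
    hence "k' = k \<or> k' = Suc k \<or> (k > 0 \<and> k' = k - 1)" by linarith
    thus ?thesis using yu by auto
  qed
  have occ: "\<exists>x. x \<in> \<omega> \<inter> rcell (corner i) h z" if "z \<in> frame" for z
  proof -
    have "rcell (corner i) h z \<in> set (Zs i)" using that by (simp add: set_Zs)
    thus ?thesis using pl unfolding planted_def by blast
  qed
  define q where "q z = (SOME x. x \<in> \<omega> \<inter> rcell (corner i) h z)" for z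
  have q: "q z \<in> \<omega>" "q z \<in> rcell (corner i) h z" if "z \<in> frame" for z
    using someI_ex[OF occ[OF that]] by (auto simp: q_def)
  have hH: "0 \<le> h j \<and> h j \<le> 2 * r / real S" for j using h_props[of j] S_pos by (auto simp: field_simps)
  have qnbr: "dist (q z) (q z') \<le> r" if "z \<in> frame" "z' \<in> frame" "nbr z z'" for z z'
  proof -
    have "dist (q z) (q z') \<le> 2 * real CARD('d) * (2 * r / real S)"
      by (rule rcell_nbr_dist[OF q(2) q(2)]) (use that hH in auto)
    also have "\<dots> \<le> r" using r_pos by (simp add: S_pos(2))
    finally show ?thesis .
  qed
  have conn: "grid_conn frame"
    unfolding frame_def using S_pos W_ge by (intro grid_conn_frame[OF d2]) (auto simp: Suc_le_eq intro: less_le_trans[of 0 8])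
  have closed: "y \<in> C" if "x \<in> C" "path_in r \<omega> x y" for x y
    using that(2,1) unfolding path_in_def
  proof (induction rule: rtranclp_induct)
    case (step y z)
    thus ?case using C unfolding cluster_def by blast
  qed simp
  \<comment> \<open>\<open>v\<close> is the point at which a path of the cluster from outside first
    enters the tile.\<close>
  obtain v v' where v: "v \<in> C \<inter> T i" "v' \<in> C - T i" "dist v' v \<le> r"
  proof -
    obtain x y where xy: "x \<in> C - T i" "y \<in> C \<inter> T i" using t by blast
    have "path_in r C x y" using C xy unfolding cluster_def by blast
    from path_enters[OF this xy(1)] xy(2) show ?thesis using that by blast
  qed
  have v\<Lambda>: "v \<in> Lambda n" "v' \<in> Lambda n" using v C \<Lambda> unfolding cluster_def by blast+
  have vj: "corner i $ j \<le> v $ j" "v $ j \<le> corner i $ j + side j" for j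
  proof -
    have xl: "- L / 2 \<le> v $ j" "v $ j \<le> L / 2" using v\<Lambda> by (auto simp: Lambda_def L_def abs_le_iff dest!: spec[of _ j])
    show "corner i $ j \<le> v $ j" using v xl by (auto simp: T_def corner_def dest!: spec[of _ j])
    show "v $ j \<le> corner i $ j + side j"
    proof (cases "Suc (i j) = Mt j")
      case True
      have "corner i $ j + side j = - L / 2 + side j * real (Suc (i j))" by (simp add: corner_def algebra_simps)
      also have "\<dots> = L / 2" unfolding True using Mt_props(4)[of j] by simp
      finally show ?thesis using xl by simp
    next
      case False
      thus ?thesis using v by (auto simp: T_def less_imp_le dest!: spec[of _ j])
    qed
  qed
  define f where "f j = nat \<lfloor>(v $ j - corner i $ j) / h j\<rfloor>" for j
  \<comment> \<open>Clipped to the last cell, since \<open>v\<close> may lie on an upper face of the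
    box, outside all half-open cells.\<close>
  define z where "z j = min (W j * S - 1) (f j)" for j
  have fj: "h j * real (f j) \<le> v $ j - corner i $ j" "v $ j - corner i $ j < h j * (real (f j) + 1)" for j
  proof -
    have "(v $ j - corner i $ j) / h j \<ge> 0" using vj[of j] h_props(3)[of j] by simp
    hence "real (f j) \<le> (v $ j - corner i $ j) / h j" "(v $ j - corner i $ j) / h j < real (f j) + 1"
      unfolding f_def by linarith+
    thus "h j * real (f j) \<le> v $ j - corner i $ j" "v $ j - corner i $ j < h j * (real (f j) + 1)"
      using h_props(3)[of j] by (simp_all add: field_simps)
  qed
  have WS: "W j * S \<ge> 1" for j using W_ge[of j] S_pos by (simp add: Suc_le_eq)
  have zW: "z j < W j * S" for j using WS[of j] unfolding z_def min_less_iff_disj by arith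
  have zv: "h j * real (z j) \<le> v $ j - corner i $ j" "v $ j - corner i $ j \<le> h j * (real (z j) + 1)" for j
  proof -
    have "h j * real (z j) \<le> h j * real (f j)" using h_props(3)[of j] by (intro mult_left_mono) (auto simp: z_def)
    thus "h j * real (z j) \<le> v $ j - corner i $ j" using fj[of j] by linarith
    show "v $ j - corner i $ j \<le> h j * (real (z j) + 1)"
    proof (cases "f j \<le> W j * S - 1")
      case True
      thus ?thesis using fj[of j] by (simp add: z_def)
    next
      case False
      hence "z j = W j * S - 1" by (simp add: z_def)
      hence "z j + 1 = W j * S" using WS[of j] by linarith
      hence "real (z j) + 1 = real (W j * S)" by (metis of_nat_1 of_nat_add)
      thus ?thesis using vj[of j] h_props(4)[of j] by simp
    qed
  qed
  \<comment> \<open>The entry point is within \<open>r\<close> of a point outside the tile, and the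
    frame is at least \<open>2 * r\<close> thick.\<close>
  have zF: "z \<in> frame"
  proof -
    have "\<not> (\<forall>j. corner i $ j \<le> v' $ j \<and> v' $ j < corner i $ j + side j)" using box_T v by blast
    then obtain j where j: "v' $ j < corner i $ j \<or> corner i $ j + side j \<le> v' $ j" by (meson not_less)
    have vv: "\<bar>v' $ j - v $ j\<bar> \<le> r" using v component_le_norm_cart[of "v' - v" j] by (simp add: dist_norm)
    have "\<not> (2 * S \<le> z j \<and> z j < up j)"
    proof
      assume zz: "2 * S \<le> z j \<and> z j < up j"
      have "h j * real (2 * S) \<le> h j * real (z j)" using zz h_props(3)[of j] by (intro mult_left_mono) auto
      hence 1: "corner i $ j + 2 * r \<le> v $ j" using zv(1)[of j] h_props(1)[of j] by simp
      have "h j * (real (z j) + 1) \<le> h j * real (up j)" using zz h_props(3)[of j] by (intro mult_left_mono) auto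
      moreover have "h j * real (up j) = side j - 2 * (h j * real S)" using h_props(4)[of j] up_W(1)[of j] by (simp add: right_diff_distrib)
      ultimately have 2: "v $ j \<le> corner i $ j + side j - 2 * r" using zv(2)[of j] h_props(1)[of j] by linarith
      show False using 1 2 j vv r_pos by linarith
    qed
    thus ?thesis using zW by (auto simp: frame_def)
  qed
  have "dist v (q z) \<le> r"
  proof -
    have "\<bar>v $ j - q z $ j\<bar> \<le> 2 * r / real S" for j
    proof -
      have "corner i $ j + h j * real (z j) \<le> q z $ j" "q z $ j < corner i $ j + h j * (real (z j) + 1)"
        using q(2)[OF zF] by (auto simp: rcell_def)
      hence "\<bar>v $ j - q z $ j\<bar> \<le> h j" using zv[of j] by (simp add: distrib_left abs_le_iff)
      thus ?thesis using hH[of j] by linarith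
    qed
    from dist_le_sum_coords[OF this] have "dist v (q z) \<le> real CARD('d) * (2 * r / real S)" by simp
    also have "\<dots> \<le> r" using r_pos by (simp add: S_pos(2))
    finally show ?thesis .
  qed
  hence qC: "q z \<in> C" using C v q(1)[OF zF] unfolding cluster_def by blast
  \<comment> \<open>The frame cell at which the line of centres leaves the inner part; its lower
    corner is at distance \<open>3 * \<eta> * r\<close> from \<open>ctr i l\<close>.\<close>
  define e where "e j = (if j = a then up a else 4 * S)" for j
  have eF: "e \<in> frame"
  proof -
    have "e j < W j * S" for j
    proof (cases "j = a")
      case True
      have "(l + 6) * S < (l + 8) * S" using S_pos by simp
      thus ?thesis using True by (simp add: e_def up_W(2) W_def)
    next
      case False
      thus ?thesis using S_pos by (simp add: e_def W_def)
    qed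
    moreover have "\<not> e a < up a" by (simp add: e_def)
    ultimately show ?thesis unfolding frame_def by blast
  qed
  have "grid_path frame z e" using conn zF eF by (auto simp: grid_conn_def)
  hence "path_in r \<omega> (q z) (q e)" by (rule grid_path_points) (use q qnbr in auto)
  hence qeC: "q e \<in> C" using closed[OF qC] by blast
  have "dist (q e) (u l) \<le> r"
  proof -
    define P where "P = (\<chi> j. corner i $ j + h j * real (e j))"
    have "\<bar>q e $ j - P $ j\<bar> \<le> 2 * r / real S" for j
    proof -
      have "corner i $ j + h j * real (e j) \<le> q e $ j" "q e $ j < corner i $ j + h j * (real (e j) + 1)"
        using q(2)[OF eF] by (auto simp: rcell_def)
      hence "\<bar>q e $ j - P $ j\<bar> \<le> h j" by (simp add: distrib_left abs_le_iff P_def)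
      thus ?thesis using hH[of j] by linarith
    qed
    from dist_le_sum_coords[OF this] have 1: "dist (q e) P \<le> real CARD('d) * (2 * r / real S)" by simp
    also have "\<dots> = r / 4" by (simp add: S_pos(2))
    finally have 1: "dist (q e) P \<le> r / 4" .
    have "P - ctr i l = axis a (3 * \<eta> * r)"
      by (simp add: vec_eq_iff ctr_def axis_def P_def e_def algebra_simps)
    hence 2: "dist P (ctr i l) = 3 * \<eta> * r" using eta r_pos by (simp add: dist_norm norm_axis_real)
    have "dist (q e) (u l) \<le> dist (q e) P + dist P (ctr i l) + dist (ctr i l) (u l)"
      by (rule dist_triangle_via2)
    also have "\<dots> \<le> r / 4 + 3 * \<eta> * r + \<eta> * r / 2" using 1 2 ud[of l] by simp
    also have "\<dots> = (1 / 4 + 7 / 2 * \<eta>) * r" by (simp add: algebra_simps)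
    also have "\<dots> \<le> 1 * r" using eta r_pos by (intro mult_right_mono) auto
    finally show ?thesis by simp
  qed
  hence ulC: "u l \<in> C" using C qeC uD(2)[of l] unfolding cluster_def by blast
  \<comment> \<open>The chain is absorbed into the cluster from the root towards the tip.\<close>
  have uC: "u (l - m) \<in> C" if "m \<le> l" for m
    using that
  proof (induction m)
    case (Suc m)
    have s: "Suc (l - Suc m) = l - m" using Suc.prems by simp
    have "dist (u (l - Suc m)) (u (l - m)) \<le> r" using step[of "l - Suc m"] Suc.prems s by simp
    moreover have "u (l - m) \<in> C" using Suc by simp
    moreover have "u (l - Suc m) \<in> \<omega>" using uD by simp
    ultimately show ?case using C unfolding cluster_def by (metis dist_commute)
  qed (use ulC in simp)
  have "u k \<in> C" if "k \<le> l" for k using uC[of "l - k"] that by simp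
  thus ?thesis using uD inj step nbrs by blast
qed

end

section \<open>The cover time of the largest component\<close>

context diffuse
begin

lemma set_measurable_card_Int:
  assumes "A \<in> sets borel" shows "set_measurable U (\<lambda>\<omega>. of_nat (card (\<omega> \<inter> A)))"
proof -
  have "set_measurable U (\<lambda>\<omega>. of_nat (card (\<omega> - (- A))))"
    using set_measurable_del[OF set_measurable_card, of "- A"] assms by auto
  thus ?thesis by (simp add: Diff_eq)
qed

lemma pois_int_card_Int:
  assumes A: "A \<in> sets borel" and t: "t \<ge> 0"
  shows "pois_int U t (\<lambda>\<omega>. of_nat (card (\<omega> \<inter> A))) = ennreal (t * measure U A)"
proof -
  have AU: "A \<in> sets U" using A sets_U by simp
  have ind: "(indicator A :: 'a \<Rightarrow> ennreal) \<in> borel_measurable U" using AU by simp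
  have c1: "set_measurable U (\<lambda>_. 1)" by (simp add: set_measurable_def)
  have g: "set_measurable2 U (\<lambda>y _. indicator A y * 1)"
    by (rule set_measurable2_times_fun[OF ind set_measurable2_const[OF c1]])
  have "pois_int U t (\<lambda>\<omega>. of_nat (card (\<omega> \<inter> A))) \<le> pois_int U t (\<lambda>\<omega>. \<Sum>x\<in>\<omega>. indicator A x * 1)"
    by (intro pois_int_mono) (simp add: indicator_def of_bool_def[symmetric] sum_of_bool_eq)
  moreover have "pois_int U t (\<lambda>\<omega>. \<Sum>x\<in>\<omega>. indicator A x * 1) \<le> pois_int U t (\<lambda>\<omega>. of_nat (card (\<omega> \<inter> A)))"
    by (intro pois_int_mono) (simp add: indicator_def of_bool_def[symmetric] sum_of_bool_eq)
  ultimately have "pois_int U t (\<lambda>\<omega>. of_nat (card (\<omega> \<inter> A))) = pois_int U t (\<lambda>\<omega>. \<Sum>x\<in>\<omega>. indicator A x * 1)"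
    by (rule antisym)
  also have "\<dots> = ennreal t * (\<integral>\<^sup>+y. pois_int U t (\<lambda>_. indicator A y * 1) \<partial>U)"
    by (rule pois_int_mecke[OF g t])
  also have "\<dots> = ennreal (t * measure U A)"
    using t AU by (simp add: pois_int_const emeasure_eq_measure ennreal_mult)
  finally show ?thesis .
qed

text \<open>A Poisson variable of mean \<open>m\<close> has second moment \<open>m + m ^ 2\<close>:
  the square is the sum, over the points in \<open>A\<close>, of 1 plus the number of other points
  in \<open>A\<close>, and Mecke's formula applies.\<close>

lemma pois_int_card_Int_square:
  assumes A: "A \<in> sets borel" and t: "t \<ge> 0"
  shows "pois_int U t (\<lambda>\<omega>. of_nat ((card (\<omega> \<inter> A))\<^sup>2)) \<le> ennreal (t * measure U A * (1 + t * measure U A))"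
proof -
  have AU: "A \<in> sets U" using A sets_U by simp
  have ind: "(indicator A :: 'a \<Rightarrow> ennreal) \<in> borel_measurable U" using AU by simp
  have mc: "set_measurable U (\<lambda>\<omega>. of_nat (card (\<omega> \<inter> A)))" by (rule set_measurable_card_Int[OF A])
  have c1: "set_measurable U (\<lambda>_. 1)" by (simp add: set_measurable_def)
  have ms: "set_measurable U (\<lambda>\<omega>. 1 + of_nat (card (\<omega> \<inter> A)))"
    using mc unfolding set_measurable_def by (auto intro!: borel_measurable_add)
  have g: "set_measurable2 U (\<lambda>y \<omega>. indicator A y * (1 + of_nat (card (\<omega> \<inter> A))))"
    by (rule set_measurable2_times_fun[OF ind set_measurable2_const[OF ms]])
  have "pois_int U t (\<lambda>\<omega>. of_nat ((card (\<omega> \<inter> A))\<^sup>2)) \<le> pois_int U t (\<lambda>\<omega>. \<Sum>x\<in>\<omega>. indicator A x * (1 + of_nat (card ((\<omega> - {x}) \<inter> A))))"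
  proof (rule pois_int_mono)
    fix \<omega> :: "'a set" assume fin: "finite \<omega>"
    have "(of_nat ((card (\<omega> \<inter> A))\<^sup>2) :: ennreal) = (\<Sum>x\<in>\<omega> \<inter> A. of_nat (card (\<omega> \<inter> A)))"
      by (simp add: power2_eq_square)
    also have "\<dots> = (\<Sum>x\<in>\<omega> \<inter> A. 1 + of_nat (card ((\<omega> - {x}) \<inter> A)))"
    proof (intro sum.cong refl)
      fix x assume x: "x \<in> \<omega> \<inter> A"
      have "(\<omega> - {x}) \<inter> A = \<omega> \<inter> A - {x}" by auto
      hence "card (\<omega> \<inter> A) = Suc (card ((\<omega> - {x}) \<inter> A))"
        using card_Suc_Diff1[of "\<omega> \<inter> A" x] x fin by simp
      thus "(of_nat (card (\<omega> \<inter> A)) :: ennreal) = 1 + of_nat (card ((\<omega> - {x}) \<inter> A))" by simp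
    qed
    also have "\<dots> = (\<Sum>x\<in>\<omega>. indicator A x * (1 + of_nat (card ((\<omega> - {x}) \<inter> A))))"
      using fin by (simp add: sum.inter_restrict indicator_def if_distrib[of "\<lambda>c. c * _"] cong: if_cong)
    finally show "(of_nat ((card (\<omega> \<inter> A))\<^sup>2) :: ennreal) \<le> (\<Sum>x\<in>\<omega>. indicator A x * (1 + of_nat (card ((\<omega> - {x}) \<inter> A))))" by simp
  qed
  also have "\<dots> = ennreal t * (\<integral>\<^sup>+y. pois_int U t (\<lambda>\<omega>. indicator A y * (1 + of_nat (card (\<omega> \<inter> A)))) \<partial>U)"
    by (rule pois_int_mecke[OF g t])
  also have "\<dots> = ennreal t * (\<integral>\<^sup>+y. indicator A y * ennreal (1 + t * measure U A) \<partial>U)"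
  proof -
    have "pois_int U t (\<lambda>\<omega>. 1 + of_nat (card (\<omega> \<inter> A))) = ennreal (1 + t * measure U A)"
      using t by (simp add: pois_int_add[OF c1 mc] pois_int_const pois_int_card_Int[OF A t] ennreal_plus)
    thus ?thesis by (simp only: pois_int_cmult[OF ms])
  qed
  also have "\<dots> = ennreal t * (ennreal (measure U A) * ennreal (1 + t * measure U A))"
    using ind AU by (simp add: nn_integral_multc emeasure_eq_measure)
  also have "\<dots> = ennreal (t * measure U A * (1 + t * measure U A))" using t by (simp add: ennreal_mult mult.assoc)
  finally show ?thesis .
qed

lemma set_measurable_disj:
  assumes "set_measurable U (\<lambda>\<omega>. of_bool (P \<omega>))" "set_measurable U (\<lambda>\<omega>. of_bool (Q \<omega>))"
  shows "set_measurable U (\<lambda>\<omega>. of_bool (P \<omega> \<or> Q \<omega>))"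
proof -
  have "(of_bool (P \<omega> \<or> Q \<omega>) :: ennreal) = max (of_bool (P \<omega>)) (of_bool (Q \<omega>))" for \<omega> by (simp add: max_def)
  thus ?thesis using assms unfolding set_measurable_def by (auto intro!: borel_measurable_max)
qed

lemma pois_int_disj:
  assumes "set_measurable U (\<lambda>\<omega>. of_bool (P \<omega>))" "set_measurable U (\<lambda>\<omega>. of_bool (Q \<omega>))"
  shows "pois_int U t (\<lambda>\<omega>. of_bool (P \<omega> \<or> Q \<omega>)) \<le> pois_int U t (\<lambda>\<omega>. of_bool (P \<omega>)) + pois_int U t (\<lambda>\<omega>. of_bool (Q \<omega>))"
  unfolding pois_int_add[OF assms, symmetric] by (intro pois_int_mono) auto

lemma pois_int_markov:
  assumes F: "set_measurable U (\<lambda>\<omega>. of_bool (P \<omega>))" and c: "c > 0"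
    and le: "\<And>\<omega>. finite \<omega> \<Longrightarrow> P \<omega> \<Longrightarrow> ennreal c \<le> G \<omega>" and G: "pois_int U t G \<le> ennreal b" and b: "b \<ge> 0"
  shows "pois_int U t (\<lambda>\<omega>. of_bool (P \<omega>)) \<le> ennreal (b / c)"
proof -
  have "ennreal c * pois_int U t (\<lambda>\<omega>. of_bool (P \<omega>)) = pois_int U t (\<lambda>\<omega>. ennreal c * of_bool (P \<omega>))"
    by (rule pois_int_cmult[OF F, symmetric])
  also have "\<dots> \<le> pois_int U t G" using le by (intro pois_int_mono) auto
  also have "\<dots> \<le> ennreal b" by (rule G)
  finally have "ennreal (1 / c) * (ennreal c * pois_int U t (\<lambda>\<omega>. of_bool (P \<omega>))) \<le> ennreal (1 / c) * ennreal b"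
    by (intro mult_left_mono) auto
  thus ?thesis using c b by (simp flip: mult.assoc ennreal_mult)
qed

end

text \<open>Meant for boxes so small that points sharing a box are adjacent. The degree is then
  bounded below by the occupancy of the box, and Cauchy--Schwarz bounds the sum of squared
  occupancies below. The factor 2 allows for the point itself being counted in its box.\<close>

lemma sum_deg_ge:
  fixes \<beta> :: "'v \<Rightarrow> 'b"
  assumes fin: "finite B" and Bs: "finite J" "\<beta> ` B \<subseteq> J"
    and dg: "\<And>x. x \<in> B \<Longrightarrow> real (card {y\<in>B. \<beta> y = \<beta> x}) \<le> 2 * g x"
  shows "(real (card B))\<^sup>2 \<le> 2 * real (card J) * (\<Sum>x\<in>B. g x)"
proof -
  define f where "f b = real (card {y\<in>B. \<beta> y = b})" for b
  have "real (card B) = (\<Sum>x\<in>B. 1)" by simp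
  also have "\<dots> = (\<Sum>b\<in>J. \<Sum>x\<in>{x\<in>B. \<beta> x = b}. 1)" using fin Bs by (intro sum.group[symmetric]) auto
  also have "\<dots> = (\<Sum>b\<in>J. f b)" by (simp add: f_def)
  finally have "(real (card B))\<^sup>2 = (\<Sum>b\<in>J. 1 * f b)\<^sup>2" by simp
  also have "\<dots> \<le> (\<Sum>b\<in>J. 1\<^sup>2) * (\<Sum>b\<in>J. (f b)\<^sup>2)" by (rule Cauchy_Schwarz_ineq_sum)
  finally have cs: "(real (card B))\<^sup>2 \<le> real (card J) * (\<Sum>b\<in>J. (f b)\<^sup>2)" by simp
  have "(\<Sum>b\<in>J. (f b)\<^sup>2) = (\<Sum>b\<in>J. \<Sum>x\<in>{x\<in>B. \<beta> x = b}. real (card {y\<in>B. \<beta> y = \<beta> x}))"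
    by (intro sum.cong refl) (simp add: f_def power2_eq_square)
  also have "\<dots> = (\<Sum>x\<in>B. real (card {y\<in>B. \<beta> y = \<beta> x}))" using fin Bs by (intro sum.group) auto
  also have "\<dots> \<le> (\<Sum>x\<in>B. 2 * g x)" by (intro sum_mono dg)
  finally have "(\<Sum>b\<in>J. (f b)\<^sup>2) \<le> 2 * (\<Sum>x\<in>B. g x)" by (simp only: sum_distrib_left)
  hence "real (card J) * (\<Sum>b\<in>J. (f b)\<^sup>2) \<le> real (card J) * (2 * (\<Sum>x\<in>B. g x))" by (intro mult_left_mono) auto
  thus ?thesis using cs by simp
qed

section \<open>Exceptional events of a tiling and the bound off them\<close>

context tile_geom
begin

text \<open>The expected sum of squares is at most \<open>n * (1 + v)\<close>: in each term one
  factor is at most \<open>1 + v\<close>, and the other factors sum to at most \<open>n\<close> over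
  the disjoint tiles. Markov's inequality follows.\<close>

lemma prob_crowded:
  assumes v: "\<And>i. i \<in> tiles \<Longrightarrow> real n * measure (unif n) (T i) \<le> v" and Y: "Y > 0" and v0: "v \<ge> 0"
  shows "set_measurable (unif n) (\<lambda>\<omega>. of_bool (real n * Y < (\<Sum>i\<in>tiles. (real (card (\<omega> \<inter> T i)))\<^sup>2)))"
    and "pois_int (unif n) (real n) (\<lambda>\<omega>. of_bool (real n * Y < (\<Sum>i\<in>tiles. (real (card (\<omega> \<inter> T i)))\<^sup>2))) \<le> ennreal ((1 + v) / Y)"
proof -
  interpret diffuse "unif n :: (real^'d) measure" by (rule diffuse_unif[OF n_pos])
  let ?P = "\<lambda>\<omega>. real n * Y < (\<Sum>i\<in>tiles. (real (card (\<omega> \<inter> T i)))\<^sup>2)"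
  have "local_prop 0 (T ` tiles) ?P"
    unfolding local_prop_def
  proof (intro allI impI, elim conjE)
    fix \<omega> \<omega>' :: "(real^'d) set" and \<phi>
    assume \<phi>: "bij_betw \<phi> \<omega> \<omega>'" and R: "\<forall>x\<in>\<omega>. \<forall>R\<in>T ` tiles. \<phi> x \<in> R \<longleftrightarrow> x \<in> R" and P: "?P \<omega>"
    have "card (\<omega>' \<inter> T i) = card (\<omega> \<inter> T i)" if "i \<in> tiles" for i
    proof -
      have "\<omega>' \<inter> T i = \<phi> ` (\<omega> \<inter> T i)" using \<phi> R that by (auto simp: bij_betw_def)
      moreover have "inj_on \<phi> (\<omega> \<inter> T i)" using \<phi> by (auto simp: bij_betw_def intro: inj_on_subset)
      ultimately show ?thesis by (simp add: card_image)
    qed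
    thus "?P \<omega>'" using P by simp
  qed
  thus mP: "set_measurable (unif n) (\<lambda>\<omega>. of_bool (?P \<omega>))"
    using finite_tiles T_borel' by (intro set_measurable_local_prop) auto
  let ?G = "\<lambda>\<omega>. \<Sum>i\<in>tiles. of_nat ((card (\<omega> \<inter> T i))\<^sup>2) :: ennreal"
  have mG: "set_measurable (unif n) (\<lambda>\<omega>. of_nat ((card (\<omega> \<inter> T i))\<^sup>2))" for i
    using set_measurable_times[OF set_measurable_card_Int[OF T_borel'] set_measurable_card_Int[OF T_borel'], of i i]
    by (simp add: power2_eq_square)
  have "pois_int (unif n) (real n) ?G = (\<Sum>i\<in>tiles. pois_int (unif n) (real n) (\<lambda>\<omega>. of_nat ((card (\<omega> \<inter> T i))\<^sup>2)))"
    by (rule pois_int_sum[OF finite_tiles mG])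
  also have "\<dots> \<le> (\<Sum>i\<in>tiles. ennreal (real n * measure (unif n) (T i) * (1 + real n * measure (unif n) (T i))))"
    by (intro sum_mono pois_int_card_Int_square T_borel') simp
  also have "\<dots> \<le> (\<Sum>i\<in>tiles. ennreal (real n * measure (unif n) (T i) * (1 + v)))"
    using v by (intro sum_mono ennreal_leI mult_left_mono) auto
  also have "\<dots> = ennreal (\<Sum>i\<in>tiles. real n * measure (unif n) (T i) * (1 + v))"
    using v0 by (intro sum_ennreal) auto
  also have "\<dots> \<le> ennreal (real n * (1 + v))"
  proof (rule ennreal_leI)
    have "(\<Sum>i\<in>tiles. measure (unif n) (T i)) = measure (unif n) (\<Union>i\<in>tiles. T i)"
      using finite_tiles T_borel' T_disj by (intro finite_measure_finite_Union[symmetric]) (auto simp: disjoint_family_on_def)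
    also have "\<dots> \<le> 1" by simp
    finally have "real n * (1 + v) * (\<Sum>i\<in>tiles. measure (unif n) (T i)) \<le> real n * (1 + v) * 1"
      using v0 by (intro mult_left_mono) auto
    thus "(\<Sum>i\<in>tiles. real n * measure (unif n) (T i) * (1 + v)) \<le> real n * (1 + v)"
      by (simp add: sum_distrib_left mult_ac)
  qed
  finally have G: "pois_int (unif n) (real n) ?G \<le> ennreal (real n * (1 + v))" .
  have "pois_int (unif n) (real n) (\<lambda>\<omega>. of_bool (?P \<omega>)) \<le> ennreal (real n * (1 + v) / (real n * Y))"
  proof (rule pois_int_markov[OF mP _ _ G])
    show "real n * Y > 0" using n_pos Y by simp
    fix \<omega> assume "?P \<omega>"
    hence "ennreal (real n * Y) \<le> ennreal (\<Sum>i\<in>tiles. (real (card (\<omega> \<inter> T i)))\<^sup>2)" by (intro ennreal_leI) simp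
    also have "\<dots> = ?G \<omega>" by (simp add: ennreal_of_nat_eq_real_of_nat flip: sum_ennreal)
    finally show "ennreal (real n * Y) \<le> ?G \<omega>" .
  qed (use v0 in auto)
  thus "pois_int (unif n) (real n) (\<lambda>\<omega>. of_bool (?P \<omega>)) \<le> ennreal ((1 + v) / Y)" using n_pos by simp
qed

text \<open>Markov's inequality for the number of tiles that see a sparse cluster. Counting them is
  effective because a large cluster with few planted tiles is seen as sparse from every tile that it
  touches.\<close>

lemma prob_sparse:
  assumes m: "m > 0" and s: "s > 0"
    and z: "z > 0" "z \<le> ball_vol TYPE('d) * (min (\<eta> / 2) (1 / (2 * real S)) * r) ^ CARD('d)"
    and e: "real l * (ball_vol TYPE('d) * ((1 + \<eta>) * r) ^ CARD('d)) \<le> e"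
  shows "set_measurable (unif n) (\<lambda>\<omega>. of_bool (m \<le> real (card {i\<in>tiles. sparse_cluster K s i \<omega>})))"
    and "pois_int (unif n) (real n) (\<lambda>\<omega>. of_bool (m \<le> real (card {i\<in>tiles. sparse_cluster K s i \<omega>}))) \<le>
      ennreal (exp e * (1 + 1 / z) ^ ((2 + 9 * 8 ^ CARD('d) * S ^ CARD('d)) * l) * real (2 * K + 1) * real n / (real s * m))"
proof -
  interpret diffuse "unif n :: (real^'d) measure" by (rule diffuse_unif[OF n_pos])
  interpret diffuse_tiling "unif n :: (real^'d) measure" tiles T E Zs r ..
  let ?P = "\<lambda>\<omega>. m \<le> real (card {i\<in>tiles. sparse_cluster K s i \<omega>})"
  let ?b = "exp e * (1 + 1 / z) ^ ((2 + 9 * 8 ^ CARD('d) * S ^ CARD('d)) * l) * real (2 * K + 1) * real n"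
  have "local_prop r regions ?P"
    unfolding local_prop_def
  proof (intro allI impI)
    fix \<omega> \<omega>' :: "(real^'d) set" and \<phi>
    assume h: "finite \<omega> \<and> bij_betw \<phi> \<omega> \<omega>' \<and> (\<forall>x\<in>\<omega>. \<forall>y\<in>\<omega>. (dist (\<phi> x) (\<phi> y) \<le> r) = (dist x y \<le> r)) \<and>
       (\<forall>x\<in>\<omega>. \<forall>R\<in>regions. (\<phi> x \<in> R) = (x \<in> R)) \<and> ?P \<omega>"
    have "sparse_cluster K s i \<omega>'" if "i \<in> tiles" "sparse_cluster K s i \<omega>" for i
      using local_prop_sparse[OF that(1), of K s, unfolded local_prop_def, rule_format, of \<omega> \<phi> \<omega>'] h that(2) by blast
    hence "card {i\<in>tiles. sparse_cluster K s i \<omega>} \<le> card {i\<in>tiles. sparse_cluster K s i \<omega>'}"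
      using finite_tiles by (intro card_mono) auto
    thus "?P \<omega>'" using h by linarith
  qed
  thus mP: "set_measurable (unif n) (\<lambda>\<omega>. of_bool (?P \<omega>))" by (rule set_measurable_local_prop[OF regions])
  have ms: "set_measurable (unif n) (\<lambda>\<omega>. of_bool (sparse_cluster K s i \<omega>))" if "i \<in> tiles" for i
    by (rule set_measurable_local_prop[OF regions local_prop_sparse[OF that]])
  let ?G = "\<lambda>\<omega>. of_nat s * (\<Sum>i\<in>tiles. of_bool (sparse_cluster K s i \<omega>)) :: ennreal"
  have "pois_int (unif n) (real n) ?G = of_nat s * (\<Sum>i\<in>tiles. pois_int (unif n) (real n) (\<lambda>\<omega>. of_bool (sparse_cluster K s i \<omega>)))"
    by (simp only: pois_int_cmult[OF set_measurable_sum[OF ms]] pois_int_sum[OF finite_tiles ms])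
  also have "\<dots> \<le> ennreal ?b"
  proof (rule sparse_cluster_bound)
    show "z \<le> real n * measure (unif n) Z" if "i \<in> tiles" "Z \<in> set (Zs i)" for i Z
      using unif_Zs[OF that] z(2) by linarith
    show "real n * measure (unif n) (E i) \<le> e" for i using unif_E[of i] e by linarith
    show "length (Zs i) \<le> (2 + 9 * 8 ^ CARD('d) * S ^ CARD('d)) * l" for i by (rule length_Zs)
  qed (use n_pos z in auto)
  finally have G: "pois_int (unif n) (real n) ?G \<le> ennreal ?b" .
  show "pois_int (unif n) (real n) (\<lambda>\<omega>. of_bool (?P \<omega>)) \<le> ennreal (?b / (real s * m))"
  proof (rule pois_int_markov[OF mP _ _ G])
    show "real s * m > 0" using s m by simp
    fix \<omega> assume "?P \<omega>"
    hence "ennreal (real s * m) \<le> ennreal (real s * real (card {i\<in>tiles. sparse_cluster K s i \<omega>}))"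
      by (intro ennreal_leI mult_left_mono) auto
    also have "\<dots> = ?G \<omega>"
      using finite_tiles by (simp add: sum_of_bool_eq Collect_conj_eq ennreal_mult ennreal_of_nat_eq_real_of_nat)
    finally show "ennreal (real s * m) \<le> ?G \<omega>" .
  qed (use z in auto)
qed

text \<open>By Cauchy--Schwarz, a large cluster touches many tiles unless some tiles are crowded.\<close>

lemma many_planted:
  assumes C: "cluster r \<omega> C" and fin: "finite \<omega>" and \<Lambda>: "\<omega> \<subseteq> Lambda n"
    and cC: "c * real n \<le> real (card C)" and c: "c > 0" and Y: "Y > 0"
    and un: "(\<Sum>i\<in>tiles. (real (card (\<omega> \<inter> T i)))\<^sup>2) \<le> real n * Y"
    and s: "real s \<le> c * real n / 2 + 1" and nY: "real n * Y \<le> (c * real n / 2 - 1)\<^sup>2" "c * real n \<ge> 2"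
    and no: "real (card {i\<in>tiles. sparse_cluster K s i \<omega>}) < c\<^sup>2 * real n / Y"
  shows "K < card {i\<in>tiles. planted i \<omega> \<and> C \<inter> T i \<noteq> {}}" and "\<And>i. i \<in> tiles \<Longrightarrow> \<not> C \<subseteq> T i"
proof -
  have C\<omega>: "C \<subseteq> \<omega>" using C unfolding cluster_def by blast
  have finC: "finite C" using C\<omega> fin finite_subset by blast
  \<comment> \<open>No tile holds half of the cluster, so at least \<open>s\<close> of its points
    remain off each tile.\<close>
  have small: "real (card (C \<inter> T i)) \<le> c * real n / 2 - 1" if i: "i \<in> tiles" for i
  proof -
    have "(real (card (C \<inter> T i)))\<^sup>2 \<le> (real (card (\<omega> \<inter> T i)))\<^sup>2"
      using C\<omega> fin by (intro power_mono) (auto intro!: card_mono)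
    also have "\<dots> \<le> (\<Sum>i\<in>tiles. (real (card (\<omega> \<inter> T i)))\<^sup>2)"
      using finite_tiles by (intro member_le_sum[OF i]) auto
    also have "\<dots> \<le> (c * real n / 2 - 1)\<^sup>2" using un nY by linarith
    finally show ?thesis by (rule power2_le_imp_le) (use nY(2) in linarith)
  qed
  show nsub: "\<not> C \<subseteq> T i" if i: "i \<in> tiles" for i
  proof
    assume "C \<subseteq> T i"
    hence "C \<inter> T i = C" by auto
    thus False using small[OF i] cC nY(2) by simp
  qed
  let ?J = "{i\<in>tiles. C \<inter> T i \<noteq> {}}"
  show "K < card {i\<in>tiles. planted i \<omega> \<and> C \<inter> T i \<noteq> {}}"
  proof (rule ccontr)
    assume nK: "\<not> ?thesis"
    have sp: "sparse_cluster K s i \<omega>" if i: "i \<in> ?J" for i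
    proof -
      have "C = (C - T i) \<union> (C \<inter> T i)" by auto
      hence "card C = card (C - T i) + card (C \<inter> T i)" using finC by (metis card_Int_Diff add.commute)
      hence "real s \<le> real (card (C - T i))" using small[of i] i cC s by simp
      thus ?thesis unfolding sparse_cluster_def using C i nK by (intro exI[of _ C]) auto
    qed
    \<comment> \<open>Cauchy--Schwarz over the touched tiles will give
      \<open>(c * n) ^ 2 \<le> card ?J * (n * Y)\<close>; hence at least
      \<open>c ^ 2 * n / Y\<close> tiles are touched and see a sparse cluster, against
      \<open>no\<close>.\<close>
    have "c * real n \<le> (\<Sum>i\<in>?J. 1 * real (card (C \<inter> T i)))"
    proof -
      have "C = (\<Union>i\<in>?J. C \<inter> T i)"
      proof
        show "C \<subseteq> (\<Union>i\<in>?J. C \<inter> T i)"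
        proof
          fix x assume x: "x \<in> C"
          then obtain i where "i \<in> tiles" "x \<in> T i" using T_cover[of x] C\<omega> \<Lambda> by blast
          thus "x \<in> (\<Union>i\<in>?J. C \<inter> T i)" using x by blast
        qed
      qed auto
      hence "card C = card (\<Union>i\<in>?J. C \<inter> T i)" by simp
      also have "\<dots> \<le> (\<Sum>i\<in>?J. card (C \<inter> T i))" using finite_tiles by (intro card_UN_le) auto
      finally have "real (card C) \<le> (\<Sum>i\<in>?J. real (card (C \<inter> T i)))" by (simp flip: of_nat_sum)
      thus ?thesis using cC by simp
    qed
    hence "(c * real n)\<^sup>2 \<le> (\<Sum>i\<in>?J. 1 * real (card (C \<inter> T i)))\<^sup>2" using c by (intro power_mono) auto
    also have "\<dots> \<le> (\<Sum>i\<in>?J. 1\<^sup>2) * (\<Sum>i\<in>?J. (real (card (C \<inter> T i)))\<^sup>2)" by (rule Cauchy_Schwarz_ineq_sum)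
    also have "\<dots> \<le> real (card ?J) * (real n * Y)"
    proof -
      have "(\<Sum>i\<in>?J. (real (card (C \<inter> T i)))\<^sup>2) \<le> (\<Sum>i\<in>?J. (real (card (\<omega> \<inter> T i)))\<^sup>2)"
        using C\<omega> fin by (intro sum_mono power_mono) (auto intro!: card_mono)
      also have "\<dots> \<le> (\<Sum>i\<in>tiles. (real (card (\<omega> \<inter> T i)))\<^sup>2)" using finite_tiles by (intro sum_mono2) auto
      finally have "(\<Sum>i\<in>?J. (real (card (C \<inter> T i)))\<^sup>2) \<le> real n * Y" using un by linarith
      thus ?thesis by (simp add: mult_left_mono)
    qed
    finally have "c\<^sup>2 * real n * real n \<le> real (card ?J) * Y * real n" by (simp add: power2_eq_square mult_ac)
    hence "c\<^sup>2 * real n \<le> real (card ?J) * Y" using n_pos by simp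
    hence "c\<^sup>2 * real n / Y \<le> real (card ?J)" using Y by (simp add: field_simps)
    also have "\<dots> \<le> real (card {i\<in>tiles. sparse_cluster K s i \<omega>})"
      using sp finite_tiles by (auto intro!: card_mono)
    finally show False using no by simp
  qed
qed

text \<open>Transfers the geometric picture to the graph on labels. Planted tiles give pendant paths
  for the walk, and the total degree off one such path is of order \<open>n * r ^ d\<close>, by
  counting in boxes of side \<open>r / d\<close>.\<close>

lemma tau_cov_lower:
  fixes x :: "nat \<Rightarrow> real^'d"
  assumes inj: "inj_on x {..<N}" and \<Lambda>: "x ` {..<N} \<subseteq> Lambda n" and C: "C \<in> geo_components N r x"
    and pl: "K < card {i\<in>tiles. planted i (x ` {..<N}) \<and> (x ` C) \<inter> T i \<noteq> {}}"
    and ns: "\<And>i. i \<in> tiles \<Longrightarrow> \<not> x ` C \<subseteq> T i"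
    and cC: "c * real n \<le> real (card C)" and c: "c > 0" and lc: "real l \<le> c * real n / 2"
  shows "ennreal (real l * ((c * real n / 2)\<^sup>2 * r ^ CARD('d) / (2 * (2 * real CARD('d)) ^ CARD('d) * real n)) * (ln (real (Suc K)) - 1))
     \<le> tau_cov (\<lambda>i j. i \<in> C \<and> j \<in> C \<and> geo_adj r x i j) C"
proof -
  let ?E = "\<lambda>i j. i \<in> C \<and> j \<in> C \<and> geo_adj r x i j" and ?\<omega> = "x ` {..<N}"
  let ?d = "CARD('d)"
  have cl: "cluster r ?\<omega> (x ` C)" and CN: "C \<subseteq> {..<N}" using geo_component_cluster[OF inj C] by auto
  have finC: "finite C" using CN finite_subset by blast
  have injC: "inj_on x C" by (rule inj_on_subset[OF inj CN])
  have path: "?E\<^sup>*\<^sup>* i j" if ij: "i \<in> C" "j \<in> C" for i j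
  proof -
    have "path_in r (x ` C) (x i) (x j)" using cl ij unfolding cluster_def by blast
    hence "\<forall>k\<in>C. x k = x j \<longrightarrow> ?E\<^sup>*\<^sup>* i k"
      unfolding path_in_def
    proof (induction rule: rtranclp_induct)
      case base
      thus ?case using injC ij by (auto simp: inj_on_def)
    next
      case (step y z)
      show ?case
      proof (intro ballI impI)
        fix k assume k: "k \<in> C" "x k = z"
        obtain k' where k': "k' \<in> C" "y = x k'" using step by auto
        hence "?E\<^sup>*\<^sup>* i k'" using step by auto
        moreover have "k = k' \<or> ?E k' k" using k k' step by (auto simp: geo_adj_def)
        ultimately show "?E\<^sup>*\<^sup>* i k" by (auto intro: rtranclp.rtrancl_into_rtrancl)
      qed
    qed
    thus ?thesis using ij by blast
  qed
  interpret walk_graph ?E C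
    by unfold_locales (use finC path in \<open>auto simp: geo_adj_def dist_commute\<close>)
  let ?I = "{i\<in>tiles. planted i ?\<omega> \<and> (x ` C) \<inter> T i \<noteq> {}}"
  define PP where "PP i u \<longleftrightarrow> (\<forall>k\<le>l. u k \<in> x ` C \<inter> D i k) \<and> inj_on u {..l} \<and> (\<forall>k<l. dist (u k) (u (Suc k)) \<le> r) \<and>
     (\<forall>k<l. \<forall>y\<in>?\<omega>. dist (u k) y \<le> r \<longrightarrow> y = u k \<or> y = u (Suc k) \<or> (k > 0 \<and> y = u (k - 1)))" for i and u :: "nat \<Rightarrow> real^'d"
  have "\<forall>i. \<exists>u. i \<in> ?I \<longrightarrow> PP i u"
  proof
    fix i
    show "\<exists>u. i \<in> ?I \<longrightarrow> PP i u"
    proof (cases "i \<in> ?I")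
      case True
      hence "i \<in> tiles" "planted i ?\<omega>" "x ` C \<inter> T i \<noteq> {}" by auto
      from planted_pendant[OF this(1,2) cl \<Lambda> this(3) ns[OF this(1)]] obtain u where "PP i u"
        unfolding PP_def by (rule exE)
      thus ?thesis by blast
    next
      case False
      thus ?thesis by blast
    qed
  qed
  from choice[OF this] obtain u where "\<forall>i. i \<in> ?I \<longrightarrow> PP i (u i)" by (rule exE)
  hence u: "PP i (u i)" if "i \<in> ?I" for i using that by blast
  have uC: "u i k \<in> x ` C" "u i k \<in> D i k" if "i \<in> ?I" "k \<le> l" for i k
    using u[OF that(1)] that(2) unfolding PP_def by blast+
  have uinj: "inj_on (u i) {..l}" if "i \<in> ?I" for i using u[OF that] unfolding PP_def by blast
  have ustep: "dist (u i k) (u i (Suc k)) \<le> r" if "i \<in> ?I" "k < l" for i k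
    using u[OF that(1)] that(2) unfolding PP_def by blast
  have unbr: "y = u i k \<or> y = u i (Suc k) \<or> (k > 0 \<and> y = u i (k - 1))"
    if "i \<in> ?I" "k < l" "y \<in> ?\<omega>" "dist (u i k) y \<le> r" for i k y
    using u[OF that(1)] that(2-4) unfolding PP_def by blast
  define w where "w i k = inv_into C x (u i k)" for i k
  have w: "w i k \<in> C" "x (w i k) = u i k" if "i \<in> ?I" "k \<le> l" for i k
  proof -
    have "u i k \<in> x ` C" by (rule uC(1)[OF that])
    thus "w i k \<in> C" "x (w i k) = u i k" unfolding w_def by (auto intro: inv_into_into f_inv_into_f)
  qed
  have xe: "i = j" if "x i = x j" "i \<in> C" "j \<in> C" for i j using injC that by (auto simp: inj_on_def)
  have pp: "pendant_path l (w i)" if i: "i \<in> ?I" for i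
    unfolding pendant_path_def
  proof (intro conjI allI impI)
    have ui: "inj_on (u i) {..l}" by (rule uinj[OF i])
    show "inj_on (w i) {..l}"
    proof (rule inj_onI)
      fix k k' assume "k \<in> {..l}" "k' \<in> {..l}" "w i k = w i k'"
      moreover from this have "u i k = u i k'" using w(2)[OF i, of k] w(2)[OF i, of k'] by simp
      ultimately show "k = k'" using ui by (auto simp: inj_on_def)
    qed
    show "w i ` {..l} \<subseteq> C" using w(1)[OF i] by auto
    fix k assume k: "k < l"
    have "u i k \<noteq> u i (Suc k)" using ui k unfolding inj_on_def by (metis Suc_leI atMost_iff less_imp_le n_not_Suc_n)
    hence "w i k \<noteq> w i (Suc k)" using w(2)[OF i, of k] w(2)[OF i, of "Suc k"] k by auto
    moreover have "dist (x (w i k)) (x (w i (Suc k))) \<le> r"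
      using ustep[OF i k] w(2)[OF i, of k] w(2)[OF i, of "Suc k"] k by auto
    ultimately have "geo_adj r x (w i k) (w i (Suc k))" by (simp add: geo_adj_def)
    moreover have "w i k \<in> C" "w i (Suc k) \<in> C" using w(1)[OF i, of k] w(1)[OF i, of "Suc k"] k by simp_all
    ultimately show "w i k \<in> C" "w i (Suc k) \<in> C" "geo_adj r x (w i k) (w i (Suc k))" by auto
    fix y assume y: "w i k \<in> C \<and> y \<in> C \<and> geo_adj r x (w i k) y"
    hence "dist (u i k) (x y) \<le> r" "x y \<in> ?\<omega>" using w(2)[OF i, of k] k CN by (auto simp: geo_adj_def)
    hence "x y = u i k \<or> x y = u i (Suc k) \<or> (k > 0 \<and> x y = u i (k - 1))" using unbr[OF i k] by blast
    hence "x y = x (w i k) \<or> x y = x (w i (Suc k)) \<or> (k > 0 \<and> x y = x (w i (k - 1)))"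
      using w(2)[OF i, of k] w(2)[OF i, of "Suc k"] w(2)[OF i, of "k - 1"] k by simp
    hence "y = w i k \<or> y = w i (Suc k) \<or> (k > 0 \<and> y = w i (k - 1))"
      using xe[of y] w(1)[OF i, of k] w(1)[OF i, of "Suc k"] w(1)[OF i, of "k - 1"] k y by auto
    thus "y = w i (Suc k) \<or> 0 < k \<and> y = w i (k - 1)" using y by (auto simp: geo_adj_def)
  qed
  have disj: "w i 0 \<notin> w j ` {..<l}" if ij: "i \<in> ?I" "j \<in> ?I" "i \<noteq> j" for i j
  proof
    assume "w i 0 \<in> w j ` {..<l}"
    then obtain k where k: "k < l" "w i 0 = w j k" by auto
    hence "u i 0 = u j k" using w(2)[OF ij(1), of 0] w(2)[OF ij(2), of k] by simp
    moreover have "u i 0 \<in> D i 0" "u j k \<in> D j k" using uC(2)[OF ij(1), of 0] uC(2)[OF ij(2), of k] k by auto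
    ultimately have "u i 0 \<in> T i \<inter> T j" using D_sub_E[of 0 i] D_sub_E[of k j] E_sub_T k by auto
    thus False using T_disj[of i j] ij by auto
  qed
  let ?Dg = "(c * real n / 2)\<^sup>2 * r ^ ?d / (2 * (2 * real ?d) ^ ?d * real n)"
  have Dg: "?Dg \<le> (\<Sum>v\<in>C - w i ` {..<l}. dg v)" if i: "i \<in> ?I" for i
  proof -
    let ?B = "C - w i ` {..<l}"
    have "card (w i ` {..<l}) \<le> l" using card_image_le[of "{..<l}" "w i"] by simp
    hence "card C - l \<le> card ?B" using diff_card_le_card_Diff[of "w i ` {..<l}" C] by simp
    hence cB: "c * real n / 2 \<le> real (card ?B)" using cC lc by linarith
    \<comment> \<open>The sum of the coordinate differences bounds the distance, so points sharing a
      box of side \<open>r / d\<close> are within \<open>r\<close>.\<close>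
    define q where "q = r / real ?d"
    define \<beta> :: "nat \<Rightarrow> 'd cell" where "\<beta> v = (\<lambda>j. nat \<lfloor>(x v $ j + L / 2) / q\<rfloor>)" for v
    define M where "M = nat \<lfloor>L / q\<rfloor>"
    have rd: "q > 0" using r_pos by (simp add: q_def)
    have xL: "0 \<le> x v $ j + L / 2" "x v $ j + L / 2 \<le> L" if "v \<in> C" for v j
    proof -
      have "x v \<in> Lambda n" using \<Lambda> that CN by blast
      hence "\<bar>x v $ j\<bar> \<le> L / 2" by (simp add: Lambda_def L_def)
      thus "0 \<le> x v $ j + L / 2" "x v $ j + L / 2 \<le> L" by (auto simp: abs_le_iff)
    qed
    have \<beta>J: "\<beta> ` ?B \<subseteq> grid_box (\<lambda>_. 0) (\<lambda>_. M)"
    proof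
      fix b assume "b \<in> \<beta> ` ?B"
      then obtain v where v: "v \<in> C" "b = \<beta> v" by auto
      have "b j \<le> M" for j
        unfolding v(2) \<beta>_def M_def using xL(2)[OF v(1), of j] rd by (intro nat_mono floor_mono divide_right_mono) auto
      thus "b \<in> grid_box (\<lambda>_. 0) (\<lambda>_. M)" by (simp add: grid_box_def)
    qed
    have adj: "v = v' \<or> geo_adj r x v v'" if v: "v \<in> C" "v' \<in> C" "\<beta> v = \<beta> v'" for v v'
    proof -
      have "\<bar>x v $ j - x v' $ j\<bar> \<le> q" for j
      proof -
        let ?p = "(x v $ j + L / 2) / q" and ?q = "(x v' $ j + L / 2) / q"
        have "0 \<le> ?p" "0 \<le> ?q" using xL(1)[OF v(1), of j] xL(1)[OF v(2), of j] rd by auto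
        moreover have "nat \<lfloor>?p\<rfloor> = nat \<lfloor>?q\<rfloor>" using fun_cong[OF v(3), of j] by (simp only: \<beta>_def)
        ultimately have "\<bar>?p - ?q\<bar> \<le> 1" by linarith
        moreover have "?p - ?q = (x v $ j - x v' $ j) / q" by (simp only: diff_divide_distrib[symmetric] add_diff_cancel_right)
        ultimately have "\<bar>x v $ j - x v' $ j\<bar> / q \<le> 1" using rd by (simp add: abs_divide)
        thus ?thesis using rd by (simp only: divide_le_eq_1_pos)
      qed
      from dist_le_sum_coords[OF this] have "dist (x v) (x v') \<le> r" by (simp add: q_def)
      thus ?thesis by (auto simp: geo_adj_def)
    qed
    have "(real (card ?B))\<^sup>2 \<le> 2 * real (card (grid_box (\<lambda>_::'d. 0) (\<lambda>_. M))) * (\<Sum>v\<in>?B. dg v)"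
    proof (rule sum_deg_ge[OF _ finite_grid_box \<beta>J])
      show "finite ?B" using finC by simp
      fix v assume v: "v \<in> ?B"
      have "w i 0 \<in> C" "w i 1 \<in> C" using w(1)[OF i, of 0] w(1)[OF i, of 1] l_pos by simp_all
      moreover have "inj_on (w i) {..l}" using pp[OF i] unfolding pendant_path_def by blast
      hence "w i 0 \<noteq> w i 1" using l_pos inj_onD[of "w i" "{..l}" 0 1] by auto
      ultimately have "w i 0 \<in> C" "w i 1 \<in> C" "w i 0 \<noteq> w i 1" by blast+
      hence "dg v > 0" using deg_pos[of "w i 0" "w i 1" v] v by blast
      hence d1: "deg ?E C v \<ge> 1" by simp
      \<comment> \<open>Besides neighbours of \<open>v\<close> its box contains \<open>v\<close>;
        the degree is positive, so \<open>deg + 1 \<le> 2 * deg\<close>.\<close>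
      have "{y\<in>?B. \<beta> y = \<beta> v} \<subseteq> insert v {y\<in>C. ?E v y}"
      proof
        fix y assume y: "y \<in> {y\<in>?B. \<beta> y = \<beta> v}"
        hence "v = y \<or> geo_adj r x v y" using v by (intro adj) auto
        thus "y \<in> insert v {y\<in>C. ?E v y}" using y v by auto
      qed
      hence "card {y\<in>?B. \<beta> y = \<beta> v} \<le> card (insert v {y\<in>C. ?E v y})" using finC by (intro card_mono) auto
      also have "\<dots> \<le> Suc (deg ?E C v)" unfolding deg_def by (rule card_insert_le_m1) auto
      finally show "real (card {y\<in>?B. \<beta> y = \<beta> v}) \<le> 2 * dg v" using d1 by linarith
    qed
    also have "real (card (grid_box (\<lambda>_::'d. 0) (\<lambda>_. M))) = (real M + 1) ^ ?d" by (subst card_grid_box) (auto simp: add.commute)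
    also have "2 * (real M + 1) ^ ?d * (\<Sum>v\<in>?B. dg v) \<le> 2 * ((2 * real ?d) ^ ?d * real n / r ^ ?d) * (\<Sum>v\<in>?B. dg v)"
    proof (intro mult_right_mono mult_left_mono)
      have Lr: "L \<ge> r"
      proof -
        have "1 * r \<le> (real l + 8) * r" using r_pos by (intro mult_right_mono) auto
        thus ?thesis using big by (simp add: L_def)
      qed
      have q1: "L / q \<ge> 1"
      proof -
        have "q \<le> r / 1" unfolding q_def using r_pos by (intro divide_left_mono) auto
        thus ?thesis using Lr rd by (simp only: le_divide_eq_1_pos)
      qed
      have "real M \<le> L / q" using q1 unfolding M_def by linarith
      hence "real M + 1 \<le> 2 * (L / q)" using q1 by linarith
      hence "(real M + 1) ^ ?d \<le> (2 * (L / q)) ^ ?d" by (intro power_mono) auto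
      also have "\<dots> = (2 * real ?d) ^ ?d * L ^ ?d / r ^ ?d" by (simp add: q_def power_mult_distrib power_divide)
      also have "L ^ ?d = real n" unfolding L_def by (rule side_power[OF n_pos])
      finally show "(real M + 1) ^ ?d \<le> (2 * real ?d) ^ ?d * real n / r ^ ?d" .
    qed (auto intro: sum_nonneg)
    finally have 1: "(real (card ?B))\<^sup>2 \<le> 2 * ((2 * real ?d) ^ ?d * real n / r ^ ?d) * (\<Sum>v\<in>?B. dg v)" .
    have "(c * real n / 2)\<^sup>2 \<le> (real (card ?B))\<^sup>2" using cB c by (intro power_mono) auto
    hence "(c * real n / 2)\<^sup>2 \<le> (\<Sum>v\<in>?B. dg v) * (2 * (2 * real ?d) ^ ?d * real n) / r ^ ?d" using 1 by (simp add: mult_ac)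
    hence "(c * real n / 2)\<^sup>2 * r ^ ?d \<le> (\<Sum>v\<in>?B. dg v) * (2 * (2 * real ?d) ^ ?d * real n)"
      using r_pos by (simp add: field_simps)
    moreover have "2 * (2 * real ?d) ^ ?d * real n > 0" using n_pos by simp
    ultimately show ?thesis by (simp only: pos_divide_le_eq)
  qed
  have D0: "?Dg \<ge> 0" using r_pos by simp
  have finI: "finite ?I" using finite_tiles by simp
  have neI: "?I \<noteq> {}" using pl by (metis card.empty not_less_zero)
  have "ennreal (real l * ?Dg * (ln (real (Suc K)) - 1)) \<le> ennreal (real l * ?Dg * (ln (real (card ?I)) - 1))"
  proof (intro ennreal_leI mult_left_mono diff_right_mono)
    have "real (Suc K) \<le> real (card ?I)" using pl by linarith
    thus "ln (real (Suc K)) \<le> ln (real (card ?I))" by (subst ln_le_cancel_iff) auto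
  qed (rule mult_nonneg_nonneg[OF of_nat_0_le_iff D0])
  also have "\<dots> \<le> tau_cov ?E C"
    by (rule tau_cov_ge_pendant_paths[OF _ finI neI pp disj Dg D0]) (use l_pos in auto)
  finally show ?thesis .
qed

end

text \<open>The opposite direction to \<open>ppp_prob_le\<close>; it brings the hypothesis on the
  giant component into the language of point sets.\<close>

lemma pois_int_le_ppp_prob:
  assumes n: "n > 0"
    and m: "\<And>N. {x \<in> space (PiM {..<N} (\<lambda>_. unif n :: (real^'d::finite) measure)). P N x} \<in> sets (PiM {..<N} (\<lambda>_. unif n))"
    and B: "\<And>N x. inj_on x {..<N} \<Longrightarrow> B (x ` {..<N}) \<Longrightarrow> P N x"
  shows "pois_int (unif n) (real n) (\<lambda>\<omega>. of_bool (B \<omega>)) \<le> ennreal (ppp_prob n P)"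
proof -
  interpret diffuse "unif n :: (real^'d) measure" by (rule diffuse_unif[OF n])
  have "iid_int (unif n) N (\<lambda>\<omega>. of_bool (B \<omega>)) \<le> emeasure (prodU N) {x \<in> space (prodU N). P N x}" for N
  proof -
    have "iid_int (unif n) N (\<lambda>\<omega>. of_bool (B \<omega>)) \<le> (\<integral>\<^sup>+x. indicator {x \<in> space (prodU N). P N x} x \<partial>prodU N)"
      unfolding iid_int_def
    proof (rule nn_integral_mono_AE)
      show "AE x in prodU N. (of_bool (B (x ` {..<N})) :: ennreal) \<le> indicator {x \<in> space (prodU N). P N x} x"
        using AE_inj[of N] AE_space by eventually_elim (auto simp: indicator_def dest: B)
    qed
    thus ?thesis using m by simp
  qed
  thus ?thesis unfolding ppp_emeasure(1)[OF n m] pois_int_def by (intro suminf_le mult_left_mono) auto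
qed

text \<open>Apply the invariance to the inverse bijection.\<close>

lemma local_prop_not:
  assumes Q: "local_prop r \<R> Q" shows "local_prop r \<R> (\<lambda>\<omega>. \<not> Q \<omega>)"
  unfolding local_prop_def
proof (intro allI impI notI, elim conjE)
  fix \<omega> \<omega>' :: "'a set" and \<phi>
  assume \<phi>: "finite \<omega>" "bij_betw \<phi> \<omega> \<omega>'" "\<forall>x\<in>\<omega>. \<forall>y\<in>\<omega>. dist (\<phi> x) (\<phi> y) \<le> r \<longleftrightarrow> dist x y \<le> r"
      "\<forall>x\<in>\<omega>. \<forall>R\<in>\<R>. \<phi> x \<in> R \<longleftrightarrow> x \<in> R"
    and Q': "Q \<omega>'" and nQ: "\<not> Q \<omega>"
  let ?\<psi> = "inv_into \<omega> \<phi>"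
  have "finite \<omega>'" using \<phi>(1,2) bij_betw_finite by blast
  moreover have bj: "bij_betw ?\<psi> \<omega>' \<omega>" by (rule bij_betw_inv_into[OF \<phi>(2)])
  moreover have mem: "?\<psi> x \<in> \<omega>" "\<phi> (?\<psi> x) = x" if "x \<in> \<omega>'" for x
    using that bij_betwE[OF bj] bij_betw_inv_into_right[OF \<phi>(2)] by auto
  have "\<forall>x\<in>\<omega>'. \<forall>y\<in>\<omega>'. dist (?\<psi> x) (?\<psi> y) \<le> r \<longleftrightarrow> dist x y \<le> r" using \<phi>(3) mem by metis
  moreover have "\<forall>x\<in>\<omega>'. \<forall>R\<in>\<R>. ?\<psi> x \<in> R \<longleftrightarrow> x \<in> R" using \<phi>(4) mem by metis
  ultimately have "Q \<omega>" using Q Q' unfolding local_prop_def by blast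
  thus False using nQ by contradiction
qed

section \<open>The exceptional event for one value of \<open>n\<close>\<close>

context tile_geom
begin

text \<open>\<open>B\<close> is a union of three events: no large cluster at radius
  \<open>r1\<close>, crowded tiles, and too many tiles that see a sparse cluster. A cluster at
  radius \<open>r1\<close> lies in a component at radius \<open>r\<close>, so off \<open>B\<close>
  the largest component has linear size and \<open>many_planted\<close> applies to it.\<close>

lemma bad_event:
  assumes r1: "r1 \<le> r" and c: "c > 0"
    and b1: "ppp_prob n (\<lambda>N (x :: nat \<Rightarrow> real^'d). \<not> (\<exists>C\<in>geo_components N r1 x. real (card C) \<ge> c * real n)) \<le> b1"
    and v: "ball_vol TYPE('d) * (2 * r * (8 * real CARD('d) + real l + 9)) ^ CARD('d) \<le> v" and Y: "Y > 0"
    and s: "s > 0" "real s \<le> c * real n / 2 + 1"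
    and nY: "real n * Y \<le> (c * real n / 2 - 1)\<^sup>2" "c * real n \<ge> 2" and lc: "real l \<le> c * real n / 2"
    and z: "z > 0" "z \<le> ball_vol TYPE('d) * (min (\<eta> / 2) (1 / (2 * (8 * real CARD('d)))) * r) ^ CARD('d)"
    and e: "real l * (ball_vol TYPE('d) * ((1 + \<eta>) * r) ^ CARD('d)) \<le> e"
  shows "\<exists>B. set_measurable (unif n) (\<lambda>\<omega>. of_bool (B \<omega>)) \<and>
    pois_int (unif n) (real n) (\<lambda>\<omega>. of_bool (B \<omega>)) \<le> ennreal (b1 + ((1 + v) / Y +
      exp e * (1 + 1 / z) ^ ((2 + 9 * 8 ^ CARD('d) * (8 * CARD('d)) ^ CARD('d)) * l) * real (2 * K + 1) * real n / (real s * (c\<^sup>2 * real n / Y)))) \<and>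
    (\<forall>N (x :: nat \<Rightarrow> real^'d) C. inj_on x {..<N} \<longrightarrow> x ` {..<N} \<subseteq> Lambda n \<longrightarrow> \<not> B (x ` {..<N}) \<longrightarrow> is_largest_component N r x C \<longrightarrow>
      ennreal (real l * ((c * real n / 2)\<^sup>2 * r ^ CARD('d) / (2 * (2 * real CARD('d)) ^ CARD('d) * real n)) * (ln (real (Suc K)) - 1))
      \<le> tau_cov (\<lambda>i j. i \<in> C \<and> j \<in> C \<and> geo_adj r x i j) C)"
proof -
  interpret diffuse "unif n :: (real^'d) measure" by (rule diffuse_unif[OF n_pos])
  let ?m = "c\<^sup>2 * real n / Y"
  define B1 where "B1 \<omega> \<longleftrightarrow> \<not> (\<exists>C. cluster r1 \<omega> C \<and> c * real n \<le> real (card C))" for \<omega> :: "(real^'d) set"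
  define B2 where "B2 \<omega> \<longleftrightarrow> real n * Y < (\<Sum>i\<in>tiles. (real (card (\<omega> \<inter> T i)))\<^sup>2)" for \<omega> :: "(real^'d) set"
  define B3 where "B3 \<omega> \<longleftrightarrow> ?m \<le> real (card {i\<in>tiles. sparse_cluster K s i \<omega>})" for \<omega> :: "(real^'d) set"
  have v0: "v \<ge> 0" using v r_pos ball_vol_pos[where 'd = 'd] by (intro order_trans[OF _ v]) auto
  have m0: "?m > 0" using c n_pos Y by simp
  have S': "real S = 8 * real CARD('d)" by (simp add: S_def)
  have m1: "set_measurable (unif n) (\<lambda>\<omega>. of_bool (B1 \<omega>))"
    unfolding B1_def
  proof (rule set_measurable_local_prop[of "{}"])
    show "local_prop r1 {} (\<lambda>\<omega> :: (real^'d) set. \<not> (\<exists>C. cluster r1 \<omega> C \<and> c * real n \<le> real (card C)))"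
      by (rule local_prop_not[OF local_prop_big_cluster])
  qed auto
  let ?P = "\<lambda>N (x :: nat \<Rightarrow> real^'d). \<not> (\<exists>C\<in>geo_components N r1 x. real (card C) \<ge> c * real n)"
  have mP: "{x \<in> space (prodU N). ?P N x} \<in> sets (prodU N)" for N
  proof -
    have "{x \<in> space (prodU N). ?P N x} = space (prodU N) - {x \<in> space (prodU N). \<exists>C\<in>geo_components N r1 x. c * real n \<le> real (card C)}"
      by auto
    thus ?thesis by (simp only:) (intro sets.Diff sets.top giant_event_sets[OF n_pos])
  qed
  have p1: "pois_int (unif n) (real n) (\<lambda>\<omega>. of_bool (B1 \<omega>)) \<le> ennreal b1"
  proof -
    have "pois_int (unif n) (real n) (\<lambda>\<omega>. of_bool (B1 \<omega>)) \<le> ennreal (ppp_prob n ?P)"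
    proof (rule pois_int_le_ppp_prob[OF n_pos mP])
      fix N and x :: "nat \<Rightarrow> real^'d" assume inj: "inj_on x {..<N}" and B: "B1 (x ` {..<N})"
      show "?P N x"
      proof
        assume "\<exists>C\<in>geo_components N r1 x. c * real n \<le> real (card C)"
        then obtain C where C: "C \<in> geo_components N r1 x" "c * real n \<le> real (card C)" by blast
        have "card (x ` C) = card C"
          by (rule card_image, rule inj_on_subset[OF inj geo_component_cluster(2)[OF inj C(1)]])
        thus False using B geo_component_cluster(1)[OF inj C(1)] C(2) unfolding B1_def by metis
      qed
    qed
    thus ?thesis using b1 by (meson ennreal_leI order_trans)
  qed
  have vT: "real n * measure (unif n) (T i) \<le> v" if "i \<in> tiles" for i using unif_T[OF that] v by linarith
  have m2: "set_measurable (unif n) (\<lambda>\<omega>. of_bool (B2 \<omega>))"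
    and p2: "pois_int (unif n) (real n) (\<lambda>\<omega>. of_bool (B2 \<omega>)) \<le> ennreal ((1 + v) / Y)"
    unfolding B2_def using prob_crowded[OF vT Y v0] by blast+
  let ?b3 = "exp e * (1 + 1 / z) ^ ((2 + 9 * 8 ^ CARD('d) * S ^ CARD('d)) * l) * real (2 * K + 1) * real n / (real s * ?m)"
  have m3: "set_measurable (unif n) (\<lambda>\<omega>. of_bool (B3 \<omega>))"
    and p3: "pois_int (unif n) (real n) (\<lambda>\<omega>. of_bool (B3 \<omega>)) \<le> ennreal ?b3"
    unfolding B3_def using prob_sparse[OF m0 s(1) z(1) z(2)[folded S'] e] by blast+
  let ?B = "\<lambda>\<omega>. B1 \<omega> \<or> B2 \<omega> \<or> B3 \<omega>"
  have m23: "set_measurable (unif n) (\<lambda>\<omega>. of_bool (B2 \<omega> \<or> B3 \<omega>))" by (rule set_measurable_disj[OF m2 m3])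
  have mB: "set_measurable (unif n) (\<lambda>\<omega>. of_bool (?B \<omega>))" by (rule set_measurable_disj[OF m1 m23])
  have b10: "b1 \<ge> 0"
  proof -
    have "ppp_prob n (\<lambda>N (x :: nat \<Rightarrow> real^'d). \<not> (\<exists>C\<in>geo_components N r1 x. real (card C) \<ge> c * real n)) \<ge> 0"
      by (rule ppp_emeasure(2)[OF n_pos mP])
    thus ?thesis using b1 by linarith
  qed
  have "pois_int (unif n) (real n) (\<lambda>\<omega>. of_bool (?B \<omega>)) \<le> ennreal b1 + (ennreal ((1 + v) / Y) + ennreal ?b3)"
    using pois_int_disj[OF m1 m23, of "real n"] pois_int_disj[OF m2 m3, of "real n"] p1 p2 p3
    by (meson add_mono order_trans)
  also have "\<dots> = ennreal (b1 + ((1 + v) / Y + ?b3))"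
    using b10 v0 Y s c z by (simp add: ennreal_plus del: of_nat_add)
  finally have pB: "pois_int (unif n) (real n) (\<lambda>\<omega>. of_bool (?B \<omega>)) \<le> ennreal (b1 + ((1 + v) / Y + ?b3))" .
  have tau: "ennreal (real l * ((c * real n / 2)\<^sup>2 * r ^ CARD('d) / (2 * (2 * real CARD('d)) ^ CARD('d) * real n)) * (ln (real (Suc K)) - 1))
      \<le> tau_cov (\<lambda>i j. i \<in> C \<and> j \<in> C \<and> geo_adj r x i j) C"
    if inj: "inj_on x {..<N}" and \<Lambda>: "x ` {..<N} \<subseteq> Lambda n" and nB: "\<not> ?B (x ` {..<N})" and lg: "is_largest_component N r x C"
    for N and x :: "nat \<Rightarrow> real^'d" and C
  proof -
    have C: "C \<in> geo_components N r x" and mx: "\<And>C'. C' \<in> geo_components N r x \<Longrightarrow> card C' \<le> card C"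
      using lg by (auto simp: is_largest_component_def)
    obtain D' where D': "cluster r1 (x ` {..<N}) D'" "c * real n \<le> real (card D')" using nB unfolding B1_def by blast
    obtain C' where "C' \<in> geo_components N r x" "card D' \<le> card C'" using cluster_le_component[OF inj D'(1) r1] by blast
    hence cC: "c * real n \<le> real (card C)" using D'(2) mx[of C'] by linarith
    have cl: "cluster r (x ` {..<N}) (x ` C)" and CN: "C \<subseteq> {..<N}" using geo_component_cluster[OF inj C] by auto
    have "card (x ` C) = card C" by (rule card_image, rule inj_on_subset[OF inj CN])
    hence cxC: "c * real n \<le> real (card (x ` C))" using cC by simp
    have un: "(\<Sum>i\<in>tiles. (real (card (x ` {..<N} \<inter> T i)))\<^sup>2) \<le> real n * Y" using nB unfolding B2_def by linarith
    have no: "real (card {i\<in>tiles. sparse_cluster K s i (x ` {..<N})}) < ?m" using nB unfolding B3_def by linarith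
    have fin: "finite (x ` {..<N})" by simp
    note mp = many_planted[OF cl fin \<Lambda> cxC c Y un s(2) nY no]
    show ?thesis by (rule tau_cov_lower[OF inj \<Lambda> C mp cC c lc])
  qed
  show ?thesis
    by (intro exI[of _ ?B] conjI mB pB[unfolded S_def] allI impI) (rule tau)
qed

end

text \<open>The event depends on \<open>x\<close> through the adjacency pattern alone.\<close>

lemma largest_component_event_sets:
  assumes n: "n > 0"
  shows "{x \<in> space (PiM {..<N} (\<lambda>_. unif n :: (real^'d::finite) measure)). \<forall>C. is_largest_component N r x C \<longrightarrow>
      b \<le> tau_cov (\<lambda>i j. i \<in> C \<and> j \<in> C \<and> geo_adj r x i j) C} \<in> sets (PiM {..<N} (\<lambda>_. unif n))"
proof -
  interpret diffuse "unif n :: (real^'d) measure" by (rule diffuse_unif[OF n])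
  show ?thesis
  proof (rule sets_label_pattern[of "{}" N r])
    fix x x' :: "nat \<Rightarrow> real^'d"
    assume pat: "\<And>i j. i < N \<Longrightarrow> j < N \<Longrightarrow> dist (x i) (x j) \<le> r \<longleftrightarrow> dist (x' i) (x' j) \<le> r"
      and P: "\<forall>C. is_largest_component N r x C \<longrightarrow> b \<le> tau_cov (\<lambda>i j. i \<in> C \<and> j \<in> C \<and> geo_adj r x i j) C"
    have geq: "geo_components N r x = geo_components N r x'" by (rule geo_components_cong[OF pat])
    show "\<forall>C. is_largest_component N r x' C \<longrightarrow> b \<le> tau_cov (\<lambda>i j. i \<in> C \<and> j \<in> C \<and> geo_adj r x' i j) C"
    proof (intro allI impI)
      fix C assume C': "is_largest_component N r x' C"
      hence C: "is_largest_component N r x C" unfolding is_largest_component_def geq .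
      have "C \<subseteq> {..<N}" using C' by (auto simp: is_largest_component_def geo_components_def geo_component_def)
      hence "(\<lambda>i j. i \<in> C \<and> j \<in> C \<and> geo_adj r x i j) = (\<lambda>i j. i \<in> C \<and> j \<in> C \<and> geo_adj r x' i j)"
        using pat by (auto simp: fun_eq_iff geo_adj_def)
      thus "b \<le> tau_cov (\<lambda>i j. i \<in> C \<and> j \<in> C \<and> geo_adj r x' i j) C" using P[rule_format, OF C] by simp
    qed
  qed auto
qed

text \<open>Choice of the parameters. All constants, in particular \<open>\<delta>\<close>, are
  fixed before \<open>r\<close>; the radius \<open>r1\<close> serves as a lower bound for
  \<open>r n\<close> in estimates with a power of \<open>r\<close> in the denominator.\<close>

lemma aas_cover_time_lower:
  fixes c r1 \<epsilon> :: real
  assumes d2: "CARD('d::finite) \<ge> 2" and \<epsilon>: "0 < \<epsilon>" "\<epsilon> < 1" and r1: "r1 > 0" and c: "c > 0"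
    and giant: "aas (\<lambda>n N (x :: nat \<Rightarrow> real^'d). \<exists>C\<in>geo_components N r1 x. real (card C) \<ge> c * real n)"
  shows "\<exists>\<delta>>0. \<forall>r. (\<forall>\<^sub>F n in sequentially. r1 \<le> r n \<and> r n \<le> (1 - \<epsilon>) * r_c TYPE('d) n) \<longrightarrow>
    aas (\<lambda>n N (x :: nat \<Rightarrow> real^'d). \<forall>C. is_largest_component N (r n) x C \<longrightarrow>
      tau_cov (\<lambda>i j. i \<in> C \<and> j \<in> C \<and> geo_adj (r n) x i j) C \<ge> ennreal (\<delta> * real n * (ln (real n))\<^sup>2))"
proof -
  let ?d = "CARD('d)" and ?V = "ball_vol TYPE('d)"
  have V: "?V > 0" by (rule ball_vol_pos)
  define \<eta> where "\<eta> = min \<epsilon> (1 / 10)"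
  have \<eta>: "0 < \<eta>" "\<eta> \<le> 1 / 10" "\<eta> \<le> \<epsilon>" using \<epsilon> by (auto simp: \<eta>_def)
  \<comment> \<open>The exponent for emptying one ball: at \<open>r = (1 - \<epsilon>) * r_c\<close>
    the ball of radius \<open>(1 + \<eta>) * r\<close> has volume \<open>\<alpha> * ln n\<close>.
    The choice \<open>\<eta> \<le> \<epsilon>\<close> gives
    \<open>\<alpha> \<le> (1 - \<epsilon> ^ 2) ^ d\<close>.\<close>
  define \<alpha> where "\<alpha> = ((1 + \<eta>) * (1 - \<epsilon>)) ^ ?d"
  have \<alpha>: "0 < \<alpha>" "\<alpha> < 1"
  proof -
    have 0: "0 < (1 + \<eta>) * (1 - \<epsilon>)" using \<eta> \<epsilon> by simp
    have "(1 + \<eta>) * (1 - \<epsilon>) \<le> (1 + \<epsilon>) * (1 - \<epsilon>)" using \<eta> \<epsilon> by (intro mult_right_mono) auto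
    also have "\<dots> < 1" using \<epsilon> by (simp add: algebra_simps)
    finally have "(1 + \<eta>) * (1 - \<epsilon>) < 1" .
    thus "0 < \<alpha>" "\<alpha> < 1" using 0 by (auto simp: \<alpha>_def power_less_one_iff)
  qed
  define \<zeta> where "\<zeta> = min (\<eta> / 2) (1 / (2 * (8 * real ?d)))"
  have \<zeta>: "\<zeta> > 0" using \<eta> by (simp add: \<zeta>_def)
  define z where "z = ?V * (\<zeta> * r1) ^ ?d"
  have z: "z > 0" using V \<zeta> r1 by (simp add: z_def)
  define \<kappa> where "\<kappa> = 2 + 9 * 8 ^ ?d * (8 * ?d) ^ ?d"
  define lam where "lam = ln (1 + 1 / z)"
  have lam: "lam > 0" using z unfolding lam_def by (intro ln_gt_zero) simp
  \<comment> \<open>Each unit of \<open>\<delta>'\<close> adds at most \<open>B\<close> to the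
    exponent of \<open>n\<close>: the first term for emptying, the second for filling. Then
    \<open>\<delta>'\<close> is chosen so that \<open>\<alpha> + \<delta>' * B = \<theta>\<close>,
    the midpoint of \<open>\<alpha>\<close> and 1.\<close>
  define B where "B = (1 + \<eta>) ^ ?d * ?V + real \<kappa> * lam / r1 ^ ?d"
  have B: "B > 0" using \<eta> V lam r1 by (auto simp: B_def intro!: add_pos_nonneg)
  define \<delta>' where "\<delta>' = (1 - \<alpha>) / (2 * B)"
  have \<delta>': "\<delta>' > 0" using \<alpha> B by (simp add: \<delta>'_def)
  define \<theta> where "\<theta> = (1 + \<alpha>) / 2"
  \<comment> \<open>The slack \<open>1 - \<theta> = 3 * q\<close> is shared: \<open>n ^ q\<close>
    for \<open>K\<close>, \<open>n ^ q\<close> for the crowding threshold \<open>Y\<close>, and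
    \<open>n ^ q\<close> for the decay of the probability.\<close>
  define q where "q = (1 - \<theta>) / 3"
  have q: "0 < q" "q < 1" using \<alpha> by (auto simp: q_def \<theta>_def field_simps)
  define b where "b = \<delta>' / r1 ^ ?d"
  have b: "b > 0" using \<delta>' r1 by (simp add: b_def)
  \<comment> \<open>Bounds the mean number of points in a tile, from \<open>r \<le> ln n / V\<close>
    and \<open>l \<le> 1 + b * ln n\<close>. It is polylogarithmic in \<open>n\<close>.\<close>
  define v where "v n = ?V * (2 / ?V * ln (real n) * ((8 * real ?d + 10) + b * ln (real n))) ^ ?d" for n
  have v0: "v n \<ge> 0" for n using V b by (cases "n = 0") (auto simp: v_def intro!: mult_nonneg_nonneg add_nonneg_nonneg)
  \<comment> \<open>Makes the bound \<open>(1 + v) / Y\<close> for the probability of crowding equal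
    to \<open>1 / ln n\<close>.\<close>
  define Y where "Y n = ln (real n) * (1 + v n)" for n
  define M where "M = 2 * exp (real \<kappa> * lam) / c ^ 3"
  have M: "M > 0" using c by (simp add: M_def)
  define \<delta> where "\<delta> = \<delta>' * (c\<^sup>2 / (8 * (2 * real ?d) ^ ?d)) * (q / 2)"
  have \<delta>: "\<delta> > 0" using \<delta>' c q by (simp add: \<delta>_def)
  let ?P = "\<lambda>n N (x :: nat \<Rightarrow> real^'d). \<exists>C\<in>geo_components N r1 x. real (card C) \<ge> c * real n"
  define b1 where "b1 n = \<bar>1 - ppp_prob n (?P n)\<bar>" for n
  have "(\<lambda>n. ppp_prob n (?P n)) \<longlonglongrightarrow> 1" using giant by (simp add: aas_def)
  hence "(\<lambda>n. \<bar>1 - ppp_prob n (?P n)\<bar>) \<longlonglongrightarrow> \<bar>1 - 1\<bar>" by (intro tendsto_intros)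
  hence b1_lim: "b1 \<longlonglongrightarrow> 0" by (simp add: b1_def[abs_def])
  define bb where "bb n = b1 n + (1 / ln (real n) + M * (2 * real n powr q + 1) * real n powr q * real n powr (-3 * q))" for n
  have "(\<lambda>n. 1 / ln (real n) + M * (2 * real n powr q + 1) * real n powr q * real n powr (-3 * q)) \<longlonglongrightarrow> 0"
    using q(1) M by real_asymp
  from tendsto_add[OF b1_lim this] have bb_lim: "bb \<longlonglongrightarrow> 0" by (simp add: bb_def[abs_def])
  have bb0: "bb n \<ge> 0" for n using M by (cases "n = 0") (auto simp: bb_def b1_def intro!: add_nonneg_nonneg)
  have Y_le: "\<forall>\<^sub>F n in sequentially. Y n \<le> real n powr q"
  proof -
    have "q / 3 / real ?d > 0" "2 / ?V > 0" "8 * real ?d + 10 > 0" using q V by auto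
    hence 1: "\<forall>\<^sub>F n in sequentially. 2 / ?V * ln (real n) * ((8 * real ?d + 10) + b * ln (real n)) \<le> real n powr (q / 3 / real ?d)"
      using b by real_asymp
    have 2: "\<forall>\<^sub>F n in sequentially. ln (real n) * (1 + ?V * real n powr (q / 3)) \<le> real n powr q"
      using q(1) V by real_asymp
    show ?thesis
      using 1 2 eventually_gt_at_top[of 0]
    proof eventually_elim
      case (elim n)
      have ln0: "ln (real n) \<ge> 0" using elim by simp
      have "(2 / ?V * ln (real n) * ((8 * real ?d + 10) + b * ln (real n))) ^ ?d \<le> (real n powr (q / 3 / real ?d)) ^ ?d"
        using elim ln0 V b by (intro power_mono) (auto intro!: mult_nonneg_nonneg add_nonneg_nonneg)
      also have "\<dots> = real n powr (q / 3)" using elim by (simp add: powr_realpow[symmetric] powr_powr)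
      finally have "v n \<le> ?V * real n powr (q / 3)" unfolding v_def using V by (intro mult_left_mono) auto
      hence "Y n \<le> ln (real n) * (1 + ?V * real n powr (q / 3))" unfolding Y_def using ln0 by (intro mult_left_mono) auto
      thus ?case using elim by linarith
    qed
  qed
  have "1 / real ?d > 0" by simp
  hence ev8: "\<forall>\<^sub>F n in sequentially. (9 + b * ln (real n)) * ln (real n) / ?V \<le> real n powr (1 / real ?d)"
    using b V by real_asymp
  have ev3: "\<forall>\<^sub>F n in sequentially. max 1 ?V \<le> ln (real n)" by real_asymp
  have ev5: "\<forall>\<^sub>F n in sequentially. real n * real n powr q \<le> (c * real n / 2 - 1)\<^sup>2" using q c by real_asymp
  have ev6: "\<forall>\<^sub>F n in sequentially. c * real n \<ge> 2" using c by real_asymp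
  have ev7: "\<forall>\<^sub>F n in sequentially. 1 + b * ln (real n) \<le> c * real n / 2" using b c by real_asymp
  have ev9: "\<forall>\<^sub>F n in sequentially. q * ln (real n) - 1 \<ge> q / 2 * ln (real n)" using q(1) by real_asymp
  define good_event where "good_event r n Q \<longleftrightarrow> set_measurable (unif n) (\<lambda>\<omega>. of_bool (Q \<omega>)) \<and>
      pois_int (unif n) (real n) (\<lambda>\<omega>. of_bool (Q \<omega>)) \<le> ennreal (bb n) \<and>
      (\<forall>N (x :: nat \<Rightarrow> real^'d) C. inj_on x {..<N} \<longrightarrow> x ` {..<N} \<subseteq> Lambda n \<longrightarrow> \<not> Q (x ` {..<N}) \<longrightarrow> is_largest_component N (r n) x C \<longrightarrow>
        ennreal (\<delta> * real n * (ln (real n))\<^sup>2) \<le> tau_cov (\<lambda>i j. i \<in> C \<and> j \<in> C \<and> geo_adj (r n) x i j) C)"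
    for r n and Q :: "(real^'d) set \<Rightarrow> bool"
  have main: "aas (\<lambda>n N (x :: nat \<Rightarrow> real^'d). \<forall>C. is_largest_component N (r n) x C \<longrightarrow>
      tau_cov (\<lambda>i j. i \<in> C \<and> j \<in> C \<and> geo_adj (r n) x i j) C \<ge> ennreal (\<delta> * real n * (ln (real n))\<^sup>2))"
    if hr: "\<forall>\<^sub>F n in sequentially. r1 \<le> r n \<and> r n \<le> (1 - \<epsilon>) * r_c TYPE('d) n" for r
  proof -
    have "\<forall>\<^sub>F n in sequentially. \<exists>Q. good_event r n Q"
      using hr eventually_gt_at_top[of 0] ev3 Y_le ev5 ev6 ev7 ev8 ev9
    proof eventually_elim
      case (elim n)
      let ?Lg = "ln (real n)"
      have n: "n > 0" and Lg: "?Lg \<ge> 1" "?Lg \<ge> ?V" using elim by auto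
      define \<rho> where "\<rho> = r n"
      have \<rho>: "r1 \<le> \<rho>" "\<rho> \<le> (1 - \<epsilon>) * r_c TYPE('d) n" using elim(1) by (auto simp: \<rho>_def)
      have \<rho>0: "\<rho> > 0" using \<rho> r1 by linarith
      have xV: "1 \<le> ?Lg / ?V" using Lg V by (simp add: field_simps)
      have rc: "r_c TYPE('d) n ^ ?d = ?Lg / ?V" "r_c TYPE('d) n \<le> ?Lg / ?V" "r_c TYPE('d) n \<ge> 0"
      proof -
        have "(x powr (1 / real ?d)) ^ ?d = x" if "x \<ge> 1" for x :: real
          using that by (subst powr_realpow[symmetric]) (auto simp: powr_powr)
        thus "r_c TYPE('d) n ^ ?d = ?Lg / ?V" using xV unfolding r_c_def by blast
        have "(?Lg / ?V) powr (1 / real ?d) \<le> (?Lg / ?V) powr 1" using xV by (intro powr_mono) auto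
        thus "r_c TYPE('d) n \<le> ?Lg / ?V" using xV by (simp add: r_c_def)
      qed (simp add: r_c_def)
      have \<rho>d: "\<rho> ^ ?d \<le> (1 - \<epsilon>) ^ ?d * (?Lg / ?V)"
        using power_mono[OF \<rho>(2), of ?d] \<rho>0 rc(1) by (simp add: power_mult_distrib)
      have \<rho>l: "\<rho> \<le> ?Lg / ?V"
        using \<rho>(2) rc(2) mult_right_mono[of "1 - \<epsilon>" 1 "r_c TYPE('d) n"] rc(3) \<epsilon> by linarith
      have \<rho>d1: "r1 ^ ?d \<le> \<rho> ^ ?d" using \<rho> r1 by (intro power_mono) auto
      have r1d: "r1 ^ ?d > 0" using r1 by simp
      have \<rho>d0: "\<rho> ^ ?d > 0" using \<rho>0 by simp
      \<comment> \<open>The summand 1 keeps the path nonempty when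
        \<open>\<delta>' * ln n / r ^ d < 1\<close>; the cost of emptying around it is the
        \<open>\<alpha>\<close> in the exponent.\<close>
      define l where "l = 1 + nat \<lfloor>\<delta>' * ?Lg / \<rho> ^ ?d\<rfloor>"
      have "\<delta>' * ?Lg / \<rho> ^ ?d \<ge> 0" using \<delta>' Lg \<rho>d0 by simp
      hence l: "\<delta>' * ?Lg / \<rho> ^ ?d \<le> real l" "real l \<le> 1 + \<delta>' * ?Lg / \<rho> ^ ?d" unfolding l_def by linarith+
      have "\<delta>' * ?Lg / \<rho> ^ ?d \<le> \<delta>' * ?Lg / r1 ^ ?d" using \<delta>' Lg \<rho>d1 r1d \<rho>d0 by (intro divide_left_mono) auto
      hence lb: "real l \<le> 1 + b * ?Lg" using l(2) by (simp add: b_def)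
      have l\<rho>1: "\<delta>' * ?Lg \<le> real l * \<rho> ^ ?d" using l(1) \<rho>d0 by (simp add: pos_divide_le_eq)
      have l\<rho>2: "real l * \<rho> ^ ?d \<le> \<rho> ^ ?d + \<delta>' * ?Lg"
        using mult_right_mono[OF l(2), of "\<rho> ^ ?d"] \<rho>0 by (simp add: distrib_right)
      have bL: "b * ?Lg \<ge> 0" using b Lg by simp
      \<comment> \<open>The direction of the chains is arbitrary, so an unspecified axis is
        taken.\<close>
      interpret tile_geom n \<rho> \<eta> l "undefined :: 'd"
      proof
        have "(real l + 8) * \<rho> \<le> (9 + b * ?Lg) * (?Lg / ?V)" using lb \<rho>l \<rho>0 bL by (intro mult_mono) auto
        thus "(real l + 8) * \<rho> \<le> real n powr (1 / real ?d)" using elim(8) by simp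
      qed (use d2 n \<rho>0 \<eta> l_def in auto)
      define e where "e = (\<alpha> + (1 + \<eta>) ^ ?d * ?V * \<delta>') * ?Lg"
      have e: "real l * (?V * ((1 + \<eta>) * \<rho>) ^ ?d) \<le> e"
      proof -
        have "real l * (?V * ((1 + \<eta>) * \<rho>) ^ ?d) = (1 + \<eta>) ^ ?d * ?V * (real l * \<rho> ^ ?d)" by (simp add: power_mult_distrib mult_ac)
        also have "\<dots> \<le> (1 + \<eta>) ^ ?d * ?V * ((1 - \<epsilon>) ^ ?d * (?Lg / ?V) + \<delta>' * ?Lg)"
          using l\<rho>2 \<rho>d \<eta> V by (intro mult_left_mono) auto
        also have "\<dots> = e" unfolding e_def \<alpha>_def power_mult_distrib using V by (simp add: field_simps)
        finally show ?thesis .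
      qed
      have zc: "z \<le> ?V * (\<zeta> * \<rho>) ^ ?d"
        unfolding z_def using V \<zeta> \<rho> r1 by (intro mult_left_mono power_mono) auto
      have vc: "?V * (2 * \<rho> * (8 * real ?d + real l + 9)) ^ ?d \<le> v n"
      proof -
        have "\<rho> * (8 * real ?d + real l + 9) \<le> (?Lg / ?V) * ((8 * real ?d + 10) + b * ?Lg)"
          using \<rho>l lb \<rho>0 V Lg by (intro mult_mono) auto
        hence "2 * \<rho> * (8 * real ?d + real l + 9) \<le> 2 / ?V * ?Lg * ((8 * real ?d + 10) + b * ?Lg)" by simp
        thus ?thesis unfolding v_def using V \<rho>0 by (intro mult_left_mono power_mono) auto
      qed
      have Y0: "Y n > 0" unfolding Y_def using Lg v0[of n] by (intro mult_pos_pos) auto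
      define s where "s = nat \<lceil>c * real n / 2\<rceil>"
      have cn: "c * real n > 0" using c n by simp
      hence s: "s > 0" "c * real n / 2 \<le> real s" "real s \<le> c * real n / 2 + 1" unfolding s_def by linarith+
      define K where "K = nat \<lfloor>real n powr q\<rfloor>"
      have nq: "real n powr q > 0" using n by simp
      have K: "real K \<le> real n powr q" "real n powr q \<le> real (Suc K)" using nq unfolding K_def by linarith+
      have p1: "ppp_prob n (\<lambda>N (x :: nat \<Rightarrow> real^'d). \<not> ?P n N x) \<le> b1 n"
      proof -
        have "ppp_prob n (?P n) + ppp_prob n (\<lambda>N (x :: nat \<Rightarrow> real^'d). \<not> ?P n N x) = 1"
          by (rule ppp_prob_compl[OF n giant_event_sets[OF n]])
        thus ?thesis unfolding b1_def by linarith
      qed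
      have nY: "real n * Y n \<le> (c * real n / 2 - 1)\<^sup>2"
        using mult_left_mono[OF elim(4), of "real n"] elim(5) by simp
      have lc: "real l \<le> c * real n / 2" using lb elim(7) by linarith
      let ?X = "exp e * (1 + 1 / z) ^ (\<kappa> * l) * real (2 * K + 1) * real n / (real s * (c\<^sup>2 * real n / Y n))"
      from bad_event[OF \<rho>(1) c p1 vc Y0 s(1,3) nY elim(6) lc z zc[unfolded \<zeta>_def] e, of K, folded \<kappa>_def]
      obtain Q where Qm: "set_measurable (unif n) (\<lambda>\<omega>. of_bool (Q \<omega>))"
        and Qp: "pois_int (unif n) (real n) (\<lambda>\<omega>. of_bool (Q \<omega>)) \<le> ennreal (b1 n + ((1 + v n) / Y n + ?X))"
        and Qt: "\<And>N (x :: nat \<Rightarrow> real^'d) C. inj_on x {..<N} \<Longrightarrow> x ` {..<N} \<subseteq> Lambda n \<Longrightarrow> \<not> Q (x ` {..<N}) \<Longrightarrow> is_largest_component N \<rho> x C \<Longrightarrow>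
          ennreal (real l * ((c * real n / 2)\<^sup>2 * \<rho> ^ ?d / (2 * (2 * real ?d) ^ ?d * real n)) * (ln (real (Suc K)) - 1))
          \<le> tau_cov (\<lambda>i j. i \<in> C \<and> j \<in> C \<and> geo_adj \<rho> x i j) C"
        by blast
      have X: "?X \<le> M * (2 * real n powr q + 1) * real n powr q * real n powr (-3 * q)"
      proof -
        have "(1 + 1 / z) ^ (\<kappa> * l) = exp (real (\<kappa> * l) * lam)" unfolding exp_of_nat_mult using z by (simp add: lam_def add_pos_pos)
        hence "exp e * (1 + 1 / z) ^ (\<kappa> * l) = exp (e + real \<kappa> * lam * real l)" by (simp add: exp_add mult_ac)
        also have "\<dots> \<le> exp (e + real \<kappa> * lam * (1 + b * ?Lg))" using lb lam by (simp add: mult_left_mono)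
        \<comment> \<open>The coefficients of \<open>ln n\<close> for emptying and filling combine
          to \<open>\<alpha> + \<delta>' * B\<close>; the rest goes into the constant
          \<open>M\<close>.\<close>
        also have "e + real \<kappa> * lam * (1 + b * ?Lg) = real \<kappa> * lam + (\<alpha> + \<delta>' * B) * ?Lg"
          by (simp add: e_def b_def B_def algebra_simps)
        also have "\<alpha> + \<delta>' * B = \<theta>" using B by (simp add: \<delta>'_def \<theta>_def field_simps)
        also have "exp (real \<kappa> * lam + \<theta> * ?Lg) = exp (real \<kappa> * lam) * real n powr \<theta>" using n by (simp add: exp_add powr_def)
        finally have 1: "exp e * (1 + 1 / z) ^ (\<kappa> * l) \<le> exp (real \<kappa> * lam) * real n powr \<theta>" .
        have 2: "c * real n / 2 * (c\<^sup>2 * real n / Y n) \<le> real s * (c\<^sup>2 * real n / Y n)"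
          using s(2) Y0 by (intro mult_right_mono) auto
        have "?X \<le> exp (real \<kappa> * lam) * real n powr \<theta> * (2 * real n powr q + 1) * real n / (c * real n / 2 * (c\<^sup>2 * real n / Y n))"
          using K(1) Y0 cn c n by (intro frac_le mult_mono 1 2) auto
        also have "\<dots> = M * (2 * real n powr q + 1) * Y n * (real n powr \<theta> / real n)"
          using c n Y0 by (simp add: M_def field_simps power2_eq_square power3_eq_cube)
        also have "real n powr \<theta> / real n = real n powr (-3 * q)"
        proof -
          have "- 3 * q = \<theta> - 1" by (simp add: q_def)
          thus ?thesis using n by (simp add: powr_diff)
        qed
        also have "M * (2 * real n powr q + 1) * Y n * real n powr (-3 * q) \<le> M * (2 * real n powr q + 1) * real n powr q * real n powr (-3 * q)"
          using M elim(4) nq by (intro mult_right_mono mult_left_mono) auto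
        finally show ?thesis .
      qed
      have "(1 + v n) / Y n = 1 / ?Lg" using Lg v0[of n] by (simp add: Y_def)
      hence "b1 n + ((1 + v n) / Y n + ?X) \<le> bb n" using X by (simp add: bb_def)
      hence Qp': "pois_int (unif n) (real n) (\<lambda>\<omega>. of_bool (Q \<omega>)) \<le> ennreal (bb n)" using Qp by (meson ennreal_leI order_trans)
      \<comment> \<open>One logarithm comes from \<open>l * r ^ d \<ge> \<delta>' * ln n\<close>,
        the other from \<open>ln (K + 1) \<ge> q * ln n\<close>.\<close>
      have low: "\<delta> * real n * ?Lg\<^sup>2 \<le> real l * ((c * real n / 2)\<^sup>2 * \<rho> ^ ?d / (2 * (2 * real ?d) ^ ?d * real n)) * (ln (real (Suc K)) - 1)"
      proof -
        have "q * ?Lg = ln (real n powr q)" using n by (simp add: ln_powr)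
        also have "\<dots> \<le> ln (real (Suc K))" using K(2) nq by (subst ln_le_cancel_iff) auto
        finally have lnK: "q / 2 * ?Lg \<le> ln (real (Suc K)) - 1" using elim(9) by linarith
        let ?G = "c\<^sup>2 * real n / (8 * (2 * real ?d) ^ ?d)"
        have "\<delta> * real n * ?Lg\<^sup>2 = (\<delta>' * ?Lg * ?G) * (q / 2 * ?Lg)" by (simp add: \<delta>_def power2_eq_square)
        also have "\<dots> \<le> (real l * \<rho> ^ ?d * ?G) * (ln (real (Suc K)) - 1)"
        proof (rule mult_mono[OF _ lnK])
          show "\<delta>' * ?Lg * ?G \<le> real l * \<rho> ^ ?d * ?G" by (rule mult_right_mono[OF l\<rho>1]) simp
        qed (use q Lg \<rho>d0 in auto)
        also have "real l * \<rho> ^ ?d * ?G = real l * ((c * real n / 2)\<^sup>2 * \<rho> ^ ?d / (2 * (2 * real ?d) ^ ?d * real n))"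
          using n by (simp add: power2_eq_square power_divide field_simps)
        finally show ?thesis .
      qed
      have "good_event r n Q"
        unfolding good_event_def
      proof (intro conjI Qm Qp' allI impI)
        fix N and x :: "nat \<Rightarrow> real^'d" and C
        assume "inj_on x {..<N}" "x ` {..<N} \<subseteq> Lambda n" "\<not> Q (x ` {..<N})" "is_largest_component N (r n) x C"
        from Qt[OF this[folded \<rho>_def]] ennreal_leI[OF low]
        show "ennreal (\<delta> * real n * ?Lg\<^sup>2) \<le> tau_cov (\<lambda>i j. i \<in> C \<and> j \<in> C \<and> geo_adj (r n) x i j) C"
          unfolding \<rho>_def by (rule order_trans[rotated])
      qed
      thus ?case by blast
    qed
    \<comment> \<open>One exceptional event is selected for each \<open>n\<close>; where none exists
      the selected value is arbitrary, which concerns finitely many \<open>n\<close> only.\<close>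
    hence Q: "\<forall>\<^sub>F n in sequentially. good_event r n (SOME Q. good_event r n Q)"
    proof eventually_elim
      case (elim n)
      thus ?case by (rule someI_ex[of "good_event r n"])
    qed
    show ?thesis
    proof (rule aasI[where B = "\<lambda>n. SOME Q. good_event r n Q" and b = bb, OF _ _ _ bb_lim bb0])
      show "\<forall>\<^sub>F n in sequentially. \<forall>N (x :: nat \<Rightarrow> real^'d). inj_on x {..<N} \<longrightarrow> x ` {..<N} \<subseteq> Lambda n \<longrightarrow>
          \<not> (\<forall>C. is_largest_component N (r n) x C \<longrightarrow> ennreal (\<delta> * real n * (ln (real n))\<^sup>2) \<le> tau_cov (\<lambda>i j. i \<in> C \<and> j \<in> C \<and> geo_adj (r n) x i j) C) \<longrightarrow>
          (SOME Q. good_event r n Q) (x ` {..<N})"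
        using Q by eventually_elim (unfold good_event_def, blast)
      show "\<forall>\<^sub>F n in sequentially. set_measurable (unif n) (\<lambda>\<omega> :: (real^'d) set. of_bool ((SOME Q. good_event r n Q) \<omega>)) \<and>
          pois_int (unif n) (real n) (\<lambda>\<omega>. of_bool ((SOME Q. good_event r n Q) \<omega>)) \<le> ennreal (bb n)"
        using Q by eventually_elim (unfold good_event_def, blast)
    qed (rule largest_component_event_sets)
  qed
  show ?thesis using \<delta> main by blast
qed

theorem mainTheorem8:
  assumes "CARD('d) \<ge> 2"
    and "\<epsilon> > 0"
  shows "\<exists>\<delta>>0. \<forall>r :: nat \<Rightarrow> real.
           (\<forall>\<^sub>F n in sequentially.
              (1 + \<epsilon>) * r_g TYPE('d) \<le> r n \<and> r n \<le> (1 - \<epsilon>) * r_c TYPE('d) n) \<longrightarrow>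
           aas (\<lambda>n N (x :: nat \<Rightarrow> real^'d::finite).
              \<forall>C. is_largest_component N (r n) x C \<longrightarrow>
                 tau_cov (\<lambda>i j. i \<in> C \<and> j \<in> C \<and> geo_adj (r n) x i j) C
                   \<ge> ennreal (\<delta> * real n * (ln (real n))\<^sup>2))"
proof -
  have rg: "r_g TYPE('d) > 0" by (rule r_g_pos[OF assms(1)])
  show ?thesis
  proof (cases "\<epsilon> < 1")
    case True
    have "1 * r_g TYPE('d) < (1 + \<epsilon>) * r_g TYPE('d)" using rg assms(2) by (intro mult_strict_right_mono) auto
    hence "r_g TYPE('d) < (1 + \<epsilon>) * r_g TYPE('d)" by simp
    \<comment> \<open>\<open>r1\<close> and \<open>c\<close> are picked before \<open>r\<close>, so
      the resulting \<open>\<delta>\<close> does not depend on \<open>r\<close>.\<close>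
    from giant_below[OF assms(1) this] obtain r1 c where r1: "0 < r1" "r1 < (1 + \<epsilon>) * r_g TYPE('d)" and c: "c > 0"
      and giant: "aas (\<lambda>n N (x :: nat \<Rightarrow> real^'d). \<exists>C\<in>geo_components N r1 x. real (card C) \<ge> c * real n)"
      by blast
    from aas_cover_time_lower[OF assms True r1(1) c giant] obtain \<delta> where \<delta>: "\<delta> > 0"
      and lower: "\<And>r. \<forall>\<^sub>F n in sequentially. r1 \<le> r n \<and> r n \<le> (1 - \<epsilon>) * r_c TYPE('d) n \<Longrightarrow>
        aas (\<lambda>n N (x :: nat \<Rightarrow> real^'d). \<forall>C. is_largest_component N (r n) x C \<longrightarrow>
          tau_cov (\<lambda>i j. i \<in> C \<and> j \<in> C \<and> geo_adj (r n) x i j) C \<ge> ennreal (\<delta> * real n * (ln (real n))\<^sup>2))"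
      by blast
    show ?thesis
    proof (intro exI[of _ \<delta>] conjI \<delta> allI impI lower)
      fix r assume "\<forall>\<^sub>F n in sequentially. (1 + \<epsilon>) * r_g TYPE('d) \<le> r n \<and> r n \<le> (1 - \<epsilon>) * r_c TYPE('d) n"
      thus "\<forall>\<^sub>F n in sequentially. r1 \<le> r n \<and> r n \<le> (1 - \<epsilon>) * r_c TYPE('d) n"
        by eventually_elim (use r1 in linarith)
    qed
  next
    case False
    have no: "\<not> ((1 + \<epsilon>) * r_g TYPE('d) \<le> r n \<and> r n \<le> (1 - \<epsilon>) * r_c TYPE('d) n)" for r :: "nat \<Rightarrow> real" and n
    proof -
      have "(1 - \<epsilon>) * r_c TYPE('d) n \<le> 0" using False by (intro mult_nonpos_nonneg) (auto simp: r_c_def)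
      moreover have "(1 + \<epsilon>) * r_g TYPE('d) > 0" using rg assms(2) by simp
      ultimately show ?thesis by linarith
    qed
    show ?thesis by (intro exI[of _ 1]) (simp add: no)
  qed
qed

end
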